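(* Let $d\ge 2$, let $\Omega\subset\mathbb{R}^d$ be a bounded Lipschitz domain satisfying Assumption L($\beta$) for some $\beta>0$, and let $u\in \mathring{W}^1_2(\Omega)$ be a weak solution to $$ -D_i\left(A_{ij}(x,u) D_j u + a_i(x,u)\right) = b(x,u,\nabla u)\ \text{ in }\Omega,\qquad u=0\ \text{ on }\partial\Omega, $$ where $A_{ij},a_i,b$ satisfy the ellipticity and controlled growth conditions given in the context (with $f\in L_2(\Omega)$, $g\in L_{\gamma/(\gamma-1)}(\Omega)$). Suppose in addition that $f\in L_{\sigma}(\Omega)$ and $g\in L_{\tau}(\Omega)$ for some $\sigma\in (2,\infty)$ and $\tau\in (\gamma/(\gamma-1),\infty)$. Then there exists $p>2$ depending only on $d,\mu,\mu_1,\mu_2,\sigma,\tau,\beta$, and $u$, such that $$ \|u\|_{L_{\gamma p/2}(\Omega)} + \|Du\|_{L_p(\Omega)}\le N, $$ where $N$ depends only on $d,\mu,\mu_1,\mu_2,\sigma,\tau,\beta,u,\|f\|_{L_\sigma(\Omega)},\|g\|_{L_\tau(\Omega)},|\Omega|$.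
   Context: Repeated indices are summed over $1,\dots,d$. Assumption L($\beta$): there is a constant $R_0\in(0,1]$ such that for any $x_0\in\partial\Omega$ and $r\in(0,R_0]$ there is a Lipschitz function $\phi:\mathbb{R}^{d-1}\to\mathbb{R}$ such that, in an appropriate coordinate system, $\Omega\cap B_r(x_0)=\{x\in B_r(x_0): x^1>\phi(x')\}$ and $\sup_{x',y'\in B_r'(x_0'),\,x'\ne y'}\frac{|\phi(y')-\phi(x')|}{|y'-x'|}\le\beta$. Structure conditions: $\gamma=\frac{2d}{d-2}$ if $d>2$, and $\gamma$ is any fixed number bigger than $2$ if $d=2$. The functions $A_{ij}(x,z)$, $a_i(x,z)$, $b(x,z,\xi)$ are Carathéodory: measurable in $x$ for all $(z,\xi)\in\mathbb{R}\times\mathbb{R}^d$ and continuous in $(z,\xi)$ for almost all $x$. For some $\mu\in(0,1]$, $|A_{ij}|\le\mu^{-1}$ and $A_{ij}\xi_i\xi_j\ge\mu|\xi|^2$ for all $\xi\in\mathbb{R}^d$. Controlled growth conditions: for some constants $\mu_1,\mu_2>0$, $$|a_i(x,u)|\le\mu_1(|u|^{\gamma/2}+f),\qquad |b(x,u,\nabla u)|\le\mu_2(|\nabla u|^{2(1-1/\gamma)}+|u|^{\gamma-1}+g),$$ with $f=f(x)\in L_2(\Omega)$ and $g=g(x)\in L_{\gamma/(\gamma-1)}(\Omega)$. $\mathring{W}^1_2(\Omega)$ is the usual Sobolev space with zero trace. $u\in\mathring{W}^1_2(\Omega)$ is a weak solution if for every $\phi\in\mathring{W}^1_2(\Omega)$,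 $$\int_\Omega (A_{ij}(x,u)D_ju+a_i(x,u))D_i\phi\,dx=\int_\Omega b(x,u,Du)\phi\,dx.$$ *)

theory Defs
  imports "HOL-Analysis.Analysis"
begin

section \<open>Lebesgue and Sobolev spaces\<close>

text \<open>Membership in \<open>Lp\<close> is kept separate from the value of \<open>Lp_norm\<close>, because the Bochner integral
  of a non-integrable function is \<open>0\<close>.\<close>

definition Lp :: "'a::euclidean_space set \<Rightarrow> real \<Rightarrow> ('a \<Rightarrow> 'b::euclidean_space) set" where
  "Lp \<Omega> p = {f. f \<in> borel_measurable (lebesgue_on \<Omega>) \<and>
                integrable (lebesgue_on \<Omega>) (\<lambda>x. norm (f x) powr p)}"

definition Lp_norm :: "'a::euclidean_space set \<Rightarrow> real \<Rightarrow> ('a \<Rightarrow> 'b::euclidean_space) \<Rightarrow> real" where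
  "Lp_norm \<Omega> p f = (\<integral>x. norm (f x) powr p \<partial>lebesgue_on \<Omega>) powr (1 / p)"

primrec Ck :: "nat \<Rightarrow> ('a::euclidean_space \<Rightarrow> real) \<Rightarrow> bool" where
  "Ck 0 f \<longleftrightarrow> continuous_on UNIV f"
| "Ck (Suc k) f \<longleftrightarrow>
     (\<forall>x. f differentiable (at x)) \<and> (\<forall>v. Ck k (\<lambda>x. frechet_derivative f (at x) v))"

definition test_function :: "'a::euclidean_space set \<Rightarrow> ('a \<Rightarrow> real) \<Rightarrow> bool" where
  "test_function \<Omega> \<phi> \<longleftrightarrow>
     (\<forall>k. Ck k \<phi>) \<and> compact (closure {x. \<phi> x \<noteq> 0}) \<and> closure {x. \<phi> x \<noteq> 0} \<subseteq> \<Omega>"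

definition grad :: "(real^'n \<Rightarrow> real) \<Rightarrow> real^'n \<Rightarrow> real^'n" where
  "grad \<phi> x = (\<chi> i. frechet_derivative \<phi> (at x) (axis i 1))"

definition locally_integrable :: "'a::euclidean_space set \<Rightarrow> ('a \<Rightarrow> 'b::euclidean_space) \<Rightarrow> bool" where
  "locally_integrable \<Omega> f \<longleftrightarrow>
     (\<forall>K. compact K \<and> K \<subseteq> \<Omega> \<longrightarrow> integrable (lebesgue_on K) f)"

definition has_weak_grad :: "(real^'n) set \<Rightarrow> (real^'n \<Rightarrow> real) \<Rightarrow> (real^'n \<Rightarrow> real^'n) \<Rightarrow> bool" where
  "has_weak_grad \<Omega> u v \<longleftrightarrow> locally_integrable \<Omega> u \<and> locally_integrable \<Omega> v \<and>
     (\<forall>\<phi> i. test_function \<Omega> \<phi> \<longrightarrow>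
        (\<integral>x. u x * grad \<phi> x $ i \<partial>lebesgue_on \<Omega>) = - (\<integral>x. v x $ i * \<phi> x \<partial>lebesgue_on \<Omega>))"

text \<open>A weak gradient is determined only almost everywhere on \<open>\<Omega>\<close>; \<open>weak_grad\<close> picks a representative.\<close>

definition weak_grad :: "(real^'n) set \<Rightarrow> (real^'n \<Rightarrow> real) \<Rightarrow> real^'n \<Rightarrow> real^'n" where
  "weak_grad \<Omega> u = (SOME v. has_weak_grad \<Omega> u v)"

definition W12 :: "(real^'n) set \<Rightarrow> (real^'n \<Rightarrow> real) set" where
  "W12 \<Omega> = {u. (\<exists>v. has_weak_grad \<Omega> u v) \<and> u \<in> Lp \<Omega> 2 \<and> weak_grad \<Omega> u \<in> Lp \<Omega> 2}"

text \<open>The closure of the test functions in \<open>W12 \<Omega>\<close>. Its elements are functions on \<open>\<Omega>\<close>, which are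
  represented here by their extension by zero to the whole space, so that a function of
  type \<open>real^'n \<Rightarrow> real\<close> carries no information beyond its values on \<open>\<Omega>\<close>.\<close>

definition W12_0 :: "(real^'n) set \<Rightarrow> (real^'n \<Rightarrow> real) set" where
  "W12_0 \<Omega> = {u \<in> W12 \<Omega>. (\<forall>x. x \<notin> \<Omega> \<longrightarrow> u x = 0) \<and>
     (\<exists>\<phi>. (\<forall>k::nat. test_function \<Omega> (\<phi> k)) \<and>
          (\<lambda>k. Lp_norm \<Omega> 2 (\<lambda>x. u x - \<phi> k x)) \<longlonglongrightarrow> 0 \<and>
          (\<lambda>k. Lp_norm \<Omega> 2 (\<lambda>x. weak_grad \<Omega> u x - grad (\<phi> k) x)) \<longlonglongrightarrow> 0)}"


section \<open>Lipschitz domains\<close>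

text \<open>A coordinate system enters the condition only through the unit vector \<open>e\<close> of the
  \<open>x\<^sup>1\<close>-axis: \<open>x\<^sup>1 = x \<bullet> e\<close>, and \<open>x'\<close> is the orthogonal projection of \<open>x\<close> to the hyperplane
  orthogonal to \<open>e\<close>, which plays the role of the space of dimension \<open>d - 1\<close>.\<close>

definition hyperplane :: "'a::euclidean_space \<Rightarrow> 'a set" where
  "hyperplane e = {y. y \<bullet> e = 0}"

definition hproj :: "'a::euclidean_space \<Rightarrow> 'a \<Rightarrow> 'a" where
  "hproj e x = x - (x \<bullet> e) *\<^sub>R e"

definition assumption_L :: "real \<Rightarrow> 'a::euclidean_space set \<Rightarrow> bool" where
  "assumption_L \<beta> \<Omega> \<longleftrightarrow> (\<exists>R0. 0 < R0 \<and> R0 \<le> 1 \<and>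
     (\<forall>x0\<in>frontier \<Omega>. \<forall>r. 0 < r \<and> r \<le> R0 \<longrightarrow>
        (\<exists>e (\<phi> :: 'a \<Rightarrow> real). norm e = 1 \<and>
           (\<exists>L. L-lipschitz_on (hyperplane e) \<phi>) \<and>
           \<Omega> \<inter> ball x0 r = {x \<in> ball x0 r. x \<bullet> e > \<phi> (hproj e x)} \<and>
           \<beta>-lipschitz_on (hyperplane e \<inter> ball (hproj e x0) r) \<phi>)))"

definition bounded_lipschitz_domain :: "real \<Rightarrow> 'a::euclidean_space set \<Rightarrow> bool" where
  "bounded_lipschitz_domain \<beta> \<Omega> \<longleftrightarrow>
     open \<Omega> \<and> connected \<Omega> \<and> \<Omega> \<noteq> {} \<and> bounded \<Omega> \<and> assumption_L \<beta> \<Omega>"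


section \<open>Structure conditions and weak solutions\<close>

definition critical_exponent :: "nat \<Rightarrow> real \<Rightarrow> bool" where
  "critical_exponent d \<gamma> \<longleftrightarrow> (if d = 2 then \<gamma> > 2 else \<gamma> = 2 * real d / (real d - 2))"

definition caratheodory ::
  "'a::euclidean_space set \<Rightarrow> ('a \<Rightarrow> 'b::topological_space \<Rightarrow> 'c::topological_space) \<Rightarrow> bool" where
  "caratheodory \<Omega> F \<longleftrightarrow> (\<forall>y. (\<lambda>x. F x y) \<in> borel_measurable (lebesgue_on \<Omega>)) \<and>
                       (AE x in lebesgue_on \<Omega>. continuous_on UNIV (F x))"

definition elliptic :: "(real^'n) set \<Rightarrow> real \<Rightarrow> (real^'n \<Rightarrow> real \<Rightarrow> real^'n^'n) \<Rightarrow> bool" where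
  "elliptic \<Omega> \<mu> A \<longleftrightarrow> (AE x in lebesgue_on \<Omega>. \<forall>z.
     (\<forall>i j. \<bar>A x z $ i $ j\<bar> \<le> inverse \<mu>) \<and>
     (\<forall>\<xi>. (\<Sum>i\<in>UNIV. \<Sum>j\<in>UNIV. A x z $ i $ j * \<xi> $ i * \<xi> $ j) \<ge> \<mu> * (norm \<xi>)\<^sup>2))"

definition controlled_growth ::
  "(real^'n) set \<Rightarrow> real \<Rightarrow> real \<Rightarrow> real \<Rightarrow> (real^'n \<Rightarrow> real \<Rightarrow> real^'n) \<Rightarrow>
   (real^'n \<Rightarrow> real \<Rightarrow> real^'n \<Rightarrow> real) \<Rightarrow> (real^'n \<Rightarrow> real) \<Rightarrow> (real^'n \<Rightarrow> real) \<Rightarrow> bool" where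
  "controlled_growth \<Omega> \<gamma> \<mu>1 \<mu>2 a b f g \<longleftrightarrow>
     f \<in> Lp \<Omega> 2 \<and> g \<in> Lp \<Omega> (\<gamma> / (\<gamma> - 1)) \<and>
     (AE x in lebesgue_on \<Omega>. \<forall>z i. \<bar>a x z $ i\<bar> \<le> \<mu>1 * (\<bar>z\<bar> powr (\<gamma> / 2) + f x)) \<and>
     (AE x in lebesgue_on \<Omega>. \<forall>z \<xi>.
        \<bar>b x z \<xi>\<bar> \<le> \<mu>2 * (norm \<xi> powr (2 * (1 - 1 / \<gamma>)) + \<bar>z\<bar> powr (\<gamma> - 1) + g x))"

definition structure_conditions ::
  "(real^'n) set \<Rightarrow> real \<Rightarrow> real \<Rightarrow> real \<Rightarrow> real \<Rightarrow> (real^'n \<Rightarrow> real \<Rightarrow> real^'n^'n) \<Rightarrow>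
   (real^'n \<Rightarrow> real \<Rightarrow> real^'n) \<Rightarrow> (real^'n \<Rightarrow> real \<Rightarrow> real^'n \<Rightarrow> real) \<Rightarrow>
   (real^'n \<Rightarrow> real) \<Rightarrow> (real^'n \<Rightarrow> real) \<Rightarrow> bool" where
  "structure_conditions \<Omega> \<gamma> \<mu> \<mu>1 \<mu>2 A a b f g \<longleftrightarrow>
     caratheodory \<Omega> A \<and> caratheodory \<Omega> a \<and> caratheodory \<Omega> (\<lambda>x (z, \<xi>). b x z \<xi>) \<and>
     elliptic \<Omega> \<mu> A \<and> controlled_growth \<Omega> \<gamma> \<mu>1 \<mu>2 a b f g"

definition weak_solution ::
  "(real^'n) set \<Rightarrow> (real^'n \<Rightarrow> real \<Rightarrow> real^'n^'n) \<Rightarrow> (real^'n \<Rightarrow> real \<Rightarrow> real^'n) \<Rightarrow>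
   (real^'n \<Rightarrow> real \<Rightarrow> real^'n \<Rightarrow> real) \<Rightarrow> (real^'n \<Rightarrow> real) \<Rightarrow> bool" where
  "weak_solution \<Omega> A a b u \<longleftrightarrow> u \<in> W12_0 \<Omega> \<and> (\<forall>\<phi>\<in>W12_0 \<Omega>.
     (\<integral>x. (\<Sum>i\<in>UNIV. ((\<Sum>j\<in>UNIV. A x (u x) $ i $ j * weak_grad \<Omega> u x $ j) + a x (u x) $ i)
                  * weak_grad \<Omega> \<phi> x $ i) \<partial>lebesgue_on \<Omega>) =
     (\<integral>x. b x (u x) (weak_grad \<Omega> u x) * \<phi> x \<partial>lebesgue_on \<Omega>))"

end

theory Submission
  imports Defs
begin

text \<open>Both norms are determined by \<open>u\<close> alone, so only the gain of integrability matters.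
  Testing the equation with \<open>\<eta>\<^sup>2 (u - c)\<close>, where \<open>c = 0\<close> or \<open>c\<close> is a mean of \<open>u\<close> over a small ball, gives
  a Caccioppoli inequality on every small ball; at the boundary \<open>c = 0\<close> is the mean over a ball in the
  complement of \<open>\<Omega>\<close>. The lower order terms are controlled by \<open>|u|\<^sup>\<gamma>\<close>, whose level sets are bounded by those of
  a small multiple of the gradient: this is the absolute continuity of the integral of \<open>|Du|\<^sup>2\<close>, and the reason
  why critical growth is allowed and \<open>p\<close> depends on \<open>u\<close>. The mean oscillation of \<open>u\<close> is bounded by the gradient
  through translation estimates. A Vitali covering at the stopping times of \<open>|Du|\<^sup>2\<close> turns these bounds into an
  inequality between level sets, and integrating it over the levels raises the exponent as in Gehring's lemma.\<close>

section \<open>Covering and maximal sets\<close>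

text \<open>The obstacle is that \<gamma> is critical: for d > 2 the term |u|^\<gamma> scales
  exactly like |Du|^2, so shrinking the radius does not make it small. It is absorbed at high levels
  instead: there |u|^(\<gamma>/2) is controlled by e times a maximal function of |Du|, with e as
  small as desired once the level is large, and how large depends on u itself. With \<alpha> =
  2/\<gamma> the only link between dimension and exponent is d (1 - \<alpha>) \<le> 2, which covers
  d = 2 and d > 2 at once. The same estimate yields the integrability of |u|^\<gamma>, i.e. the
  Sobolev embedding. A Gehring argument wants a lower power of |Du| on the right of the Caccioppoli
  inequality. This comes from a Poincare inequality with a small multiple of the integral of |Du|^2
  and a large multiple of the squared integral of |Du|: at the stopping radius the former is
  absorbed. All estimates concern the zero extension of u on the whole space, so interior and
  boundary balls differ only in the constant c.\<close>

lemma emeasure_UN_countable_le: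
  assumes [measurable]: "\<And>i. i \<in> I \<Longrightarrow> X i \<in> sets M" and I: "countable I"
  shows "emeasure M (\<Union>(X ` I)) \<le> (\<integral>\<^sup>+i. emeasure M (X i) \<partial>count_space I)"
proof -
  have [measurable]: "\<Union>(X ` I) \<in> sets M" using I by (rule sets.countable_UN'') auto
  have "emeasure M (\<Union>(X ` I)) = (\<integral>\<^sup>+x. indicator (\<Union>(X ` I)) x \<partial>M)" by simp
  also have "\<dots> \<le> (\<integral>\<^sup>+x. (\<integral>\<^sup>+i. indicator (X i) x \<partial>count_space I) \<partial>M)"
  proof (rule nn_integral_mono)
    fix x
    show "indicator (\<Union>(X ` I)) x \<le> (\<integral>\<^sup>+i. indicator (X i) x \<partial>count_space I)"
    proof (cases "x \<in> \<Union>(X ` I)")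
      case True
      then obtain j where j: "j \<in> I" "x \<in> X j" by auto
      have "(1::ennreal) = (\<integral>\<^sup>+i. indicator {j} i \<partial>count_space I)"
        using j by (subst nn_integral_indicator) auto
      also have "\<dots> \<le> (\<integral>\<^sup>+i. indicator (X i) x \<partial>count_space I)"
        using j by (intro nn_integral_mono) (auto split: split_indicator)
      finally show ?thesis using True by simp
    qed simp
  qed
  also have "\<dots> = (\<integral>\<^sup>+i. (\<integral>\<^sup>+x. indicator (X i) x \<partial>M) \<partial>count_space I)"
    using I by (subst nn_integral_count_space_nn_integral) auto
  also have "\<dots> = (\<integral>\<^sup>+i. emeasure M (X i) \<partial>count_space I)"
    by (rule nn_integral_cong) auto
  finally show ?thesis .
qed

text \<open>At each point \<Phi> of the five times larger ball is paid for by \<Psi> of the ball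
  itself. The Vitali subfamily is disjoint while its fivefold enlargements still cover E, so the
  payments add up without overlap. Serves both the weak type bound and the stopping time
  estimate.\<close>

lemma vitali_emeasure_bound:
  fixes E :: "'a::euclidean_space set"
  assumes [measurable_cong, simp]: "sets \<Phi> = sets borel" "sets \<Psi> = sets borel"
    and E: "E \<in> sets borel"
    and r: "\<And>x. x \<in> E \<Longrightarrow> \<exists>r. 0 < r \<and> r \<le> R \<and> emeasure \<Phi> (ball x (5 * r)) \<le> emeasure \<Psi> (ball x r)"
  shows "emeasure \<Phi> E \<le> emeasure \<Psi> UNIV"
proof -
  obtain \<rho> where \<rho>: "\<And>x. x \<in> E \<Longrightarrow> 0 < \<rho> x \<and> \<rho> x \<le> R \<and>
      emeasure \<Phi> (ball x (5 * \<rho> x)) \<le> emeasure \<Psi> (ball x (\<rho> x))"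
    using r by metis
  have "E \<subseteq> (\<Union>i\<in>E. ball i (\<rho> i))" using \<rho> by force
  then obtain C where C: "countable C" "C \<subseteq> E"
     "pairwise (\<lambda>i j. disjnt (ball i (\<rho> i)) (ball j (\<rho> j))) C"
     "E \<subseteq> (\<Union>i\<in>C. ball i (5 * \<rho> i))"
    by (rule Vitali_covering_lemma_balls[of E "\<lambda>x. x" \<rho> E R]) (use \<rho> in blast)+
  have dis: "disjoint_family_on (\<lambda>i. ball i (\<rho> i)) C"
    using C(3) by (auto simp: disjoint_family_on_def pairwise_def disjnt_def)
  have "emeasure \<Phi> E \<le> emeasure \<Phi> (\<Union>i\<in>C. ball i (5 * \<rho> i))"
    by (rule emeasure_mono[OF C(4)]) (use C(1) in \<open>auto intro!: borel_open\<close>)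
  also have "\<dots> \<le> (\<integral>\<^sup>+i. emeasure \<Phi> (ball i (5 * \<rho> i)) \<partial>count_space C)"
    by (rule emeasure_UN_countable_le) (use C(1) in auto)
  also have "\<dots> \<le> (\<integral>\<^sup>+i. emeasure \<Psi> (ball i (\<rho> i)) \<partial>count_space C)"
    by (rule nn_integral_mono) (use \<rho> C(2) in auto)
  also have "\<dots> = emeasure \<Psi> (\<Union>i\<in>C. ball i (\<rho> i))"
    by (rule emeasure_UN_countable[symmetric]) (use C(1) dis in auto)
  also have "\<dots> \<le> emeasure \<Psi> UNIV"
    by (rule emeasure_mono) (auto simp: sets_eq_imp_space_eq[of \<Psi> borel])
  finally show ?thesis .
qed

abbreviation vol :: "'a::euclidean_space set \<Rightarrow> real" where "vol \<equiv> measure lborel"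

text \<open>Superlevel set of the centred Hardy-Littlewood maximal function of h with radii at most
  R, written without a quotient and without a supremum.\<close>

definition maximal_set :: "real \<Rightarrow> ('a::euclidean_space \<Rightarrow> real) \<Rightarrow> real \<Rightarrow> 'a set" where
  "maximal_set R h t =
     {x. \<exists>r. 0 < r \<and> r \<le> R \<and> t * vol (ball x r) < (LINT y:ball x r|lborel. h y)}"

lemma set_integrable_borel:
  assumes "integrable lborel (h :: 'a::euclidean_space \<Rightarrow> 'b::{banach,second_countable_topology})" "S \<in> sets borel"
  shows "set_integrable lborel S h"
  using assms unfolding set_integrable_def by (intro integrable_mult_indicator) auto

lemma sets_borel_ball [measurable]: "ball (x :: 'a::metric_space) r \<in> sets borel"
  by simp

lemma set_integrable_const_ball [simp]:
  "set_integrable lborel (ball x r :: 'a::euclidean_space set) (\<lambda>_. c :: real)"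
  unfolding set_integrable_def using emeasure_bounded_finite[of "ball x r"] by auto

lemma set_integral_const_ball [simp]:
  "(LINT y:(ball x r :: 'a::euclidean_space set)|lborel. (c :: real)) = c * vol (ball x r)"
  by (simp add: set_lebesgue_integral_def)

lemma ennreal_set_integral:
  assumes "integrable lborel (h :: 'a::euclidean_space \<Rightarrow> real)" "S \<in> sets borel" "\<And>x. 0 \<le> h x"
  shows "ennreal (LINT x:S|lborel. h x) = (\<integral>\<^sup>+x\<in>S. ennreal (h x) \<partial>lborel)"
  using set_integrable_borel[OF assms(1,2)] assms(3) unfolding set_integrable_def set_lebesgue_integral_def
  by (subst nn_integral_eq_integral[symmetric]) (auto intro!: nn_integral_cong split: split_indicator)

lemma set_integral_mono_set:
  assumes "integrable lborel (h :: 'a::euclidean_space \<Rightarrow> real)" "S \<in> sets borel" "S' \<in> sets borel" "S \<subseteq> S'" "\<And>x. 0 \<le> h x"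
  shows "(LINT x:S|lborel. h x) \<le> (LINT x:S'|lborel. h x)"
  using set_integrable_borel[OF assms(1,2)] set_integrable_borel[OF assms(1,3)] assms(4,5)
  unfolding set_integrable_def set_lebesgue_integral_def
  by (intro integral_mono) (auto split: split_indicator)

text \<open>A strict inequality survives a small shrinking of the radius, by continuity of the
  integral from below, and the shrunk ball lies in every ball of the original radius whose centre
  has moved by less than the gained margin.\<close>

lemma open_maximal_set:
  fixes h :: "'a::euclidean_space \<Rightarrow> real"
  assumes h: "integrable lborel h" "\<And>x. 0 \<le> h x" and t: "0 \<le> t"
  shows "open (maximal_set R h t)"
  unfolding open_contains_ball
proof
  fix x assume "x \<in> maximal_set R h t"
  then obtain r where r: "0 < r" "r \<le> R" "t * vol (ball x r) < (LINT y:ball x r|lborel. h y)"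
    by (auto simp: maximal_set_def)
  \<comment> \<open>The 2 in the denominator keeps every radius at least r/2, hence
    positive.\<close>
  let ?\<rho> = "\<lambda>n::nat. r - r / (2 + real n)"
  have lim: "(\<lambda>n. LINT y:ball x (?\<rho> n)|lborel. h y) \<longlonglongrightarrow> (LINT y:(\<Union>n. ball x (?\<rho> n))|lborel. h y)"
  proof (rule set_integral_cont_up)
    show "incseq (\<lambda>n. ball x (?\<rho> n))"
      using r by (auto simp: incseq_def intro!: subset_ball divide_left_mono)
    show "set_integrable lborel (\<Union>i. ball x (?\<rho> i)) h"
      by (rule set_integrable_borel[OF h(1)]) auto
  qed auto
  have Un: "(\<Union>n. ball x (?\<rho> n)) = ball x r"
  proof safe
    fix y n assume "y \<in> ball x (?\<rho> n)" then show "y \<in> ball x r" using r(1) by (auto intro: less_le_trans)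
  next
    fix y assume "y \<in> ball x r"
    then have d: "0 < r - dist x y" by auto
    obtain n :: nat where "r / (r - dist x y) < real n" using reals_Archimedean2 by blast
    then have "r / (2 + real n) < r - dist x y"
      using d r(1) by (simp add: field_simps)
    then have "y \<in> ball x (?\<rho> n)" by simp
    then show "y \<in> (\<Union>n. ball x (?\<rho> n))" by blast
  qed
  obtain n where n: "t * vol (ball x r) < (LINT y:ball x (?\<rho> n)|lborel. h y)"
    using order_tendstoD(1)[OF lim[unfolded Un] r(3)] by (auto simp: eventually_sequentially)
  have "ball x (r / (2 + real n)) \<subseteq> maximal_set R h t"
  proof
    fix y assume y: "y \<in> ball x (r / (2 + real n))"
    then have sub: "ball x (?\<rho> n) \<subseteq> ball y r"
      by (auto) (smt (verit) dist_commute dist_triangle)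
    have "t * vol (ball y r) = t * vol (ball x r)" using r(1) by (simp add: content_ball)
    also have "\<dots> < (LINT y:ball x (?\<rho> n)|lborel. h y)" by (rule n)
    also have "\<dots> \<le> (LINT y:ball y r|lborel. h y)"
      by (rule set_integral_mono_set) (use h sub in auto)
    finally show "y \<in> maximal_set R h t" using r by (auto simp: maximal_set_def)
  qed
  then show "\<exists>e>0. ball x e \<subseteq> maximal_set R h t"
    using r(1) by (intro exI[of _ "r / (2 + real n)"]) auto
qed

lemma measurable_maximal_set:
  fixes h :: "'a::euclidean_space \<Rightarrow> real"
  assumes h: "integrable lborel h" "\<And>x. 0 \<le> h x" and t: "0 \<le> t"
  shows "maximal_set R h t \<in> sets borel"
  using open_maximal_set[OF assms] by auto

text \<open>Enlarging a ball five times multiplies its volume by 5^d, and a mean above t bounds the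
  volume of the ball by the integral of h over it divided by t.\<close>

lemma weak_type:
  fixes h :: "'a::euclidean_space \<Rightarrow> real"
  assumes h: "integrable lborel h" "\<And>x. 0 \<le> h x" and t: "0 < t"
  shows "emeasure lborel (maximal_set R h t) \<le> ennreal (5 ^ DIM('a) / t) * (\<integral>\<^sup>+x. ennreal (h x) \<partial>lborel)"
proof -
  note [measurable] = borel_measurable_integrable[OF h(1)]
  let ?\<Psi> = "density lborel (\<lambda>x. ennreal (5 ^ DIM('a) / t) * ennreal (h x))"
  have "emeasure lborel (maximal_set R h t) \<le> emeasure ?\<Psi> UNIV"
  proof (rule vitali_emeasure_bound[where R=R])
    fix x assume "x \<in> maximal_set R h t"
    then obtain r where r: "0 < r" "r \<le> R" "t * vol (ball x r) < (LINT y:ball x r|lborel. h y)"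
      by (auto simp: maximal_set_def)
    have "emeasure lborel (ball x (5 * r)) = ennreal (5 ^ DIM('a) * vol (ball x r))"
      using r(1) by (simp add: emeasure_ball content_ball power_mult_distrib mult_ac)
    also have "\<dots> \<le> ennreal ((5 ^ DIM('a) / t) * (LINT y:ball x r|lborel. h y))"
    proof (rule ennreal_leI)
      have "5 ^ DIM('a) * vol (ball x r) = (5 ^ DIM('a) / t) * (t * vol (ball x r))" using t by simp
      also have "\<dots> \<le> (5 ^ DIM('a) / t) * (LINT y:ball x r|lborel. h y)"
        using r t by (intro mult_left_mono) auto
      finally show "5 ^ DIM('a) * vol (ball x r) \<le> (5 ^ DIM('a) / t) * (LINT y:ball x r|lborel. h y)" .
    qed
    also have "\<dots> = ennreal (5 ^ DIM('a) / t) * (\<integral>\<^sup>+y\<in>ball x r. ennreal (h y) \<partial>lborel)"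
      using t by (subst ennreal_mult') (auto simp: ennreal_set_integral[OF h(1) _ h(2)])
    also have "\<dots> = (\<integral>\<^sup>+y. ennreal (5 ^ DIM('a) / t) * (ennreal (h y) * indicator (ball x r) y) \<partial>lborel)"
      by (rule nn_integral_cmult[symmetric]) measurable
    also have "\<dots> = emeasure ?\<Psi> (ball x r)"
      by (simp add: emeasure_density mult.assoc)
    finally show "\<exists>r. 0 < r \<and> r \<le> R \<and> emeasure lborel (ball x (5 * r)) \<le> emeasure ?\<Psi> (ball x r)"
      using r by auto
  qed (use measurable_maximal_set[OF h] t in auto)
  also have "\<dots> = ennreal (5 ^ DIM('a) / t) * (\<integral>\<^sup>+x. ennreal (h x) \<partial>lborel)"
    by (subst emeasure_density) (auto simp: nn_integral_cmult)
  finally show ?thesis .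
qed

text \<open>Removing the values of h up to t/2 lowers any mean by at most t/2, so a mean above t
  leaves a mean above t/2 for the remaining part. Only high values of h then appear on the right, as
  an iteration over level sets requires.\<close>

lemma weak_type_truncated:
  fixes h :: "'a::euclidean_space \<Rightarrow> real"
  assumes h: "integrable lborel h" "\<And>x. 0 \<le> h x" and t: "0 < t"
  shows "emeasure lborel (maximal_set R h t)
     \<le> ennreal (2 * 5 ^ DIM('a) / t) * (\<integral>\<^sup>+x\<in>{x. t / 2 < h x}. ennreal (h x) \<partial>lborel)"
proof -
  note [measurable] = borel_measurable_integrable[OF h(1)]
  define k where "k x = h x * indicator {x. t / 2 < h x} x" for x
  have k: "integrable lborel k" "\<And>x. 0 \<le> k x" "\<And>x. h x \<le> k x + t / 2"
    using h t unfolding k_def by (auto intro!: integrable_real_mult_indicator split: split_indicator)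
  have "maximal_set R h t \<subseteq> maximal_set R k (t / 2)"
  proof
    fix x assume "x \<in> maximal_set R h t"
    then obtain r where r: "0 < r" "r \<le> R" "t * vol (ball x r) < (LINT y:ball x r|lborel. h y)"
      by (auto simp: maximal_set_def)
    have "(LINT y:ball x r|lborel. h y) \<le> (LINT y:ball x r|lborel. k y + t / 2)"
      by (rule set_integral_mono)
        (use k(3) set_integral_add(1)[OF set_integrable_borel[OF k(1), of "ball x r"] set_integrable_const_ball]
           set_integrable_borel[OF h(1), of "ball x r"] in auto)
    also have "\<dots> = (LINT y:ball x r|lborel. k y) + t / 2 * vol (ball x r)"
      by (subst set_integral_add)
        (use k in \<open>auto intro!: set_integrable_borel\<close>)
    finally show "x \<in> maximal_set R k (t / 2)"
      using r by (auto simp: maximal_set_def)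
  qed
  then have "emeasure lborel (maximal_set R h t) \<le> emeasure lborel (maximal_set R k (t / 2))"
    by (rule emeasure_mono) (use measurable_maximal_set[OF k(1,2)] t in auto)
  also have "\<dots> \<le> ennreal (5 ^ DIM('a) / (t / 2)) * (\<integral>\<^sup>+x. ennreal (k x) \<partial>lborel)"
    by (rule weak_type) (use k t in auto)
  also have "(\<integral>\<^sup>+x. ennreal (k x) \<partial>lborel) = (\<integral>\<^sup>+x\<in>{x. t / 2 < h x}. ennreal (h x) \<partial>lborel)"
    by (auto intro!: nn_integral_cong simp: k_def split: split_indicator)
  finally show ?thesis by (simp add: mult_ac)
qed

text \<open>The limit holds everywhere for continuous functions, and the exceptional set for w is
  estimated by the weak type inequality for |w - \<phi> n|, which tends to 0 in L1. The approximants
  form a hypothesis because the zero trace space comes with them: they will be test functions, or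
  the squared norms of their gradients.\<close>

lemma lebesgue_points:
  fixes w :: "'a::euclidean_space \<Rightarrow> real"
  assumes w: "integrable lborel w"
    and k: "\<And>n. integrable lborel (\<phi> n)" "\<And>n. continuous_on UNIV (\<phi> n :: 'a \<Rightarrow> real)"
    and lim: "(\<lambda>n. LINT x|lborel. \<bar>w x - \<phi> n x\<bar>) \<longlonglongrightarrow> 0"
  shows "AE x in lborel. ((\<lambda>r. (LINT y:ball x r|lborel. w y) / vol (ball x r)) \<longlongrightarrow> w x) (at_right 0)"
proof -
  have [measurable]: "w \<in> borel_measurable borel" "\<And>n. \<phi> n \<in> borel_measurable borel"
    using borel_measurable_integrable[OF w] borel_measurable_integrable[OF k(1)] by auto
  let ?A = "\<lambda>x r. (LINT y:ball x r|lborel. w y) / vol (ball x r)"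
  have ce: "AE x in lborel. eventually (\<lambda>r. \<bar>?A x r - w x\<bar> \<le> e) (at_right 0)" if e: "0 < e" for e :: real
  proof -
    let ?g = "\<lambda>n x. \<bar>w x - \<phi> n x\<bar>"
    \<comment> \<open>Off \<open>?B n\<close> the error e splits into three equal parts: the mean of
      |w - \<phi> n| near x, the oscillation of the continuous \<open>\<phi> n\<close>, and |w -
      \<phi> n| at x. Bad points lie in every \<open>?B n\<close>, and the measures of these sets
      have arbitrarily small bounds.\<close>
    let ?B = "\<lambda>n. maximal_set 1 (?g n) (e / 3) \<union> {x. e / 3 < ?g n x}"
    have g: "integrable lborel (?g n)" for n using w k by auto
    have M[measurable]: "maximal_set 1 (?g n) (e / 3) \<in> sets borel" for n
      using measurable_maximal_set[OF g] e by auto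
    have em: "emeasure lborel (?B n) \<le> ennreal (((5 ^ DIM('a) + 1) * 3 / e) * (LINT x|lborel. ?g n x))" for n
    proof -
      have "emeasure lborel (?B n) \<le> emeasure lborel (maximal_set 1 (?g n) (e / 3)) + emeasure lborel {x. e / 3 < ?g n x}"
        by (rule emeasure_subadditive) auto
      also have "\<dots> \<le> ennreal (5 ^ DIM('a) / (e / 3)) * (\<integral>\<^sup>+x. ennreal (?g n x) \<partial>lborel)
          + ennreal (3 / e) * (\<integral>\<^sup>+x. ennreal (?g n x) \<partial>lborel)"
      proof (rule add_mono)
        show "emeasure lborel (maximal_set 1 (?g n) (e / 3))
          \<le> ennreal (5 ^ DIM('a) / (e / 3)) * (\<integral>\<^sup>+x. ennreal (?g n x) \<partial>lborel)"
          by (rule weak_type) (use g e in auto)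
        have "emeasure lborel {x. e / 3 < ?g n x} \<le> emeasure lborel {x\<in>space lborel. 1 \<le> ennreal (3 / e) * ennreal (?g n x)}"
        proof (rule emeasure_mono)
          show "{x. e / 3 < ?g n x} \<subseteq> {x \<in> space lborel. 1 \<le> ennreal (3 / e) * ennreal (?g n x)}"
          proof safe
            fix x assume "e / 3 < ?g n x"
            then have "1 \<le> 3 / e * ?g n x" using e by (simp add: field_simps)
            then show "1 \<le> ennreal (3 / e) * ennreal (?g n x)"
              using e by (subst ennreal_mult'[symmetric]) auto
          qed auto
        qed measurable
        also have "\<dots> \<le> ennreal (3 / e) * (\<integral>\<^sup>+x\<in>space lborel. ennreal (?g n x) \<partial>lborel)"
          by (rule order.trans[OF _ nn_integral_Markov_inequality]) auto
        finally show "emeasure lborel {x. e / 3 < ?g n x} \<le> ennreal (3 / e) * (\<integral>\<^sup>+x. ennreal (?g n x) \<partial>lborel)"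
          by simp
      qed
      also have "\<dots> = ennreal (((5 ^ DIM('a) + 1) * 3 / e) * (LINT x|lborel. ?g n x))"
      proof -
        have nn: "(\<integral>\<^sup>+x. ennreal (?g n x) \<partial>lborel) = ennreal (LINT x|lborel. ?g n x)"
          by (rule nn_integral_eq_integral) (use g in auto)
        show ?thesis unfolding nn using e
          by (simp add: ennreal_mult'[symmetric] ennreal_plus[symmetric] field_simps del: ennreal_plus)
      qed
      finally show ?thesis .
    qed
    have lim0: "(\<lambda>n. ennreal (((5 ^ DIM('a) + 1) * 3 / e) * (LINT x|lborel. ?g n x))) \<longlonglongrightarrow> ennreal 0"
      by (rule tendsto_ennrealI, rule tendsto_mult_right_zero, rule lim)
    have "emeasure lborel (\<Inter>n. ?B n) \<le> ennreal (((5 ^ DIM('a) + 1) * 3 / e) * (LINT x|lborel. ?g n x))" for n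
      by (rule order.trans[OF emeasure_mono em]) auto
    then have "emeasure lborel (\<Inter>n. ?B n) \<le> ennreal 0"
      by (intro LIMSEQ_le_const[OF lim0]) auto
    then have null: "(\<Inter>n. ?B n) \<in> null_sets lborel" by (auto simp: null_sets_def)
    show ?thesis
    proof (rule AE_I'[OF null], intro subsetI INT_I UnCI)
      fix x n assume "x \<in> {x \<in> space lborel. \<not> eventually (\<lambda>r. \<bar>?A x r - w x\<bar> \<le> e) (at_right 0)}"
      then have nx: "\<not> eventually (\<lambda>r. \<bar>?A x r - w x\<bar> \<le> e) (at_right 0)" by blast
      assume "x \<notin> {x. e / 3 < ?g n x}"
      then have x2: "\<not> e / 3 < ?g n x" by blast
      show "x \<in> maximal_set 1 (?g n) (e / 3)"
      proof (rule ccontr)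
        assume x1: "x \<notin> maximal_set 1 (?g n) (e / 3)"
        have "continuous (at x) (\<phi> n)" using k(2)[of n] by (simp add: continuous_on_eq_continuous_at)
        then obtain d where d: "0 < d" "\<And>y. dist y x < d \<Longrightarrow> dist (\<phi> n y) (\<phi> n x) < e / 3"
          using e unfolding continuous_at_eps_delta by (drule_tac spec[of _ "e / 3"]) auto
        have "\<bar>?A x r - w x\<bar> \<le> e" if r: "0 < r" "r < min d 1" for r
        proof -
          have v: "0 < vol (ball x r)" using r by (simp add: content_ball)
          have si: "set_integrable lborel (ball x r) w" "set_integrable lborel (ball x r) (\<phi> n)"
            "set_integrable lborel (ball x r) (?g n)"
            using w k g by (auto intro!: set_integrable_borel)
          have "(LINT y:ball x r|lborel. ?g n y) \<le> e / 3 * vol (ball x r)"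
            using x1 r unfolding maximal_set_def by (auto simp: not_less dest!: spec[of _ r])
          moreover have "\<bar>LINT y:ball x r|lborel. w y - w x\<bar> \<le> (LINT y:ball x r|lborel. \<bar>w y - w x\<bar>)"
            using set_integral_norm_bound[of lborel "ball x r" "\<lambda>y. w y - w x"] si by auto
          moreover have "(LINT y:ball x r|lborel. \<bar>w y - w x\<bar>) \<le> (LINT y:ball x r|lborel. ?g n y + (2 * e / 3))"
          proof (rule set_integral_mono)
            fix y assume "y \<in> ball x r"
            then have "\<bar>\<phi> n y - \<phi> n x\<bar> < e / 3" using d(2)[of y] r by (auto simp: dist_commute dist_real_def abs_minus_commute)
            then show "\<bar>w y - w x\<bar> \<le> ?g n y + (2 * e / 3)" using x2 by linarith
          qed (use si in \<open>auto intro!: set_integrable_abs\<close>)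
          moreover have "\<dots> = (LINT y:ball x r|lborel. ?g n y) + 2 * e / 3 * vol (ball x r)"
            by (subst set_integral_add) (use si in auto)
          moreover have "(LINT y:ball x r|lborel. w y - w x) = (LINT y:ball x r|lborel. w y) - w x * vol (ball x r)"
            by (subst set_integral_diff) (use si in auto)
          ultimately have "\<bar>(LINT y:ball x r|lborel. w y) - w x * vol (ball x r)\<bar> \<le> e * vol (ball x r)"
            by (simp add: field_simps)
          then have "\<bar>((LINT y:ball x r|lborel. w y) - w x * vol (ball x r)) / vol (ball x r)\<bar> \<le> e"
            using v by (simp add: abs_divide field_simps)
          then show ?thesis using v by (simp add: diff_divide_distrib)
        qed
        then have "eventually (\<lambda>r. \<bar>?A x r - w x\<bar> \<le> e) (at_right 0)"
          unfolding eventually_at_right_field using d(1) by (intro exI[of _ "min d 1"]) auto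
        with nx show False by blast
      qed
    qed
  qed
  have "AE x in lborel. \<forall>m. eventually (\<lambda>r. \<bar>?A x r - w x\<bar> \<le> 1 / real (Suc m)) (at_right 0)"
    by (subst AE_all_countable) (intro allI ce, simp)
  then show ?thesis
  proof eventually_elim
    case (elim x)
    show ?case
    proof (rule tendstoI)
      fix e :: real assume "0 < e"
      then obtain m where m: "1 / real (Suc m) < e" using nat_approx_posE by blast
      show "eventually (\<lambda>r. dist (?A x r) (w x) < e) (at_right 0)"
        by (rule eventually_mono[OF elim[rule_format, of m]]) (use m in \<open>auto simp: dist_real_def\<close>)
    qed
  qed
qed

section \<open>Mean oscillation\<close>

definition mean :: "'a::euclidean_space set \<Rightarrow> ('a \<Rightarrow> real) \<Rightarrow> real" where
  "mean S f = (LINT y:S|lborel. f y) / vol S"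

lemma vol_ball_pos: "0 < r \<Longrightarrow> 0 < vol (ball x r :: 'a::euclidean_space set)"
  by (simp add: content_ball)

lemma emeasure_ball_eq: "emeasure lborel (ball x r :: 'a::euclidean_space set) = ennreal (vol (ball x r))"
  by (rule emeasure_eq_ennreal_measure) (use emeasure_bounded_finite[of "ball x r"] in auto)

lemma abs_set_integral_le:
  fixes f :: "'a::euclidean_space \<Rightarrow> real"
  shows "ennreal \<bar>LINT x:S|lborel. f x\<bar> \<le> (\<integral>\<^sup>+x\<in>S. ennreal \<bar>f x\<bar> \<partial>lborel)"
proof (cases "set_integrable lborel S f")
  case True
  then have "ennreal (norm (LINT x|lborel. indicator S x *\<^sub>R f x)) \<le> (\<integral>\<^sup>+x. ennreal (norm (indicator S x *\<^sub>R f x)) \<partial>lborel)"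
    unfolding set_integrable_def by (rule integral_norm_bound_ennreal)
  also have "\<dots> = (\<integral>\<^sup>+x\<in>S. ennreal \<bar>f x\<bar> \<partial>lborel)"
    by (rule nn_integral_cong) (auto split: split_indicator)
  finally show ?thesis by (simp add: set_lebesgue_integral_def)
next
  case False
  then show ?thesis
    by (simp add: set_integrable_def set_lebesgue_integral_def not_integrable_integral_eq)
qed

lemma nn_integral_translate:
  fixes f :: "'a::euclidean_space \<Rightarrow> ennreal"
  assumes [measurable]: "f \<in> borel_measurable borel"
  shows "(\<integral>\<^sup>+x. f (a + x) \<partial>lborel) = (\<integral>\<^sup>+x. f x \<partial>lborel)"
proof -
  have "(\<integral>\<^sup>+x. f x \<partial>lborel) = (\<integral>\<^sup>+x. f x \<partial>distr lborel borel ((+) a))" by (simp only: lborel_distr_plus)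
  also have "\<dots> = (\<integral>\<^sup>+x. f (a + x) \<partial>lborel)" by (subst nn_integral_distr) auto
  finally show ?thesis by simp
qed

text \<open>Jensen for the square: expand the integral of the squared deviation from the mean, which
  is nonnegative.\<close>

lemma mean_square_le:
  fixes f :: "'a::euclidean_space \<Rightarrow> real"
  assumes S: "S \<in> sets borel" "emeasure lborel S < \<infinity>" "0 < vol S"
    and f: "set_integrable lborel S f" "set_integrable lborel S (\<lambda>x. (f x)\<^sup>2)"
  shows "(mean S f)\<^sup>2 \<le> mean S (\<lambda>x. (f x)\<^sup>2)"
proof -
  let ?m = "mean S f"
  have c[simp]: "set_integrable lborel S (\<lambda>_. c)" for c :: real
    unfolding set_integrable_def using S by auto
  have ci: "(LINT x:S|lborel. c) = c * vol S" for c :: real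
    using S by (simp add: set_lebesgue_integral_def)
  have "0 \<le> (LINT x:S|lborel. (f x - ?m)\<^sup>2)" 
    unfolding set_lebesgue_integral_def by (rule integral_nonneg_AE) (auto split: split_indicator)
  also have "\<dots> = (LINT x:S|lborel. (f x)\<^sup>2 - (2 * ?m * f x - ?m\<^sup>2))"
    by (simp add: power2_diff algebra_simps)
  also have "\<dots> = (LINT x:S|lborel. (f x)\<^sup>2) - (2 * ?m * (LINT x:S|lborel. f x) - ?m\<^sup>2 * vol S)"
    using f by (subst set_integral_diff) (auto simp: set_integral_diff ci)
  also have "\<dots> = (LINT x:S|lborel. (f x)\<^sup>2) - ?m\<^sup>2 * vol S"
    using S by (simp add: mean_def power2_eq_square)
  finally show ?thesis using S by (simp add: mean_def field_simps)
qed

text \<open>h stands for |Du|. The locale isolates what the level set arguments use of a Sobolev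
  function: differences of u under a shift by z are controlled by norm z and h on a ball enlarged by
  norm z, in an L1 and an L2 form, and almost every point is a Lebesgue point. No derivative of u
  occurs from here to the higher integrability theorem.\<close>

locale gradient_pair =
  fixes u h :: "'a::euclidean_space \<Rightarrow> real"
  assumes int_u: "integrable lborel u" "integrable lborel (\<lambda>x. (u x)\<^sup>2)"
    and int_h: "integrable lborel h" "integrable lborel (\<lambda>x. (h x)\<^sup>2)"
    and h_nonneg: "\<And>x. 0 \<le> h x"
    and translation1: "\<And>z x \<rho>. 0 < \<rho> \<Longrightarrow> (\<integral>\<^sup>+y\<in>ball x \<rho>. ennreal \<bar>u (y + z) - u y\<bar> \<partial>lborel)
        \<le> ennreal (norm z * (LINT y:ball x (\<rho> + norm z)|lborel. h y))"
    and translation2: "\<And>z x \<rho>. 0 < \<rho> \<Longrightarrow> (\<integral>\<^sup>+y\<in>ball x \<rho>. ennreal ((u (y + z) - u y)\<^sup>2) \<partial>lborel)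
        \<le> ennreal ((norm z)\<^sup>2 * (LINT y:ball x (\<rho> + norm z)|lborel. (h y)\<^sup>2))"
    and lebesgue_u: "AE x in lborel. ((\<lambda>r. mean (ball x r) u) \<longlongrightarrow> u x) (at_right 0)"
    and lebesgue_h: "AE x in lborel. ((\<lambda>r. mean (ball x r) (\<lambda>y. (h y)\<^sup>2)) \<longlongrightarrow> (h x)\<^sup>2) (at_right 0)"
begin

lemma measurable_u [measurable]: "u \<in> borel_measurable borel"
  and measurable_h [measurable]: "h \<in> borel_measurable borel"
  using int_u(1) int_h(1) by (auto dest: borel_measurable_integrable)

lemma measurable_mean [measurable]: "(\<lambda>w. mean (ball w \<rho>) u) \<in> borel_measurable borel"
proof -
  have [measurable]: "(\<lambda>w. LINT y|lborel. (if dist w y < \<rho> then u y else 0)) \<in> borel_measurable borel"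
    by (rule lborel.borel_measurable_lebesgue_integral) measurable
  have "mean (ball w \<rho>) u = (LINT y|lborel. (if dist w y < \<rho> then u y else 0)) / vol (ball (0::'a) \<rho>)" for w
  proof -
    have "vol (ball w \<rho>) = vol (ball (0::'a) \<rho>)"
      by (cases "0 \<le> \<rho>") (auto simp: content_ball ball_empty)
    then show ?thesis unfolding mean_def set_lebesgue_integral_def
      by (auto intro!: arg_cong2[where f="(/)"] Bochner_Integration.integral_cong split: split_indicator)
  qed
  then show ?thesis by simp
qed

text \<open>Substitute y = w + z and apply the L1 translation bound for each z. Two points of a ball
  of radius \<rho> differ by less than 2 \<rho>, which gives the factor 2 \<rho>, the ball of radius
  2 \<rho> for z, and the enlarged ball of radius 3 \<rho>.\<close>

lemma double_integral_le:
  assumes "0 < \<rho>" and [measurable]: "S \<in> sets borel" "T \<in> sets borel" and ST: "S \<subseteq> ball x \<rho>" "T \<subseteq> ball x \<rho>"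
  shows "(\<integral>\<^sup>+w\<in>S. (\<integral>\<^sup>+y\<in>T. ennreal \<bar>u w - u y\<bar> \<partial>lborel) \<partial>lborel)
    \<le> ennreal (2 * \<rho> * vol (ball (0::'a) (2 * \<rho>)) * (LINT y:ball x (3 * \<rho>)|lborel. h y))"
proof -
  have "(\<integral>\<^sup>+w\<in>S. (\<integral>\<^sup>+y\<in>T. ennreal \<bar>u w - u y\<bar> \<partial>lborel) \<partial>lborel)
    = (\<integral>\<^sup>+w\<in>S. (\<integral>\<^sup>+z. ennreal \<bar>u w - u (w + z)\<bar> * indicator T (w + z) \<partial>lborel) \<partial>lborel)"
    by (intro nn_integral_cong arg_cong2[where f="(*)"] refl nn_integral_translate[symmetric]) simp
  also have "\<dots> = (\<integral>\<^sup>+w. (\<integral>\<^sup>+z. ennreal \<bar>u w - u (w + z)\<bar> * indicator T (w + z) * indicator S w \<partial>lborel) \<partial>lborel)"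
    by (intro nn_integral_cong nn_integral_multc[symmetric]) measurable
  also have "\<dots> \<le> (\<integral>\<^sup>+w. (\<integral>\<^sup>+z. ennreal \<bar>u (w + z) - u w\<bar> * indicator (ball x \<rho>) w * indicator (ball 0 (2*\<rho>)) z \<partial>lborel) \<partial>lborel)"
  proof (intro nn_integral_mono)
    fix w z :: 'a
    have "norm z < 2 * \<rho>" if "w \<in> ball x \<rho>" "w + z \<in> ball x \<rho>"
      using that norm_triangle_ineq4[of "w + z - x" "w - x"] by (auto simp: dist_norm norm_minus_commute)
    then show "ennreal \<bar>u w - u (w + z)\<bar> * indicator T (w + z) * indicator S w
       \<le> ennreal \<bar>u (w + z) - u w\<bar> * indicator (ball x \<rho>) w * indicator (ball 0 (2*\<rho>)) z"
      using ST by (auto split: split_indicator simp: abs_minus_commute)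
  qed
  also have "\<dots> = (\<integral>\<^sup>+z. (\<integral>\<^sup>+w. ennreal \<bar>u (w + z) - u w\<bar> * indicator (ball x \<rho>) w * indicator (ball 0 (2*\<rho>)) z \<partial>lborel) \<partial>lborel)"
    by (rule lborel_pair.Fubini') measurable
  also have "\<dots> = (\<integral>\<^sup>+z\<in>ball 0 (2*\<rho>). (\<integral>\<^sup>+w\<in>ball x \<rho>. ennreal \<bar>u (w + z) - u w\<bar> \<partial>lborel) \<partial>lborel)"
    by (intro nn_integral_cong nn_integral_multc) measurable
  also have "\<dots> \<le> (\<integral>\<^sup>+z\<in>ball (0::'a) (2*\<rho>). ennreal (2 * \<rho> * (LINT y:ball x (3 * \<rho>)|lborel. h y)) \<partial>lborel)"
  proof (intro nn_integral_mono)
    fix z :: 'a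
    show "(\<integral>\<^sup>+w\<in>ball x \<rho>. ennreal \<bar>u (w + z) - u w\<bar> \<partial>lborel) * indicator (ball 0 (2*\<rho>)) z
      \<le> ennreal (2 * \<rho> * (LINT y:ball x (3 * \<rho>)|lborel. h y)) * indicator (ball 0 (2*\<rho>)) z"
    proof (cases "z \<in> ball 0 (2*\<rho>)")
      case True
      have "norm z * (LINT y:ball x (\<rho> + norm z)|lborel. h y) \<le> 2 * \<rho> * (LINT y:ball x (3 * \<rho>)|lborel. h y)"
        using True assms(1)
        by (intro mult_mono set_integral_mono_set)
          (auto simp: int_h h_nonneg set_lebesgue_integral_def intro!: integral_nonneg_AE)
      then show ?thesis
        using True order.trans[OF translation1[OF assms(1), where x=x and z=z] ennreal_leI] by simp
    qed simp
  qed
  also have "\<dots> = ennreal (2 * \<rho> * (LINT y:ball x (3 * \<rho>)|lborel. h y)) * ennreal (vol (ball (0::'a) (2*\<rho>)))"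
    by (subst nn_integral_cmult_indicator) (auto simp: emeasure_ball_eq)
  also have "\<dots> = ennreal (2 * \<rho> * vol (ball (0::'a) (2 * \<rho>)) * (LINT y:ball x (3 * \<rho>)|lborel. h y))"
    by (subst ennreal_mult''[symmetric]) (simp_all add: mult_ac)
  finally show ?thesis .
qed

text \<open>Multiplied by the two volumes, the difference of the means is the double integral of u w
  - u y, so \<open>double_integral_le\<close> applies.\<close>

lemma mean_diff_le:
  assumes \<rho>: "0 < \<rho>" "0 < a" "0 < b" and S: "ball p a \<subseteq> ball x \<rho>" "ball q b \<subseteq> ball x \<rho>"
  shows "\<bar>mean (ball p a) u - mean (ball q b) u\<bar>
    \<le> 2 * \<rho> * vol (ball (0::'a) (2 * \<rho>)) / (vol (ball p a) * vol (ball q b)) * (LINT y:ball x (3 * \<rho>)|lborel. h y)"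
proof -
  let ?S = "ball p a" and ?T = "ball q b"
  let ?I = "2 * \<rho> * vol (ball (0::'a) (2 * \<rho>)) * (LINT y:ball x (3 * \<rho>)|lborel. h y)"
  have I0: "0 \<le> ?I" using \<rho> h_nonneg by (auto intro!: mult_nonneg_nonneg integral_nonneg_AE simp: set_lebesgue_integral_def)
  have su: "set_integrable lborel (ball y r) u" for y r by (rule set_integrable_borel[OF int_u(1)]) auto
  have 1: "(LINT y:?T|lborel. u w - u y) = u w * vol ?T - (LINT y:?T|lborel. u y)" for w
    using su by (subst set_integral_diff) auto
  have "(LINT w:?S|lborel. u w * vol ?T - (LINT y:?T|lborel. u y))
      = (LINT w:?S|lborel. u w) * vol ?T - (LINT y:?T|lborel. u y) * vol ?S"
    using su by (subst set_integral_diff) (auto simp: mult.commute)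
  then have "ennreal \<bar>(LINT w:?S|lborel. u w) * vol ?T - (LINT y:?T|lborel. u y) * vol ?S\<bar>
     = ennreal \<bar>LINT w:?S|lborel. (LINT y:?T|lborel. u w - u y)\<bar>" by (simp add: 1)
  also have "\<dots> \<le> (\<integral>\<^sup>+w\<in>?S. ennreal \<bar>LINT y:?T|lborel. u w - u y\<bar> \<partial>lborel)"
    by (rule abs_set_integral_le)
  also have "\<dots> \<le> (\<integral>\<^sup>+w\<in>?S. (\<integral>\<^sup>+y\<in>?T. ennreal \<bar>u w - u y\<bar> \<partial>lborel) \<partial>lborel)"
    by (intro nn_integral_mono mult_right_mono abs_set_integral_le) auto
  also have "\<dots> \<le> ennreal ?I" by (rule double_integral_le) (use \<rho> S in auto)
  finally have *: "\<bar>(LINT w:?S|lborel. u w) * vol ?T - (LINT y:?T|lborel. u y) * vol ?S\<bar> \<le> ?I"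
    using I0 by simp
  have v: "0 < vol ?S" "0 < vol ?T" using \<rho> by (auto intro: vol_ball_pos)
  have "mean ?S u - mean ?T u
     = ((LINT w:?S|lborel. u w) * vol ?T - (LINT y:?T|lborel. u y) * vol ?S) / (vol ?S * vol ?T)"
    using v by (simp add: mean_def field_simps)
  then have "\<bar>mean ?S u - mean ?T u\<bar> \<le> ?I / (vol ?S * vol ?T)"
    using * v by (simp add: abs_divide abs_mult divide_right_mono)
  then show ?thesis by simp
qed

lemma set_integrable_u_sq:
  "set_integrable lborel (ball x r) (\<lambda>y. (u y - c)\<^sup>2)" 
proof -
  have "set_integrable lborel (ball x r) (\<lambda>y. (u y)\<^sup>2 - (2 * c * u y - c\<^sup>2))"
    by (intro set_integral_diff set_integrable_borel integrable_mult_right int_u set_integrable_const_ball) auto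
  then show ?thesis by (simp add: power2_diff algebra_simps)
qed

text \<open>Compares u with its own average at the small scale \<theta> r. By Jensen the squared
  error is at most an average of squared differences over shifts shorter than \<theta> r, and the L2
  translation bound turns these into the factor (\<theta> r)^2.\<close>

lemma mean_oscillation_le:
  assumes r: "0 < r" "0 < \<theta>" "\<theta> \<le> 1"
  shows "(\<integral>\<^sup>+w\<in>ball x (2 * r). ennreal ((u w - mean (ball w (\<theta> * r)) u)\<^sup>2) \<partial>lborel)
    \<le> ennreal ((\<theta> * r)\<^sup>2 * (LINT y:ball x (3 * r)|lborel. (h y)\<^sup>2))"
proof -
  let ?\<rho> = "\<theta> * r"
  define V where "V = vol (ball (0::'a) ?\<rho>)"
  have \<rho>: "0 < ?\<rho>" "?\<rho> \<le> r" using r by (auto simp: mult_le_cancel_right2)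
  have V: "0 < V" unfolding V_def using \<rho> by (intro vol_ball_pos)
  have vV: "vol (ball w ?\<rho>) = V" for w :: 'a using \<rho> unfolding V_def by (simp only: content_ball[OF less_imp_le])
  have eV: "emeasure lborel (ball w ?\<rho>) = ennreal V" for w :: 'a
    unfolding vV[of w, symmetric] by (rule emeasure_ball_eq)
  have su: "set_integrable lborel (ball y r) u" for y r by (rule set_integrable_borel[OF int_u(1)]) auto
  have step: "ennreal ((u w - mean (ball w ?\<rho>) u)\<^sup>2)
     \<le> ennreal (1 / V) * (\<integral>\<^sup>+z. ennreal ((u (w + z) - u w)\<^sup>2) * indicator (ball 0 ?\<rho>) z \<partial>lborel)" for w
  proof -
    let ?B = "ball w ?\<rho>"
    have "mean ?B (\<lambda>y. u y - u w) = mean ?B u - u w"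
      using V by (simp add: mean_def set_integral_diff(2)[OF su set_integrable_const_ball] vV diff_divide_distrib)
    then have "(u w - mean ?B u)\<^sup>2 = (mean ?B (\<lambda>y. u y - u w))\<^sup>2" by (simp add: power2_commute)
    also have "\<dots> \<le> mean ?B (\<lambda>y. (u y - u w)\<^sup>2)"
      using V by (intro mean_square_le set_integrable_u_sq set_integral_diff su) 
         (auto simp: vV eV)
    finally have "ennreal ((u w - mean ?B u)\<^sup>2) \<le> ennreal (1 / V * (LINT y:?B|lborel. (u y - u w)\<^sup>2))"
      by (simp add: mean_def vV ennreal_leI)
    also have "\<dots> = ennreal (1 / V) * ennreal (LINT y:?B|lborel. (u y - u w)\<^sup>2)"
      using V by (subst ennreal_mult') auto
    also have "\<dots> \<le> ennreal (1 / V) * (\<integral>\<^sup>+y\<in>?B. ennreal ((u y - u w)\<^sup>2) \<partial>lborel)"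
      using abs_set_integral_le[of "?B" "\<lambda>y. (u y - u w)\<^sup>2"]
      by (intro mult_left_mono) (auto simp: set_lebesgue_integral_def)
    also have "(\<integral>\<^sup>+y\<in>?B. ennreal ((u y - u w)\<^sup>2) \<partial>lborel)
       = (\<integral>\<^sup>+z. ennreal ((u (w + z) - u w)\<^sup>2) * indicator ?B (w + z) \<partial>lborel)"
      by (rule nn_integral_translate[symmetric]) measurable
    also have "\<dots> = (\<integral>\<^sup>+z. ennreal ((u (w + z) - u w)\<^sup>2) * indicator (ball 0 ?\<rho>) z \<partial>lborel)"
      by (intro nn_integral_cong) (auto split: split_indicator simp: dist_norm)
    finally show ?thesis .
  qed
  have "(\<integral>\<^sup>+w\<in>ball x (2 * r). ennreal ((u w - mean (ball w ?\<rho>) u)\<^sup>2) \<partial>lborel)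
    \<le> (\<integral>\<^sup>+w\<in>ball x (2 * r). ennreal (1 / V) * (\<integral>\<^sup>+z. ennreal ((u (w + z) - u w)\<^sup>2) * indicator (ball 0 ?\<rho>) z \<partial>lborel) \<partial>lborel)"
    by (intro nn_integral_mono mult_right_mono step) auto
  also have "\<dots> = (\<integral>\<^sup>+w. ennreal (1 / V) * (\<integral>\<^sup>+z. ennreal ((u (w + z) - u w)\<^sup>2) * indicator (ball 0 ?\<rho>) z * indicator (ball x (2 * r)) w \<partial>lborel) \<partial>lborel)"
    by (intro nn_integral_cong) (subst nn_integral_multc, measurable, simp add: mult.assoc)
  also have "\<dots> = ennreal (1 / V) * (\<integral>\<^sup>+w. (\<integral>\<^sup>+z. ennreal ((u (w + z) - u w)\<^sup>2) * indicator (ball 0 ?\<rho>) z * indicator (ball x (2 * r)) w \<partial>lborel) \<partial>lborel)"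
    by (rule nn_integral_cmult) measurable
  also have "(\<integral>\<^sup>+w. (\<integral>\<^sup>+z. ennreal ((u (w + z) - u w)\<^sup>2) * indicator (ball 0 ?\<rho>) z * indicator (ball x (2 * r)) w \<partial>lborel) \<partial>lborel)
    = (\<integral>\<^sup>+z. (\<integral>\<^sup>+w. ennreal ((u (w + z) - u w)\<^sup>2) * indicator (ball 0 ?\<rho>) z * indicator (ball x (2 * r)) w \<partial>lborel) \<partial>lborel)"
    by (rule lborel_pair.Fubini') measurable
  also have "\<dots> \<le> (\<integral>\<^sup>+z. ennreal (?\<rho>\<^sup>2 * (LINT y:ball x (3 * r)|lborel. (h y)\<^sup>2)) * indicator (ball (0::'a) ?\<rho>) z \<partial>lborel)"
  proof (intro nn_integral_mono)
    fix z :: 'a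
    show "(\<integral>\<^sup>+w. ennreal ((u (w + z) - u w)\<^sup>2) * indicator (ball 0 ?\<rho>) z * indicator (ball x (2 * r)) w \<partial>lborel)
       \<le> ennreal (?\<rho>\<^sup>2 * (LINT y:ball x (3 * r)|lborel. (h y)\<^sup>2)) * indicator (ball (0::'a) ?\<rho>) z"
    proof (cases "z \<in> ball 0 ?\<rho>")
      case True
      have "(norm z)\<^sup>2 * (LINT y:ball x (2 * r + norm z)|lborel. (h y)\<^sup>2) \<le> ?\<rho>\<^sup>2 * (LINT y:ball x (3 * r)|lborel. (h y)\<^sup>2)"
        using True \<rho>
        by (intro mult_mono set_integral_mono_set power_mono)
          (auto simp: int_h set_lebesgue_integral_def intro!: integral_nonneg_AE)
      then show ?thesis
        using True r order.trans[OF translation2[of "2 * r", where x=x and z=z] ennreal_leI] by simp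
    qed simp
  qed
  also have "\<dots> = ennreal (?\<rho>\<^sup>2 * (LINT y:ball x (3 * r)|lborel. (h y)\<^sup>2)) * ennreal V"
    using \<rho> by (subst nn_integral_cmult_indicator) (auto simp: eV)
  finally have "(\<integral>\<^sup>+w\<in>ball x (2 * r). ennreal ((u w - mean (ball w ?\<rho>) u)\<^sup>2) \<partial>lborel)
    \<le> ennreal (1 / V) * (ennreal (?\<rho>\<^sup>2 * (LINT y:ball x (3 * r)|lborel. (h y)\<^sup>2)) * ennreal V)"
    by (simp add: mult_left_mono)
  also have "\<dots> = ennreal (?\<rho>\<^sup>2 * (LINT y:ball x (3 * r)|lborel. (h y)\<^sup>2))"
    using V by (subst ennreal_mult''[symmetric], simp, subst ennreal_mult'[symmetric], simp, simp)
  finally show ?thesis .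
qed

text \<open>Compare u first with its averages at scale \<theta> r, then those averages with the
  fixed mean. The first error is small in L2 through \<theta>^2; the second involves only the
  integral of h to the first power, with a constant that blows up as \<theta> tends to 0. This trade
  takes the place of a Sobolev-Poincare inequality: the L2 term will be absorbed, and the L1 term is
  what gains integrability.\<close>

lemma poincare_with_small_constant:
  assumes r: "0 < r" "0 < \<theta>" "\<theta> \<le> 1" "0 < \<kappa>" and S: "ball q (\<kappa> * r) \<subseteq> ball x (3 * r)"
  shows "(LINT w:ball x (2 * r)|lborel. (u w - mean (ball q (\<kappa> * r)) u)\<^sup>2)
    \<le> 2 * \<theta>\<^sup>2 * r\<^sup>2 * (LINT y:ball x (3 * r)|lborel. (h y)\<^sup>2)
      + 72 * 2 ^ DIM('a) * ((6 / (\<theta> * \<kappa>)) ^ DIM('a))\<^sup>2 * r\<^sup>2 / vol (ball x r) * (LINT y:ball x (9 * r)|lborel. h y)\<^sup>2"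
proof -
  let ?c = "mean (ball q (\<kappa> * r)) u" and ?I = "LINT y:ball x (9 * r)|lborel. h y"
  let ?v = "unit_ball_vol (real DIM('a))" and ?n = "DIM('a)" and ?J = "LINT y:ball x (3 * r)|lborel. (h y)\<^sup>2"
  \<comment> \<open>The bound of \<open>mean_diff_le\<close> for balls of radii \<theta> r and
    \<kappa> r inside a ball of radius 3 r: the volumes give the power of 6 / (\<theta> \<kappa>),
    and tripling the radius once more gives 9 r.\<close>
  define D where "D = 6 * r * (6 / (\<theta> * \<kappa>)) ^ ?n / vol (ball x r) * ?I"
  have \<theta>r: "\<theta> * r \<le> r" using r by (auto simp: mult_le_cancel_right2)
  have v: "0 < ?v" by simp
  have V: "0 < vol (ball x r)" by (rule vol_ball_pos) (rule r)
  have J0: "0 \<le> ?J" by (auto simp: set_lebesgue_integral_def intro!: integral_nonneg_AE)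
  have D: "(mean (ball w (\<theta> * r)) u - ?c)\<^sup>2 \<le> D\<^sup>2" if w: "w \<in> ball x (2 * r)" for w
  proof -
    have sub: "ball w (\<theta> * r) \<subseteq> ball x (3 * r)"
    proof
      fix y assume "y \<in> ball w (\<theta> * r)"
      then have "dist x y < 2 * r + \<theta> * r" using w dist_triangle[of x y w] by auto
      then show "y \<in> ball x (3 * r)" using \<theta>r by auto
    qed
    have "\<bar>mean (ball w (\<theta> * r)) u - ?c\<bar>
        \<le> 2 * (3 * r) * vol (ball (0::'a) (2 * (3 * r))) / (vol (ball w (\<theta> * r)) * vol (ball q (\<kappa> * r))) * (LINT y:ball x (3 * (3 * r))|lborel. h y)"
      by (rule mean_diff_le) (use r sub S in auto)
    also have "\<dots> = D"
      using r v by (simp add: D_def content_ball power_mult_distrib power_divide field_simps)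
    finally show ?thesis by (simp add: abs_le_square_iff[symmetric])
  qed
  have su: "set_integrable lborel (ball x (2 * r)) (\<lambda>w. (u w - ?c)\<^sup>2)" by (rule set_integrable_u_sq)
  have "ennreal (LINT w:ball x (2 * r)|lborel. (u w - ?c)\<^sup>2) = ennreal \<bar>LINT w:ball x (2 * r)|lborel. (u w - ?c)\<^sup>2\<bar>"
    by (simp add: set_lebesgue_integral_def)
  also have "\<dots> \<le> (\<integral>\<^sup>+w\<in>ball x (2 * r). ennreal \<bar>(u w - ?c)\<^sup>2\<bar> \<partial>lborel)" by (rule abs_set_integral_le)
  also have "\<dots> \<le> (\<integral>\<^sup>+w. (2 * (ennreal ((u w - mean (ball w (\<theta> * r)) u)\<^sup>2) * indicator (ball x (2 * r)) w)
       + ennreal (2 * D\<^sup>2) * indicator (ball x (2 * r)) w) \<partial>lborel)"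
  proof (rule nn_integral_mono)
    fix w
    have sq: "(u w - ?c)\<^sup>2 \<le> 2 * (u w - mean (ball w (\<theta> * r)) u)\<^sup>2 + 2 * D\<^sup>2" if "w \<in> ball x (2 * r)"
    proof -
      have "(a + b)\<^sup>2 \<le> 2 * a\<^sup>2 + 2 * b\<^sup>2" for a b :: real
        using sum_squares_bound[of a b] by (simp add: power2_sum)
      from this[of "u w - mean (ball w (\<theta> * r)) u" "mean (ball w (\<theta> * r)) u - ?c"] D[OF that]
      show ?thesis by simp
    qed
    show "ennreal \<bar>(u w - ?c)\<^sup>2\<bar> * indicator (ball x (2 * r)) w
      \<le> 2 * (ennreal ((u w - mean (ball w (\<theta> * r)) u)\<^sup>2) * indicator (ball x (2 * r)) w) + ennreal (2 * D\<^sup>2) * indicator (ball x (2 * r)) w"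
    proof (cases "w \<in> ball x (2 * r)")
      case True
      have "ennreal ((u w - ?c)\<^sup>2) \<le> ennreal (2 * (u w - mean (ball w (\<theta> * r)) u)\<^sup>2 + 2 * D\<^sup>2)"
        by (rule ennreal_leI[OF sq[OF True]])
      then show ?thesis using True by (simp add: ennreal_mult)
    qed simp
  qed
  also have "\<dots> \<le> (\<integral>\<^sup>+w. (2 * (ennreal ((u w - mean (ball w (\<theta> * r)) u)\<^sup>2) * indicator (ball x (2 * r)) w)) \<partial>lborel)
       + (\<integral>\<^sup>+w. ennreal (2 * D\<^sup>2) * indicator (ball x (2 * r)) w \<partial>lborel)"
    by (subst nn_integral_add) auto
  also have "\<dots> \<le> 2 * ennreal ((\<theta> * r)\<^sup>2 * ?J) + ennreal (2 * D\<^sup>2) * ennreal (vol (ball x (2 * r)))"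
  proof (rule add_mono)
    show "(\<integral>\<^sup>+w. (2 * (ennreal ((u w - mean (ball w (\<theta> * r)) u)\<^sup>2) * indicator (ball x (2 * r)) w)) \<partial>lborel)
       \<le> 2 * ennreal ((\<theta> * r)\<^sup>2 * ?J)"
      by (subst nn_integral_cmult) (auto intro!: mult_left_mono mean_oscillation_le r)
    show "(\<integral>\<^sup>+w. ennreal (2 * D\<^sup>2) * indicator (ball x (2 * r)) w \<partial>lborel)
      \<le> ennreal (2 * D\<^sup>2) * ennreal (vol (ball x (2 * r)))"
      by (subst nn_integral_cmult_indicator) (auto simp: emeasure_ball_eq)
  qed
  also have "\<dots> = ennreal (2 * \<theta>\<^sup>2 * r\<^sup>2 * ?J + 2 * D\<^sup>2 * vol (ball x (2 * r)))"
    using J0 by (subst ennreal_mult'[symmetric], simp, subst ennreal_numeral[symmetric], subst ennreal_mult'[symmetric], simp,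
      subst ennreal_plus[symmetric]) (auto simp: power_mult_distrib mult_ac)
  finally have "(LINT w:ball x (2 * r)|lborel. (u w - ?c)\<^sup>2) \<le> 2 * \<theta>\<^sup>2 * r\<^sup>2 * ?J + 2 * D\<^sup>2 * vol (ball x (2 * r))"
    using J0 by (subst (asm) ennreal_le_iff) auto
  also have "2 * D\<^sup>2 * vol (ball x (2 * r)) = 72 * 2 ^ ?n * ((6 / (\<theta> * \<kappa>)) ^ ?n)\<^sup>2 * r\<^sup>2 / vol (ball x r) * ?I\<^sup>2"
    using r v by (simp add: D_def content_ball power_mult_distrib power_divide field_simps power2_eq_square)
  finally show ?thesis .
qed

end

section \<open>Pointwise bounds for u and its level sets\<close>

lemma integral_truncated_tendsto_0:
  fixes f h :: "'a \<Rightarrow> real"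
  assumes f: "integrable M f" and [measurable]: "h \<in> borel_measurable M"
  shows "(\<lambda>k. LINT x|M. indicator {x. real k < h x} x * f x) \<longlonglongrightarrow> 0"
proof -
  have [measurable]: "f \<in> borel_measurable M" using f by auto
  have "(\<lambda>k. LINT x|M. (if real k < h x then f x else 0)) \<longlonglongrightarrow> (LINT x|M. 0)"
  proof (rule integral_dominated_convergence[where w="\<lambda>x. \<bar>f x\<bar>"])
    show "AE x in M. (\<lambda>k. if real k < h x then f x else 0) \<longlonglongrightarrow> 0"
    proof (rule AE_I2, rule tendsto_eventually)
      fix x
      obtain k :: nat where "h x < real k" using reals_Archimedean2 by blast
      then show "eventually (\<lambda>k. (if real k < h x then f x else 0) = 0) sequentially"
        by (intro eventually_sequentiallyI[of k]) auto
    qed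
  qed (use f in auto)
  moreover have "(LINT x|M. indicator {x. real k < h x} x * f x) = (LINT x|M. (if real k < h x then f x else 0))" for k
    by (intro Bochner_Integration.integral_cong) auto
  ultimately show ?thesis by simp
qed

lemma ex_binary_scale:
  assumes "1 \<le> (Y :: real)"
  obtains N :: nat where "2 ^ N \<le> Y" "Y < 2 ^ Suc N"
proof -
  have L: "0 \<le> \<lfloor>log 2 Y\<rfloor>" using assms by (simp add: zero_le_log_cancel_iff)
  define N where "N = nat \<lfloor>log 2 Y\<rfloor>"
  have "real N \<le> log 2 Y" "log 2 Y < real N + 1"
    using L unfolding N_def by linarith+
  then have "2 powr real N \<le> Y" "Y < 2 powr (real N + 1)"
    using assms by (simp_all add: le_log_iff log_less_iff)
  then show ?thesis using that[of N] by (simp add: powr_add powr_realpow)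
qed

context gradient_pair begin

text \<open>Tends to 0 as K grows, by dominated convergence, but at a rate that depends on h itself
  and not only on its norm. The thresholds from which the level set bounds below hold inherit this
  dependence.\<close>

definition tail :: "real \<Rightarrow> real" where
  "tail K = (LINT y|lborel. indicator {y. K < h y} y * (h y)\<^sup>2)"

lemma tail_nonneg: "0 \<le> tail K"
  unfolding tail_def by (rule integral_nonneg_AE) auto

text \<open>\<open>mean_diff_le\<close> for concentric balls. In 12^d = 4^d 3^d the factor 4^d is
  the volume ratio of the radii 2 \<rho> and \<rho>/2, and 3^d normalises the integral to a mean
  over radius 3 \<rho>.\<close>

lemma mean_dyadic_diff_le:
  assumes "0 < \<rho>"
  shows "\<bar>mean (ball x \<rho>) u - mean (ball x (\<rho> / 2)) u\<bar> \<le> 2 * 12 ^ DIM('a) * \<rho> * mean (ball x (3 * \<rho>)) h"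
proof -
  have "\<bar>mean (ball x \<rho>) u - mean (ball x (\<rho> / 2)) u\<bar>
     \<le> 2 * \<rho> * vol (ball (0::'a) (2 * \<rho>)) / (vol (ball x \<rho>) * vol (ball x (\<rho> / 2))) * (LINT y:ball x (3 * \<rho>)|lborel. h y)"
    by (rule mean_diff_le) (use assms in auto)
  also have "2 * \<rho> * vol (ball (0::'a) (2 * \<rho>)) / (vol (ball x \<rho>) * vol (ball x (\<rho> / 2)))
    = 2 * 12 ^ DIM('a) * \<rho> / vol (ball x (3 * \<rho>))"
  proof -
    have "(12::real) ^ DIM('a) = 3 ^ DIM('a) * (2 ^ DIM('a) * 2 ^ DIM('a))"
      by (simp add: power_mult_distrib[symmetric])
    moreover have "0 < unit_ball_vol (real DIM('a))" by simp
    ultimately show ?thesis using assms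
      by (simp add: content_ball power_mult_distrib power_divide del: unit_ball_vol_pos)
  qed
  finally show ?thesis by (simp add: mean_def)
qed

text \<open>Values of h up to K contribute at most K to the mean; the part above K is estimated by
  Jensen, which produces \<open>tail K\<close> divided by the volume of the ball.\<close>

lemma mean_le_tail:
  assumes "0 < \<rho>" "0 \<le> K"
  shows "mean (ball x \<rho>) h \<le> K + sqrt (tail K / vol (ball x \<rho>))"
proof -
  let ?B = "ball x \<rho>"
  have V: "0 < vol ?B" using assms by (intro vol_ball_pos)
  define k where "k y = indicator {y. K < h y} y * h y" for y
  have k2: "(\<lambda>y. (k y)\<^sup>2) = (\<lambda>y. indicator {y. K < h y} y * (h y)\<^sup>2)"
    by (auto simp: k_def fun_eq_iff split: split_indicator)
  have ik2: "integrable lborel (\<lambda>y. (k y)\<^sup>2)" unfolding k2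
    using int_h(2) by (intro Bochner_Integration.integrable_bound[OF int_h(2)]) (auto split: split_indicator)
  have ik: "integrable lborel k"
    using int_h(1) h_nonneg unfolding k_def by (intro Bochner_Integration.integrable_bound[OF int_h(1)]) (auto split: split_indicator)
  have si: "set_integrable lborel ?B h" "set_integrable lborel ?B k" "set_integrable lborel ?B (\<lambda>y. (k y)\<^sup>2)"
    using int_h ik ik2 by (auto intro!: set_integrable_borel)
  have "(mean ?B k)\<^sup>2 \<le> mean ?B (\<lambda>y. (k y)\<^sup>2)"
    using V si by (intro mean_square_le) (auto simp: emeasure_ball_eq)
  also have "\<dots> \<le> tail K / vol ?B"
  proof -
    have "(LINT y:?B|lborel. (k y)\<^sup>2) \<le> (LINT y:UNIV|lborel. (k y)\<^sup>2)"
      by (rule set_integral_mono_set) (use ik2 in auto)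
    then show ?thesis using V unfolding mean_def tail_def k2
      by (intro divide_right_mono) (auto simp: set_lebesgue_integral_def)
  qed
  finally have mk: "mean ?B k \<le> sqrt (tail K / vol ?B)" by (rule real_le_rsqrt)
  have "(LINT y:?B|lborel. h y) \<le> (LINT y:?B|lborel. K + k y)"
    by (rule set_integral_mono) (use si assms h_nonneg set_integral_add(1)[OF set_integrable_const_ball si(2)] in \<open>auto simp: k_def split: split_indicator\<close>)
  also have "\<dots> = K * vol ?B + (LINT y:?B|lborel. k y)"
    by (subst set_integral_add) (use si in auto)
  finally have "mean ?B h \<le> K + mean ?B k"
    using V by (simp add: mean_def field_simps)
  then show ?thesis using mk by simp
qed

text \<open>u x is the limit of the means over radii 2^(-k), and the differences of successive means
  are summed. For k below N the mean of h is bounded through \<open>tail K\<close>: the root of the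
  volume costs 2^(kd/2) \<le> 2^(k(1+s)), and after the factor 2^(-k) a geometric series of ratio
  2^s remains. From N on the maximal bound m is used and the series decreases. N is left free in
  order to balance the two.\<close>

lemma pointwise_bound:
  assumes leb: "((\<lambda>r. mean (ball x r) u) \<longlongrightarrow> u x) (at_right 0)"
    and x: "x \<notin> maximal_set 3 h m" and "0 \<le> K" and s: "0 < s" "real DIM('a) \<le> 2 * (1 + s)"
  shows "\<bar>u x\<bar> \<le> (LINT y|lborel. \<bar>u y\<bar>) / vol (ball x 1) + 2 * 12 ^ DIM('a) *
     (2 * (1 / 2) ^ N * m + 2 * K + sqrt (tail K / vol (ball x 1)) * (2 powr s) ^ N / (2 powr s - 1))"
proof -
  define \<rho> where "\<rho> k = (1 / 2 :: real) ^ k" for k :: nat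
  define a where "a k = mean (ball x (\<rho> k)) u" for k
  define C where "C = 2 * 12 ^ DIM('a :: euclidean_space) * (1::real)"
  define S where "S = sqrt (tail K / vol (ball x 1))"
  define q where "q = 2 powr s"
  have q: "1 < q" using s powr_less_mono[of 0 s 2] unfolding q_def by simp
  have \<rho>: "0 < \<rho> k" "\<rho> k \<le> 1" "\<rho> (Suc k) = \<rho> k / 2" for k
    by (auto simp: \<rho>_def power_le_one)
  have C: "0 < C" by (simp add: C_def)
  have V: "0 < vol (ball x r)" if "0 < r" for r using that by (intro vol_ball_pos)
  have lim: "a \<longlonglongrightarrow> u x"
  proof -
    have "filterlim \<rho> (at_right 0) sequentially"
      unfolding \<rho>_def filterlim_at by (auto intro!: LIMSEQ_power_zero always_eventually)
    from filterlim_compose[OF leb this] show ?thesis by (simp add: a_def[abs_def])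
  qed
  have step: "\<bar>a k - a (Suc k)\<bar> \<le> C * (\<rho> k * mean (ball x (3 * \<rho> k)) h)" for k
    using mean_dyadic_diff_le[OF \<rho>(1), of x k] by (simp add: a_def C_def \<rho>(3) mult.assoc)
  \<comment> \<open>The radii 3 * \<rho> k are at most 3, which is why the maximal set admits radii
    up to 3.\<close>
  have b1: "\<rho> k * mean (ball x (3 * \<rho> k)) h \<le> \<rho> k * m" for k
  proof -
    have "(LINT y:ball x (3 * \<rho> k)|lborel. h y) \<le> m * vol (ball x (3 * \<rho> k))"
      using x \<rho>[of k] unfolding maximal_set_def by (auto simp: not_less dest!: spec[of _ "3 * \<rho> k"])
    then have "mean (ball x (3 * \<rho> k)) h \<le> m" using V[of "3 * \<rho> k"] \<rho>[of k] by (simp add: mean_def field_simps)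
    then show ?thesis using \<rho>(1)[of k] by (intro mult_left_mono) auto
  qed
  have b2: "\<rho> k * mean (ball x (3 * \<rho> k)) h \<le> \<rho> k * K + S * q ^ k" for k
  proof -
    have "tail K / vol (ball x (3 * \<rho> k)) \<le> tail K / (vol (ball x 1) * \<rho> k ^ DIM('a))"
    proof (rule divide_left_mono)
      have "vol (ball x 1) * \<rho> k ^ DIM('a) = vol (ball x (\<rho> k))" using \<rho>(1)[of k] by (simp add: content_ball)
      also have "\<dots> \<le> vol (ball x (3 * \<rho> k))"
        using \<rho>(1)[of k] by (simp add: content_ball power_mono)
      finally show "vol (ball x 1) * \<rho> k ^ DIM('a) \<le> vol (ball x (3 * \<rho> k))" .
    qed (use tail_nonneg V \<rho>(1)[of k] in auto)
    also have "\<dots> = tail K / vol (ball x 1) * (1 / \<rho> k ^ DIM('a))" by simp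
    also have "\<dots> \<le> tail K / vol (ball x 1) * ((2 powr (1 + s)) ^ k)\<^sup>2"
    proof (rule mult_left_mono)
      have "1 / \<rho> k ^ DIM('a) = 2 powr (real k * real DIM('a))"
        by (simp add: \<rho>_def power_one_over powr_realpow[symmetric] powr_powr powr_minus_divide[symmetric] field_simps)
      also have "\<dots> \<le> 2 powr (real k * (2 * (1 + s)))"
        using s by (intro powr_mono mult_left_mono) auto
      also have "\<dots> = ((2 powr (1 + s)) ^ k)\<^sup>2"
        by (simp add: powr_realpow[symmetric] powr_powr powr_add[symmetric] power2_eq_square algebra_simps)
      finally show "1 / \<rho> k ^ DIM('a) \<le> ((2 powr (1 + s)) ^ k)\<^sup>2" .
    qed (use tail_nonneg in auto)
    finally have "sqrt (tail K / vol (ball x (3 * \<rho> k))) \<le> sqrt (tail K / vol (ball x 1) * ((2 powr (1 + s)) ^ k)\<^sup>2)"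
      by (rule real_sqrt_le_mono)
    moreover have "mean (ball x (3 * \<rho> k)) h \<le> K + sqrt (tail K / vol (ball x (3 * \<rho> k)))"
      by (rule mean_le_tail) (use \<rho>(1)[of k] assms in auto)
    ultimately have "mean (ball x (3 * \<rho> k)) h \<le> K + sqrt (tail K / vol (ball x 1) * ((2 powr (1 + s)) ^ k)\<^sup>2)"
      by linarith
    then have *: "mean (ball x (3 * \<rho> k)) h \<le> K + S * (2 powr (1 + s)) ^ k"
      by (simp only: S_def real_sqrt_mult real_sqrt_abs abs_power2 abs_of_nonneg zero_le_power powr_ge_zero)
    have "\<rho> k * mean (ball x (3 * \<rho> k)) h \<le> \<rho> k * (K + S * (2 powr (1 + s)) ^ k)"
      using * \<rho>(1)[of k] by (intro mult_left_mono) auto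
    also have "\<dots> = \<rho> k * K + S * (\<rho> k * (2 powr (1 + s)) ^ k)" by (simp add: algebra_simps)
    also have "\<rho> k * (2 powr (1 + s)) ^ k = q ^ k"
      unfolding \<rho>_def q_def by (subst power_mult_distrib[symmetric]) (simp add: powr_add)
    finally show ?thesis .
  qed
  have tele: "\<bar>a i - a (i + j)\<bar> \<le> (\<Sum>k<j. \<bar>a (i + k) - a (Suc (i + k))\<bar>)" for i j
    by (induction j) auto
  have geo: "(\<Sum>k<j. \<rho> (i + k)) \<le> 2 * \<rho> i" for i j
  proof -
    have "(\<Sum>k<j. \<rho> (i + k)) = \<rho> i * (\<Sum>k<j. (1/2) ^ k)"
      by (simp add: \<rho>_def power_add sum_distrib_left)
    also have "(\<Sum>k<j. (1/2 :: real) ^ k) \<le> 2" by (simp add: sum_gp_strict)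
    finally show ?thesis using \<rho>(1)[of i] by (simp add: mult_left_mono mult.commute)
  qed
  have m0: "0 \<le> m"
  proof -
    have "0 \<le> mean (ball x (3 * \<rho> 0)) h" by (auto simp: mean_def set_lebesgue_integral_def h_nonneg intro!: divide_nonneg_nonneg integral_nonneg_AE)
    then show ?thesis using b1[of 0] \<rho>(1)[of 0] by (auto simp: \<rho>_def)
  qed
  have "\<bar>a N - a (N + j)\<bar> \<le> C * (2 * \<rho> N * m)" for j
  proof -
    have "\<bar>a N - a (N + j)\<bar> \<le> (\<Sum>k<j. C * (\<rho> (N + k) * m))"
      by (rule order.trans[OF tele sum_mono]) (rule order.trans[OF step mult_left_mono[OF b1]], use C in auto)
    also have "\<dots> = C * ((\<Sum>k<j. \<rho> (N + k)) * m)" by (simp add: sum_distrib_left sum_distrib_right)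
    also have "\<dots> \<le> C * (2 * \<rho> N * m)"
      using C m0 geo by (intro mult_left_mono mult_right_mono) auto
    finally show ?thesis .
  qed
  moreover have "(\<lambda>j. \<bar>a N - a (N + j)\<bar>) \<longlonglongrightarrow> \<bar>a N - u x\<bar>"
    using LIMSEQ_ignore_initial_segment[OF lim, of N] by (intro tendsto_intros) (simp add: add.commute)
  ultimately have 1: "\<bar>a N - u x\<bar> \<le> C * (2 * \<rho> N * m)" by (intro LIMSEQ_le_const2) auto
  have "\<bar>a 0 - a (0 + N)\<bar> \<le> (\<Sum>k<N. C * (\<rho> (0 + k) * K + S * q ^ k))"
    by (rule order.trans[OF tele sum_mono]) (rule order.trans[OF step mult_left_mono], use C b2 in auto)
  also have "\<dots> = C * ((\<Sum>k<N. \<rho> (0 + k)) * K + S * (\<Sum>k<N. q ^ k))"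
    by (simp add: sum_distrib_left sum_distrib_right sum.distrib algebra_simps)
  also have "\<dots> \<le> C * (2 * K + S * (q ^ N / (q - 1)))"
  proof (intro mult_left_mono add_mono mult_right_mono)
    show "(\<Sum>k<N. \<rho> (0 + k)) \<le> 2" using geo[of 0 N] by (simp add: \<rho>_def)
    show "(\<Sum>k<N. q ^ k) \<le> q ^ N / (q - 1)"
      using q geometric_sum[of q N] by (simp add: divide_right_mono)
  qed (use assms C tail_nonneg in \<open>auto simp: S_def\<close>)
  finally have 2: "\<bar>a 0 - a N\<bar> \<le> C * (2 * K + S * (q ^ N / (q - 1)))" by simp
  have "\<bar>a 0\<bar> \<le> (LINT y|lborel. \<bar>u y\<bar>) / vol (ball x 1)"
  proof -
    have "\<bar>LINT y:ball x 1|lborel. u y\<bar> \<le> (LINT y:ball x 1|lborel. \<bar>u y\<bar>)"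
      using set_integral_norm_bound[OF set_integrable_borel[OF int_u(1)], of "ball x 1"] by simp
    also have "\<dots> \<le> (LINT y:UNIV|lborel. \<bar>u y\<bar>)"
      by (rule set_integral_mono_set) (use int_u in auto)
    finally show ?thesis using V[of 1]
      by (simp add: a_def \<rho>_def mean_def abs_divide divide_right_mono set_lebesgue_integral_def)
  qed
  then have "\<bar>u x\<bar> \<le> (LINT y|lborel. \<bar>u y\<bar>) / vol (ball x 1) + C * (2 * \<rho> N * m + 2 * K + S * q ^ N / (q - 1))"
    using 1 2 by (simp add: algebra_simps)
  then show ?thesis by (simp add: C_def S_def q_def \<rho>_def)
qed

text \<open>Splitting the dyadic means of \<open>u\<close> at the scale where \<open>2 ^ N\<close> is comparable to \<open>m powr (1 - \<alpha>)\<close>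
  balances the two contributions in \<open>pointwise_bound\<close>; only the part of \<open>h\<close> above a large level enters with a
  large radius, which makes the constant arbitrarily small.\<close>

lemma level_set_subset_maximal_set:
  assumes \<alpha>: "0 < \<alpha>" "\<alpha> < 1" "real DIM('a) * (1 - \<alpha>) \<le> 2" and e: "0 < e"
  shows "\<exists>\<tau>0>0. \<forall>\<tau>\<ge>\<tau>0. AE x in lborel. x \<notin> maximal_set 3 h (\<tau> / e) \<longrightarrow> \<bar>u x\<bar> powr (1 / \<alpha>) \<le> \<tau>"
proof -
  \<comment> \<open>With this s the hypothesis d (1 - \<alpha>) \<le> 2 becomes d \<le> 2 (1 + s),
    and a scale 2^N comparable to m^(1 - \<alpha>) makes (2^N)^s comparable to m^\<alpha>.\<close>
  define s where "s = \<alpha> / (1 - \<alpha>)"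
  have s: "0 < s" "real DIM('a) \<le> 2 * (1 + s)" "(1 - \<alpha>) * s = \<alpha>"
    using \<alpha> by (auto simp: s_def field_simps)
  define v where "v = vol (ball (0::'a) 1)"
  have v: "0 < v" unfolding v_def by (rule vol_ball_pos) simp
  have vx: "vol (ball x 1) = v" for x :: 'a by (simp add: v_def content_ball)
  define C where "C = 2 * 12 ^ DIM('a :: euclidean_space) * (1::real)"
  have C: "0 < C" by (simp add: C_def)
  define E where "E = e powr \<alpha>"
  have E: "0 < E" using e by (simp add: E_def)
  \<comment> \<open>Makes the contribution of the small scales, at most 4 C / A times m^\<alpha>, a
    quarter of E m^\<alpha>. Another quarter is reserved for the tail term and one half for the
    terms that do not grow with m.\<close>
  define A where "A = 16 * C / E"
  have A: "0 < A" using C E by (simp add: A_def)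
  define q where "q = 2 powr s"
  have q: "1 < q" using s powr_less_mono[of 0 s 2] unfolding q_def by simp
  \<comment> \<open>Only the growing geometric series needs a small factor, and the tail provides
    it. The level K itself goes into M0, which is dominated once m is large.\<close>
  have "(\<lambda>K. C * (sqrt (tail (real K) / v) * A powr s / (q - 1))) \<longlonglongrightarrow> C * (sqrt (0 / v) * A powr s / (q - 1))"
    unfolding tail_def using v q by (intro tendsto_intros integral_truncated_tendsto_0 int_h) auto
  then have "eventually (\<lambda>K. C * (sqrt (tail (real K) / v) * A powr s / (q - 1)) < E / 4) sequentially"
    using E by (intro order_tendstoD(2)) auto
  then obtain K :: nat where K: "C * (sqrt (tail (real K) / v) * A powr s / (q - 1)) < E / 4"
    by (auto simp: eventually_sequentially)
  define M0 where "M0 = (LINT y|lborel. \<bar>u y\<bar>) / v + 2 * C * K"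
  have M0: "0 \<le> M0" unfolding M0_def using v C by (intro add_nonneg_nonneg divide_nonneg_nonneg) auto
  \<comment> \<open>The first entry makes M0 at most half of E m^\<alpha>; the second makes A m^(1 -
    \<alpha>) at least 1, so that an admissible N exists.\<close>
  define m0 where "m0 = max ((2 * M0 / E) powr (1 / \<alpha>)) ((1 / A) powr (1 / (1 - \<alpha>)))"
  have m0: "0 < m0" using A by (auto simp: m0_def less_max_iff_disj)
  have main: "\<bar>u x\<bar> \<le> E * m powr \<alpha>"
    if m: "m0 \<le> m" and x: "x \<notin> maximal_set 3 h m" and leb: "((\<lambda>r. mean (ball x r) u) \<longlongrightarrow> u x) (at_right 0)" for m x
  proof -
    have mpos: "0 < m" using m m0 by simp
    let ?Y = "A * m powr (1 - \<alpha>)"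
    have "1 / A = ((1 / A) powr (1 / (1 - \<alpha>))) powr (1 - \<alpha>)" using \<alpha> A by (simp add: powr_powr)
    also have "\<dots> \<le> m powr (1 - \<alpha>)" using m \<alpha> by (intro powr_mono2) (auto simp: m0_def)
    finally have "1 \<le> ?Y" using A by (simp add: field_simps)
    \<comment> \<open>A smaller N would spoil the bound for the small scales, a larger N the one for
      the tail term.\<close>
    then obtain N where N: "2 ^ N \<le> ?Y" "?Y < 2 ^ Suc N" by (rule ex_binary_scale)
    have "(1 / 2) ^ N \<le> 2 / ?Y" using N(2) A mpos by (simp add: power_one_over field_simps)
    then have "2 * (1 / 2) ^ N * m \<le> 2 * (2 / ?Y) * m"
      using mpos by (intro mult_right_mono mult_left_mono) auto
    also have "\<dots> = 4 / A * m powr \<alpha>"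
      using mpos A by (simp add: powr_diff field_simps)
    finally have t1: "C * (2 * (1 / 2) ^ N * m) \<le> E / 4 * m powr \<alpha>"
      using C E by (simp add: A_def field_simps)
    have "q ^ N = (2 ^ N) powr s" by (simp add: q_def powr_realpow[symmetric] powr_powr mult.commute)
    also have "\<dots> \<le> ?Y powr s" using N(1) s by (intro powr_mono2) auto
    also have "\<dots> = A powr s * m powr \<alpha>" using A mpos by (simp add: powr_mult powr_powr s(3))
    finally have qN: "q ^ N \<le> A powr s * m powr \<alpha>" .
    have "C * (sqrt (tail K / v) * q ^ N / (q - 1)) \<le> C * (sqrt (tail K / v) * (A powr s * m powr \<alpha>) / (q - 1))"
      using C q v qN tail_nonneg by (intro mult_left_mono divide_right_mono) auto
    also have "\<dots> = C * (sqrt (tail K / v) * A powr s / (q - 1)) * m powr \<alpha>" by simp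
    also have "\<dots> \<le> E / 4 * m powr \<alpha>" using K by (intro mult_right_mono) auto
    finally have t2: "C * (sqrt (tail K / v) * q ^ N / (q - 1)) \<le> E / 4 * m powr \<alpha>" .
    have "2 * M0 / E = ((2 * M0 / E) powr (1 / \<alpha>)) powr \<alpha>" using \<alpha> M0 E by (simp add: powr_powr)
    also have "\<dots> \<le> m powr \<alpha>" using m \<alpha> by (intro powr_mono2) (auto simp: m0_def)
    finally have t3: "M0 \<le> E / 2 * m powr \<alpha>" using E by (simp add: field_simps)
    have "\<bar>u x\<bar> \<le> (LINT y|lborel. \<bar>u y\<bar>) / v + C * (2 * (1 / 2) ^ N * m + 2 * K + sqrt (tail K / v) * q ^ N / (q - 1))"
      using pointwise_bound[OF leb x _ s(1,2), of "real K" N] by (simp add: C_def q_def vx)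
    also have "\<dots> = M0 + C * (2 * (1 / 2) ^ N * m) + C * (sqrt (tail K / v) * q ^ N / (q - 1))"
      by (simp add: M0_def algebra_simps)
    also have "\<dots> \<le> E * m powr \<alpha>" using t1 t2 t3 by linarith
    finally show ?thesis .
  qed
  show ?thesis
  proof (intro exI[of _ "e * m0"] conjI allI impI)
    show "0 < e * m0" using e m0 by simp
    fix \<tau> assume \<tau>: "e * m0 \<le> \<tau>"
    show "AE x in lborel. x \<notin> maximal_set 3 h (\<tau> / e) \<longrightarrow> \<bar>u x\<bar> powr (1 / \<alpha>) \<le> \<tau>"
      using lebesgue_u
    proof eventually_elim
      case (elim x)
      show ?case
      proof
        assume x: "x \<notin> maximal_set 3 h (\<tau> / e)"
        have "m0 \<le> \<tau> / e" using \<tau> e by (simp add: field_simps)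
        from main[OF this x elim] have "\<bar>u x\<bar> \<le> (e * (\<tau> / e)) powr \<alpha>"
          unfolding E_def using e by (subst powr_mult) auto
        then have "\<bar>u x\<bar> powr (1 / \<alpha>) \<le> (\<tau> powr \<alpha>) powr (1 / \<alpha>)"
          using e \<alpha> by (intro powr_mono2) auto
        also have "\<dots> = \<tau>" using \<alpha> less_le_trans[OF mult_pos_pos[OF e m0] \<tau>] by (simp add: powr_powr)
        finally show "\<bar>u x\<bar> powr (1 / \<alpha>) \<le> \<tau>" .
      qed
    qed
  qed
qed

text \<open>The inclusion above combined with the truncated weak type inequality at level \<tau>/e.
  Both the factor e in front and the high level \<tau>/(2e) on the right are used when the critical
  term is absorbed.\<close>

lemma level_set_bound:
  assumes \<alpha>: "0 < \<alpha>" "\<alpha> < 1" "real DIM('a) * (1 - \<alpha>) \<le> 2" and e: "0 < e"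
  shows "\<exists>\<tau>0>0. \<forall>\<tau>\<ge>\<tau>0. emeasure lborel {x. \<tau> < \<bar>u x\<bar> powr (1 / \<alpha>)}
     \<le> ennreal (2 * 5 ^ DIM('a) * e / \<tau>) * (\<integral>\<^sup>+x\<in>{x. \<tau> / (2 * e) < h x}. ennreal (h x) \<partial>lborel)"
proof -
  obtain \<tau>0 where \<tau>0: "0 < \<tau>0"
    "\<And>\<tau>. \<tau>0 \<le> \<tau> \<Longrightarrow> AE x in lborel. x \<notin> maximal_set 3 h (\<tau> / e) \<longrightarrow> \<bar>u x\<bar> powr (1 / \<alpha>) \<le> \<tau>"
    using level_set_subset_maximal_set[OF assms] by blast
  have "emeasure lborel {x. \<tau> < \<bar>u x\<bar> powr (1 / \<alpha>)}
     \<le> ennreal (2 * 5 ^ DIM('a) * e / \<tau>) * (\<integral>\<^sup>+x\<in>{x. \<tau> / (2 * e) < h x}. ennreal (h x) \<partial>lborel)" if \<tau>: "\<tau>0 \<le> \<tau>" for \<tau>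
  proof -
    have p: "0 < \<tau> / e" using \<tau> \<tau>0 e by auto
    have "emeasure lborel {x. \<tau> < \<bar>u x\<bar> powr (1 / \<alpha>)} \<le> emeasure lborel (maximal_set 3 h (\<tau> / e))"
    proof (rule emeasure_mono_AE)
      show "AE x in lborel. x \<in> {x. \<tau> < \<bar>u x\<bar> powr (1 / \<alpha>)} \<longrightarrow> x \<in> maximal_set 3 h (\<tau> / e)"
        using \<tau>0(2)[OF \<tau>] by (rule eventually_mono) force
      show "maximal_set 3 h (\<tau> / e) \<in> sets lborel"
        using measurable_maximal_set[OF int_h(1) h_nonneg, of "\<tau> / e" 3] p by simp
    qed
    also have "\<dots> \<le> ennreal (2 * 5 ^ DIM('a) / (\<tau> / e)) * (\<integral>\<^sup>+x\<in>{x. (\<tau> / e) / 2 < h x}. ennreal (h x) \<partial>lborel)"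
      by (rule weak_type_truncated) (use int_h h_nonneg p in auto)
    finally show ?thesis by (simp add: mult.commute)
  qed
  then show ?thesis using \<tau>0(1) by blast
qed

end

section \<open>Higher integrability from a stopping time argument\<close>

lemma nn_integral_powr_Ioc:
  assumes a: "0 < a" "0 \<le> b" and \<epsilon>: "0 < \<epsilon>"
  shows "ennreal ((b powr \<epsilon> - a powr \<epsilon>) / \<epsilon>) \<le> (\<integral>\<^sup>+l. ennreal (l powr (\<epsilon> - 1)) * indicator {a..b} l \<partial>lborel)"
proof (cases "a \<le> b")
  case True
  have "(\<integral>\<^sup>+l. ennreal (l powr (\<epsilon> - 1)) * indicator {a..b} l \<partial>lborel) = ennreal (b powr \<epsilon> / \<epsilon> - a powr \<epsilon> / \<epsilon>)"
  proof (rule nn_integral_FTC_Icc)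
    fix x assume "x \<in> {a..b}"
    then show "DERIV (\<lambda>x. x powr \<epsilon> / \<epsilon>) x :> x powr (\<epsilon> - 1)"
      using a \<epsilon> by (auto intro!: derivative_eq_intros)
  qed (use True in auto)
  then show ?thesis by (simp add: diff_divide_distrib)
next
  case False
  then have "b powr \<epsilon> \<le> a powr \<epsilon>"
    using a \<epsilon> by (auto intro: powr_mono2)
  then show ?thesis using \<epsilon> by (simp add: ennreal_neg divide_nonpos_pos)
qed

text \<open>Tonelli in layer cake form: after the exchange, each x is weighted by the integral of f
  over the levels l that it satisfies.\<close>

lemma nn_integral_layer_swap:
  fixes Y :: "'a::euclidean_space \<Rightarrow> real" and P :: "real \<Rightarrow> 'a \<Rightarrow> bool"
  assumes [measurable]: "Y \<in> borel_measurable borel" "f \<in> borel_measurable borel" "A \<in> sets borel"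
    and [measurable]: "Measurable.pred (borel \<Otimes>\<^sub>M borel) (\<lambda>(l, x). P l x)"
  shows "(\<integral>\<^sup>+l\<in>A. (ennreal (f l) * (\<integral>\<^sup>+x\<in>{x. P l x}. ennreal (Y x) \<partial>lborel)) \<partial>lborel)
    = (\<integral>\<^sup>+x. ennreal (Y x) * (\<integral>\<^sup>+l\<in>A. (ennreal (f l) * indicator {l. P l x} l) \<partial>lborel) \<partial>lborel)"
proof -
  have [measurable]: "Measurable.pred borel (\<lambda>x. P l x)" for l by measurable
  have [measurable]: "Measurable.pred borel (\<lambda>l. P l x)" for x by measurable
  have 1: "(\<integral>\<^sup>+l\<in>A. (ennreal (f l) * (\<integral>\<^sup>+x\<in>{x. P l x}. ennreal (Y x) \<partial>lborel)) \<partial>lborel)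
    = (\<integral>\<^sup>+l. (\<integral>\<^sup>+x. (ennreal (f l) * indicator A l) * (ennreal (Y x) * indicator {x. P l x} x) \<partial>lborel) \<partial>lborel)"
    by (subst nn_integral_cmult) (auto intro!: nn_integral_cong simp: mult_ac)
  also have "\<dots> = (\<integral>\<^sup>+l. (\<integral>\<^sup>+x. (if P l x then (ennreal (f l) * indicator A l) * ennreal (Y x) else 0) \<partial>lborel) \<partial>lborel)"
    by (intro nn_integral_cong) auto
  also have "\<dots> = (\<integral>\<^sup>+x. (\<integral>\<^sup>+l. (if P l x then (ennreal (f l) * indicator A l) * ennreal (Y x) else 0) \<partial>lborel) \<partial>lborel)"
    by (rule lborel_pair.Fubini') measurable
  also have "\<dots> = (\<integral>\<^sup>+x. (\<integral>\<^sup>+l. ennreal (Y x) * (ennreal (f l) * indicator {l. P l x} l * indicator A l) \<partial>lborel) \<partial>lborel)"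
    by (intro nn_integral_cong) (auto simp: mult_ac)
  also have "\<dots> = (\<integral>\<^sup>+x. ennreal (Y x) * (\<integral>\<^sup>+l\<in>A. (ennreal (f l) * indicator {l. P l x} l) \<partial>lborel) \<partial>lborel)"
    by (intro nn_integral_cong nn_integral_cmult) measurable
  finally show ?thesis .
qed

text \<open>The exponent gain: the factor \<open>1 / \<epsilon>\<close> produced on the left by integrating the level set inequality
  against \<open>l powr (\<epsilon> - 1)\<close> beats the constant on the right for small \<open>\<epsilon>\<close>.\<close>

lemma gehring_level_sets:
  fixes h W :: "'a::euclidean_space \<Rightarrow> real"
  assumes h: "h \<in> borel_measurable borel" "\<And>x. 0 \<le> h x" "integrable lborel (\<lambda>x. (h x)\<^sup>2)"
    and W: "W \<in> borel_measurable borel" "\<And>x. 0 \<le> W x" "integrable lborel (\<lambda>x. W x powr (2 + \<epsilon>))"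
    and c: "0 < c" "c \<le> 1" "0 < C" "0 < l0" and \<epsilon>: "0 < \<epsilon>" "\<epsilon> \<le> 1" "2 * C * \<epsilon> \<le> c\<^sup>2"
    and level: "\<And>l. l0 \<le> l \<Longrightarrow> (\<integral>\<^sup>+x\<in>{x. l < h x}. ennreal ((h x)\<^sup>2) \<partial>lborel)
       \<le> ennreal (C * l) * (\<integral>\<^sup>+x\<in>{x. c * l < h x}. ennreal (h x) \<partial>lborel)
         + ennreal C * (\<integral>\<^sup>+x\<in>{x. c * l < W x}. ennreal ((W x)\<^sup>2) \<partial>lborel)"
  shows "integrable lborel (\<lambda>x. h x powr (2 + \<epsilon>))"
proof -
  note [measurable] = h(1) W(1)
  define H where "H = (LINT x|lborel. (h x)\<^sup>2)"
  define V where "V = (LINT x|lborel. W x powr (2 + \<epsilon>))"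
  have HV: "0 \<le> H" "0 \<le> V" by (simp_all add: H_def V_def)
  have eH: "(\<integral>\<^sup>+x. ennreal ((h x)\<^sup>2) \<partial>lborel) = ennreal H"
    unfolding H_def by (rule nn_integral_eq_integral) (use h in auto)
  have eV: "(\<integral>\<^sup>+x. ennreal (W x powr (2 + \<epsilon>)) \<partial>lborel) = ennreal V"
    unfolding V_def by (rule nn_integral_eq_integral) (use W in auto)
  \<comment> \<open>Truncating one factor at L makes X finite a priori, so that it can be absorbed;
    the bound B does not depend on L.\<close>
  define X where "X L = (\<integral>\<^sup>+x. ennreal ((h x)\<^sup>2 * (min (h x) L) powr \<epsilon>) \<partial>lborel)" for L
  define B where "B = 2 * (l0 powr \<epsilon> * H + C * (1 / c) powr \<epsilon> * V)"
  have bound: "X L \<le> ennreal B" if L: "0 < L" for L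
  proof -
    let ?A = "{l0..L}" and ?f = "\<lambda>l. l powr (\<epsilon> - 1)"
    have Xfin: "X L \<le> ennreal (L powr \<epsilon> * H)"
    proof -
      have "X L \<le> (\<integral>\<^sup>+x. ennreal (L powr \<epsilon>) * ennreal ((h x)\<^sup>2) \<partial>lborel)"
        unfolding X_def
      proof (rule nn_integral_mono)
        fix x
        have "(h x)\<^sup>2 * (min (h x) L) powr \<epsilon> \<le> (h x)\<^sup>2 * L powr \<epsilon>"
          using h(2)[of x] L \<epsilon> by (intro mult_left_mono powr_mono2) auto
        then show "ennreal ((h x)\<^sup>2 * (min (h x) L) powr \<epsilon>) \<le> ennreal (L powr \<epsilon>) * ennreal ((h x)\<^sup>2)"
          by (simp add: ennreal_mult'[symmetric] mult.commute ennreal_leI)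
      qed
      also have "\<dots> = ennreal (L powr \<epsilon> * H)"
        by (subst nn_integral_cmult, measurable, simp add: eH ennreal_mult''[OF HV(1), symmetric])
      finally show ?thesis .
    qed
    then obtain x where x: "X L = ennreal x" "0 \<le> x" by (cases "X L") (auto simp: top_unique)
    \<comment> \<open>Integrating l^(\<epsilon> - 1) over the levels from l0 to min (h x) L produces
      the truncated power divided by \<epsilon>, up to the share of the levels below l0.\<close>
    have lhs: "ennreal (1 / \<epsilon>) * X L \<le> (\<integral>\<^sup>+l\<in>?A. (ennreal (?f l) * (\<integral>\<^sup>+x\<in>{x. l < h x}. ennreal ((h x)\<^sup>2) \<partial>lborel)) \<partial>lborel) + ennreal (l0 powr \<epsilon> / \<epsilon> * H)"
    proof -
      have "ennreal (1 / \<epsilon>) * X L = (\<integral>\<^sup>+x. ennreal ((h x)\<^sup>2 * (min (h x) L) powr \<epsilon> / \<epsilon>) \<partial>lborel)"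
        unfolding X_def by (subst nn_integral_cmult[symmetric]) (use \<epsilon> in \<open>auto simp: ennreal_mult'[symmetric]\<close>)
      also have "\<dots> \<le> (\<integral>\<^sup>+x. (ennreal ((h x)\<^sup>2) * (\<integral>\<^sup>+l\<in>?A. (ennreal (?f l) * indicator {l. l < h x} l) \<partial>lborel)
           + ennreal (l0 powr \<epsilon> / \<epsilon>) * ennreal ((h x)\<^sup>2)) \<partial>lborel)"
      proof (rule nn_integral_mono)
        fix x
        let ?b = "min (h x) L"
        have "ennreal ((?b powr \<epsilon> - l0 powr \<epsilon>) / \<epsilon>) \<le> (\<integral>\<^sup>+l. ennreal (?f l) * indicator {l0..?b} l \<partial>lborel)"
          by (rule nn_integral_powr_Ioc) (use c \<epsilon> L h(2)[of x] in auto)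
        also have "\<dots> \<le> (\<integral>\<^sup>+l\<in>?A. (ennreal (?f l) * indicator {l. l < h x} l) \<partial>lborel)"
        proof (rule nn_integral_mono_AE)
          \<comment> \<open>The closed interval of levels and the strict inequality differ only in
            the single level l = h x.\<close>
          have "AE l in lborel. l \<noteq> h x" by (rule AE_lborel_singleton)
          then show "AE l in lborel. ennreal (?f l) * indicator {l0..?b} l \<le> ennreal (?f l) * indicator {l. l < h x} l * indicator ?A l"
            by eventually_elim (auto split: split_indicator)
        qed
        finally have *: "ennreal ((?b powr \<epsilon> - l0 powr \<epsilon>) / \<epsilon>) \<le> (\<integral>\<^sup>+l\<in>?A. (ennreal (?f l) * indicator {l. l < h x} l) \<partial>lborel)" .
        have "ennreal ((h x)\<^sup>2 * ?b powr \<epsilon> / \<epsilon>) = ennreal ((h x)\<^sup>2 * ((?b powr \<epsilon> - l0 powr \<epsilon>) / \<epsilon>) + l0 powr \<epsilon> / \<epsilon> * (h x)\<^sup>2)"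
          using \<epsilon> by (simp add: field_simps)
        also have "\<dots> \<le> ennreal ((h x)\<^sup>2 * ((?b powr \<epsilon> - l0 powr \<epsilon>) / \<epsilon>)) + ennreal (l0 powr \<epsilon> / \<epsilon> * (h x)\<^sup>2)"
          using \<epsilon> by (cases "0 \<le> (h x)\<^sup>2 * ((?b powr \<epsilon> - l0 powr \<epsilon>) / \<epsilon>)")
             (auto simp: ennreal_neg intro!: ennreal_leI)
        also have "\<dots> \<le> ennreal ((h x)\<^sup>2) * (\<integral>\<^sup>+l\<in>?A. (ennreal (?f l) * indicator {l. l < h x} l) \<partial>lborel) + ennreal (l0 powr \<epsilon> / \<epsilon>) * ennreal ((h x)\<^sup>2)"
          using \<epsilon> by (subst (1 2) ennreal_mult') (auto intro!: add_mono mult_left_mono *)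
        finally show "ennreal ((h x)\<^sup>2 * ?b powr \<epsilon> / \<epsilon>) \<le> ennreal ((h x)\<^sup>2) * (\<integral>\<^sup>+l\<in>?A. (ennreal (?f l) * indicator {l. l < h x} l) \<partial>lborel) + ennreal (l0 powr \<epsilon> / \<epsilon>) * ennreal ((h x)\<^sup>2)" .
      qed
      also have "\<dots> = (\<integral>\<^sup>+x. (ennreal ((h x)\<^sup>2) * (\<integral>\<^sup>+l\<in>?A. (ennreal (?f l) * indicator {l. l < h x} l) \<partial>lborel)) \<partial>lborel)
           + ennreal (l0 powr \<epsilon> / \<epsilon> * H)"
      proof (subst nn_integral_add)
        have "(\<lambda>x. \<integral>\<^sup>+l. (if l < h x \<and> l \<in> ?A then ennreal (?f l) else 0) \<partial>lborel) \<in> borel_measurable lborel"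
          by (rule lborel.borel_measurable_nn_integral) measurable
        also have "(\<lambda>x. \<integral>\<^sup>+l. (if l < h x \<and> l \<in> ?A then ennreal (?f l) else 0) \<partial>lborel) = (\<lambda>x. \<integral>\<^sup>+l\<in>?A. (ennreal (?f l) * indicator {l. l < h x} l) \<partial>lborel)"
          by (intro ext nn_integral_cong) auto
        finally show "(\<lambda>x. ennreal ((h x)\<^sup>2) * (\<integral>\<^sup>+l\<in>?A. (ennreal (?f l) * indicator {l. l < h x} l) \<partial>lborel)) \<in> borel_measurable lborel"
          by (intro borel_measurable_times_ennreal) auto
        show "(\<lambda>x. ennreal (l0 powr \<epsilon> / \<epsilon>) * ennreal ((h x)\<^sup>2)) \<in> borel_measurable lborel" by measurable
        have "(\<integral>\<^sup>+x. ennreal (l0 powr \<epsilon> / \<epsilon>) * ennreal ((h x)\<^sup>2) \<partial>lborel) = ennreal (l0 powr \<epsilon> / \<epsilon> * H)"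
          by (subst nn_integral_cmult, measurable, simp add: eH ennreal_mult''[OF HV(1), symmetric])
        then show "(\<integral>\<^sup>+x. (ennreal ((h x)\<^sup>2) * (\<integral>\<^sup>+l\<in>?A. (ennreal (?f l) * indicator {l. l < h x} l) \<partial>lborel)) \<partial>lborel) + (\<integral>\<^sup>+x. ennreal (l0 powr \<epsilon> / \<epsilon>) * ennreal ((h x)\<^sup>2) \<partial>lborel)
          = (\<integral>\<^sup>+x. (ennreal ((h x)\<^sup>2) * (\<integral>\<^sup>+l\<in>?A. (ennreal (?f l) * indicator {l. l < h x} l) \<partial>lborel)) \<partial>lborel) + ennreal (l0 powr \<epsilon> / \<epsilon> * H)"
          by simp
      qed
      also have "(\<integral>\<^sup>+x. (ennreal ((h x)\<^sup>2) * (\<integral>\<^sup>+l\<in>?A. (ennreal (?f l) * indicator {l. l < h x} l) \<partial>lborel)) \<partial>lborel)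
         = (\<integral>\<^sup>+l\<in>?A. (ennreal (?f l) * (\<integral>\<^sup>+x\<in>{x. l < h x}. ennreal ((h x)\<^sup>2) \<partial>lborel)) \<partial>lborel)"
        by (rule nn_integral_layer_swap[symmetric]) measurable
      finally show ?thesis .
    qed
    have rhs: "(\<integral>\<^sup>+l\<in>?A. (ennreal (?f l) * (\<integral>\<^sup>+x\<in>{x. l < h x}. ennreal ((h x)\<^sup>2) \<partial>lborel)) \<partial>lborel)
       \<le> (\<integral>\<^sup>+l\<in>?A. (ennreal (l powr \<epsilon>) * (\<integral>\<^sup>+x\<in>{x. c * l < h x}. ennreal (C * h x) \<partial>lborel)) \<partial>lborel)
        + (\<integral>\<^sup>+l\<in>?A. (ennreal (?f l) * (\<integral>\<^sup>+x\<in>{x. c * l < W x}. ennreal (C * (W x)\<^sup>2) \<partial>lborel)) \<partial>lborel)" (is "?S \<le> ?S1 + ?S2")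
    proof -
      have m1: "(\<lambda>l. \<integral>\<^sup>+x\<in>{x. c * l < Z x}. ennreal (Y x) \<partial>lborel) \<in> borel_measurable borel"
        if [measurable]: "Z \<in> borel_measurable borel" "Y \<in> borel_measurable borel" for Z Y :: "'a \<Rightarrow> real"
      proof -
        have "(\<lambda>l. \<integral>\<^sup>+x. (if c * l < Z x then ennreal (Y x) else 0) \<partial>lborel) \<in> borel_measurable borel"
          by (rule lborel.borel_measurable_nn_integral) measurable
        also have "(\<lambda>l. \<integral>\<^sup>+x. (if c * l < Z x then ennreal (Y x) else 0) \<partial>lborel) = (\<lambda>l. \<integral>\<^sup>+x\<in>{x. c * l < Z x}. ennreal (Y x) \<partial>lborel)"
          by (intro ext nn_integral_cong) auto
        finally show ?thesis .
      qed
      have [measurable]: "(\<lambda>l. \<integral>\<^sup>+x\<in>{x. c * l < h x}. ennreal (C * h x) \<partial>lborel) \<in> borel_measurable borel"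
         "(\<lambda>l. \<integral>\<^sup>+x\<in>{x. c * l < W x}. ennreal (C * (W x)\<^sup>2) \<partial>lborel) \<in> borel_measurable borel"
        by (intro m1; measurable)+
      have "?S \<le> (\<integral>\<^sup>+l. ((ennreal (l powr \<epsilon>) * (\<integral>\<^sup>+x\<in>{x. c * l < h x}. ennreal (C * h x) \<partial>lborel)) * indicator ?A l
        + (ennreal (?f l) * (\<integral>\<^sup>+x\<in>{x. c * l < W x}. ennreal (C * (W x)\<^sup>2) \<partial>lborel)) * indicator ?A l) \<partial>lborel)"
      proof (rule nn_integral_mono)
        fix l :: real
        show "ennreal (?f l) * (\<integral>\<^sup>+x\<in>{x. l < h x}. ennreal ((h x)\<^sup>2) \<partial>lborel) * indicator ?A l
          \<le> (ennreal (l powr \<epsilon>) * (\<integral>\<^sup>+x\<in>{x. c * l < h x}. ennreal (C * h x) \<partial>lborel)) * indicator ?A l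
        + (ennreal (?f l) * (\<integral>\<^sup>+x\<in>{x. c * l < W x}. ennreal (C * (W x)\<^sup>2) \<partial>lborel)) * indicator ?A l"
        proof (cases "l \<in> ?A")
          case True
          then have l: "0 < l" using c by simp
          have i: "(\<integral>\<^sup>+x\<in>{x. c * l < Z x}. ennreal (C * Y x) \<partial>lborel) = ennreal C * (\<integral>\<^sup>+x\<in>{x. c * l < Z x}. ennreal (Y x) \<partial>lborel)"
            if [measurable]: "Z \<in> borel_measurable borel" "Y \<in> borel_measurable borel" for Z Y :: "'a \<Rightarrow> real"
          proof -
            have "(\<integral>\<^sup>+x\<in>{x. c * l < Z x}. ennreal (C * Y x) \<partial>lborel) = (\<integral>\<^sup>+x. ennreal C * (ennreal (Y x) * indicator {x. c * l < Z x} x) \<partial>lborel)"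
              using c by (intro nn_integral_cong) (auto simp: ennreal_mult' mult.assoc)
            also have "\<dots> = ennreal C * (\<integral>\<^sup>+x\<in>{x. c * l < Z x}. ennreal (Y x) \<partial>lborel)"
              by (rule nn_integral_cmult) measurable
            finally show ?thesis .
          qed
          have "ennreal (?f l) * (\<integral>\<^sup>+x\<in>{x. l < h x}. ennreal ((h x)\<^sup>2) \<partial>lborel)
            \<le> ennreal (?f l) * (ennreal (C * l) * (\<integral>\<^sup>+x\<in>{x. c * l < h x}. ennreal (h x) \<partial>lborel)
         + ennreal C * (\<integral>\<^sup>+x\<in>{x. c * l < W x}. ennreal ((W x)\<^sup>2) \<partial>lborel))"
            using True by (intro mult_left_mono level) auto
          also have "\<dots> = ennreal (?f l * (C * l)) * (\<integral>\<^sup>+x\<in>{x. c * l < h x}. ennreal (h x) \<partial>lborel)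
              + ennreal (?f l) * (ennreal C * (\<integral>\<^sup>+x\<in>{x. c * l < W x}. ennreal ((W x)\<^sup>2) \<partial>lborel))"
            by (simp add: distrib_left ennreal_mult' mult.assoc)
          also have "?f l * (C * l) = l powr \<epsilon> * C" using l by (simp add: powr_diff)
          also have "ennreal (l powr \<epsilon> * C) * (\<integral>\<^sup>+x\<in>{x. c * l < h x}. ennreal (h x) \<partial>lborel)
            = ennreal (l powr \<epsilon>) * (\<integral>\<^sup>+x\<in>{x. c * l < h x}. ennreal (C * h x) \<partial>lborel)"
            by (subst i) (auto simp: ennreal_mult' mult.assoc)
          finally show ?thesis using True by (simp add: i)
        qed simp
      qed
      also have "\<dots> = ?S1 + ?S2" by (rule nn_integral_add) measurable
      finally show ?thesis .
    qed
    have s1: "?S1 \<le> ennreal (C / c\<^sup>2) * X L"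
    proof -
      have "?S1 = (\<integral>\<^sup>+x. ennreal (C * h x) * (\<integral>\<^sup>+l\<in>?A. (ennreal (l powr \<epsilon>) * indicator {l. c * l < h x} l) \<partial>lborel) \<partial>lborel)"
        by (rule nn_integral_layer_swap) measurable
      also have "\<dots> \<le> (\<integral>\<^sup>+x. ennreal (C / c\<^sup>2) * ennreal ((h x)\<^sup>2 * (min (h x) L) powr \<epsilon>) \<partial>lborel)"
      proof (rule nn_integral_mono)
        fix x
        let ?m = "min (h x) L"
        have m: "0 \<le> ?m" using h(2)[of x] L by simp
        have "(\<integral>\<^sup>+l\<in>?A. (ennreal (l powr \<epsilon>) * indicator {l. c * l < h x} l) \<partial>lborel)
           \<le> (\<integral>\<^sup>+l. ennreal ((?m / c) powr \<epsilon>) * indicator {0..?m / c} l \<partial>lborel)"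
        proof (rule nn_integral_mono)
          fix l
          \<comment> \<open>Since c \<le> 1, a level with l \<le> L and c l < h x lies below min (h
            x) L / c. The right side thus leads back to the same truncated quantity X.\<close>
          have "l \<le> ?m / c" if "l0 \<le> l" "l \<le> L" "c * l < h x"
          proof -
            have "c * l \<le> L" using that c mult_mono[of c 1 l L] by auto
            then show ?thesis using that c by (simp add: field_simps)
          qed
          then show "ennreal (l powr \<epsilon>) * indicator {l. c * l < h x} l * indicator ?A l \<le> ennreal ((?m / c) powr \<epsilon>) * indicator {0..?m / c} l"
            using c \<epsilon> by (auto split: split_indicator intro!: ennreal_leI powr_mono2)
        qed
        also have "\<dots> = ennreal ((?m / c) powr \<epsilon>) * ennreal (?m / c)"
          using m c by (subst nn_integral_cmult_indicator) auto
        also have "\<dots> \<le> ennreal ((1 / c\<^sup>2) * (?m powr \<epsilon> * h x))"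
        proof -
          \<comment> \<open>\<epsilon> \<le> 1 gives (1/c)^\<epsilon> \<le> 1/c, hence a constant C
            / c^2 that does not involve \<epsilon>.\<close>
          have "(?m / c) powr \<epsilon> = ?m powr \<epsilon> * (1 / c) powr \<epsilon>"
            using m c by (simp add: powr_divide)
          also have "\<dots> \<le> ?m powr \<epsilon> * (1 / c)"
            using c \<epsilon> powr_mono[of \<epsilon> 1 "1 / c"] by (intro mult_left_mono) auto
          finally have "(?m / c) powr \<epsilon> * (?m / c) \<le> (?m powr \<epsilon> * (1 / c)) * (h x / c)"
            using m c by (intro mult_mono) (auto intro!: mult_left_mono divide_right_mono)
          then show ?thesis using m c
            by (subst ennreal_mult'[symmetric]) (auto simp: power2_eq_square intro!: ennreal_leI)
        qed
        finally have "ennreal (C * h x) * (\<integral>\<^sup>+l\<in>?A. (ennreal (l powr \<epsilon>) * indicator {l. c * l < h x} l) \<partial>lborel)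
          \<le> ennreal (C * h x) * ennreal ((1 / c\<^sup>2) * (?m powr \<epsilon> * h x))" by (rule mult_left_mono) simp
        also have "\<dots> = ennreal (C / c\<^sup>2) * ennreal ((h x)\<^sup>2 * ?m powr \<epsilon>)"
          using c h(2)[of x] by (subst (1 2) ennreal_mult'[symmetric]) (auto simp: power2_eq_square field_simps)
        finally show "ennreal (C * h x) * (\<integral>\<^sup>+l\<in>?A. (ennreal (l powr \<epsilon>) * indicator {l. c * l < h x} l) \<partial>lborel)
          \<le> ennreal (C / c\<^sup>2) * ennreal ((h x)\<^sup>2 * ?m powr \<epsilon>)" .
      qed
      also have "\<dots> = ennreal (C / c\<^sup>2) * X L" unfolding X_def by (rule nn_integral_cmult) measurable
      finally show ?thesis .
    qed
    have s2: "?S2 \<le> ennreal (C * (1 / c) powr \<epsilon> / \<epsilon> * V)"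
    proof -
      have "?S2 = (\<integral>\<^sup>+x. ennreal (C * (W x)\<^sup>2) * (\<integral>\<^sup>+l\<in>?A. (ennreal (?f l) * indicator {l. c * l < W x} l) \<partial>lborel) \<partial>lborel)"
        by (rule nn_integral_layer_swap) measurable
      also have "\<dots> \<le> (\<integral>\<^sup>+x. ennreal (C * (1 / c) powr \<epsilon> / \<epsilon>) * ennreal (W x powr (2 + \<epsilon>)) \<partial>lborel)"
      proof (rule nn_integral_mono)
        fix x
        have "(\<integral>\<^sup>+l\<in>?A. (ennreal (?f l) * indicator {l. c * l < W x} l) \<partial>lborel) \<le> ennreal ((W x / c) powr \<epsilon> / \<epsilon>)"
        proof (cases "l0 \<le> W x / c")
          case True
          have "(\<integral>\<^sup>+l\<in>?A. (ennreal (?f l) * indicator {l. c * l < W x} l) \<partial>lborel)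
             \<le> (\<integral>\<^sup>+l. ennreal (?f l) * indicator {l0..W x / c} l \<partial>lborel)"
            using c by (intro nn_integral_mono) (auto split: split_indicator simp: field_simps)
          also have "\<dots> = ennreal ((W x / c) powr \<epsilon> / \<epsilon> - l0 powr \<epsilon> / \<epsilon>)"
          proof (rule nn_integral_FTC_Icc)
            fix y assume "y \<in> {l0..W x / c}"
            then show "DERIV (\<lambda>x. x powr \<epsilon> / \<epsilon>) y :> y powr (\<epsilon> - 1)"
              using c \<epsilon> by (auto intro!: derivative_eq_intros)
          qed (use True in auto)
          also have "\<dots> \<le> ennreal ((W x / c) powr \<epsilon> / \<epsilon>)" using \<epsilon> by (intro ennreal_leI) auto
          finally show ?thesis .
        next
          case False
          have "\<not> (l0 \<le> l \<and> c * l < W x)" for l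
          proof
            assume l: "l0 \<le> l \<and> c * l < W x"
            then have "c * l0 \<le> c * l" using c by simp
            with l have "c * l0 < W x" by linarith
            then show False using False c by (simp add: field_simps)
          qed
          then have "(\<integral>\<^sup>+l\<in>?A. (ennreal (?f l) * indicator {l. c * l < W x} l) \<partial>lborel) = (\<integral>\<^sup>+(l::real). 0 \<partial>lborel)"
            by (intro nn_integral_cong) (auto split: split_indicator)
          then show ?thesis by simp
        qed
        then have "ennreal (C * (W x)\<^sup>2) * (\<integral>\<^sup>+l\<in>?A. (ennreal (?f l) * indicator {l. c * l < W x} l) \<partial>lborel)
          \<le> ennreal (C * (W x)\<^sup>2) * ennreal ((W x / c) powr \<epsilon> / \<epsilon>)" by (rule mult_left_mono) simp
        also have "\<dots> = ennreal (C * (1 / c) powr \<epsilon> / \<epsilon>) * ennreal (W x powr (2 + \<epsilon>))"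
          using c \<epsilon> W(2)[of x]
          by (subst (1 2) ennreal_mult'[symmetric]) (auto simp: powr_add powr_divide field_simps)
        finally show "ennreal (C * (W x)\<^sup>2) * (\<integral>\<^sup>+l\<in>?A. (ennreal (?f l) * indicator {l. c * l < W x} l) \<partial>lborel)
          \<le> ennreal (C * (1 / c) powr \<epsilon> / \<epsilon>) * ennreal (W x powr (2 + \<epsilon>))" .
      qed
      also have "\<dots> = ennreal (C * (1 / c) powr \<epsilon> / \<epsilon> * V)"
        by (subst nn_integral_cmult, measurable, simp add: eV ennreal_mult''[OF HV(2), symmetric])
      finally show ?thesis .
    qed
    have "ennreal (1 / \<epsilon> * x) = ennreal (1 / \<epsilon>) * X L" using x by (simp only: ennreal_mult'')
    also have "\<dots> \<le> (ennreal (C / c\<^sup>2) * X L + ennreal (C * (1 / c) powr \<epsilon> / \<epsilon> * V)) + ennreal (l0 powr \<epsilon> / \<epsilon> * H)"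
      using lhs rhs s1 s2 by (meson add_mono order.trans order_refl)
    also have "\<dots> = ennreal (C / c\<^sup>2 * x + C * (1 / c) powr \<epsilon> / \<epsilon> * V + l0 powr \<epsilon> / \<epsilon> * H)"
    proof -
      have "0 \<le> C / c\<^sup>2 * x" "0 \<le> C * (1 / c) powr \<epsilon> / \<epsilon> * V" "0 \<le> l0 powr \<epsilon> / \<epsilon> * H" using x c HV \<epsilon> by auto
      then show ?thesis using x by (simp only: ennreal_mult''[symmetric] ennreal_plus[symmetric] add_nonneg_nonneg)
    qed
    finally have "1 / \<epsilon> * x \<le> C / c\<^sup>2 * x + C * (1 / c) powr \<epsilon> / \<epsilon> * V + l0 powr \<epsilon> / \<epsilon> * H"
      using x c HV \<epsilon> by (subst (asm) ennreal_le_iff) auto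
    then have "x \<le> (C * \<epsilon> / c\<^sup>2) * x + C * (1 / c) powr \<epsilon> * V + l0 powr \<epsilon> * H"
      using \<epsilon> by (simp add: field_simps)
    \<comment> \<open>The hypothesis 2 C \<epsilon> \<le> c^2 is exactly what lets half of x absorb
      this term.\<close>
    moreover have "(C * \<epsilon> / c\<^sup>2) * x \<le> 1 / 2 * x"
      using \<epsilon> c x by (intro mult_right_mono) (auto simp: field_simps)
    moreover have "x \<le> 2 * (w + v)" if "x \<le> t + v + w" "t \<le> 1 / 2 * x" for t v w x :: real
      using that by (simp add: field_simps)
    ultimately have "x \<le> B" unfolding B_def by blast
    then show ?thesis using x by (simp add: ennreal_leI)
  qed
  \<comment> \<open>Fatou removes the truncation: at each point the integrands are eventually
    constant in L.\<close>
  have "(\<integral>\<^sup>+x. ennreal (h x powr (2 + \<epsilon>)) \<partial>lborel) \<le> (\<integral>\<^sup>+x. liminf (\<lambda>L. ennreal ((h x)\<^sup>2 * (min (h x) (real L)) powr \<epsilon>)) \<partial>lborel)"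
  proof (rule nn_integral_mono)
    fix x
    obtain L0 :: nat where L0: "h x < real L0" using reals_Archimedean2 by blast
    have "eventually (\<lambda>L. ennreal (h x powr (2 + \<epsilon>)) = ennreal ((h x)\<^sup>2 * (min (h x) (real L)) powr \<epsilon>)) sequentially"
    proof (rule eventually_sequentiallyI)
      fix L assume "L0 \<le> L"
      then have "min (h x) (real L) = h x" using L0 by simp
      then show "ennreal (h x powr (2 + \<epsilon>)) = ennreal ((h x)\<^sup>2 * (min (h x) (real L)) powr \<epsilon>)"
        using h(2)[of x] by (simp add: powr_add)
    qed
    then have "(\<lambda>L. ennreal ((h x)\<^sup>2 * (min (h x) (real L)) powr \<epsilon>)) \<longlonglongrightarrow> ennreal (h x powr (2 + \<epsilon>))"
      by (intro tendsto_eventually) (auto elim: eventually_mono)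
    then show "ennreal (h x powr (2 + \<epsilon>)) \<le> liminf (\<lambda>L. ennreal ((h x)\<^sup>2 * (min (h x) (real L)) powr \<epsilon>))"
      using lim_imp_Liminf[OF sequentially_bot] by fastforce
  qed
  also have "\<dots> \<le> liminf (\<lambda>L. \<integral>\<^sup>+x. ennreal ((h x)\<^sup>2 * (min (h x) (real L)) powr \<epsilon>) \<partial>lborel)"
    by (rule nn_integral_liminf) measurable
  also have "\<dots> \<le> ennreal B"
    unfolding X_def[symmetric] by (intro Liminf_le eventually_sequentiallyI[of 1] bound) auto
  finally show ?thesis
    by (intro integrableI_nonneg) (auto simp: top_unique less_top[symmetric])
qed

section \<open>Power integrals of u over its level sets\<close>

lemma nn_integral_powr_le:
  assumes ab: "0 < a" "0 \<le> s"
  shows "(\<integral>\<^sup>+l\<in>{a..}. (ennreal (l powr s) * indicator {l. l < b} l) \<partial>lborel) \<le> ennreal (b powr (s + 1)) * indicator {a<..} b"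
proof (cases "a < b")
  case True
  then have b: "0 < b" using ab by simp
  have "(\<integral>\<^sup>+l\<in>{a..}. (ennreal (l powr s) * indicator {l. l < b} l) \<partial>lborel)
     \<le> (\<integral>\<^sup>+l. ennreal (b powr s) * indicator {0..b} l \<partial>lborel)"
    using ab by (intro nn_integral_mono) (auto split: split_indicator intro!: ennreal_leI powr_mono2)
  also have "\<dots> = ennreal (b powr s) * ennreal b"
    using b by (subst nn_integral_cmult_indicator) auto
  also have "\<dots> = ennreal (b powr (s + 1))"
    using b by (simp add: ennreal_mult'[symmetric] powr_add)
  finally show ?thesis using True by simp
next
  case False
  then have "(\<integral>\<^sup>+l\<in>{a..}. (ennreal (l powr s) * indicator {l. l < b} l) \<partial>lborel) = (\<integral>\<^sup>+(l::real). 0 \<partial>lborel)"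
    by (intro nn_integral_cong) (auto split: split_indicator)
  then show ?thesis by simp
qed

lemma nn_integral_cmult_set:
  fixes f :: "'a::euclidean_space \<Rightarrow> real"
  assumes [measurable]: "f \<in> borel_measurable borel" "S \<in> sets borel" and "0 \<le> c"
  shows "(\<integral>\<^sup>+x\<in>S. ennreal (c * f x) \<partial>lborel) = ennreal c * (\<integral>\<^sup>+x\<in>S. ennreal (f x) \<partial>lborel)"
proof -
  have "(\<integral>\<^sup>+x\<in>S. ennreal (c * f x) \<partial>lborel) = (\<integral>\<^sup>+x. ennreal c * (ennreal (f x) * indicator S x) \<partial>lborel)"
    using assms(3) by (intro nn_integral_cong) (simp add: ennreal_mult' mult.assoc)
  also have "\<dots> = ennreal c * (\<integral>\<^sup>+x\<in>S. ennreal (f x) \<partial>lborel)"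
    by (rule nn_integral_cmult) measurable
  finally show ?thesis .
qed

context gradient_pair begin

text \<open>Layer cake for \<open>level_set_bound\<close> over the levels from t on, with t^p times
  the measure of the level set treated separately. The factor (2e)^p can be made as small as desired
  at the price of a larger threshold; with p = 2 this is the smallness of the critical term.\<close>

lemma level_set_power_bound:
  assumes \<alpha>: "0 < \<alpha>" "\<alpha> < 1" "real DIM('a) * (1 - \<alpha>) \<le> 2" and e: "0 < e" and p: "2 \<le> p"
  shows "\<exists>\<tau>0>0. \<forall>t\<ge>\<tau>0. (\<integral>\<^sup>+x\<in>{x. t < \<bar>u x\<bar> powr (1 / \<alpha>)}. ennreal ((\<bar>u x\<bar> powr (1 / \<alpha>)) powr p) \<partial>lborel)
     \<le> ennreal (5 ^ DIM('a) * (1 + p) * (2 * e) powr p) * (\<integral>\<^sup>+x\<in>{x. t / (2 * e) < h x}. ennreal (h x powr p) \<partial>lborel)"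
proof -
  let ?U = "\<lambda>x. \<bar>u x\<bar> powr (1 / \<alpha>)" and ?c = "2 * 5 ^ DIM('a) * e"
  obtain \<tau>0 where \<tau>0: "0 < \<tau>0" and lev: "\<And>\<tau>. \<tau>0 \<le> \<tau> \<Longrightarrow> emeasure lborel {x. \<tau> < ?U x}
     \<le> ennreal (?c / \<tau>) * (\<integral>\<^sup>+x\<in>{x. \<tau> / (2 * e) < h x}. ennreal (h x) \<partial>lborel)"
    using level_set_bound[OF \<alpha> e] by blast
  have c0: "0 < ?c" using e by simp
  have main: "(\<integral>\<^sup>+x\<in>{x. t < ?U x}. ennreal (?U x powr p) \<partial>lborel)
     \<le> ennreal (5 ^ DIM('a) * (1 + p) * (2 * e) powr p) * (\<integral>\<^sup>+x\<in>{x. t / (2 * e) < h x}. ennreal (h x powr p) \<partial>lborel)"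
    if t: "\<tau>0 \<le> t" for t
  proof -
    have t0: "0 < t" using t \<tau>0 by simp
    let ?J = "\<integral>\<^sup>+x\<in>{x. t / (2 * e) < h x}. ennreal (h x powr p) \<partial>lborel"
    let ?f = "\<lambda>l. p * l powr (p - 1)" and ?g = "\<lambda>l. l powr (p - 2)"
    have q: "(\<integral>\<^sup>+x\<in>{x. t / (2 * e) < h x}. ennreal ((2 * e) powr (p - 1) * h x powr p) \<partial>lborel) = ennreal ((2 * e) powr (p - 1)) * ?J"
      by (rule nn_integral_cmult_set) auto
    \<comment> \<open>Where t / (2e) < h one has t < 2 e h, so powers of t are traded for powers of
      h.\<close>
    have first: "ennreal (t powr p) * emeasure lborel {x. t < ?U x} \<le> ennreal (?c * (2 * e) powr (p - 1)) * ?J"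
    proof -
      have "ennreal (t powr p) * emeasure lborel {x. t < ?U x}
        \<le> ennreal (t powr p) * (ennreal (?c / t) * (\<integral>\<^sup>+x\<in>{x. t / (2 * e) < h x}. ennreal (h x) \<partial>lborel))"
        by (intro mult_left_mono lev t) simp
      also have "\<dots> = ennreal (t powr p * (?c / t)) * (\<integral>\<^sup>+x\<in>{x. t / (2 * e) < h x}. ennreal (h x) \<partial>lborel)"
        by (simp only: ennreal_mult' mult.assoc powr_ge_zero)
      also have "t powr p * (?c / t) = ?c * t powr (p - 1)" using t0 by (simp add: powr_diff)
      also have "ennreal (?c * t powr (p - 1)) * (\<integral>\<^sup>+x\<in>{x. t / (2 * e) < h x}. ennreal (h x) \<partial>lborel)
         = ennreal ?c * (ennreal (t powr (p - 1)) * (\<integral>\<^sup>+x\<in>{x. t / (2 * e) < h x}. ennreal (h x) \<partial>lborel))"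
        by (subst ennreal_mult'', simp, rule mult.assoc)
      also have "ennreal (t powr (p - 1)) * (\<integral>\<^sup>+x\<in>{x. t / (2 * e) < h x}. ennreal (h x) \<partial>lborel)
         = (\<integral>\<^sup>+x\<in>{x. t / (2 * e) < h x}. ennreal (t powr (p - 1) * h x) \<partial>lborel)"
        by (rule nn_integral_cmult_set[symmetric]) auto
      also have "\<dots> \<le> (\<integral>\<^sup>+x\<in>{x. t / (2 * e) < h x}. ennreal ((2 * e) powr (p - 1) * h x powr p) \<partial>lborel)"
      proof (rule nn_integral_mono)
        fix x
        have "t powr (p - 1) * h x \<le> (2 * e) powr (p - 1) * h x powr p" if "t / (2 * e) < h x"
        proof -
          have hx: "0 < h x" using that t0 e by (meson divide_pos_pos less_trans mult_pos_pos zero_less_numeral)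
          have "t powr (p - 1) \<le> (2 * e * h x) powr (p - 1)"
            using that t0 e p by (intro powr_mono2) (auto simp: field_simps)
          also have "\<dots> = (2 * e) powr (p - 1) * h x powr (p - 1)" using e hx by (simp add: powr_mult)
          finally have "t powr (p - 1) * h x \<le> (2 * e) powr (p - 1) * h x powr (p - 1) * h x"
            using hx by (intro mult_right_mono) auto
          also have "\<dots> = (2 * e) powr (p - 1) * h x powr p" using hx by (simp add: powr_diff)
          finally show ?thesis .
        qed
        then show "ennreal (t powr (p - 1) * h x) * indicator {x. t / (2 * e) < h x} x
          \<le> ennreal ((2 * e) powr (p - 1) * h x powr p) * indicator {x. t / (2 * e) < h x} x"
          by (auto split: split_indicator intro!: ennreal_leI)
      qed
      finally have "ennreal (t powr p) * emeasure lborel {x. t < ?U x} \<le> ennreal ?c * (ennreal ((2 * e) powr (p - 1)) * ?J)"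
        unfolding q by (simp add: mult_left_mono)
      then show ?thesis by (subst ennreal_mult'') (simp_all only: mult.assoc powr_ge_zero)
    qed
    have second: "(\<integral>\<^sup>+l\<in>{t..}. (ennreal (?f l) * (\<integral>\<^sup>+x\<in>{x. l < ?U x}. ennreal 1 \<partial>lborel)) \<partial>lborel)
       \<le> ennreal (?c * p * (2 * e) powr (p - 1)) * ?J"
    proof -
      have "(\<integral>\<^sup>+l\<in>{t..}. (ennreal (?f l) * (\<integral>\<^sup>+x\<in>{x. l < ?U x}. ennreal 1 \<partial>lborel)) \<partial>lborel)
        \<le> (\<integral>\<^sup>+l\<in>{t..}. (ennreal (?g l) * (\<integral>\<^sup>+x\<in>{x. l < 2 * e * h x}. ennreal (?c * p * h x) \<partial>lborel)) \<partial>lborel)"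
      proof (rule nn_integral_mono)
        fix l :: real
        show "ennreal (?f l) * (\<integral>\<^sup>+x\<in>{x. l < ?U x}. ennreal 1 \<partial>lborel) * indicator {t..} l
          \<le> ennreal (?g l) * (\<integral>\<^sup>+x\<in>{x. l < 2 * e * h x}. ennreal (?c * p * h x) \<partial>lborel) * indicator {t..} l"
        proof (cases "l \<in> {t..}")
          case True
          then have l: "0 < l" "\<tau>0 \<le> l" using t t0 by auto
          have "ennreal (?f l) * (\<integral>\<^sup>+x\<in>{x. l < ?U x}. ennreal 1 \<partial>lborel) = ennreal (?f l) * emeasure lborel {x. l < ?U x}"
            by simp
          also have "\<dots> \<le> ennreal (?f l) * (ennreal (?c / l) * (\<integral>\<^sup>+x\<in>{x. l / (2 * e) < h x}. ennreal (h x) \<partial>lborel))"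
            by (intro mult_left_mono lev l) simp
          also have "\<dots> = ennreal (?f l * (?c / l)) * (\<integral>\<^sup>+x\<in>{x. l / (2 * e) < h x}. ennreal (h x) \<partial>lborel)"
            using c0 l(1) by (subst ennreal_mult''[of "?c / l" "?f l"], simp, simp only: mult.assoc)
          also have "?f l * (?c / l) = ?g l * (?c * p)"
            using l by (simp add: powr_diff power2_eq_square)
          also have "ennreal (?g l * (?c * p)) * (\<integral>\<^sup>+x\<in>{x. l / (2 * e) < h x}. ennreal (h x) \<partial>lborel)
             = ennreal (?g l) * (\<integral>\<^sup>+x\<in>{x. l / (2 * e) < h x}. ennreal (?c * p * h x) \<partial>lborel)"
          proof -
            have "(\<integral>\<^sup>+x\<in>{x. l / (2 * e) < h x}. ennreal (?c * p * h x) \<partial>lborel)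
               = ennreal (?c * p) * (\<integral>\<^sup>+x\<in>{x. l / (2 * e) < h x}. ennreal (h x) \<partial>lborel)"
              by (rule nn_integral_cmult_set) (use c0 p in auto)
            moreover have "ennreal (?g l * (?c * p)) = ennreal (?g l) * ennreal (?c * p)"
              using c0 p by (intro ennreal_mult'') auto
            ultimately show ?thesis by (simp only: mult.assoc)
          qed
          also have "{x. l / (2 * e) < h x} = {x. l < 2 * e * h x}" using e by (auto simp: field_simps)
          finally show ?thesis using True by simp
        qed simp
      qed
      also have "\<dots> = (\<integral>\<^sup>+x. ennreal (?c * p * h x) * (\<integral>\<^sup>+l\<in>{t..}. (ennreal (?g l) * indicator {l. l < 2 * e * h x} l) \<partial>lborel) \<partial>lborel)"
        by (rule nn_integral_layer_swap) measurable
      also have "\<dots> \<le> (\<integral>\<^sup>+x\<in>{x. t / (2 * e) < h x}. ennreal (?c * p * (2 * e) powr (p - 1) * h x powr p) \<partial>lborel)"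
      proof (rule nn_integral_mono)
        fix x
        have "ennreal (?c * p * h x) * (\<integral>\<^sup>+l\<in>{t..}. (ennreal (?g l) * indicator {l. l < 2 * e * h x} l) \<partial>lborel)
          \<le> ennreal (?c * p * h x) * (ennreal ((2 * e * h x) powr (p - 2 + 1)) * indicator {t<..} (2 * e * h x))"
          by (intro mult_left_mono nn_integral_powr_le) (use t0 p in auto)
        also have "\<dots> = ennreal (?c * p * h x * (2 * e * h x) powr (p - 1)) * indicator {x. t / (2 * e) < h x} x"
        proof -
          have "ennreal (?c * p * h x * (2 * e * h x) powr (p - 1)) = ennreal (?c * p * h x) * ennreal ((2 * e * h x) powr (p - 1))"
            by (rule ennreal_mult'') simp
          moreover have "indicator {t<..} (2 * e * h x) = (indicator {x. t / (2 * e) < h x} x :: ennreal)"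
            using e by (auto simp: field_simps split: split_indicator)
          moreover have "p - 2 + 1 = p - 1" by simp
          ultimately show ?thesis by (simp only: mult.assoc)
        qed
        also have "?c * p * h x * (2 * e * h x) powr (p - 1) = ?c * p * (2 * e) powr (p - 1) * h x powr p"
          using e h_nonneg[of x] p by (cases "h x = 0") (auto simp: powr_mult powr_diff)
        finally show "ennreal (?c * p * h x) * (\<integral>\<^sup>+l\<in>{t..}. (ennreal (?g l) * indicator {l. l < 2 * e * h x} l) \<partial>lborel)
          \<le> ennreal (?c * p * (2 * e) powr (p - 1) * h x powr p) * indicator {x. t / (2 * e) < h x} x" .
      qed
      also have "\<dots> = ennreal (?c * p * (2 * e) powr (p - 1)) * ?J"
        by (rule nn_integral_cmult_set) (use c0 p in auto)
      finally show ?thesis .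
    qed
    have mm[measurable]: "(\<lambda>x. \<integral>\<^sup>+l\<in>{t..}. (ennreal (?f l) * indicator {l. l < ?U x} l) \<partial>lborel) \<in> borel_measurable borel"
    proof -
      have "(\<lambda>x. \<integral>\<^sup>+l. (if l < ?U x \<and> l \<in> {t..} then ennreal (?f l) else 0) \<partial>lborel) \<in> borel_measurable borel"
        by (rule lborel.borel_measurable_nn_integral) measurable
      also have "(\<lambda>x. \<integral>\<^sup>+l. (if l < ?U x \<and> l \<in> {t..} then ennreal (?f l) else 0) \<partial>lborel) = (\<lambda>x. \<integral>\<^sup>+l\<in>{t..}. (ennreal (?f l) * indicator {l. l < ?U x} l) \<partial>lborel)"
        by (intro ext nn_integral_cong) auto
      finally show ?thesis .
    qed
    have "(\<integral>\<^sup>+x\<in>{x. t < ?U x}. ennreal (?U x powr p) \<partial>lborel)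
      \<le> (\<integral>\<^sup>+x. (ennreal (t powr p) * indicator {x. t < ?U x} x + ennreal 1 * (\<integral>\<^sup>+l\<in>{t..}. (ennreal (?f l) * indicator {l. l < ?U x} l) \<partial>lborel)) \<partial>lborel)"
    proof (rule nn_integral_mono)
      fix x
      have "ennreal (?U x powr p) \<le> ennreal (t powr p) + (\<integral>\<^sup>+l\<in>{t..}. (ennreal (?f l) * indicator {l. l < ?U x} l) \<partial>lborel)"
      proof -
        have "ennreal ((?U x powr p - t powr p) / p) \<le> (\<integral>\<^sup>+l. ennreal (l powr (p - 1)) * indicator {t..?U x} l \<partial>lborel)"
          by (rule nn_integral_powr_Ioc) (use t0 p in auto)
        then have "ennreal p * ennreal ((?U x powr p - t powr p) / p) \<le> ennreal p * (\<integral>\<^sup>+l. ennreal (l powr (p - 1)) * indicator {t..?U x} l \<partial>lborel)"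
          by (rule mult_left_mono) simp
        also have "\<dots> = (\<integral>\<^sup>+l. ennreal (?f l) * indicator {t..?U x} l \<partial>lborel)"
          by (subst nn_integral_cmult[symmetric]) (use p in \<open>auto simp: ennreal_mult' mult.assoc\<close>)
        also have "\<dots> \<le> (\<integral>\<^sup>+l\<in>{t..}. (ennreal (?f l) * indicator {l. l < ?U x} l) \<partial>lborel)"
        proof (rule nn_integral_mono_AE)
          have "AE l in lborel. l \<noteq> ?U x" by (rule AE_lborel_singleton)
          then show "AE l in lborel. ennreal (?f l) * indicator {t..?U x} l \<le> ennreal (?f l) * indicator {l. l < ?U x} l * indicator {t..} l"
            by eventually_elim (auto split: split_indicator)
        qed
        also have "ennreal p * ennreal ((?U x powr p - t powr p) / p) = ennreal (?U x powr p - t powr p)"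
          using p by (simp add: ennreal_mult'[symmetric])
        finally have "ennreal (t powr p) + ennreal (?U x powr p - t powr p) \<le> ennreal (t powr p) + (\<integral>\<^sup>+l\<in>{t..}. (ennreal (?f l) * indicator {l. l < ?U x} l) \<partial>lborel)"
          by (rule add_left_mono)
        moreover have "ennreal (?U x powr p) \<le> ennreal (t powr p) + ennreal (?U x powr p - t powr p)"
          by (cases "t powr p \<le> ?U x powr p") (auto simp: ennreal_plus[symmetric] ennreal_neg simp del: ennreal_plus intro!: ennreal_leI)
        ultimately show ?thesis by (rule order.trans[rotated])
      qed
      then show "ennreal (?U x powr p) * indicator {x. t < ?U x} x
        \<le> ennreal (t powr p) * indicator {x. t < ?U x} x + ennreal 1 * (\<integral>\<^sup>+l\<in>{t..}. (ennreal (?f l) * indicator {l. l < ?U x} l) \<partial>lborel)"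
        by (auto split: split_indicator)
    qed
    also have "\<dots> = ennreal (t powr p) * emeasure lborel {x. t < ?U x} + (\<integral>\<^sup>+x. ennreal 1 * (\<integral>\<^sup>+l\<in>{t..}. (ennreal (?f l) * indicator {l. l < ?U x} l) \<partial>lborel) \<partial>lborel)"
      by (subst nn_integral_add, measurable) (simp add: nn_integral_cmult_indicator)
    also have "(\<integral>\<^sup>+x. ennreal 1 * (\<integral>\<^sup>+l\<in>{t..}. (ennreal (?f l) * indicator {l. l < ?U x} l) \<partial>lborel) \<partial>lborel)
       = (\<integral>\<^sup>+l\<in>{t..}. (ennreal (?f l) * (\<integral>\<^sup>+x\<in>{x. l < ?U x}. ennreal 1 \<partial>lborel)) \<partial>lborel)"
      by (rule nn_integral_layer_swap[symmetric]) measurable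
    also have "ennreal (t powr p) * emeasure lborel {x. t < ?U x} + \<dots>
      \<le> ennreal (?c * (2 * e) powr (p - 1)) * ?J + ennreal (?c * p * (2 * e) powr (p - 1)) * ?J"
      by (rule add_mono[OF first second])
    also have "\<dots> = ennreal (?c * (2 * e) powr (p - 1) + ?c * p * (2 * e) powr (p - 1)) * ?J"
      using c0 p by (subst ennreal_plus) (auto simp: distrib_right)
    also have "?c * (2 * e) powr (p - 1) + ?c * p * (2 * e) powr (p - 1) = 5 ^ DIM('a) * (1 + p) * (2 * e) powr p"
      using e by (simp add: powr_diff field_simps)
    finally show ?thesis .
  qed
  then show ?thesis using \<tau>0 by blast
qed

text \<open>With p = 2 this is the Sobolev embedding into the power 2/\<alpha>, without a bound on
  the norm; with p > 2 it carries the higher integrability of h over to u. Above a level t the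
  previous lemma applies, below it the square integrability of u.\<close>

lemma integrable_u_powr:
  assumes \<alpha>: "0 < \<alpha>" "\<alpha> < 1" "real DIM('a) * (1 - \<alpha>) \<le> 2" and p: "2 \<le> p"
    and hp: "integrable lborel (\<lambda>x. h x powr p)"
  shows "integrable lborel (\<lambda>x. (\<bar>u x\<bar> powr (1 / \<alpha>)) powr p)"
proof (rule integrableI_nonneg)
  let ?U = "\<lambda>x. \<bar>u x\<bar> powr (1 / \<alpha>)" and ?A = "5 ^ DIM('a) * (1 + p) * (2 * 1) powr p"
  obtain t where t: "0 < t" and le: "(\<integral>\<^sup>+x\<in>{x. t < ?U x}. ennreal (?U x powr p) \<partial>lborel)
     \<le> ennreal ?A * (\<integral>\<^sup>+x\<in>{x. t / (2 * 1) < h x}. ennreal (h x powr p) \<partial>lborel)"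
    using level_set_power_bound[OF \<alpha> zero_less_one p] by blast
  \<comment> \<open>Where the power of u is at most t, |u| is at most t^\<alpha>, and
    |u|^(p/\<alpha>) is u^2 times the power p/\<alpha> - 2 \<ge> 0 of |u|.\<close>
  define M where "M = (t powr \<alpha>) powr (p / \<alpha> - 2)"
  have "(\<integral>\<^sup>+x. ennreal (?U x powr p) \<partial>lborel) \<le> (\<integral>\<^sup>+x. (ennreal (?U x powr p) * indicator {x. t < ?U x} x + ennreal M * ennreal ((u x)\<^sup>2)) \<partial>lborel)"
  proof (rule nn_integral_mono)
    fix x
    have "?U x powr p \<le> M * (u x)\<^sup>2" if U: "\<not> t < ?U x"
    proof (cases "u x = 0")
      case False
      then have u0: "0 < \<bar>u x\<bar>" by simp
      have "\<bar>u x\<bar> = ?U x powr \<alpha>" using \<alpha> by (simp add: powr_powr)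
      also have "\<dots> \<le> t powr \<alpha>" using U \<alpha> by (intro powr_mono2) auto
      finally have ut: "\<bar>u x\<bar> \<le> t powr \<alpha>" .
      have p2: "0 \<le> p / \<alpha> - 2"
      proof -
        have "2 * \<alpha> \<le> p" using \<alpha> p by (smt (verit))
        then show ?thesis using \<alpha> by (simp add: field_simps)
      qed
      have "?U x powr p = \<bar>u x\<bar> powr (p / \<alpha> - 2) * \<bar>u x\<bar> powr 2"
        by (simp add: powr_powr powr_add[symmetric] del: powr_numeral)
      also have "\<dots> \<le> M * \<bar>u x\<bar> powr 2"
        unfolding M_def using ut p2 by (intro mult_right_mono powr_mono2) auto
      finally show ?thesis using u0 by simp
    qed simp
    then show "ennreal (?U x powr p) \<le> ennreal (?U x powr p) * indicator {x. t < ?U x} x + ennreal M * ennreal ((u x)\<^sup>2)"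
      by (auto split: split_indicator simp: ennreal_mult'[symmetric] M_def intro!: ennreal_leI)
  qed
  also have "\<dots> = (\<integral>\<^sup>+x\<in>{x. t < ?U x}. ennreal (?U x powr p) \<partial>lborel) + ennreal M * (\<integral>\<^sup>+x. ennreal ((u x)\<^sup>2) \<partial>lborel)"
    by (subst nn_integral_add) (auto simp: nn_integral_cmult)
  also have "\<dots> \<le> ennreal ?A * (\<integral>\<^sup>+x. ennreal (h x powr p) \<partial>lborel) + ennreal M * (\<integral>\<^sup>+x. ennreal ((u x)\<^sup>2) \<partial>lborel)"
    by (intro add_right_mono order.trans[OF le] mult_left_mono nn_integral_mono) (auto split: split_indicator)
  also have "\<dots> < \<infinity>"
    using int_u(2) hp by (subst (1 2) nn_integral_eq_integral) (auto simp: ennreal_mult''[symmetric] ennreal_plus[symmetric] simp del: ennreal_plus)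
  finally show "(\<integral>\<^sup>+x. ennreal (?U x powr p) \<partial>lborel) < \<infinity>" .
qed auto

section \<open>From a Caccioppoli inequality to level sets\<close>

lemma set_integral_square_nonneg: "0 \<le> (LINT y:S|lborel. (f y :: real)\<^sup>2)"
  by (auto simp: set_lebesgue_integral_def intro!: integral_nonneg_AE)

text \<open>Near a point where h exceeds l, take almost the largest radius at which the mean of h^2
  still exceeds l^2; on clearly larger balls the mean is at most l^2. At that radius RH and the
  Poincare inequality with small constant bound l^2 times the volume by terms of which three
  quarters are absorbed. What is left comes from {h > c l} and {G > c l^2}, and the Vitali lemma
  sums it over disjoint balls.\<close>

lemma stopping_time_estimate:
  assumes R: "0 < R" "0 < \<kappa>" "0 < C1" and G: "integrable lborel G" "\<And>x. 0 \<le> G x"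
    and RH: "\<And>x r. 0 < r \<Longrightarrow> r \<le> R \<Longrightarrow> \<exists>q. ball q (\<kappa> * r) \<subseteq> ball x (3 * r) \<and>
      (LINT y:ball x r|lborel. (h y)\<^sup>2) \<le> C1 * (1 / r\<^sup>2 * (LINT w:ball x (2 * r)|lborel. (u w - mean (ball q (\<kappa> * r)) u)\<^sup>2)
         + (LINT y:ball x (3 * r)|lborel. G y))"
  shows "\<exists>C>0. \<exists>c>0. c \<le> 1 \<and> (\<exists>l0>0. \<forall>l\<ge>l0. (\<integral>\<^sup>+x\<in>{x. l < h x}. ennreal ((h x)\<^sup>2) \<partial>lborel)
     \<le> ennreal (C * l) * (\<integral>\<^sup>+x\<in>{x. c * l < h x}. ennreal (h x) \<partial>lborel)
       + ennreal C * (\<integral>\<^sup>+x\<in>{x. c * l\<^sup>2 < G x}. ennreal (G x) \<partial>lborel))"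
proof -
  note [measurable] = borel_measurable_integrable[OF G(1)]
  define n where "n = DIM('a)"
  \<comment> \<open>Makes the L2 term of the Poincare inequality at most a quarter of l^2 times the
    volume: the ball of radius 3 r contributes 3^n and RH the factor C1.\<close>
  define \<theta> where "\<theta> = min 1 (sqrt (1 / (8 * C1 * 3 ^ n)))"
  have \<theta>: "0 < \<theta>" "\<theta> \<le> 1" using R by (auto simp: \<theta>_def)
  have th: "2 * C1 * \<theta>\<^sup>2 * 3 ^ n \<le> 1 / 4"
  proof -
    have "\<theta>\<^sup>2 \<le> (sqrt (1 / (8 * C1 * 3 ^ n)))\<^sup>2" using \<theta> by (intro power_mono) (auto simp: \<theta>_def)
    also have "\<dots> = 1 / (8 * C1 * 3 ^ n)" using R by simp
    finally show ?thesis using R by (simp add: field_simps)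
  qed
  define D where "D = 72 * 2 ^ n * ((6 / (\<theta> * \<kappa>)) ^ n)\<^sup>2"
  have D: "0 < D" using \<theta> R by (auto simp: D_def)
  define c where "c = min 1 (min (1 / (4 * (C1 * D * 81 ^ n))) (1 / (4 * (C1 * 9 ^ n))))"
  have c: "0 < c" "c \<le> 1" using R D by (auto simp: c_def)
  have c1: "C1 * D * 81 ^ n * c \<le> 1 / 4"
  proof -
    have "c \<le> 1 / (4 * (C1 * D * 81 ^ n))" by (simp add: c_def)
    then show ?thesis using R D by (simp add: field_simps)
  qed
  have c2: "C1 * 9 ^ n * c \<le> 1 / 4"
  proof -
    have "c \<le> 1 / (4 * (C1 * 9 ^ n))" by (simp add: c_def)
    then show ?thesis using R by (simp add: field_simps)
  qed
  \<comment> \<open>45 = 5 * 9 is the dilation from r to the Vitali enlargement of the ball of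
    radius 9 r; the 4 inverts the quarter that is not absorbed.\<close>
  define C where "C = 4 * 45 ^ n * C1 * (D * 9 ^ n + 1)"
  have C: "0 < C" using R D by (auto simp: C_def intro!: mult_pos_pos add_pos_pos)
  define I where "I = (LINT y|lborel. (h y)\<^sup>2)"
  have vR: "0 < vol (ball (0::'a) R)" using R by (intro vol_ball_pos)
  \<comment> \<open>From l0 on, the mean of h^2 over a ball of radius beyond R is at most l^2 by
    total energy alone, so the stopping property extends to all large radii.\<close>
  define l0 where "l0 = max 1 (sqrt (I / vol (ball (0::'a) R)))"
  have l0: "0 < l0" by (simp add: l0_def)
  have volr: "vol (ball x (k * r)) = k ^ n * vol (ball x r)" if "0 < r" "0 < k" for x :: 'a and k r
    using that by (simp add: content_ball n_def power_mult_distrib)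
  have Ile: "(LINT y:S|lborel. (h y)\<^sup>2) \<le> I" if "S \<in> sets borel" for S
    using set_integral_mono_set[OF int_h(2) that, of UNIV] unfolding I_def by (simp add: set_lebesgue_integral_def)
  have main: "(\<integral>\<^sup>+x\<in>{x. l < h x}. ennreal ((h x)\<^sup>2) \<partial>lborel)
     \<le> ennreal (C * l) * (\<integral>\<^sup>+x\<in>{x. c * l < h x}. ennreal (h x) \<partial>lborel)
       + ennreal C * (\<integral>\<^sup>+x\<in>{x. c * l\<^sup>2 < G x}. ennreal (G x) \<partial>lborel)" if l: "l0 \<le> l" for l
  proof -
    have lpos: "0 < l" using l l0 by simp
    define E where "E = maximal_set R (\<lambda>x. (h x)\<^sup>2) (l\<^sup>2)"
    have E[measurable]: "E \<in> sets borel" unfolding E_def by (rule measurable_maximal_set) (use int_h in auto)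
    define hc where "hc x = h x * indicator {x. c * l < h x} x" for x
    define Gc where "Gc x = G x * indicator {x. c * l\<^sup>2 < G x} x" for x
    have hc: "integrable lborel hc" "\<And>x. 0 \<le> hc x" "\<And>x. h x \<le> c * l + hc x"
      using int_h(1) h_nonneg c lpos unfolding hc_def by (auto intro!: integrable_real_mult_indicator split: split_indicator)
    have Gc: "integrable lborel Gc" "\<And>x. 0 \<le> Gc x" "\<And>x. G x \<le> c * l\<^sup>2 + Gc x"
      using G c lpos unfolding Gc_def by (auto intro!: integrable_real_mult_indicator split: split_indicator)
    note [measurable] = borel_measurable_integrable[OF hc(1)] borel_measurable_integrable[OF Gc(1)]
    let ?\<Phi> = "density lborel (\<lambda>x. ennreal ((h x)\<^sup>2))"
    let ?\<Psi> = "density lborel (\<lambda>x. ennreal (C * (l * hc x + Gc x)))"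
    have "emeasure ?\<Phi> E \<le> emeasure ?\<Psi> UNIV"
    proof (rule vitali_emeasure_bound[where R="9 * R"])
      fix x assume "x \<in> E"
      define S where "S = {r. 0 < r \<and> r \<le> R \<and> l\<^sup>2 * vol (ball x r) < (LINT y:ball x r|lborel. (h y)\<^sup>2)}"
      have S: "S \<noteq> {}" "bdd_above S" using \<open>x \<in> E\<close> by (auto simp: S_def E_def maximal_set_def intro!: bdd_aboveI[of _ R])
      then obtain r0 where r0: "r0 \<in> S" by blast
      have "0 < Sup S" using cSup_upper[OF r0 S(2)] r0 by (auto simp: S_def)
      \<comment> \<open>The supremum need not belong to S, so a radius r above half of it is taken;
        every radius from 2 r on then exceeds the supremum.\<close>
      then have "Sup S / 2 < Sup S" by simp
      then obtain r where r: "r \<in> S" "Sup S / 2 < r" using less_cSupE[OF _ S(1)] by blast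
      then have rp: "0 < r" "r \<le> R" and rl: "l\<^sup>2 * vol (ball x r) < (LINT y:ball x r|lborel. (h y)\<^sup>2)" by (auto simp: S_def)
      have stop: "(LINT y:ball x \<rho>|lborel. (h y)\<^sup>2) \<le> l\<^sup>2 * vol (ball x \<rho>)" if \<rho>: "2 * r \<le> \<rho>" for \<rho>
      proof (cases "\<rho> \<le> R")
        case True
        have "\<rho> \<notin> S" using cSup_upper[OF _ S(2), of \<rho>] r(2) \<rho> by auto
        then show ?thesis using True \<rho> rp by (auto simp: S_def)
      next
        case False
        have "I / vol (ball (0::'a) R) = (sqrt (I / vol (ball (0::'a) R)))\<^sup>2" using vR by (simp add: I_def)
        also have "\<dots> \<le> l\<^sup>2" using l vR by (intro power_mono) (auto simp: l0_def I_def)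
        finally have "I \<le> l\<^sup>2 * vol (ball (0::'a) R)" using vR by (simp add: field_simps)
        also have "vol (ball (0::'a) R) \<le> vol (ball x \<rho>)" using False R by (simp add: content_ball power_mono)
        finally have "I \<le> l\<^sup>2 * vol (ball x \<rho>)" by (simp add: mult_left_mono)
        then show ?thesis using Ile[of "ball x \<rho>"] by simp
      qed
      define v where "v = vol (ball x r)"
      have v: "0 < v" unfolding v_def using rp by (intro vol_ball_pos)
      have vk: "vol (ball x (k * r)) = k ^ n * v" if "0 < k" for k using volr[OF rp(1) that] by (simp add: v_def)
      define J where "J = (LINT y:ball x (9 * r)|lborel. h y)"
      define Hh where "Hh = (LINT y:ball x (9 * r)|lborel. hc y)"
      define Hg where "Hg = (LINT y:ball x (9 * r)|lborel. Gc y)"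
      have si: "set_integrable lborel (ball x (9 * r)) f" if "integrable lborel f" for f :: "'a \<Rightarrow> real"
        using that by (rule set_integrable_borel) auto
      have J0: "0 \<le> J" "0 \<le> Hh" "0 \<le> Hg" using h_nonneg hc Gc
        by (auto simp: J_def Hh_def Hg_def set_lebesgue_integral_def intro!: integral_nonneg_AE)
      have v9: "vol (ball x (9 * r)) = 9 ^ n * v" using vk[of 9] by simp
      \<comment> \<open>J gets two bounds: this one by Jensen from the stopping property, the next
        by splitting h at c l. Their product bounds J^2 by an expression that is only linear in the
        integral of h over {h > c l}.\<close>
      have J1: "J \<le> l * (9 ^ n * v)"
      proof -
        have "(mean (ball x (9 * r)) h)\<^sup>2 \<le> mean (ball x (9 * r)) (\<lambda>y. (h y)\<^sup>2)"
          using v by (intro mean_square_le si int_h) (auto simp: emeasure_ball_eq vk)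
        also have "\<dots> \<le> l\<^sup>2" using stop[of "9 * r"] rp v unfolding mean_def v9 by (simp add: pos_divide_le_eq)
        finally have "mean (ball x (9 * r)) h \<le> l" by (rule power2_le_imp_le[OF _ less_imp_le[OF lpos]])
        then show ?thesis using v unfolding mean_def J_def v9 by (simp add: pos_divide_le_eq)
      qed
      have J2: "J \<le> c * l * (9 ^ n * v) + Hh"
      proof -
        have "J \<le> (LINT y:ball x (9 * r)|lborel. c * l + hc y)"
          unfolding J_def by (rule set_integral_mono) (use si int_h hc set_integral_add(1)[OF set_integrable_const_ball si[OF hc(1)]] in auto)
        also have "\<dots> = c * l * (9 ^ n * v) + Hh"
          by (subst set_integral_add) (use si hc in \<open>auto simp: Hh_def vk\<close>)
        finally show ?thesis .
      qed
      have G1: "(LINT y:ball x (3 * r)|lborel. G y) \<le> c * l\<^sup>2 * (9 ^ n * v) + Hg"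
      proof -
        have "(LINT y:ball x (3 * r)|lborel. G y) \<le> (LINT y:ball x (9 * r)|lborel. G y)"
          by (rule set_integral_mono_set) (use G rp in auto)
        also have "\<dots> \<le> (LINT y:ball x (9 * r)|lborel. c * l\<^sup>2 + Gc y)"
          by (rule set_integral_mono) (use si G Gc set_integral_add(1)[OF set_integrable_const_ball si[OF Gc(1)]] in auto)
        also have "\<dots> = c * l\<^sup>2 * (9 ^ n * v) + Hg"
          by (subst set_integral_add) (use si Gc in \<open>auto simp: Hg_def vk\<close>)
        finally show ?thesis .
      qed
      obtain q where q: "ball q (\<kappa> * r) \<subseteq> ball x (3 * r)"
        "(LINT y:ball x r|lborel. (h y)\<^sup>2) \<le> C1 * (1 / r\<^sup>2 * (LINT w:ball x (2 * r)|lborel. (u w - mean (ball q (\<kappa> * r)) u)\<^sup>2)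
         + (LINT y:ball x (3 * r)|lborel. G y))"
        using RH[OF rp] by blast
      have "(LINT w:ball x (2 * r)|lborel. (u w - mean (ball q (\<kappa> * r)) u)\<^sup>2)
         \<le> 2 * \<theta>\<^sup>2 * r\<^sup>2 * (LINT y:ball x (3 * r)|lborel. (h y)\<^sup>2) + D * r\<^sup>2 / v * J\<^sup>2"
        using poincare_with_small_constant[OF rp(1) \<theta> R(2) q(1)] by (simp add: D_def v_def J_def n_def)
      also have "\<dots> \<le> 2 * \<theta>\<^sup>2 * r\<^sup>2 * (l\<^sup>2 * (3 ^ n * v)) + D * r\<^sup>2 / v * (l * (9 ^ n * v) * (c * l * (9 ^ n * v) + Hh))"
      proof (intro add_mono mult_left_mono)
        show "(LINT y:ball x (3 * r)|lborel. (h y)\<^sup>2) \<le> l\<^sup>2 * (3 ^ n * v)" using stop[of "3 * r"] rp by (simp add: vk)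
        show "J\<^sup>2 \<le> l * (9 ^ n * v) * (c * l * (9 ^ n * v) + Hh)"
          unfolding power2_eq_square using J0 J1 J2 lpos v by (intro mult_mono) auto
      qed (use D v in auto)
      also have "\<dots> = r\<^sup>2 * (2 * \<theta>\<^sup>2 * l\<^sup>2 * 3 ^ n * v + D * (81 ^ n * c * l\<^sup>2 * v + 9 ^ n * l * Hh))"
      proof -
        have "(81 :: real) ^ n = 9 ^ n * 9 ^ n" by (simp add: power_mult_distrib[symmetric])
        then show ?thesis using v by (simp add: field_simps power2_eq_square)
      qed
      finally have P: "1 / r\<^sup>2 * (LINT w:ball x (2 * r)|lborel. (u w - mean (ball q (\<kappa> * r)) u)\<^sup>2)
         \<le> 2 * \<theta>\<^sup>2 * l\<^sup>2 * 3 ^ n * v + D * (81 ^ n * c * l\<^sup>2 * v + 9 ^ n * l * Hh)"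
        using rp by (simp add: field_simps)
      have "l\<^sup>2 * v < C1 * (2 * \<theta>\<^sup>2 * l\<^sup>2 * 3 ^ n * v + D * (81 ^ n * c * l\<^sup>2 * v + 9 ^ n * l * Hh) + (c * l\<^sup>2 * (9 ^ n * v) + Hg))"
        using rl[folded v_def] q(2) mult_left_mono[OF add_mono[OF P G1], of C1] R by linarith
      also have "\<dots> = (2 * C1 * \<theta>\<^sup>2 * 3 ^ n) * (l\<^sup>2 * v) + (C1 * D * 81 ^ n * c) * (l\<^sup>2 * v) + (C1 * 9 ^ n * c) * (l\<^sup>2 * v)
         + (C1 * D * 9 ^ n * (l * Hh) + C1 * Hg)" by (simp add: algebra_simps)
      also have "\<dots> \<le> 1 / 4 * (l\<^sup>2 * v) + 1 / 4 * (l\<^sup>2 * v) + 1 / 4 * (l\<^sup>2 * v) + (C1 * D * 9 ^ n * (l * Hh) + C1 * Hg)"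
        using v by (intro add_right_mono add_mono mult_right_mono th c1 c2) auto
      finally have "l\<^sup>2 * v < 1 / 4 * (l\<^sup>2 * v) + 1 / 4 * (l\<^sup>2 * v) + 1 / 4 * (l\<^sup>2 * v) + (C1 * D * 9 ^ n * (l * Hh) + C1 * Hg)" .
      moreover have "a \<le> 4 * b" if "a < 1 / 4 * a + 1 / 4 * a + 1 / 4 * a + b" for a b :: real
        using that by (simp add: field_simps)
      ultimately have "l\<^sup>2 * v \<le> 4 * (C1 * D * 9 ^ n * (l * Hh) + C1 * Hg)" by blast
      also have "\<dots> \<le> 4 * C1 * (D * 9 ^ n + 1) * (l * Hh + Hg)"
        using R D J0 lpos by (simp add: algebra_simps)
      finally have "45 ^ n * (l\<^sup>2 * v) \<le> 45 ^ n * (4 * C1 * (D * 9 ^ n + 1) * (l * Hh + Hg))"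
        by (rule mult_left_mono) simp
      also have "\<dots> = C * (l * Hh + Hg)" by (simp add: C_def)
      finally have lv: "45 ^ n * (l\<^sup>2 * v) \<le> C * (l * Hh + Hg)" .
      \<comment> \<open>The estimates live on the ball of radius 9 r, so that ball is handed to the
        Vitali lemma; on its enlargement of radius 45 r the mean is still at most l^2.\<close>
      have "emeasure ?\<Phi> (ball x (5 * (9 * r))) = ennreal (LINT y:ball x (45 * r)|lborel. (h y)\<^sup>2)"
        by (subst emeasure_density) (auto simp: ennreal_set_integral[OF int_h(2)])
      also have "\<dots> \<le> ennreal (C * (l * Hh + Hg))"
      proof (rule ennreal_leI)
        have "(LINT y:ball x (45 * r)|lborel. (h y)\<^sup>2) \<le> l\<^sup>2 * vol (ball x (45 * r))" by (rule stop) (use rp in simp)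
        also have "\<dots> = 45 ^ n * (l\<^sup>2 * v)" using vk[of 45] by simp
        also have "\<dots> \<le> C * (l * Hh + Hg)" by (rule lv)
        finally show "(LINT y:ball x (45 * r)|lborel. (h y)\<^sup>2) \<le> C * (l * Hh + Hg)" .
      qed
      also have "C * (l * Hh + Hg) = (LINT y:ball x (9 * r)|lborel. C * (l * hc y + Gc y))"
        unfolding Hh_def Hg_def using si hc Gc by simp
      also have "ennreal \<dots> = emeasure ?\<Psi> (ball x (9 * r))"
        using C lpos hc Gc by (subst emeasure_density, simp, simp, subst ennreal_set_integral) (auto intro!: mult_nonneg_nonneg add_nonneg_nonneg)
      finally show "\<exists>r. 0 < r \<and> r \<le> 9 * R \<and> emeasure ?\<Phi> (ball x (5 * r)) \<le> emeasure ?\<Psi> (ball x r)"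
        using rp by (intro exI[of _ "9 * r"]) auto
    qed auto
    also have "emeasure ?\<Psi> UNIV = ennreal (C * l) * (\<integral>\<^sup>+x\<in>{x. c * l < h x}. ennreal (h x) \<partial>lborel)
       + ennreal C * (\<integral>\<^sup>+x\<in>{x. c * l\<^sup>2 < G x}. ennreal (G x) \<partial>lborel)"
    proof -
      have "emeasure ?\<Psi> UNIV = (\<integral>\<^sup>+x. (ennreal (C * l * h x) * indicator {x. c * l < h x} x + ennreal (C * G x) * indicator {x. c * l\<^sup>2 < G x} x) \<partial>lborel)"
      proof (subst emeasure_density)
        show "(\<integral>\<^sup>+x\<in>UNIV. ennreal (C * (l * hc x + Gc x)) \<partial>lborel)
          = (\<integral>\<^sup>+x. (ennreal (C * l * h x) * indicator {x. c * l < h x} x + ennreal (C * G x) * indicator {x. c * l\<^sup>2 < G x} x) \<partial>lborel)"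
          using C lpos h_nonneg G(2)
          by (intro nn_integral_cong) (auto simp: hc_def Gc_def ennreal_plus[symmetric] algebra_simps simp del: ennreal_plus split: split_indicator)
      qed auto
      also have "\<dots> = (\<integral>\<^sup>+x\<in>{x. c * l < h x}. ennreal (C * l * h x) \<partial>lborel) + (\<integral>\<^sup>+x\<in>{x. c * l\<^sup>2 < G x}. ennreal (C * G x) \<partial>lborel)"
        by (rule nn_integral_add) measurable
      finally show ?thesis using C lpos by (simp add: nn_integral_cmult_set)
    qed
    finally have *: "emeasure ?\<Phi> E \<le> ennreal (C * l) * (\<integral>\<^sup>+x\<in>{x. c * l < h x}. ennreal (h x) \<partial>lborel)
       + ennreal C * (\<integral>\<^sup>+x\<in>{x. c * l\<^sup>2 < G x}. ennreal (G x) \<partial>lborel)" .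
    have "(\<integral>\<^sup>+x\<in>{x. l < h x}. ennreal ((h x)\<^sup>2) \<partial>lborel) \<le> (\<integral>\<^sup>+x\<in>E. ennreal ((h x)\<^sup>2) \<partial>lborel)"
    proof (rule nn_integral_mono_AE)
      show "AE x in lborel. ennreal ((h x)\<^sup>2) * indicator {x. l < h x} x \<le> ennreal ((h x)\<^sup>2) * indicator E x"
        using lebesgue_h
      proof eventually_elim
        case (elim x)
        \<comment> \<open>At a Lebesgue point of h^2 with h x > l, small balls already have a mean
          above l^2.\<close>
        have "x \<in> E" if lx: "l < h x"
        proof -
          have "l\<^sup>2 < (h x)\<^sup>2" using lx lpos by (simp add: power_strict_mono)
          from order_tendstoD(1)[OF elim this]
          obtain b where b: "0 < b" "\<And>r. 0 < r \<Longrightarrow> r < b \<Longrightarrow> l\<^sup>2 < mean (ball x r) (\<lambda>y. (h y)\<^sup>2)"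
            by (auto simp: eventually_at_right_field)
          define r where "r = min R (b / 2)"
          have r: "0 < r" "r \<le> R" "r < b" using R b(1) by (auto simp: r_def)
          have "0 < vol (ball x r)" using r(1) by (rule vol_ball_pos)
          then have "l\<^sup>2 * vol (ball x r) < (LINT y:ball x r|lborel. (h y)\<^sup>2)"
            using b(2)[OF r(1,3)] by (simp add: mean_def field_simps)
          then show ?thesis using r by (auto simp: E_def maximal_set_def)
        qed
        then show ?case by (auto split: split_indicator)
      qed
    qed
    also have "\<dots> = emeasure ?\<Phi> E" by (subst emeasure_density) auto
    finally show ?thesis using * by simp
  qed
  show ?thesis using C c l0 main by blast
qed

text \<open>RH carries the critical term |u|^(2/\<alpha>) on the right. The stopping time estimate
  puts it into level set form; \<open>level_set_power_bound\<close> with small e bounds its level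
  set integral by a small multiple of the left side, which is absorbed, and what remains is the
  hypothesis of \<open>gehring_level_sets\<close>.\<close>

theorem higher_integrability:
  assumes \<alpha>: "0 < \<alpha>" "\<alpha> < 1" "real DIM('a) * (1 - \<alpha>) \<le> 2"
    and R: "0 < R" "0 < \<kappa>" "0 < C1"
    and W: "W \<in> borel_measurable borel" "\<And>x. 0 \<le> W x" "integrable lborel (\<lambda>x. (W x)\<^sup>2)"
      "0 < \<eta>" "integrable lborel (\<lambda>x. W x powr (2 + \<eta>))"
    and RH: "\<And>x r. 0 < r \<Longrightarrow> r \<le> R \<Longrightarrow> \<exists>q. ball q (\<kappa> * r) \<subseteq> ball x (3 * r) \<and>
      (LINT y:ball x r|lborel. (h y)\<^sup>2) \<le> C1 * (1 / r\<^sup>2 * (LINT w:ball x (2 * r)|lborel. (u w - mean (ball q (\<kappa> * r)) u)\<^sup>2)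
         + (LINT y:ball x (3 * r)|lborel. (\<bar>u y\<bar> powr (1 / \<alpha>))\<^sup>2 + (W y)\<^sup>2))"
  shows "\<exists>p>2. integrable lborel (\<lambda>x. h x powr p) \<and> integrable lborel (\<lambda>x. (\<bar>u x\<bar> powr (1 / \<alpha>)) powr p)"
proof -
  note [measurable] = W(1)
  let ?U = "\<lambda>x. \<bar>u x\<bar> powr (1 / \<alpha>)"
  let ?G = "\<lambda>x. (?U x)\<^sup>2 + (W x)\<^sup>2"
  have h2: "(\<lambda>x. h x powr 2) = (\<lambda>x. (h x)\<^sup>2)" using h_nonneg by (simp add: fun_eq_iff)
  have iU: "integrable lborel (\<lambda>x. (?U x)\<^sup>2)"
    using integrable_u_powr[OF \<alpha>, of 2] int_h(2) unfolding h2 by simp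
  have G: "integrable lborel ?G" "\<And>x. 0 \<le> ?G x" using iU W(3) by auto
  obtain C c l1 where C: "0 < C" and c: "0 < c" "c \<le> 1" and l1: "0 < l1"
    and st: "\<And>l. l1 \<le> l \<Longrightarrow> (\<integral>\<^sup>+x\<in>{x. l < h x}. ennreal ((h x)\<^sup>2) \<partial>lborel)
     \<le> ennreal (C * l) * (\<integral>\<^sup>+x\<in>{x. c * l < h x}. ennreal (h x) \<partial>lborel)
       + ennreal C * (\<integral>\<^sup>+x\<in>{x. c * l\<^sup>2 < ?G x}. ennreal (?G x) \<partial>lborel)"
    using stopping_time_estimate[OF R G RH] by blast
  \<comment> \<open>If U^2 + W^2 exceeds c l^2, the larger summand exceeds c l^2 / 2, so its root
    exceeds d l. The bound d \<le> c keeps {h > c l} inside {h > d l}.\<close>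
  define d where "d = min c (sqrt (c / 2))"
  have d: "0 < d" "d \<le> 1" "d \<le> c" "2 * d\<^sup>2 \<le> c"
  proof -
    have "d\<^sup>2 \<le> (sqrt (c / 2))\<^sup>2" using c by (intro power_mono) (auto simp: d_def)
    then show "2 * d\<^sup>2 \<le> c" using c by simp
  qed (use c in \<open>auto simp: d_def\<close>)
  define A where "A = 5 ^ DIM('a) * (1 + 2) * (4::real)"
  have A: "0 < A" by (simp add: A_def)
  \<comment> \<open>2 e \<le> d raises the level d l / (2 e) of h to at least l, so the critical
    term is compared with the left side itself; the second entry makes its factor at most a half.
    The 4 in A is the square of the 2 in (2 e)^2.\<close>
  define e where "e = min (d / 2) (1 / sqrt (4 * C * A))"
  have e: "0 < e" "2 * e \<le> d" using d C A by (auto simp: e_def)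
  have eA: "2 * C * (A * e\<^sup>2) \<le> 1 / 2"
  proof -
    have "e\<^sup>2 \<le> (1 / sqrt (4 * C * A))\<^sup>2" using e by (intro power_mono) (auto simp: e_def)
    also have "\<dots> = 1 / (4 * C * A)" using C A by (simp add: power_divide)
    finally show ?thesis using C A by (simp add: field_simps)
  qed
  obtain t0 where t0: "0 < t0" and tU: "\<And>t. t0 \<le> t \<Longrightarrow> (\<integral>\<^sup>+x\<in>{x. t < ?U x}. ennreal (?U x powr 2) \<partial>lborel)
     \<le> ennreal (5 ^ DIM('a) * (1 + 2) * (2 * e) powr 2) * (\<integral>\<^sup>+x\<in>{x. t / (2 * e) < h x}. ennreal (h x powr 2) \<partial>lborel)"
    using level_set_power_bound[OF \<alpha> e(1) order_refl] by blast
  define l0 where "l0 = max l1 (t0 / d)"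
  have l0: "0 < l0" using l1 by (simp add: l0_def less_max_iff_disj)
  have level: "(\<integral>\<^sup>+x\<in>{x. l < h x}. ennreal ((h x)\<^sup>2) \<partial>lborel)
       \<le> ennreal (4 * C * l) * (\<integral>\<^sup>+x\<in>{x. d * l < h x}. ennreal (h x) \<partial>lborel)
         + ennreal (4 * C) * (\<integral>\<^sup>+x\<in>{x. d * l < W x}. ennreal ((W x)\<^sup>2) \<partial>lborel)" if l: "l0 \<le> l" for l
  proof -
    have lp: "0 < l" "l1 \<le> l" "t0 \<le> d * l" using less_le_trans[OF l0 l] l d by (auto simp: l0_def field_simps)
    let ?a = "\<integral>\<^sup>+x\<in>{x. l < h x}. ennreal ((h x)\<^sup>2) \<partial>lborel"
    let ?b1 = "\<integral>\<^sup>+x\<in>{x. d * l < h x}. ennreal (h x) \<partial>lborel"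
    let ?b2 = "\<integral>\<^sup>+x\<in>{x. d * l < W x}. ennreal ((W x)\<^sup>2) \<partial>lborel"
    let ?bU = "\<integral>\<^sup>+x\<in>{x. d * l < ?U x}. ennreal ((?U x)\<^sup>2) \<partial>lborel"
    \<comment> \<open>Absorption subtracts, so all quantities are first shown finite and turned into
      reals.\<close>
    have fin: "(\<integral>\<^sup>+x\<in>S. ennreal (f x) \<partial>lborel) < top" if f: "integrable lborel f" "\<And>x. 0 \<le> f x" for f :: "'a \<Rightarrow> real" and S
    proof -
      have "(\<integral>\<^sup>+x\<in>S. ennreal (f x) \<partial>lborel) \<le> (\<integral>\<^sup>+x. ennreal (f x) \<partial>lborel)"
        by (intro nn_integral_mono) (auto split: split_indicator)
      also have "\<dots> < top" using f by (subst nn_integral_eq_integral) auto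
      finally show ?thesis .
    qed
    have f1: "?a < top" "?b1 < top" "?b2 < top" "?bU < top"
      using int_h h_nonneg W(3) iU by (auto intro!: fin)
    have g1: "(\<integral>\<^sup>+x\<in>{x. c * l < h x}. ennreal (h x) \<partial>lborel) \<le> ?b1"
    proof (rule nn_integral_mono)
      fix x
      have "d * l \<le> c * l" using d lp by (intro mult_right_mono) auto
      then show "ennreal (h x) * indicator {x. c * l < h x} x \<le> ennreal (h x) * indicator {x. d * l < h x} x"
        by (auto split: split_indicator)
    qed
    have g2: "(\<integral>\<^sup>+x\<in>{x. c * l\<^sup>2 < ?G x}. ennreal (?G x) \<partial>lborel) \<le> ennreal 2 * ?bU + ennreal 2 * ?b2"
    proof -
      have "(\<integral>\<^sup>+x\<in>{x. c * l\<^sup>2 < ?G x}. ennreal (?G x) \<partial>lborel)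
        \<le> (\<integral>\<^sup>+x. (ennreal (2 * (?U x)\<^sup>2) * indicator {x. d * l < ?U x} x + ennreal (2 * (W x)\<^sup>2) * indicator {x. d * l < W x} x) \<partial>lborel)"
      proof (rule nn_integral_mono)
        fix x
        have dl: "2 * (d * l)\<^sup>2 \<le> c * l\<^sup>2"
          using d(4) mult_right_mono[of "2 * d\<^sup>2" c "l\<^sup>2"] by (simp add: power_mult_distrib)
        have k: "d * l < y" if "(d * l)\<^sup>2 < y\<^sup>2" "0 \<le> y" for y :: real using that power2_less_imp_less by blast
        have "?G x \<le> 2 * (?U x)\<^sup>2 * indicator {x. d * l < ?U x} x + 2 * (W x)\<^sup>2 * indicator {x. d * l < W x} x" if "c * l\<^sup>2 < ?G x"
        proof (cases "(?U x)\<^sup>2 \<le> (W x)\<^sup>2")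
          case True
          then have "(d * l)\<^sup>2 < (W x)\<^sup>2" using that dl by linarith
          then have "d * l < W x" using W(2)[of x] by (rule k)
          then show ?thesis using True by (auto split: split_indicator)
        next
          case False
          then have "(d * l)\<^sup>2 < (?U x)\<^sup>2" using that dl by linarith
          then have "d * l < ?U x" by (rule k) simp
          then show ?thesis using False by (auto split: split_indicator)
        qed
        then have "ennreal (?G x) \<le> ennreal (2 * (?U x)\<^sup>2 * indicator {x. d * l < ?U x} x + 2 * (W x)\<^sup>2 * indicator {x. d * l < W x} x)" if "c * l\<^sup>2 < ?G x"
          using that by (intro ennreal_leI) auto
        then show "ennreal (?G x) * indicator {x. c * l\<^sup>2 < ?G x} x
          \<le> ennreal (2 * (?U x)\<^sup>2) * indicator {x. d * l < ?U x} x + ennreal (2 * (W x)\<^sup>2) * indicator {x. d * l < W x} x"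
          by (auto split: split_indicator simp: ennreal_plus)
      qed
      also have "\<dots> = (\<integral>\<^sup>+x\<in>{x. d * l < ?U x}. ennreal (2 * (?U x)\<^sup>2) \<partial>lborel) + (\<integral>\<^sup>+x\<in>{x. d * l < W x}. ennreal (2 * (W x)\<^sup>2) \<partial>lborel)"
        by (rule nn_integral_add) measurable
      also have "\<dots> = ennreal 2 * ?bU + ennreal 2 * ?b2"
        by (intro arg_cong2[where f="(+)"] nn_integral_cmult_set) auto
      finally show ?thesis .
    qed
    have g3: "?bU \<le> ennreal (A * e\<^sup>2) * ?a"
    proof -
      have "?bU \<le> ennreal (5 ^ DIM('a) * (1 + 2) * (2 * e) powr 2) * (\<integral>\<^sup>+x\<in>{x. d * l / (2 * e) < h x}. ennreal (h x powr 2) \<partial>lborel)"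
        using tU[OF lp(3)] by simp
      also have "(\<integral>\<^sup>+x\<in>{x. d * l / (2 * e) < h x}. ennreal (h x powr 2) \<partial>lborel) \<le> ?a"
      proof (rule nn_integral_mono)
        fix x
        have "l \<le> d * l / (2 * e)" using e lp by (simp add: field_simps mult_right_mono)
        then show "ennreal (h x powr 2) * indicator {x. d * l / (2 * e) < h x} x \<le> ennreal ((h x)\<^sup>2) * indicator {x. l < h x} x"
          using h_nonneg[of x] by (auto split: split_indicator)
      qed
      also have "5 ^ DIM('a) * (1 + 2) * (2 * e) powr 2 = A * e\<^sup>2" using e by (simp add: A_def power_mult_distrib)
      finally show ?thesis by (simp add: mult_left_mono)
    qed
    obtain a where a: "?a = ennreal a" "0 \<le> a" using f1(1) by (cases ?a) auto
    obtain b1 where b1: "?b1 = ennreal b1" "0 \<le> b1" using f1(2) by (cases ?b1) auto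
    obtain b2 where b2: "?b2 = ennreal b2" "0 \<le> b2" using f1(3) by (cases ?b2) auto
    obtain bU where bU: "?bU = ennreal bU" "0 \<le> bU" using f1(4) by (cases ?bU) auto
    have "ennreal a \<le> ennreal (C * l) * ennreal b1 + ennreal C * (ennreal 2 * ennreal bU + ennreal 2 * ennreal b2)"
      using order.trans[OF st[OF lp(2)] add_mono[OF mult_left_mono[OF g1] mult_left_mono[OF g2]]]
      unfolding a(1) b1(1) b2(1) bU(1) by simp
    also have "\<dots> = ennreal (C * l * b1 + C * (2 * bU + 2 * b2))"
      using C lp b1 b2 bU by (simp only: ennreal_mult''[symmetric] ennreal_plus[symmetric] mult_nonneg_nonneg add_nonneg_nonneg zero_le_numeral less_imp_le)
    finally have r1: "a \<le> C * l * b1 + C * (2 * bU + 2 * b2)"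
      using C lp b1 b2 bU by (subst (asm) ennreal_le_iff) auto
    have "ennreal bU \<le> ennreal (A * e\<^sup>2 * a)"
      using g3 a(2) unfolding a(1) bU(1) by (simp only: ennreal_mult''[symmetric])
    then have "bU \<le> A * e\<^sup>2 * a" using A a by (subst (asm) ennreal_le_iff) auto
    then have "2 * C * bU \<le> (2 * C * (A * e\<^sup>2)) * a" using C by (simp add: mult_left_mono mult.assoc)
    also have "\<dots> \<le> 1 / 2 * a" using eA a by (intro mult_right_mono) auto
    finally have "2 * C * bU \<le> 1 / 2 * a" .
    moreover have "C * (2 * bU + 2 * b2) = 2 * C * bU + 2 * C * b2" by (simp add: algebra_simps)
    moreover have "0 \<le> C * l * b1" using C lp b1 by auto
    ultimately have "a \<le> 4 * (C * l * b1) + 4 * (C * b2)" using r1 by linarith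
    then have "ennreal a \<le> ennreal (4 * C * l * b1 + 4 * C * b2)" by (intro ennreal_leI) (simp add: mult.assoc)
    also have "\<dots> = ennreal (4 * C * l) * ennreal b1 + ennreal (4 * C) * ennreal b2"
      using C lp b1 b2 by (simp only: ennreal_mult''[symmetric] ennreal_plus[symmetric] mult_nonneg_nonneg zero_le_numeral less_imp_le)
    finally show ?thesis unfolding a(1) b1(1) b2(1) .
  qed
  \<comment> \<open>Three constraints: the integrability of W, the bound \<epsilon> \<le> 1, and the
    absorption in \<open>gehring_level_sets\<close> with the constants 4 C and d.\<close>
  define \<epsilon> where "\<epsilon> = min (min \<eta> 1) (d\<^sup>2 / (8 * C))"
  have \<epsilon>: "0 < \<epsilon>" "\<epsilon> \<le> 1" "\<epsilon> \<le> \<eta>" "2 * (4 * C) * \<epsilon> \<le> d\<^sup>2"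
  proof -
    have "\<epsilon> \<le> d\<^sup>2 / (8 * C)" by (simp add: \<epsilon>_def)
    then show "2 * (4 * C) * \<epsilon> \<le> d\<^sup>2" using C by (simp add: field_simps)
  qed (use W(4) d C in \<open>auto simp: \<epsilon>_def\<close>)
  have W\<epsilon>: "integrable lborel (\<lambda>x. W x powr (2 + \<epsilon>))"
  proof (rule Bochner_Integration.integrable_bound)
    show "integrable lborel (\<lambda>x. (W x)\<^sup>2 + W x powr (2 + \<eta>))" using W by auto
    show "AE x in lborel. norm (W x powr (2 + \<epsilon>)) \<le> norm ((W x)\<^sup>2 + W x powr (2 + \<eta>))"
    proof (rule AE_I2)
      fix x
      show "norm (W x powr (2 + \<epsilon>)) \<le> norm ((W x)\<^sup>2 + W x powr (2 + \<eta>))"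
      proof (cases "W x \<le> 1")
        case True
        then have "W x powr (2 + \<epsilon>) \<le> W x powr 2" using W(2)[of x] \<epsilon> by (intro powr_mono') auto
        then show ?thesis using W(2)[of x] by (simp add: add_increasing2)
      next
        case False
        then have "W x powr (2 + \<epsilon>) \<le> W x powr (2 + \<eta>)" using \<epsilon> by (intro powr_mono) auto
        then show ?thesis by (simp add: add_increasing)
      qed
    qed
  qed measurable
  have "integrable lborel (\<lambda>x. h x powr (2 + \<epsilon>))"
    by (rule gehring_level_sets[OF measurable_h h_nonneg int_h(2) W(1,2) W\<epsilon> d(1,2) _ l0 \<epsilon>(1,2,4) level]) (use C in auto)
  moreover from integrable_u_powr[OF \<alpha> _ this] \<epsilon> have "integrable lborel (\<lambda>x. ?U x powr (2 + \<epsilon>))" by simp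
  ultimately show ?thesis using \<epsilon> by (intro exI[of _ "2 + \<epsilon>"]) auto
qed

end

section \<open>Smooth bumps\<close>

lemma has_derivative_imp_frechet_eq:
  "(f has_derivative f') (at x) \<Longrightarrow> frechet_derivative f (at x) v = f' v"
  by (metis frechet_derivative_at)

lemma Ck_continuous: "Ck k f \<Longrightarrow> continuous_on UNIV f"
  by (cases k) (auto simp: continuous_at_imp_continuous_on differentiable_imp_continuous_within)

lemma Ck_Suc_imp: "Ck (Suc k) f \<Longrightarrow> Ck k f"
proof (induction k arbitrary: f)
  case 0
  then show ?case using Ck_continuous[OF 0] by simp
next
  case (Suc k)
  then show ?case using Ck.simps(2) by blast
qed

lemma Ck_const [simp]: "Ck k (\<lambda>x. c)"
  by (induction k arbitrary: c) (auto simp: frechet_derivative_const)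

lemma Ck_add: "Ck k f \<Longrightarrow> Ck k g \<Longrightarrow> Ck k (\<lambda>x. f x + g x)"
proof (induction k arbitrary: f g)
  case 0
  then show ?case by (auto intro: continuous_intros)
next
  case (Suc k)
  then have d: "\<And>x. f differentiable (at x)" "\<And>x. g differentiable (at x)" by auto
  have "frechet_derivative (\<lambda>x. f x + g x) (at x) v = frechet_derivative f (at x) v + frechet_derivative g (at x) v" for x v
    using d by (intro has_derivative_imp_frechet_eq has_derivative_add) (auto simp: frechet_derivative_works[symmetric])
  then show ?case using Suc d by auto
qed

lemma Ck_mult: "Ck k f \<Longrightarrow> Ck k g \<Longrightarrow> Ck k (\<lambda>x. f x * g x)"
proof (induction k arbitrary: f g)
  case 0
  then show ?case by (auto intro: continuous_intros)
next
  case (Suc k)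
  then have d: "\<And>x. f differentiable (at x)" "\<And>x. g differentiable (at x)" by auto
  have "frechet_derivative (\<lambda>x. f x * g x) (at x) v = f x * frechet_derivative g (at x) v + frechet_derivative f (at x) v * g x" for x v
    using d by (intro has_derivative_imp_frechet_eq has_derivative_mult) (auto simp: frechet_derivative_works[symmetric])
  moreover have "Ck k f" "Ck k g" using Suc.prems by (auto intro: Ck_Suc_imp simp del: Ck.simps)
  ultimately show ?case using Suc d by (auto intro!: Ck_add Suc.IH)
qed

lemma Ck_cmult: "Ck k f \<Longrightarrow> Ck k (\<lambda>x. c * f x)"
  by (rule Ck_mult) auto

lemma Ck_diff: "Ck k f \<Longrightarrow> Ck k g \<Longrightarrow> Ck k (\<lambda>x. f x - g x)"
  using Ck_add[of k f "\<lambda>x. (- 1) * g x"] Ck_cmult[of k g "- 1"] by simp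

lemma Ck_prod: "finite I \<Longrightarrow> (\<And>i. i \<in> I \<Longrightarrow> Ck k (f i)) \<Longrightarrow> Ck k (\<lambda>x. \<Prod>i\<in>I. f i x)"
  by (induction I rule: finite_induct) (auto intro: Ck_mult)

lemma Ck_sum: "finite I \<Longrightarrow> (\<And>i. i \<in> I \<Longrightarrow> Ck k (f i)) \<Longrightarrow> Ck k (\<lambda>x. \<Sum>i\<in>I. f i x)"
  by (induction I rule: finite_induct) (auto intro: Ck_add)

lemma Ck_inner: "Ck k (\<lambda>x. x \<bullet> a)"
proof (cases k)
  case (Suc j)
  have "frechet_derivative (\<lambda>x. x \<bullet> a) (at x) v = v \<bullet> a" for x v
    by (rule has_derivative_imp_frechet_eq) (auto intro!: derivative_eq_intros)
  then show ?thesis using Suc by (auto intro!: derivative_intros)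
qed (auto intro: continuous_intros)

lemma Ck_norm_sq: "Ck k (\<lambda>x::'a::euclidean_space. (norm (x - a))\<^sup>2)"
proof -
  have "(norm (x - a))\<^sup>2 = (\<Sum>i\<in>Basis. (x \<bullet> i - a \<bullet> i) * (x \<bullet> i - a \<bullet> i))" for x :: 'a
    unfolding power2_norm_eq_inner by (subst euclidean_inner) (simp add: inner_diff_left)
  then show ?thesis
    by (auto intro!: Ck_sum Ck_mult Ck_diff Ck_inner)
qed

text \<open>The derivatives of exp(-1/t), extended by 0 to t \<le> 0, are combinations of these
  functions; carrying the power m makes the family closed under differentiation.\<close>

definition flat :: "nat \<Rightarrow> real \<Rightarrow> real" where
  "flat m t = (if 0 < t then (1 / t) ^ m * exp (- (1 / t)) else 0)"

lemma flat_nonneg: "0 \<le> flat m t"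
  by (simp add: flat_def)

lemma flat_tendsto_0: "(flat m \<longlongrightarrow> 0) (at 0)"
proof -
  have "((\<lambda>t. inverse t ^ m / exp (inverse t)) \<longlongrightarrow> 0) (at_right (0::real))"
    by (rule filterlim_compose[OF tendsto_power_div_exp_0 filterlim_inverse_at_top_right])
  then have r: "(flat m \<longlongrightarrow> 0) (at_right 0)"
    by (rule Lim_transform_eventually)
       (auto simp: eventually_at_filter flat_def exp_minus field_simps)
  have l: "(flat m \<longlongrightarrow> 0) (at_left 0)"
    by (rule tendsto_eventually) (auto simp: eventually_at_filter flat_def)
  show ?thesis using l r by (simp add: filterlim_split_at)
qed

text \<open>At 0 the difference quotient of \<open>flat m\<close> is \<open>flat (Suc m)\<close>,
  which tends to 0 there; elsewhere the formula is ordinary calculus.\<close>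

lemma has_real_derivative_flat:
  "(flat m has_real_derivative flat (m + 2) t - real m * flat (m + 1) t) (at t)"
proof (cases t "0 :: real" rule: linorder_cases)
  case less
  have "((\<lambda>t. 0) has_real_derivative 0) (at t)" by simp
  then show ?thesis
    using less by (subst DERIV_cong_ev[OF refl, of _ "\<lambda>t. 0"])
      (auto simp: flat_def eventually_nhds intro!: exI[of _ "{..<0}"])
next
  case equal
  have "((\<lambda>h. (flat m (0 + h) - flat m 0) / h) \<longlongrightarrow> 0) (at 0)"
  proof (rule Lim_transform_eventually[OF flat_tendsto_0[of "Suc m"]])
    show "eventually (\<lambda>h. flat (Suc m) h = (flat m (0 + h) - flat m 0) / h) (at 0)"
      by (auto simp: eventually_at_filter flat_def)
  qed
  then show ?thesis using equal by (simp add: DERIV_def flat_def)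
next
  case greater
  have "((\<lambda>t. (1 / t) ^ m * exp (- (1 / t))) has_real_derivative flat (m + 2) t - real m * flat (m + 1) t) (at t)"
  proof -
    have 1: "((\<lambda>s. s ^ m * exp (- s)) has_real_derivative (real m * s ^ (m - 1) - s ^ m) * exp (- s)) (at s)" for s :: real
      by (auto intro!: derivative_eq_intros simp: algebra_simps)
    have "((\<lambda>t. 1 / t) has_real_derivative - ((1 / t)\<^sup>2)) (at t)"
      using greater by (auto intro!: derivative_eq_intros simp: power2_eq_square)
    from DERIV_chain2[OF 1 this]
    have "((\<lambda>t. (1 / t) ^ m * exp (- (1 / t))) has_real_derivative
       (real m * (1 / t) ^ (m - 1) - (1 / t) ^ m) * exp (- (1 / t)) * - ((1 / t)\<^sup>2)) (at t)" .
    also have "(real m * (1 / t) ^ (m - 1) - (1 / t) ^ m) * exp (- (1 / t)) * - ((1 / t)\<^sup>2) = flat (m + 2) t - real m * flat (m + 1) t"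
      using greater by (cases m) (simp_all add: flat_def power2_eq_square algebra_simps add_divide_distrib)
    finally show ?thesis .
  qed
  then show ?thesis
    using greater by (subst DERIV_cong_ev[OF refl, of _ "\<lambda>t. (1 / t) ^ m * exp (- (1 / t))"])
      (auto simp: flat_def eventually_nhds intro!: exI[of _ "{0<..}"])
qed

lemma has_derivative_flat_comp:
  assumes "q differentiable (at x)"
  shows "((\<lambda>x. flat m (q x)) has_derivative
     (\<lambda>v. (flat (m + 2) (q x) - real m * flat (m + 1) (q x)) * frechet_derivative q (at x) v)) (at x)"
proof -
  have "(q has_derivative frechet_derivative q (at x)) (at x)" using assms by (simp add: frechet_derivative_works)
  from has_derivative_compose[OF this has_real_derivative_flat[of m "q x", unfolded has_field_derivative_def]]
  show ?thesis by simp
qed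

text \<open>The induction on k treats all m at once, because a derivative brings in
  \<open>flat (m + 2)\<close> and \<open>flat (m + 1)\<close>.\<close>

lemma Ck_flat_comp:
  assumes q: "\<And>k. Ck k q"
  shows "Ck k (\<lambda>x. flat m (q x))"
proof (induction k arbitrary: m)
  case 0
  have "q differentiable (at x)" for x using q[of 1] by simp
  then have "(\<lambda>x. flat m (q x)) differentiable (at x)" for x
    using has_derivative_flat_comp differentiable_def by blast
  then show ?case by (auto simp: continuous_at_imp_continuous_on differentiable_imp_continuous_within)
next
  case (Suc k)
  have d: "q differentiable (at x)" for x using q[of 1] by simp
  have f: "frechet_derivative (\<lambda>x. flat m (q x)) (at x) v
     = (flat (m + 2) (q x) - real m * flat (m + 1) (q x)) * frechet_derivative q (at x) v" for x v
    by (rule has_derivative_imp_frechet_eq[OF has_derivative_flat_comp[OF d]])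
  have "Ck k (\<lambda>x. frechet_derivative q (at x) v)" for v using q[of "Suc k"] by simp
  then show ?case
    using has_derivative_flat_comp[OF d] by (auto simp: f differentiable_def intro!: Ck_mult Ck_diff Ck_cmult Suc.IH)
qed

lemma test_function_mono: "test_function S \<phi> \<Longrightarrow> S \<subseteq> T \<Longrightarrow> test_function T \<phi>"
  by (auto simp: test_function_def)

lemma test_functionI:
  assumes "\<And>k. Ck k \<phi>" "compact K" "K \<subseteq> S" "\<And>x. x \<notin> K \<Longrightarrow> \<phi> x = 0"
  shows "test_function S \<phi>"
proof -
  have sub: "closure {x. \<phi> x \<noteq> 0} \<subseteq> K"
    using assms(2,4) by (intro closure_minimal compact_imp_closed) auto
  then show ?thesis using assms compact_Int_closed[OF assms(2) closed_closure, of "{x. \<phi> x \<noteq> 0}"]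
    by (auto simp: test_function_def Int_absorb1)
qed

lemma test_function_mult:
  assumes "test_function S \<phi>" "\<And>k. Ck k g"
  shows "test_function S (\<lambda>x. g x * \<phi> x)"
proof (rule test_functionI[where K="closure {x. \<phi> x \<noteq> 0}"])
  show "g x * \<phi> x = 0" if "x \<notin> closure {x. \<phi> x \<noteq> 0}" for x
    using that closure_subset[of "{x. \<phi> x \<noteq> 0}"] by auto
qed (use assms in \<open>auto simp: test_function_def intro: Ck_mult\<close>)

section \<open>Uniqueness of weak gradients\<close>

text \<open>Smooth functions that approximate the indicator of the box from a to b: a factor is
  exp(-1/(k y)), with y > 0 exactly when that coordinate lies inside, and tends to 1 as k
  grows.\<close>

definition box_bump :: "'a::euclidean_space \<Rightarrow> 'a \<Rightarrow> nat \<Rightarrow> 'a \<Rightarrow> real" where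
  "box_bump a b k x = (\<Prod>i\<in>Basis. flat 0 (real k * ((x \<bullet> i - a \<bullet> i) * (b \<bullet> i - x \<bullet> i))))"

lemma flat_0_le_1: "flat 0 t \<le> 1"
  by (auto simp: flat_def)

lemma box_bump_bounds: "0 \<le> box_bump a b k x" "box_bump a b k x \<le> 1"
  unfolding box_bump_def by (auto intro!: prod_nonneg prod_le_1 flat_nonneg flat_0_le_1)

lemma box_bump_eq_0:
  assumes "\<And>i. i \<in> Basis \<Longrightarrow> a \<bullet> i \<le> b \<bullet> i" "x \<notin> box a b"
  shows "box_bump a b k x = 0"
proof -
  obtain i where i: "i \<in> Basis" "\<not> (a \<bullet> i < x \<bullet> i \<and> x \<bullet> i < b \<bullet> i)" using assms(2) by (auto simp: mem_box)
  have "(x \<bullet> i - a \<bullet> i) * (b \<bullet> i - x \<bullet> i) \<le> 0"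
    using i assms(1)[OF i(1)] by (auto simp: mult_le_0_iff)
  then have "flat 0 (real k * ((x \<bullet> i - a \<bullet> i) * (b \<bullet> i - x \<bullet> i))) = 0"
    by (simp add: flat_def mult_nonneg_nonpos not_less)
  then show ?thesis using i(1) unfolding box_bump_def by (auto intro!: prod_zero)
qed

lemma box_bump_tendsto:
  assumes "x \<in> box a b"
  shows "(\<lambda>k. box_bump a b k x) \<longlonglongrightarrow> 1"
proof -
  have "(\<lambda>k. flat 0 (real k * y)) \<longlonglongrightarrow> 1" if y: "0 < y" for y
  proof (rule Lim_transform_eventually)
    have "(\<lambda>k. exp (- (1 / y * (1 / real k)))) \<longlonglongrightarrow> exp (- (1 / y * 0))"
      by (intro tendsto_intros lim_1_over_n)
    then show "(\<lambda>k. exp (- (1 / y * (1 / real k)))) \<longlonglongrightarrow> 1" by simp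
    show "eventually (\<lambda>k. exp (- (1 / y * (1 / real k))) = flat 0 (real k * y)) sequentially"
      using y by (intro eventually_sequentiallyI[of 1]) (auto simp: flat_def field_simps)
  qed
  then have "(\<lambda>k. box_bump a b k x) \<longlonglongrightarrow> (\<Prod>i\<in>(Basis :: 'a set). 1)"
    unfolding box_bump_def using assms by (intro tendsto_prod) (auto simp: mem_box)
  then show ?thesis by simp
qed

lemma test_function_box_bump:
  assumes "\<And>i. i \<in> Basis \<Longrightarrow> a \<bullet> i \<le> b \<bullet> i" "cbox a b \<subseteq> S"
  shows "test_function S (box_bump a b k)"
proof (rule test_functionI[OF _ compact_cbox assms(2)])
  show "Ck j (box_bump a b k)" for j
    unfolding box_bump_def[abs_def] by (intro Ck_prod Ck_flat_comp Ck_cmult Ck_mult Ck_diff Ck_inner Ck_const) auto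
  show "box_bump a b k x = 0" if "x \<notin> cbox a b" for x
    using that box_subset_cbox[of a b] by (intro box_bump_eq_0 assms) auto
qed

text \<open>Open boxes form an intersection-stable generator of the Borel sets, so vanishing
  integrals spread from boxes to all Borel sets, and a function whose integral over every set is 0
  vanishes almost everywhere. As f is zero outside one box, testing the boxes inside it is
  enough.\<close>

lemma box_integral_zero_imp_AE_zero:
  fixes f :: "'a::euclidean_space \<Rightarrow> real"
  assumes f: "integrable lborel f" and out: "\<And>x. x \<notin> box c d \<Longrightarrow> f x = 0"
    and box: "\<And>a b. box a b \<subseteq> box c d \<Longrightarrow> (LINT x:box a b|lborel. f x) = 0"
  shows "AE x in lborel. f x = 0"
proof (rule sigma_finite_measure.density_zero[OF sigma_finite_lborel f])
  note [measurable] = borel_measurable_integrable[OF f]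
  let ?G = "range (\<lambda>(a, b). box a b :: 'a set)"
  have si: "set_integrable lborel A f" if "A \<in> sets borel" for A
    using f that unfolding set_integrable_def by (intro integrable_mult_indicator) auto
  have gbox: "(LINT x:box a b|lborel. f x) = 0" for a b
  proof -
    obtain p q where pq: "box a b \<inter> box c d = box p q" using box_Int_box[of a b c d] by blast
    have "(LINT x:box a b|lborel. f x) = (LINT x:box p q|lborel. f x)"
      unfolding pq[symmetric] set_lebesgue_integral_def
      by (intro Bochner_Integration.integral_cong) (auto split: split_indicator simp: out)
    then show ?thesis using box[of p q] pq by auto
  qed
  have all: "(LINT x|lborel. f x) = 0"
  proof -
    have "(LINT x|lborel. f x) = (LINT x:box c d|lborel. f x)"
      unfolding set_lebesgue_integral_def
      by (intro Bochner_Integration.integral_cong) (auto split: split_indicator simp: out)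
    then show ?thesis by (simp add: gbox)
  qed
  fix A :: "'a set" assume "A \<in> sets lborel"
  then have A: "A \<in> sigma_sets UNIV ?G" by (simp add: borel_eq_box sets_measure_of)
  have "Int_stable ?G" by (auto simp: Int_stable_def box_Int_box)
  moreover have "?G \<subseteq> Pow UNIV" by auto
  moreover note A
  ultimately show "(LINT x:A|lborel. f x) = 0"
  proof (induction rule: sigma_sets_induct_disjoint)
    case (basic A)
    then show ?case using gbox by auto
  next
    case empty
    then show ?case by (simp add: set_lebesgue_integral_def)
  next
    case (compl A)
    then have A: "A \<in> sets borel" by (simp add: borel_eq_box sets_measure_of)
    have "(LINT x:UNIV - A|lborel. f x) = (LINT x|lborel. f x - indicator A x *\<^sub>R f x)"
      unfolding set_lebesgue_integral_def by (intro Bochner_Integration.integral_cong) (auto split: split_indicator)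
    also have "\<dots> = 0"
      using si[OF A] f compl.IH all unfolding set_integrable_def set_lebesgue_integral_def
      by (subst Bochner_Integration.integral_diff) auto
    finally show ?case .
  next
    case (union A)
    then have A: "A i \<in> sets borel" for i by (simp add: borel_eq_box sets_measure_of) blast
    have "(LINT x:(\<Union>i. A i)|lborel. f x) = (\<Sum>i. (LINT x:(A i)|lborel. f x))"
      using union(1) A si by (intro lebesgue_integral_countable_add) (auto simp: disjoint_family_on_def)
    then show ?case by (simp add: union.IH)
  qed
qed

lemma test_function_borel_measurable: "test_function S \<phi> \<Longrightarrow> \<phi> \<in> borel_measurable borel"
  by (auto simp: test_function_def intro!: borel_measurable_continuous_onI Ck_continuous[of 0] simp del: Ck.simps)

lemma test_function_bounded:
  assumes "test_function S \<phi>"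
  obtains B where "0 < B" "\<And>x. \<bar>\<phi> x\<bar> \<le> B"
proof -
  let ?K = "closure {x. \<phi> x \<noteq> 0}"
  have K: "compact ?K" using assms by (simp add: test_function_def)
  have c: "continuous_on UNIV \<phi>" using assms Ck_continuous[of 0] by (auto simp: test_function_def simp del: Ck.simps)
  then have "compact (\<phi> ` ?K)" using K by (intro compact_continuous_image) (auto intro: continuous_on_subset)
  then obtain B where B: "0 < B" "\<forall>y\<in>\<phi> ` ?K. norm y \<le> B"
    using compact_imp_bounded bounded_pos by metis
  have "\<bar>\<phi> x\<bar> \<le> B" for x
  proof (cases "\<phi> x = 0")
    case False
    then have "x \<in> ?K" by (auto intro: closure_subset[THEN subsetD])
    then show ?thesis using B by auto
  qed (use B in auto)
  then show ?thesis using B that by blast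
qed

text \<open>v is integrable only on compact sets, but the support of the test function is one, and
  the test function is bounded.\<close>

lemma integrable_test_function_mult:
  assumes S: "open S" and \<phi>: "test_function S \<phi>" and v: "locally_integrable S v"
  shows "integrable (lebesgue_on S) (\<lambda>x. \<phi> x *\<^sub>R v x)"
proof -
  let ?K = "closure {x. \<phi> x \<noteq> 0}"
  have K: "compact ?K" "?K \<subseteq> S" using \<phi> by (auto simp: test_function_def)
  have "integrable (lebesgue_on ?K) v" using v K by (auto simp: locally_integrable_def)
  then have iv: "integrable lebesgue (\<lambda>x. indicator ?K x *\<^sub>R v x)"
    using K by (subst (asm) integrable_restrict_space) (auto intro!: lmeasurable_compact fmeasurableD)
  obtain B where B: "0 < B" "\<And>x. \<bar>\<phi> x\<bar> \<le> B" using test_function_bounded[OF \<phi>] by metis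
  have m: "\<phi> \<in> borel_measurable lebesgue" using test_function_borel_measurable[OF \<phi>]
    by (simp add: measurable_completion)
  have "integrable lebesgue (\<lambda>x. \<phi> x *\<^sub>R (indicator ?K x *\<^sub>R v x))"
  proof (rule Bochner_Integration.integrable_bound)
    show "integrable lebesgue (\<lambda>x. B *\<^sub>R (indicator ?K x *\<^sub>R v x))" by (rule integrable_scaleR_right) (rule iv)
    show "(\<lambda>x. \<phi> x *\<^sub>R (indicator ?K x *\<^sub>R v x)) \<in> borel_measurable lebesgue"
      using m borel_measurable_integrable[OF iv] by (rule borel_measurable_scaleR)
    show "AE x in lebesgue. norm (\<phi> x *\<^sub>R (indicator ?K x *\<^sub>R v x)) \<le> norm (B *\<^sub>R (indicator ?K x *\<^sub>R v x))"
      using B by (intro AE_I2) (auto simp: indicator_def intro!: mult_right_mono)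
  qed
  also have "(\<lambda>x. \<phi> x *\<^sub>R (indicator ?K x *\<^sub>R v x)) = (\<lambda>x. indicator S x *\<^sub>R (\<phi> x *\<^sub>R v x))"
  proof
    fix x
    show "\<phi> x *\<^sub>R (indicator ?K x *\<^sub>R v x) = indicator S x *\<^sub>R (\<phi> x *\<^sub>R v x)"
      using K(2) closure_subset[of "{x. \<phi> x \<noteq> 0}"] by (cases "\<phi> x = 0") (auto split: split_indicator)
  qed
  finally show ?thesis using S by (subst integrable_restrict_space) (auto simp: borel_open)
qed

text \<open>Inside a box with closure in S, bumps converging to the indicators of smaller boxes show
  that v has integral 0 over each of these. S is then covered by countably many such boxes.\<close>

theorem fundamental_lemma:
  fixes v :: "'a::euclidean_space \<Rightarrow> real"
  assumes S: "open S" and v: "locally_integrable S v"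
    and test: "\<And>\<phi>. test_function S \<phi> \<Longrightarrow> (\<integral>x. \<phi> x * v x \<partial>lebesgue_on S) = 0"
  shows "AE x in lebesgue_on S. v x = 0"
proof -
  have local: "AE x in lebesgue. x \<in> box c d \<longrightarrow> v x = 0" if cd: "cbox c d \<subseteq> S" for c d
  proof -
    have "integrable (lebesgue_on (cbox c d)) v" using v cd by (auto simp: locally_integrable_def)
    then have iv: "integrable lebesgue (\<lambda>x. indicator (cbox c d) x *\<^sub>R v x)"
      by (subst (asm) integrable_restrict_space) auto
    then have "(\<lambda>x. indicator (cbox c d) x *\<^sub>R v x) \<in> borel_measurable (completion lborel)" by auto
    from completion_ex_borel_measurable_real[OF this]
    \<comment> \<open>The box criterion is about \<open>lborel\<close>, while v is only Lebesgue
      measurable; g is a Borel representative.\<close>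
    obtain g where g[measurable]: "g \<in> borel_measurable borel" and gv: "AE x in lborel. indicator (cbox c d) x *\<^sub>R v x = g x"
      by auto
    have gv': "AE x in lebesgue. indicator (cbox c d) x *\<^sub>R v x = g x" using gv by (rule AE_completion)
    have ig: "integrable lborel g"
    proof -
      have "integrable lebesgue g"
        using iv by (rule integrable_cong_AE_imp) (use gv' in \<open>auto intro: measurable_completion\<close>)
      then show ?thesis by (subst (asm) integrable_completion) auto
    qed
    have "AE x in lborel. indicator (box c d) x * g x = 0"
    proof (rule box_integral_zero_imp_AE_zero[where c=c and d=d])
      show "integrable lborel (\<lambda>x. indicator (box c d) x * g x)"
        using integrable_mult_indicator[OF _ ig, of "box c d"] by simp
      fix a b :: 'a assume ab: "box a b \<subseteq> box c d"
      show "(LINT x:box a b|lborel. indicator (box c d) x * g x) = 0"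
      proof (cases "box a b = {}")
        case True
        then show ?thesis by (simp add: set_lebesgue_integral_def)
      next
        case False
        then have le: "\<And>i. i \<in> Basis \<Longrightarrow> a \<bullet> i \<le> b \<bullet> i" by (auto simp: box_ne_empty intro: less_imp_le)
        have sub: "cbox a b \<subseteq> cbox c d"
        proof -
          have "closure (box a b) \<subseteq> closure (box c d)" using ab by (rule closure_mono)
          moreover have "box c d \<noteq> {}" using False ab by auto
          ultimately show ?thesis using False by (simp add: closure_box)
        qed
        have "(LINT x|lborel. box_bump a b k x * g x) = 0" for k
        proof -
          have t: "test_function S (box_bump a b k)" by (rule test_function_box_bump[OF le]) (use sub cd in auto)
          have mb[measurable]: "box_bump a b k \<in> borel_measurable borel" using test_function_borel_measurable[OF t] .
          have "(LINT x|lborel. box_bump a b k x * g x) = (LINT x|lebesgue. box_bump a b k x * g x)"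
            by (rule integral_completion[symmetric]) measurable
          also have "\<dots> = (LINT x|lebesgue. indicator S x *\<^sub>R (box_bump a b k x * v x))"
          proof (rule integral_cong_AE)
            have "integrable (lebesgue_on S) (\<lambda>x. box_bump a b k x *\<^sub>R v x)"
              by (rule integrable_test_function_mult[OF S t v])
            then have "integrable lebesgue (\<lambda>x. indicator S x *\<^sub>R (box_bump a b k x *\<^sub>R v x))"
              using S by (subst (asm) integrable_restrict_space) (auto simp: borel_open)
            then show "(\<lambda>x. indicator S x *\<^sub>R (box_bump a b k x * v x)) \<in> borel_measurable lebesgue" by auto
            show "AE x in lebesgue. box_bump a b k x * g x = indicator S x *\<^sub>R (box_bump a b k x * v x)"
              using gv'
            proof eventually_elim
              case (elim x)
              show ?case
              proof (cases "x \<in> box a b")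
                case True
                then have "x \<in> cbox c d" using ab box_subset_cbox[of c d] by blast
                then show ?thesis using elim cd by (auto simp: indicator_def)
              next
                case False
                then show ?thesis by (simp add: box_bump_eq_0[OF le])
              qed
            qed
          qed (auto intro: measurable_completion)
          also have "\<dots> = (\<integral>x. box_bump a b k x * v x \<partial>lebesgue_on S)"
            using S by (subst integral_restrict_space) (auto simp: borel_open)
          also have "\<dots> = 0" by (rule test[OF t])
          finally show ?thesis .
        qed
        moreover have "(\<lambda>k. LINT x|lborel. box_bump a b k x * g x) \<longlonglongrightarrow> (LINT x|lborel. indicator (box a b) x * g x)"
        proof (rule integral_dominated_convergence[where w="\<lambda>x. \<bar>g x\<bar>"])
          show "AE x in lborel. (\<lambda>k. box_bump a b k x * g x) \<longlonglongrightarrow> indicator (box a b) x * g x"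
          proof (rule AE_I2)
            fix x
            show "(\<lambda>k. box_bump a b k x * g x) \<longlonglongrightarrow> indicator (box a b) x * g x"
              using tendsto_mult_right[OF box_bump_tendsto, of x a b "g x"]
              by (cases "x \<in> box a b") (auto simp: box_bump_eq_0[OF le])
          qed
          have [measurable]: "box_bump a b k \<in> borel_measurable borel" for k
            using test_function_borel_measurable[OF test_function_box_bump[OF le subset_UNIV]] .
          show "(\<lambda>x. box_bump a b k x * g x) \<in> borel_measurable lborel" for k by measurable
          show "AE x in lborel. norm (box_bump a b k x * g x) \<le> \<bar>g x\<bar>" for k
            using box_bump_bounds[of a b k] by (intro AE_I2) (auto simp: abs_mult mult_left_le_one_le)
        qed (use ig in auto)
        ultimately have "(LINT x|lborel. indicator (box a b) x * g x) = 0"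
          by (simp add: LIMSEQ_const_iff)
        then show ?thesis unfolding set_lebesgue_integral_def
          using ab by (subst Bochner_Integration.integral_cong[OF refl, of _ _ "\<lambda>x. indicator (box a b) x * g x"]) (auto split: split_indicator)
      qed
    qed (auto simp: indicator_def)
    then have "AE x in lborel. x \<in> box c d \<longrightarrow> indicator (cbox c d) x *\<^sub>R v x = 0"
      using gv by eventually_elim (auto simp: indicator_def)
    then have "AE x in lborel. x \<in> box c d \<longrightarrow> v x = 0"
      by (rule eventually_mono) (use box_subset_cbox[of c d] in \<open>auto simp: indicator_def split: if_splits\<close>)
    then show ?thesis by (rule AE_completion)
  qed
  obtain \<D> :: "'a set set" where \<D>: "countable \<D>" "\<And>X. X \<in> \<D> \<Longrightarrow> \<exists>a b. X = box a b \<and> cbox a b \<subseteq> S" "S \<subseteq> \<Union>\<D>"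
  proof -
    \<comment> \<open>The local statements come with one null set per box, so the cover has to be
      countable.\<close>
    obtain \<B>' where "\<B>' \<subseteq> {box a b |a b. cbox a b \<subseteq> S}" "countable \<B>'" "\<Union>\<B>' = \<Union>{box a b |a b. cbox a b \<subseteq> S}"
      by (rule Lindelof[of "{box a b |a b. cbox a b \<subseteq> S}"]) auto
    moreover have "S \<subseteq> \<Union>{box a b |a b. cbox a b \<subseteq> S}"
    proof
      fix x assume "x \<in> S"
      then obtain a b where "cbox a b \<subseteq> S" "x \<in> box a b" using open_contains_cbox[OF S] by metis
      then show "x \<in> \<Union>{box a b |a b. cbox a b \<subseteq> S}" by blast
    qed
    ultimately show ?thesis by (intro that[of \<B>']) auto
  qed
  have "AE x in lebesgue. \<forall>X\<in>\<D>. x \<in> X \<longrightarrow> v x = 0"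
  proof (subst AE_ball_countable[OF \<D>(1)], rule ballI)
    fix X assume "X \<in> \<D>"
    then obtain a b where "X = box a b" "cbox a b \<subseteq> S" using \<D>(2) by blast
    then show "AE x in lebesgue. x \<in> X \<longrightarrow> v x = 0" using local[of a b] by simp
  qed
  then have "AE x in lebesgue. x \<in> S \<longrightarrow> v x = 0"
    by (rule eventually_mono) (use \<D>(3) in blast)
  then show ?thesis using S by (subst AE_restrict_space_iff) (auto simp: borel_open)
qed

lemma locally_integrable_component:
  fixes v :: "real^'n \<Rightarrow> real^'n"
  assumes "locally_integrable S v"
  shows "locally_integrable S (\<lambda>x. v x $ i)"
  using assms unfolding locally_integrable_def
  by (auto intro!: integrable_bounded_linear[OF bounded_linear_vec_nth])

text \<open>Makes the arbitrary choice in \<open>weak_grad\<close> harmless: whatever representative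
  it returns agrees almost everywhere with a gradient found otherwise.\<close>

theorem weak_grad_unique:
  assumes S: "open S" and v: "has_weak_grad S u v" and w: "has_weak_grad S u w"
  shows "AE x in lebesgue_on S. v x = w x"
proof -
  have "AE x in lebesgue_on S. v x $ i - w x $ i = 0" for i
  proof (rule fundamental_lemma[OF S])
    have li: "locally_integrable S (\<lambda>x. v x $ i)" "locally_integrable S (\<lambda>x. w x $ i)"
      using v w by (auto simp: has_weak_grad_def intro: locally_integrable_component)
    then show "locally_integrable S (\<lambda>x. v x $ i - w x $ i)"
      by (auto simp: locally_integrable_def)
    fix \<phi> assume \<phi>: "test_function S \<phi>"
    have "integrable (lebesgue_on S) (\<lambda>x. \<phi> x * v x $ i)" "integrable (lebesgue_on S) (\<lambda>x. \<phi> x * w x $ i)"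
      using integrable_test_function_mult[OF S \<phi>] li by fastforce+
    then have "(\<integral>x. \<phi> x * (v x $ i - w x $ i) \<partial>lebesgue_on S)
      = (\<integral>x. v x $ i * \<phi> x \<partial>lebesgue_on S) - (\<integral>x. w x $ i * \<phi> x \<partial>lebesgue_on S)"
      by (simp add: right_diff_distrib mult.commute)
    also have "\<dots> = 0" using v w \<phi> unfolding has_weak_grad_def by (metis (no_types, lifting) add.inverse_inverse cancel_comm_monoid_add_class.diff_cancel)
    finally show "(\<integral>x. \<phi> x * (v x $ i - w x $ i) \<partial>lebesgue_on S) = 0" .
  qed
  then have "AE x in lebesgue_on S. \<forall>i. v x $ i - w x $ i = 0" by (simp add: AE_all_countable)
  then show ?thesis by (rule eventually_mono) (simp add: vec_eq_iff)
qed

section \<open>Integration by parts and translation estimates\<close>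

definition smooth :: "('a::euclidean_space \<Rightarrow> real) \<Rightarrow> bool" where
  "smooth \<phi> \<longleftrightarrow> (\<forall>k. Ck k \<phi>)"

lemma smooth_test_function: "test_function S \<phi> \<Longrightarrow> smooth \<phi>"
  by (simp add: smooth_def test_function_def)

lemma smooth_mult: "smooth f \<Longrightarrow> smooth g \<Longrightarrow> smooth (\<lambda>x. f x * g x)"
  by (simp add: smooth_def Ck_mult)

lemma smooth_diff: "smooth f \<Longrightarrow> smooth g \<Longrightarrow> smooth (\<lambda>x. f x - g x)"
  by (simp add: smooth_def Ck_diff)

lemma smooth_const [simp]: "smooth (\<lambda>x. c)"
  by (simp add: smooth_def)

lemma smooth_continuous: "smooth f \<Longrightarrow> continuous_on S f"
  using Ck_continuous[of 0 f] by (auto simp: smooth_def intro: continuous_on_subset simp del: Ck.simps)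

lemma smooth_measurable: "smooth f \<Longrightarrow> f \<in> borel_measurable borel"
  by (rule borel_measurable_continuous_onI) (rule smooth_continuous)

lemma smooth_has_derivative:
  fixes \<phi> :: "real^'n \<Rightarrow> real"
  assumes "smooth \<phi>"
  shows "(\<phi> has_derivative (\<lambda>h. grad \<phi> x \<bullet> h)) (at x)"
proof -
  have "\<phi> differentiable (at x)" using assms by (auto simp: smooth_def dest!: spec[of _ 1])
  then have d: "(\<phi> has_derivative frechet_derivative \<phi> (at x)) (at x)" by (simp add: frechet_derivative_works)
  then interpret l: linear "frechet_derivative \<phi> (at x)" by (rule has_derivative_linear)
  have "frechet_derivative \<phi> (at x) h = grad \<phi> x \<bullet> h" for h
  proof -
    have "frechet_derivative \<phi> (at x) h = frechet_derivative \<phi> (at x) (\<Sum>i\<in>UNIV. h $ i *\<^sub>R axis i 1)"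
      using basis_expansion[of h] by (simp add: scalar_mult_eq_scaleR)
    also have "\<dots> = (\<Sum>i\<in>UNIV. h $ i * frechet_derivative \<phi> (at x) (axis i 1))"
      by (simp add: l.sum l.scaleR)
    also have "\<dots> = grad \<phi> x \<bullet> h" by (simp add: grad_def inner_vec_def mult.commute)
    finally show ?thesis .
  qed
  then have "frechet_derivative \<phi> (at x) = (\<lambda>h. grad \<phi> x \<bullet> h)" by (rule ext)
  then show ?thesis using d by simp
qed

lemma grad_eqI:
  assumes "(\<phi> has_derivative (\<lambda>h. w \<bullet> h)) (at x)"
  shows "grad \<phi> x = w"
proof -
  have "frechet_derivative \<phi> (at x) h = w \<bullet> h" for h
    using has_derivative_imp_frechet_eq[OF assms] .
  then show ?thesis by (simp add: grad_def vec_eq_iff inner_axis)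
qed

lemma smooth_grad_component: "smooth \<phi> \<Longrightarrow> smooth (\<lambda>x. grad \<phi> x $ i)"
  unfolding smooth_def grad_def
proof
  fix k assume "\<forall>k. Ck k \<phi>"
  then have "Ck (Suc k) \<phi>" by blast
  then show "Ck k (\<lambda>x. (\<chi> i. frechet_derivative \<phi> (at x) (axis i 1)) $ i)" by simp
qed

lemma grad_continuous:
  assumes "smooth \<phi>"
  shows "continuous_on S (grad \<phi>)"
proof -
  have "continuous_on S (\<lambda>x. \<chi> i. grad \<phi> x $ i)"
    by (intro continuous_on_vec_lambda smooth_continuous smooth_grad_component assms)
  then show ?thesis by (simp add: vec_lambda_eta)
qed

lemma grad_measurable: "smooth \<phi> \<Longrightarrow> grad \<phi> \<in> borel_measurable borel"
  by (rule borel_measurable_continuous_onI) (rule grad_continuous)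

lemma grad_mult:
  assumes "smooth f" "smooth g"
  shows "grad (\<lambda>x. f x * g x) x = f x *\<^sub>R grad g x + g x *\<^sub>R grad f x"
  by (rule grad_eqI)
    (auto intro!: derivative_eq_intros smooth_has_derivative assms simp: inner_add_left algebra_simps)

lemma grad_diff_const:
  assumes "smooth f"
  shows "grad (\<lambda>x. f x - c) x = grad f x"
  by (rule grad_eqI) (auto intro!: derivative_eq_intros smooth_has_derivative assms)

lemma grad_eq_0:
  assumes "x \<notin> closure {x. \<phi> x \<noteq> 0}"
  shows "grad \<phi> x = 0"
proof (rule grad_eqI)
  have "((\<lambda>x. 0) has_derivative (\<lambda>h. 0)) (at x)" by simp
  then have "(\<phi> has_derivative (\<lambda>h. 0)) (at x)"
  proof (rule has_derivative_transform_within_open)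
    show "open (- closure {x. \<phi> x \<noteq> 0})" by auto
    show "0 = \<phi> y" if "y \<in> - closure {x. \<phi> x \<noteq> 0}" for y
      using that closure_subset[of "{x. \<phi> x \<noteq> 0}"] by auto
  qed (use assms in auto)
  then show "(\<phi> has_derivative (\<lambda>h. 0 \<bullet> h)) (at x)" by simp
qed

lemma test_function_outside:
  assumes "test_function S \<phi>" "x \<notin> S"
  shows "\<phi> x = 0" "grad \<phi> x = 0"
  using assms closure_subset[of "{x. \<phi> x \<noteq> 0}"] grad_eq_0[of x \<phi>] by (auto simp: test_function_def)

lemma test_function_grad_component:
  assumes "test_function S \<phi>"
  shows "test_function S (\<lambda>x. grad \<phi> x $ i)"
proof (rule test_functionI[where K="closure {x. \<phi> x \<noteq> 0}"])
  show "Ck k (\<lambda>x. grad \<phi> x $ i)" for k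
    using smooth_grad_component[OF smooth_test_function[OF assms]] by (simp add: smooth_def)
qed (use assms in \<open>auto simp: test_function_def grad_eq_0\<close>)

lemma bounded_on_compact_support:
  fixes f :: "'a::euclidean_space \<Rightarrow> 'b::real_normed_vector"
  assumes c: "continuous_on UNIV f" and K: "compact K" and out: "\<And>x. x \<notin> K \<Longrightarrow> f x = 0"
  obtains B where "0 < B" "\<And>x. norm (f x) \<le> B"
proof -
  have "compact (f ` K)" using c K by (intro compact_continuous_image) (auto intro: continuous_on_subset)
  then obtain B where B: "0 < B" "\<forall>y\<in>f ` K. norm y \<le> B"
    using compact_imp_bounded bounded_pos by metis
  have "norm (f x) \<le> B" for x using B out[of x] by (cases "x \<in> K") auto
  then show ?thesis using B that by blast
qed

lemma integrable_compact_support: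
  fixes f :: "'a::euclidean_space \<Rightarrow> 'b::{banach, second_countable_topology}"
  assumes c: "continuous_on UNIV f" and K: "compact K" and out: "\<And>x. x \<notin> K \<Longrightarrow> f x = 0"
  shows "integrable lborel f"
proof -
  obtain B where B: "0 < B" "\<And>x. norm (f x) \<le> B" using bounded_on_compact_support[OF assms] by metis
  have "integrable lborel (\<lambda>x. B * indicator K x)"
    using K emeasure_compact_finite[OF K] by (intro integrable_mult_right integrable_real_indicator) (auto simp: borel_compact)
  then show ?thesis
  proof (rule Bochner_Integration.integrable_bound)
    show "f \<in> borel_measurable lborel" using borel_measurable_continuous_onI[OF c] by simp
    show "AE x in lborel. norm (f x) \<le> norm (B * indicator K x)"
      using B out by (intro AE_I2) (auto simp: indicator_def)
  qed
qed

lemma test_function_integrable: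
  fixes \<phi> :: "real^'n \<Rightarrow> real"
  assumes "test_function S \<phi>"
  shows "integrable lborel \<phi>" "integrable lborel (\<lambda>x. (\<phi> x)\<^sup>2)"
    "integrable lborel (\<lambda>x. norm (grad \<phi> x))" "integrable lborel (\<lambda>x. (norm (grad \<phi> x))\<^sup>2)"
    "integrable lborel (\<lambda>x. grad \<phi> x $ i)"
proof -
  let ?K = "closure {x. \<phi> x \<noteq> 0}"
  have K: "compact ?K" using assms by (simp add: test_function_def)
  have s: "smooth \<phi>" by (rule smooth_test_function[OF assms])
  have o: "\<phi> x = 0" if "x \<notin> ?K" for x using that closure_subset[of "{x. \<phi> x \<noteq> 0}"] by auto
  have I: "integrable lborel f" if "continuous_on UNIV f" "\<And>x. x \<notin> ?K \<Longrightarrow> f x = 0" for f :: "real^'n \<Rightarrow> real"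
    by (rule integrable_compact_support[OF that(1) K that(2)])
  have g: "continuous_on UNIV (grad \<phi>)" by (rule grad_continuous[OF s])
  have z: "grad \<phi> x = 0" if "x \<notin> ?K" for x by (rule grad_eq_0[OF that])
  show "integrable lborel \<phi>" by (rule I[OF smooth_continuous[OF s] o])
  show "integrable lborel (\<lambda>x. (\<phi> x)\<^sup>2)"
  proof (rule I)
    show "(\<phi> x)\<^sup>2 = 0" if "x \<notin> ?K" for x using o[OF that] by simp
  qed (intro continuous_intros smooth_continuous[OF s])
  show "integrable lborel (\<lambda>x. norm (grad \<phi> x))"
  proof (rule I)
    show "norm (grad \<phi> x) = 0" if "x \<notin> ?K" for x using z[OF that] by simp
  qed (intro continuous_intros g)
  show "integrable lborel (\<lambda>x. (norm (grad \<phi> x))\<^sup>2)"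
  proof (rule I)
    show "(norm (grad \<phi> x))\<^sup>2 = 0" if "x \<notin> ?K" for x using z[OF that] by simp
  qed (intro continuous_intros g)
  show "integrable lborel (\<lambda>x. grad \<phi> x $ i)"
  proof (rule I[OF smooth_continuous[OF smooth_grad_component[OF s]]])
    show "grad \<phi> x $ i = 0" if "x \<notin> ?K" for x using z[OF that] by simp
  qed
qed

lemma lborel_integral_translate:
  fixes f :: "'a::euclidean_space \<Rightarrow> real"
  assumes "integrable lborel f"
  shows "integrable lborel (\<lambda>x. f (a + x))" "(LINT x|lborel. f (a + x)) = (LINT x|lborel. f x)"
proof -
  have m: "f \<in> borel_measurable borel" using borel_measurable_integrable[OF assms] by simp
  have "integrable (distr lborel borel ((+) a)) f" using assms by (simp only: lborel_distr_plus)
  then show "integrable lborel (\<lambda>x. f (a + x))" using m by (subst (asm) integrable_distr_eq) auto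
  have "(LINT x|lborel. f x) = (LINT x|distr lborel borel ((+) a). f x)" by (simp only: lborel_distr_plus)
  also have "\<dots> = (LINT x|lborel. f (a + x))" using m by (subst integral_distr) auto
  finally show "(LINT x|lborel. f (a + x)) = (LINT x|lborel. f x)" by simp
qed

text \<open>A difference quotient has integral 0 by translation invariance, and the quotients
  converge to the partial derivative, dominated because \<phi> is Lipschitz with compact
  support.\<close>

lemma integral_grad_eq_0:
  fixes \<phi> :: "real^'n \<Rightarrow> real"
  assumes \<phi>: "test_function UNIV \<phi>"
  shows "(LINT x|lborel. grad \<phi> x $ i) = 0"
proof -
  let ?K = "closure {x. \<phi> x \<noteq> 0}" and ?e = "axis i 1 :: real^'n"
  have s: "smooth \<phi>" by (rule smooth_test_function[OF \<phi>])
  have K: "compact ?K" using \<phi> by (simp add: test_function_def)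
  have o: "\<phi> x = 0" if "x \<notin> ?K" for x using that closure_subset[of "{x. \<phi> x \<noteq> 0}"] by auto
  obtain L where L: "0 < L" "\<And>x. norm (grad \<phi> x) \<le> L"
    using bounded_on_compact_support[OF grad_continuous[OF s] K grad_eq_0] by metis
  have lip: "\<bar>\<phi> x - \<phi> y\<bar> \<le> L * norm (x - y)" for x y
  proof -
    have "norm (\<phi> x - \<phi> y) \<le> L * norm (x - y)"
    proof (rule differentiable_bound[OF convex_UNIV])
      show "(\<phi> has_derivative (\<lambda>h. grad \<phi> z \<bullet> h)) (at z within UNIV)" for z
        using smooth_has_derivative[OF s] by simp
      show "onorm (\<lambda>h. grad \<phi> z \<bullet> h) \<le> L" for z
        by (rule onorm_bound) (use L(1) order.trans[OF Cauchy_Schwarz_ineq2 mult_right_mono[OF L(2)]] in auto)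
    qed auto
    then show ?thesis by simp
  qed
  obtain \<rho> where \<rho>: "0 < \<rho>" "\<And>x. x \<in> ?K \<Longrightarrow> norm x \<le> \<rho>"
    using compact_imp_bounded[OF K] bounded_pos by metis
  define q where "q n x = (\<phi> ((1 / real (Suc n)) *\<^sub>R ?e + x) - \<phi> x) * real (Suc n)" for n x
  have m: "\<phi> \<in> borel_measurable borel" by (rule smooth_measurable[OF s])
  \<comment> \<open>The steps 1 / (n + 1) are at most 1, so all quotients vanish outside the ball of
    radius \<rho> + 1.\<close>
  have "(\<lambda>n. LINT x|lborel. q n x) \<longlonglongrightarrow> (LINT x|lborel. grad \<phi> x $ i)"
  proof (rule integral_dominated_convergence[where w="\<lambda>x. L * indicator (cball 0 (\<rho> + 1)) x"])
    show "integrable lborel (\<lambda>x. L * indicator (cball (0 :: real^'n) (\<rho> + 1)) x :: real)"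
      using emeasure_bounded_finite[of "cball (0 :: real^'n) (\<rho> + 1)"]
      by (intro integrable_mult_right integrable_real_indicator) auto
    show "(\<lambda>x. grad \<phi> x $ i) \<in> borel_measurable lborel"
      using smooth_measurable[OF smooth_grad_component[OF s]] by simp
    show "q n \<in> borel_measurable lborel" for n unfolding q_def using m by measurable
    show "AE x in lborel. (\<lambda>n. q n x) \<longlonglongrightarrow> grad \<phi> x $ i"
    proof (rule AE_I2)
      fix x
      have "((\<lambda>t. \<phi> (t *\<^sub>R ?e + x)) has_derivative (\<lambda>t. grad \<phi> (0 *\<^sub>R ?e + x) \<bullet> (t *\<^sub>R ?e))) (at 0)"
        by (rule has_derivative_compose[where g=\<phi> and f="\<lambda>t. t *\<^sub>R ?e + x"])
           (auto intro!: derivative_eq_intros smooth_has_derivative[OF s])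
      then have "((\<lambda>t. \<phi> (t *\<^sub>R ?e + x)) has_real_derivative grad \<phi> x $ i) (at 0)"
        by (simp add: has_field_derivative_def inner_axis mult_commute_abs)
      then have "((\<lambda>t. (\<phi> (t *\<^sub>R ?e + x) - \<phi> x) / t) \<longlongrightarrow> grad \<phi> x $ i) (at 0)"
        by (simp add: DERIV_def)
      moreover have "filterlim (\<lambda>n. 1 / real (Suc n)) (at 0) sequentially"
        unfolding filterlim_at using LIMSEQ_inverse_real_of_nat by (auto simp: inverse_eq_divide intro: always_eventually)
      ultimately have "(\<lambda>n. (\<phi> ((1 / real (Suc n)) *\<^sub>R ?e + x) - \<phi> x) / (1 / real (Suc n))) \<longlonglongrightarrow> grad \<phi> x $ i"
        by (rule filterlim_compose)
      then show "(\<lambda>n. q n x) \<longlonglongrightarrow> grad \<phi> x $ i" by (simp add: q_def)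
    qed
    show "AE x in lborel. norm (q n x) \<le> L * indicator (cball 0 (\<rho> + 1)) x" for n
    proof (rule AE_I2)
      fix x
      let ?t = "1 / real (Suc n)"
      have t: "0 < ?t" "?t \<le> 1" by auto
      show "norm (q n x) \<le> L * indicator (cball 0 (\<rho> + 1)) x"
      proof (cases "x \<in> cball 0 (\<rho> + 1)")
        case True
        have "\<bar>\<phi> (?t *\<^sub>R ?e + x) - \<phi> x\<bar> \<le> L * ?t" using lip[of "?t *\<^sub>R ?e + x" x] by simp
        then have "\<bar>\<phi> (?t *\<^sub>R ?e + x) - \<phi> x\<bar> * real (Suc n) \<le> L * ?t * real (Suc n)" by (rule mult_right_mono) simp
        then show ?thesis using True by (simp add: q_def abs_mult)
      next
        case False
        then have n: "\<rho> + 1 < norm x" by simp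
        have "norm x \<le> norm (?t *\<^sub>R ?e + x) + ?t"
          using norm_triangle_ineq4[of "?t *\<^sub>R ?e + x" "?t *\<^sub>R ?e"] by simp
        then have "norm x \<le> norm (?t *\<^sub>R ?e + x) + 1" using t(2) by linarith
        then have "\<rho> < norm (?t *\<^sub>R ?e + x)" using n by linarith
        then have "?t *\<^sub>R ?e + x \<notin> ?K" using \<rho>(2) not_le by blast
        moreover have "x \<notin> ?K" using n \<rho>(2)[of x] by force
        ultimately have "\<phi> (?t *\<^sub>R ?e + x) = 0" "\<phi> x = 0" by (auto intro!: o)
        then show ?thesis using False by (simp add: q_def)
      qed
    qed
  qed
  moreover have "(LINT x|lborel. q n x) = 0" for n
  proof -
    note t = lborel_integral_translate[OF test_function_integrable(1)[OF \<phi>], of "(1 / real (Suc n)) *\<^sub>R ?e"]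
    have "(LINT x|lborel. q n x) = (LINT x|lborel. \<phi> ((1 / real (Suc n)) *\<^sub>R ?e + x) - \<phi> x) * real (Suc n)"
      unfolding q_def by (rule integral_mult_left_zero)
    also have "(LINT x|lborel. \<phi> ((1 / real (Suc n)) *\<^sub>R ?e + x) - \<phi> x) = 0"
      by (subst Bochner_Integration.integral_diff[OF t(1) test_function_integrable(1)[OF \<phi>]]) (simp only: t(2) diff_self)
    finally show ?thesis by simp
  qed
  ultimately show ?thesis by (simp add: LIMSEQ_const_iff)
qed

text \<open>One factor with compact support is enough: the product then has compact support, and its
  gradient integrates to 0.\<close>

lemma integration_by_parts:
  fixes \<phi> \<psi> :: "real^'n \<Rightarrow> real"
  assumes \<phi>: "test_function UNIV \<phi>" and s: "smooth \<psi>"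
  shows "(LINT x|lborel. \<phi> x * grad \<psi> x $ i) = - (LINT x|lborel. grad \<phi> x $ i * \<psi> x)"
proof -
  have s\<phi>: "smooth \<phi>" by (rule smooth_test_function[OF \<phi>])
  have t1: "test_function UNIV (\<lambda>x. \<psi> x * \<phi> x)" by (rule test_function_mult[OF \<phi>]) (use s in \<open>simp add: smooth_def\<close>)
  have t2: "test_function UNIV (\<lambda>x. grad \<psi> x $ i * \<phi> x)"
    by (rule test_function_mult[OF \<phi>]) (use smooth_grad_component[OF s] in \<open>simp add: smooth_def\<close>)
  have t3: "test_function UNIV (\<lambda>x. \<psi> x * grad \<phi> x $ i)"
    by (rule test_function_mult[OF test_function_grad_component[OF \<phi>]]) (use s in \<open>simp add: smooth_def\<close>)
  have "0 = (LINT x|lborel. grad (\<lambda>x. \<psi> x * \<phi> x) x $ i)" by (rule integral_grad_eq_0[OF t1, symmetric])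
  also have "\<dots> = (LINT x|lborel. \<psi> x * grad \<phi> x $ i + grad \<psi> x $ i * \<phi> x)"
    by (intro Bochner_Integration.integral_cong) (simp_all add: grad_mult[OF s s\<phi>] mult.commute[of "\<phi> _"])
  also have "\<dots> = (LINT x|lborel. \<psi> x * grad \<phi> x $ i) + (LINT x|lborel. grad \<psi> x $ i * \<phi> x)"
    by (rule Bochner_Integration.integral_add) (use test_function_integrable(1) t2 t3 in auto)
  finally show ?thesis by (simp add: mult.commute)
qed

text \<open>The difference is the integral of the directional derivative along the segment from y to
  y + z. Jensen in the segment parameter t gives the power p; Tonelli and a translation by t z
  enlarge the ball by at most norm z.\<close>

lemma smooth_translation_estimate:
  fixes \<phi> :: "real^'n \<Rightarrow> real"
  assumes s: "smooth \<phi>" and p: "p = 1 \<or> p = 2" and \<rho>: "0 < \<rho>"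
  shows "(\<integral>\<^sup>+y\<in>ball x \<rho>. ennreal (\<bar>\<phi> (y + z) - \<phi> y\<bar> ^ p) \<partial>lborel)
    \<le> ennreal (norm z ^ p) * (\<integral>\<^sup>+y\<in>ball x (\<rho> + norm z). ennreal (norm (grad \<phi> y) ^ p) \<partial>lborel)"
proof -
  have [measurable]: "\<phi> \<in> borel_measurable borel" "grad \<phi> \<in> borel_measurable borel"
    using s by (auto intro: smooth_measurable grad_measurable)
  have pt: "ennreal (\<bar>\<phi> (y + z) - \<phi> y\<bar> ^ p)
     \<le> ennreal (norm z ^ p) * (\<integral>\<^sup>+t\<in>{0..1::real}. ennreal (norm (grad \<phi> (t *\<^sub>R z + y)) ^ p) \<partial>lborel)" for y
  proof -
    let ?f = "\<lambda>t. grad \<phi> (t *\<^sub>R z + y) \<bullet> z" and ?I = "{0..1::real}"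
    have cg: "continuous_on S (\<lambda>t. grad \<phi> (t *\<^sub>R z + y))" for S
      by (rule continuous_on_compose2[OF grad_continuous[OF s, of UNIV]]) (auto intro!: continuous_intros)
    have cf: "continuous_on S ?f" for S using cg by (intro continuous_intros)
    have si: "set_integrable lborel ?I g" if "continuous_on ?I g" for g :: "real \<Rightarrow> real"
      using borel_integrable_atLeastAtMost'[OF that] .
    have "((\<lambda>t. \<phi> (t *\<^sub>R z + y)) has_real_derivative ?f t) (at t)" for t
    proof -
      have "((\<lambda>t. \<phi> (t *\<^sub>R z + y)) has_derivative (\<lambda>h. grad \<phi> (t *\<^sub>R z + y) \<bullet> (h *\<^sub>R z))) (at t)"
        by (rule has_derivative_compose[where g=\<phi> and f="\<lambda>t. t *\<^sub>R z + y"])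
           (auto intro!: derivative_eq_intros smooth_has_derivative[OF s])
      then show ?thesis by (simp add: has_field_derivative_def mult_commute_abs)
    qed
    then have "(LINT t:?I|lborel. ?f t) = \<phi> (1 *\<^sub>R z + y) - \<phi> (0 *\<^sub>R z + y)"
      unfolding set_lebesgue_integral_def
      by (subst integral_FTC_Icc[where F="\<lambda>t. \<phi> (t *\<^sub>R z + y)"])
        (auto intro!: cf simp: has_real_derivative_iff_has_vector_derivative[symmetric] intro: has_field_derivative_at_within)
    then have FTC: "\<phi> (y + z) - \<phi> y = (LINT t:?I|lborel. ?f t)" by (simp add: add.commute)
    have v1: "vol ?I = 1" by simp
    have "\<bar>LINT t:?I|lborel. ?f t\<bar> ^ p \<le> (LINT t:?I|lborel. \<bar>?f t\<bar> ^ p)"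
      using p
    proof
      assume "p = 1"
      then show ?thesis using set_integral_norm_bound[OF si[OF cf]] by simp
    next
      assume "p = 2"
      moreover have "(mean ?I ?f)\<^sup>2 \<le> mean ?I (\<lambda>t. (?f t)\<^sup>2)"
        by (rule mean_square_le) (auto intro!: si cf continuous_intros cg)
      ultimately show ?thesis by (simp add: mean_def)
    qed
    also have "\<dots> \<le> (LINT t:?I|lborel. norm z ^ p * norm (grad \<phi> (t *\<^sub>R z + y)) ^ p)"
    proof (rule set_integral_mono)
      fix t
      have "\<bar>?f t\<bar> \<le> norm z * norm (grad \<phi> (t *\<^sub>R z + y))" using Cauchy_Schwarz_ineq2[of "grad \<phi> (t *\<^sub>R z + y)" z] by (simp add: mult.commute)
      from power_mono[OF this, of p] show "\<bar>?f t\<bar> ^ p \<le> norm z ^ p * norm (grad \<phi> (t *\<^sub>R z + y)) ^ p"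
        by (simp add: power_mult_distrib)
    qed (auto intro!: si cf continuous_intros cg)
    finally have "ennreal (\<bar>\<phi> (y + z) - \<phi> y\<bar> ^ p) \<le> ennreal (LINT t:?I|lborel. norm z ^ p * norm (grad \<phi> (t *\<^sub>R z + y)) ^ p)"
      unfolding FTC by (rule ennreal_leI)
    also have "\<dots> = ennreal (norm z ^ p * (LINT t:?I|lborel. norm (grad \<phi> (t *\<^sub>R z + y)) ^ p))" by simp
    also have "\<dots> = ennreal (norm z ^ p) * ennreal (LINT t:?I|lborel. norm (grad \<phi> (t *\<^sub>R z + y)) ^ p)"
      by (subst ennreal_mult') auto
    also have "ennreal (LINT t:?I|lborel. norm (grad \<phi> (t *\<^sub>R z + y)) ^ p) \<le> (\<integral>\<^sup>+t\<in>?I. ennreal (norm (grad \<phi> (t *\<^sub>R z + y)) ^ p) \<partial>lborel)"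
      using abs_set_integral_le[of ?I "\<lambda>t. norm (grad \<phi> (t *\<^sub>R z + y)) ^ p"] by (simp add: order.trans[OF ennreal_leI[OF abs_ge_self]])
    finally show ?thesis by (simp add: mult_left_mono)
  qed
  let ?J = "\<integral>\<^sup>+y\<in>ball x (\<rho> + norm z). ennreal (norm (grad \<phi> y) ^ p) \<partial>lborel"
  have "(\<integral>\<^sup>+y\<in>ball x \<rho>. ennreal (\<bar>\<phi> (y + z) - \<phi> y\<bar> ^ p) \<partial>lborel)
     \<le> (\<integral>\<^sup>+y. ennreal (norm z ^ p) * (\<integral>\<^sup>+t. ennreal (norm (grad \<phi> (t *\<^sub>R z + y)) ^ p) * indicator {0..1::real} t * indicator (ball x \<rho>) y \<partial>lborel) \<partial>lborel)"
    by (intro nn_integral_mono) (use pt in \<open>auto split: split_indicator\<close>)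
  also have "\<dots> = ennreal (norm z ^ p) * (\<integral>\<^sup>+y. (\<integral>\<^sup>+t. ennreal (norm (grad \<phi> (t *\<^sub>R z + y)) ^ p) * indicator {0..1::real} t * indicator (ball x \<rho>) y \<partial>lborel) \<partial>lborel)"
    by (rule nn_integral_cmult) measurable
  also have "(\<integral>\<^sup>+y. (\<integral>\<^sup>+t. ennreal (norm (grad \<phi> (t *\<^sub>R z + y)) ^ p) * indicator {0..1::real} t * indicator (ball x \<rho>) y \<partial>lborel) \<partial>lborel)
    = (\<integral>\<^sup>+t. (\<integral>\<^sup>+y. ennreal (norm (grad \<phi> (t *\<^sub>R z + y)) ^ p) * indicator {0..1::real} t * indicator (ball x \<rho>) y \<partial>lborel) \<partial>lborel)"
    by (rule lborel_pair.Fubini') measurable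
  also have "\<dots> \<le> (\<integral>\<^sup>+t. ?J * indicator {0..1::real} t \<partial>lborel)"
  proof (rule nn_integral_mono)
    fix t :: real
    show "(\<integral>\<^sup>+y. ennreal (norm (grad \<phi> (t *\<^sub>R z + y)) ^ p) * indicator {0..1::real} t * indicator (ball x \<rho>) y \<partial>lborel) \<le> ?J * indicator {0..1::real} t"
    proof (cases "t \<in> {0..1}")
      case True
      have "(\<integral>\<^sup>+y. ennreal (norm (grad \<phi> (t *\<^sub>R z + y)) ^ p) * indicator (ball x \<rho>) y \<partial>lborel)
        \<le> (\<integral>\<^sup>+y. ennreal (norm (grad \<phi> (t *\<^sub>R z + y)) ^ p) * indicator (ball x (\<rho> + norm z)) (t *\<^sub>R z + y) \<partial>lborel)"
      proof (rule nn_integral_mono)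
        fix y
        have "t *\<^sub>R z + y \<in> ball x (\<rho> + norm z)" if "y \<in> ball x \<rho>"
        proof -
          have "norm (t *\<^sub>R z) \<le> norm z" using True by (simp add: mult_left_le_one_le)
          moreover have "norm (x - (t *\<^sub>R z + y)) \<le> norm (x - y) + norm (t *\<^sub>R z)"
            using norm_triangle_ineq4[of "x - y" "t *\<^sub>R z"] by (simp add: algebra_simps)
          ultimately show ?thesis using that by (simp add: dist_norm)
        qed
        then show "ennreal (norm (grad \<phi> (t *\<^sub>R z + y)) ^ p) * indicator (ball x \<rho>) y
           \<le> ennreal (norm (grad \<phi> (t *\<^sub>R z + y)) ^ p) * indicator (ball x (\<rho> + norm z)) (t *\<^sub>R z + y)"
          by (auto split: split_indicator)
      qed
      also have "\<dots> = ?J"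
        by (rule nn_integral_translate[where f="\<lambda>w. ennreal (norm (grad \<phi> w) ^ p) * indicator (ball x (\<rho> + norm z)) w"]) measurable
      finally show ?thesis using True by simp
    qed simp
  qed
  also have "\<dots> = ?J" by (subst nn_integral_cmult_indicator) auto
  finally show ?thesis by (simp add: mult_left_mono)
qed

section \<open>Functions with zero trace\<close>

lemma borel_representative:
  fixes f :: "'a::euclidean_space \<Rightarrow> 'b::euclidean_space"
  assumes "f \<in> borel_measurable lebesgue"
  obtains g where "g \<in> borel_measurable borel" "AE x in lebesgue. f x = g x"
proof -
  have "\<exists>g\<in>borel_measurable borel. AE x in lborel. f x \<bullet> b = g x" for b
  proof -
    have "(\<lambda>x. f x \<bullet> b) \<in> borel_measurable (completion lborel)"
      using assms by (intro borel_measurable_inner) auto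
    from completion_ex_borel_measurable_real[OF this] show ?thesis by auto
  qed
  then obtain g where g: "\<And>b. g b \<in> borel_measurable borel" "\<And>b. AE x in lborel. f x \<bullet> b = g b x" by metis
  have "AE x in lborel. \<forall>b\<in>Basis. f x \<bullet> b = g b x" using g(2) by (intro AE_finite_allI) auto
  then have "AE x in lborel. f x = (\<Sum>b\<in>Basis. g b x *\<^sub>R b)"
    by (rule eventually_mono) (metis (mono_tags, lifting) euclidean_representation sum.cong)
  then have "AE x in lebesgue. f x = (\<Sum>b\<in>Basis. g b x *\<^sub>R b)" by (rule AE_completion)
  moreover have "(\<lambda>x. \<Sum>b\<in>Basis. g b x *\<^sub>R b) \<in> borel_measurable borel" using g(1) by measurable
  ultimately show ?thesis using that by blast
qed

lemma integrable_lebesgue_on_of_lborel: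
  fixes f :: "'a::euclidean_space \<Rightarrow> 'b::{banach, second_countable_topology}"
  assumes f: "integrable lborel f" and S: "S \<in> sets lebesgue"
  shows "integrable (lebesgue_on S) f"
proof -
  have "integrable lebesgue f" using f by (subst integrable_completion) (auto dest: borel_measurable_integrable)
  then show ?thesis using S by (subst integrable_restrict_space) (auto intro: integrable_mult_indicator)
qed

text \<open>The definitions integrate over \<open>lebesgue_on S\<close>, the estimates over
  \<open>lborel\<close> on the whole space. A Borel function that vanishes off S and agrees with f
  almost everywhere on S links the two; the same device transfers integrability and the
  \<open>Lp\<close> notions below.\<close>

lemma integral_lebesgue_on_eq_lborel:
  fixes f g :: "'a::euclidean_space \<Rightarrow> 'b::{banach, second_countable_topology}"
  assumes S: "S \<in> sets lebesgue" and g: "g \<in> borel_measurable borel"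
    and eq: "AE x in lebesgue. x \<in> S \<longrightarrow> f x = g x" and f: "f \<in> borel_measurable (lebesgue_on S)"
    and out: "\<And>x. x \<notin> S \<Longrightarrow> g x = 0"
  shows "(\<integral>x. f x \<partial>lebesgue_on S) = (LINT x|lborel. g x)"
proof -
  have mg: "g \<in> borel_measurable lebesgue" using g by (simp add: measurable_completion)
  have "(\<integral>x. f x \<partial>lebesgue_on S) = (LINT x|lebesgue. indicator S x *\<^sub>R f x)"
    using S by (subst integral_restrict_space) auto
  also have "\<dots> = (LINT x|lebesgue. g x)"
  proof (rule integral_cong_AE)
    show "(\<lambda>x. indicator S x *\<^sub>R f x) \<in> borel_measurable lebesgue"
      using f S by (subst (asm) borel_measurable_restrict_space_iff) auto
    show "AE x in lebesgue. indicator S x *\<^sub>R f x = g x"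
      using eq by (rule eventually_mono) (auto simp: indicator_def out)
  qed (rule mg)
  also have "\<dots> = (LINT x|lborel. g x)" by (rule integral_completion) (use g in simp)
  finally show ?thesis .
qed

lemma integrable_lebesgue_on_iff_lborel:
  fixes f g :: "'a::euclidean_space \<Rightarrow> 'b::{banach, second_countable_topology}"
  assumes S: "S \<in> sets lebesgue" and g: "g \<in> borel_measurable borel"
    and eq: "AE x in lebesgue. x \<in> S \<longrightarrow> f x = g x" and f: "f \<in> borel_measurable (lebesgue_on S)"
    and out: "\<And>x. x \<notin> S \<Longrightarrow> g x = 0"
  shows "integrable (lebesgue_on S) f \<longleftrightarrow> integrable lborel g"
proof -
  have mg: "g \<in> borel_measurable lebesgue" using g by (simp add: measurable_completion)
  have "integrable (lebesgue_on S) f \<longleftrightarrow> integrable lebesgue (\<lambda>x. indicator S x *\<^sub>R f x)"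
    using S by (subst integrable_restrict_space) auto
  also have "\<dots> \<longleftrightarrow> integrable lebesgue g"
  proof (rule integrable_cong_AE)
    show "(\<lambda>x. indicator S x *\<^sub>R f x) \<in> borel_measurable lebesgue"
      using f S by (subst (asm) borel_measurable_restrict_space_iff) auto
    show "AE x in lebesgue. indicator S x *\<^sub>R f x = g x"
      using eq by (rule eventually_mono) (auto simp: indicator_def out)
  qed (rule mg)
  also have "\<dots> \<longleftrightarrow> integrable lborel g" by (rule integrable_completion) (use g in simp)
  finally show ?thesis .
qed

lemma measurable_lebesgue_on_AE:
  fixes f g :: "'a::euclidean_space \<Rightarrow> 'b::euclidean_space"
  assumes S: "S \<in> sets lebesgue" and g: "g \<in> borel_measurable borel"
    and eq: "AE x in lebesgue. x \<in> S \<longrightarrow> f x = g x"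
  shows "f \<in> borel_measurable (lebesgue_on S)"
proof -
  have "(\<lambda>x. indicator S x *\<^sub>R g x) \<in> borel_measurable lebesgue"
    using g S by (intro borel_measurable_scaleR borel_measurable_indicator) (auto simp: measurable_completion)
  moreover have "AE x in lebesgue. indicator S x *\<^sub>R g x = indicator S x *\<^sub>R f x"
    using eq by (rule eventually_mono) (auto simp: indicator_def)
  ultimately have "(\<lambda>x. indicator S x *\<^sub>R f x) \<in> borel_measurable lebesgue"
    by (rule borel_measurable_AE)
  then show ?thesis using S by (subst borel_measurable_restrict_space_iff) auto
qed

lemma square_integrable_add:
  fixes f g :: "'a \<Rightarrow> 'b::{real_normed_vector, second_countable_topology}"
  assumes [measurable]: "f \<in> borel_measurable M" "g \<in> borel_measurable M"
    and i: "integrable M (\<lambda>x. (norm (f x))\<^sup>2)" "integrable M (\<lambda>x. (norm (g x))\<^sup>2)"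
  shows "integrable M (\<lambda>x. (norm (f x + g x))\<^sup>2)"
    "(LINT x|M. (norm (f x + g x))\<^sup>2) \<le> 2 * (LINT x|M. (norm (f x))\<^sup>2) + 2 * (LINT x|M. (norm (g x))\<^sup>2)"
proof -
  have le: "(norm (f x + g x))\<^sup>2 \<le> 2 * (norm (f x))\<^sup>2 + 2 * (norm (g x))\<^sup>2" for x
  proof -
    have "(norm (f x + g x))\<^sup>2 \<le> (norm (f x) + norm (g x))\<^sup>2" by (intro power_mono norm_triangle_ineq) auto
    also have "\<dots> \<le> 2 * (norm (f x))\<^sup>2 + 2 * (norm (g x))\<^sup>2"
      using sum_squares_bound[of "norm (f x)" "norm (g x)"] by (simp add: power2_sum)
    finally show ?thesis .
  qed
  have i2: "integrable M (\<lambda>x. 2 * (norm (f x))\<^sup>2 + 2 * (norm (g x))\<^sup>2)" using i by auto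
  show int: "integrable M (\<lambda>x. (norm (f x + g x))\<^sup>2)"
    by (rule Bochner_Integration.integrable_bound[OF i2]) (use le in auto)
  have "(LINT x|M. (norm (f x + g x))\<^sup>2) \<le> (LINT x|M. 2 * (norm (f x))\<^sup>2 + 2 * (norm (g x))\<^sup>2)"
    by (rule integral_mono[OF int i2 le])
  then show "(LINT x|M. (norm (f x + g x))\<^sup>2) \<le> 2 * (LINT x|M. (norm (f x))\<^sup>2) + 2 * (LINT x|M. (norm (g x))\<^sup>2)"
    using i by simp
qed

lemma square_integrable_mult_bounded:
  fixes f :: "'a \<Rightarrow> real" and g :: "'a \<Rightarrow> 'b::{real_normed_vector, second_countable_topology}"
  assumes [measurable]: "f \<in> borel_measurable M" "g \<in> borel_measurable M"
    and B: "\<And>x. \<bar>f x\<bar> \<le> B" and i: "integrable M (\<lambda>x. (norm (g x))\<^sup>2)"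
  shows "integrable M (\<lambda>x. (norm (f x *\<^sub>R g x))\<^sup>2)"
    "(LINT x|M. (norm (f x *\<^sub>R g x))\<^sup>2) \<le> B\<^sup>2 * (LINT x|M. (norm (g x))\<^sup>2)"
proof -
  have le: "(norm (f x *\<^sub>R g x))\<^sup>2 \<le> B\<^sup>2 * (norm (g x))\<^sup>2" for x
    using power_mono[OF B[of x], of 2] by (simp add: power_mult_distrib mult_right_mono)
  have i2: "integrable M (\<lambda>x. B\<^sup>2 * (norm (g x))\<^sup>2)" using i by auto
  show int: "integrable M (\<lambda>x. (norm (f x *\<^sub>R g x))\<^sup>2)"
    by (rule Bochner_Integration.integrable_bound[OF i2]) (use le in auto)
  have "(LINT x|M. (norm (f x *\<^sub>R g x))\<^sup>2) \<le> (LINT x|M. B\<^sup>2 * (norm (g x))\<^sup>2)"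
    by (rule integral_mono[OF int i2 le])
  then show "(LINT x|M. (norm (f x *\<^sub>R g x))\<^sup>2) \<le> B\<^sup>2 * (LINT x|M. (norm (g x))\<^sup>2)" by simp
qed

text \<open>Borel representatives, on the whole space, of a function in \<open>W12_0 \<Omega>\<close> and of its weak gradient,
  together with an approximating sequence of test functions.\<close>

locale zero_trace =
  fixes \<Omega> :: "(real^'n) set" and u :: "real^'n \<Rightarrow> real" and v :: "real^'n \<Rightarrow> real^'n" and \<phi> :: "nat \<Rightarrow> real^'n \<Rightarrow> real"
  assumes open_Omega: "open \<Omega>" and bounded_Omega: "bounded \<Omega>"
    and meas_u [measurable]: "u \<in> borel_measurable borel" and meas_v [measurable]: "v \<in> borel_measurable borel"
    and outside: "\<And>x. x \<notin> \<Omega> \<Longrightarrow> u x = 0" "\<And>x. x \<notin> \<Omega> \<Longrightarrow> v x = 0"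
    and sq_u: "integrable lborel (\<lambda>x. (u x)\<^sup>2)" and sq_v: "integrable lborel (\<lambda>x. (norm (v x))\<^sup>2)"
    and test: "\<And>k. test_function \<Omega> (\<phi> k)"
    and lim_u: "(\<lambda>k. LINT x|lborel. (u x - \<phi> k x)\<^sup>2) \<longlonglongrightarrow> 0"
    and lim_v: "(\<lambda>k. LINT x|lborel. (norm (v x - grad (\<phi> k) x))\<^sup>2) \<longlonglongrightarrow> 0"
begin

lemma sets_Omega [measurable]: "\<Omega> \<in> sets borel" and sets_Omega_lebesgue: "\<Omega> \<in> sets lebesgue"
  using open_Omega by (auto intro: borel_open)

lemma smooth_phi: "smooth (\<phi> k)"
  by (rule smooth_test_function[OF test])

lemma meas_phi [measurable]: "\<phi> k \<in> borel_measurable borel" "grad (\<phi> k) \<in> borel_measurable borel"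
  using smooth_phi by (auto intro: smooth_measurable grad_measurable)

lemma sq_diff: "integrable lborel (\<lambda>x. (u x - \<phi> k x)\<^sup>2)" "integrable lborel (\<lambda>x. (norm (v x - grad (\<phi> k) x))\<^sup>2)"
proof -
  show "integrable lborel (\<lambda>x. (u x - \<phi> k x)\<^sup>2)"
    using square_integrable_add(1)[of u lborel "\<lambda>x. - \<phi> k x"] sq_u test_function_integrable(2)[OF test] by simp
  show "integrable lborel (\<lambda>x. (norm (v x - grad (\<phi> k) x))\<^sup>2)"
    using square_integrable_add(1)[of v lborel "\<lambda>x. - grad (\<phi> k) x"] sq_v test_function_integrable(4)[OF test] by simp
qed

text \<open>Cauchy-Schwarz on a ball that contains \<Omega>. C is the volume of that ball and serves
  for all f at once, so that L2 convergence implies L1 convergence.\<close>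

lemma L1_L2:
  obtains C where "0 \<le> C" "\<And>f :: real^'n \<Rightarrow> real. f \<in> borel_measurable borel \<Longrightarrow> (\<And>x. x \<notin> \<Omega> \<Longrightarrow> f x = 0) \<Longrightarrow>
      integrable lborel (\<lambda>x. (f x)\<^sup>2) \<Longrightarrow> integrable lborel f \<and> (LINT x|lborel. \<bar>f x\<bar>) \<le> sqrt (C * (LINT x|lborel. (f x)\<^sup>2))"
proof -
  obtain R where R: "0 < R" "\<Omega> \<subseteq> ball 0 R" using bounded_subset_ballD[OF bounded_Omega, of 0] by auto
  let ?B = "ball (0::real^'n) R"
  have vp: "0 < vol ?B" using R(1) by (rule vol_ball_pos)
  have "integrable lborel f \<and> (LINT x|lborel. \<bar>f x\<bar>) \<le> sqrt (vol ?B * (LINT x|lborel. (f x)\<^sup>2))"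
    if [measurable]: "f \<in> borel_measurable borel" and o: "\<And>x. x \<notin> \<Omega> \<Longrightarrow> f x = 0" and i: "integrable lborel (\<lambda>x. (f x)\<^sup>2)"
    for f :: "real^'n \<Rightarrow> real"
  proof
    show intf: "integrable lborel f"
    proof (rule Bochner_Integration.integrable_bound)
      show "integrable lborel (\<lambda>x. indicator ?B x + (f x)\<^sup>2)"
        using i emeasure_bounded_finite[of ?B] by (intro Bochner_Integration.integrable_add integrable_real_indicator) auto
      show "AE x in lborel. norm (f x) \<le> norm (indicator ?B x + (f x)\<^sup>2)"
      proof (rule AE_I2)
        fix x
        have "2 * \<bar>f x\<bar> \<le> 1 + (f x)\<^sup>2" using sum_squares_bound[of 1 "\<bar>f x\<bar>"] by simp
        then have "\<bar>f x\<bar> \<le> 1 + (f x)\<^sup>2" using abs_ge_zero[of "f x"] by linarith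
        then show "norm (f x) \<le> norm (indicator ?B x + (f x)\<^sup>2)"
          using R(2) o[of x] by (cases "x \<in> \<Omega>") (auto simp: indicator_def)
      qed
    qed measurable
    have e: "(LINT x:?B|lborel. g (f x)) = (LINT x|lborel. g (f x))" if "g 0 = 0" for g :: "real \<Rightarrow> real"
    proof -
      have "f x = 0" if "x \<notin> ?B" for x using R(2) o that by blast
      then show ?thesis
        unfolding set_lebesgue_integral_def using that by (intro Bochner_Integration.integral_cong) (auto simp: indicator_def)
    qed
    have "(mean ?B (\<lambda>x. \<bar>f x\<bar>))\<^sup>2 \<le> mean ?B (\<lambda>x. \<bar>f x\<bar>\<^sup>2)"
      using intf i vp by (intro mean_square_le set_integrable_borel) (auto simp: emeasure_ball_eq)
    then have 0: "((LINT x|lborel. \<bar>f x\<bar>) / vol ?B)\<^sup>2 \<le> (LINT x|lborel. (f x)\<^sup>2) / vol ?B"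
      using e[of abs] e[of "\<lambda>y. y\<^sup>2"] by (simp add: mean_def)
    have "(LINT x|lborel. \<bar>f x\<bar>)\<^sup>2 \<le> vol ?B * (LINT x|lborel. (f x)\<^sup>2)"
    proof -
      have "(LINT x|lborel. \<bar>f x\<bar>)\<^sup>2 = (vol ?B)\<^sup>2 * ((LINT x|lborel. \<bar>f x\<bar>) / vol ?B)\<^sup>2"
        using vp by (simp add: power_divide)
      also have "\<dots> \<le> (vol ?B)\<^sup>2 * ((LINT x|lborel. (f x)\<^sup>2) / vol ?B)"
        using 0 by (rule mult_left_mono) simp
      also have "\<dots> = vol ?B * (LINT x|lborel. (f x)\<^sup>2)" using vp by (simp add: power2_eq_square)
      finally show ?thesis .
    qed
    then show "(LINT x|lborel. \<bar>f x\<bar>) \<le> sqrt (vol ?B * (LINT x|lborel. (f x)\<^sup>2))" by (rule real_le_rsqrt)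
  qed
  then show ?thesis by (rule that[OF less_imp_le[OF vp]])
qed

lemma int_u: "integrable lborel u" and int_norm_v: "integrable lborel (\<lambda>x. norm (v x))" and int_v: "integrable lborel v"
  and lim1_u: "(\<lambda>k. LINT x|lborel. \<bar>u x - \<phi> k x\<bar>) \<longlonglongrightarrow> 0"
  and lim1_v: "(\<lambda>k. LINT x|lborel. norm (v x - grad (\<phi> k) x)) \<longlonglongrightarrow> 0"
  and int_diff: "integrable lborel (\<lambda>x. norm (v x - grad (\<phi> k) x))"
proof -
  obtain C where C: "0 \<le> C" "\<And>f :: real^'n \<Rightarrow> real. f \<in> borel_measurable borel \<Longrightarrow> (\<And>x. x \<notin> \<Omega> \<Longrightarrow> f x = 0) \<Longrightarrow>
      integrable lborel (\<lambda>x. (f x)\<^sup>2) \<Longrightarrow> integrable lborel f \<and> (LINT x|lborel. \<bar>f x\<bar>) \<le> sqrt (C * (LINT x|lborel. (f x)\<^sup>2))"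
    using L1_L2 by blast
  show "integrable lborel u" using C(2)[of u] sq_u outside by auto
  show n: "integrable lborel (\<lambda>x. norm (v x))" using C(2)[of "\<lambda>x. norm (v x)"] sq_v outside by auto
  then show "integrable lborel v" by (subst (asm) integrable_norm_iff) auto
  have cu: "integrable lborel (\<lambda>x. u x - \<phi> k x) \<and> (LINT x|lborel. \<bar>u x - \<phi> k x\<bar>) \<le> sqrt (C * (LINT x|lborel. (u x - \<phi> k x)\<^sup>2))" for k
    by (rule C(2)) (use sq_diff outside test_function_outside[OF test] in auto)
  have cv: "integrable lborel (\<lambda>x. norm (v x - grad (\<phi> k) x)) \<and> (LINT x|lborel. \<bar>norm (v x - grad (\<phi> k) x)\<bar>) \<le> sqrt (C * (LINT x|lborel. (norm (v x - grad (\<phi> k) x))\<^sup>2))" for k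
    by (rule C(2)) (use sq_diff outside test_function_outside[OF test] in auto)
  show "integrable lborel (\<lambda>x. norm (v x - grad (\<phi> k) x))" using cv by blast
  have "(\<lambda>k. sqrt (C * (LINT x|lborel. (u x - \<phi> k x)\<^sup>2))) \<longlonglongrightarrow> sqrt (C * 0)" by (intro tendsto_intros lim_u)
  then have Lu: "(\<lambda>k. sqrt (C * (LINT x|lborel. (u x - \<phi> k x)\<^sup>2))) \<longlonglongrightarrow> 0" by simp
  show "(\<lambda>k. LINT x|lborel. \<bar>u x - \<phi> k x\<bar>) \<longlonglongrightarrow> 0"
    by (rule tendsto_sandwich[OF _ _ tendsto_const Lu]) (use cu in simp_all)
  have "(\<lambda>k. sqrt (C * (LINT x|lborel. (norm (v x - grad (\<phi> k) x))\<^sup>2))) \<longlonglongrightarrow> sqrt (C * 0)" by (intro tendsto_intros lim_v)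
  then have Lv: "(\<lambda>k. sqrt (C * (LINT x|lborel. (norm (v x - grad (\<phi> k) x))\<^sup>2))) \<longlonglongrightarrow> 0" by simp
  show "(\<lambda>k. LINT x|lborel. norm (v x - grad (\<phi> k) x)) \<longlonglongrightarrow> 0"
    by (rule tendsto_sandwich[OF _ _ tendsto_const Lv]) (use cv in simp_all)
qed

text \<open>For p = 1 this is the triangle inequality. For p = 2 Young's inequality bounds the
  difference of squares by a multiple of the squared error, which tends to 0 for fixed e, plus e
  times the square of norm v, with e arbitrarily small.\<close>

lemma lim_norm_power:
  assumes p: "p = 1 \<or> p = 2"
  shows "(\<lambda>k. LINT x|lborel. \<bar>norm (v x) ^ p - norm (grad (\<phi> k) x) ^ p\<bar>) \<longlonglongrightarrow> 0"
    and "integrable lborel (\<lambda>x. norm (v x) ^ p)" "integrable lborel (\<lambda>x. norm (grad (\<phi> k) x) ^ p)"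
proof -
  show iv: "integrable lborel (\<lambda>x. norm (v x) ^ p)" using p int_norm_v sq_v by auto
  show ig: "integrable lborel (\<lambda>x. norm (grad (\<phi> k) x) ^ p)" for k using p test_function_integrable(3,4)[OF test] by auto
  show "(\<lambda>k. LINT x|lborel. \<bar>norm (v x) ^ p - norm (grad (\<phi> k) x) ^ p\<bar>) \<longlonglongrightarrow> 0"
    using p
  proof
    assume p1: "p = 1"
    have "(LINT x|lborel. \<bar>norm (v x) ^ p - norm (grad (\<phi> k) x) ^ p\<bar>) \<le> (LINT x|lborel. norm (v x - grad (\<phi> k) x))" for k
      using int_norm_v test_function_integrable(3)[OF test] int_diff unfolding p1
      by (intro integral_mono) (auto intro: norm_triangle_ineq3)
    then show ?thesis
      by (intro tendsto_sandwich[OF _ _ tendsto_const lim1_v]) auto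
  next
    assume p2: "p = 2"
    define H where "H = (LINT x|lborel. (norm (v x))\<^sup>2)"
    have H: "0 \<le> H" by (simp add: H_def)
    let ?d = "\<lambda>k. LINT x|lborel. (norm (v x - grad (\<phi> k) x))\<^sup>2"
    have le: "(LINT x|lborel. \<bar>norm (v x) ^ p - norm (grad (\<phi> k) x) ^ p\<bar>) \<le> (1 + 1 / e) * ?d k + e * H" if e: "0 < e" for k e
    proof -
      have pt: "\<bar>(norm a)\<^sup>2 - (norm b)\<^sup>2\<bar> \<le> (1 + 1 / e) * (norm (a - b))\<^sup>2 + e * (norm a)\<^sup>2" for a b :: "real^'n"
      proof -
        have n: "\<bar>norm a - norm b\<bar> \<le> norm (a - b)" by (rule norm_triangle_ineq3)
        have "norm b \<le> norm a + norm (a - b)" using n by linarith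
        then have s: "norm a + norm b \<le> 2 * norm a + norm (a - b)" by simp
        have "\<bar>(norm a)\<^sup>2 - (norm b)\<^sup>2\<bar> = \<bar>norm a - norm b\<bar> * (norm a + norm b)"
          by (simp add: power2_eq_square square_diff_square_factored abs_mult mult.commute)
        also have "\<dots> \<le> norm (a - b) * (2 * norm a + norm (a - b))" using n s by (intro mult_mono) auto
        also have "\<dots> = (norm (a - b))\<^sup>2 + 2 * (norm a * norm (a - b))" by (simp add: power2_eq_square algebra_simps)
        also have "2 * (norm a * norm (a - b)) \<le> e * (norm a)\<^sup>2 + 1 / e * (norm (a - b))\<^sup>2"
        proof -
          have "0 \<le> (e * norm a - norm (a - b))\<^sup>2" by simp
          then have "2 * (e * (norm a * norm (a - b))) \<le> e\<^sup>2 * (norm a)\<^sup>2 + (norm (a - b))\<^sup>2"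
            by (simp add: power2_diff power_mult_distrib algebra_simps)
          then show ?thesis using e by (simp add: field_simps power2_eq_square)
        qed
        finally show ?thesis by (simp add: algebra_simps)
      qed
      have "(LINT x|lborel. \<bar>norm (v x) ^ p - norm (grad (\<phi> k) x) ^ p\<bar>)
        \<le> (LINT x|lborel. (1 + 1 / e) * (norm (v x - grad (\<phi> k) x))\<^sup>2 + e * (norm (v x))\<^sup>2)"
      proof (rule integral_mono)
        show "integrable lborel (\<lambda>x. \<bar>norm (v x) ^ p - norm (grad (\<phi> k) x) ^ p\<bar>)" using iv ig by auto
        show "integrable lborel (\<lambda>x. (1 + 1 / e) * (norm (v x - grad (\<phi> k) x))\<^sup>2 + e * (norm (v x))\<^sup>2)"
          using sq_v sq_diff(2) by (intro Bochner_Integration.integrable_add integrable_mult_right)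
        show "\<bar>norm (v x) ^ p - norm (grad (\<phi> k) x) ^ p\<bar> \<le> (1 + 1 / e) * (norm (v x - grad (\<phi> k) x))\<^sup>2 + e * (norm (v x))\<^sup>2" for x
          unfolding p2 by (rule pt)
      qed
      also have "\<dots> = (1 + 1 / e) * ?d k + e * H"
        unfolding H_def using sq_v sq_diff(2) by (subst Bochner_Integration.integral_add) auto
      finally show ?thesis .
    qed
    show ?thesis
    proof (rule LIMSEQ_I)
      fix r :: real assume r: "0 < r"
      define e where "e = r / (2 * (H + 1))"
      have e: "0 < e" using r H by (simp add: e_def)
      have "e * H \<le> r / 2"
      proof -
        have "e * H \<le> e * (H + 1)" using e by simp
        also have "\<dots> = r / 2" using H by (simp add: e_def field_simps)
        finally show ?thesis .
      qed
      have "(\<lambda>k. (1 + 1 / e) * ?d k) \<longlonglongrightarrow> (1 + 1 / e) * 0" by (intro tendsto_intros lim_v)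
      then have "eventually (\<lambda>k. (1 + 1 / e) * ?d k < r / 2) sequentially" using r by (intro order_tendstoD(2)) auto
      then obtain K where K: "\<And>k. K \<le> k \<Longrightarrow> (1 + 1 / e) * ?d k < r / 2" by (auto simp: eventually_sequentially)
      have "norm ((LINT x|lborel. \<bar>norm (v x) ^ p - norm (grad (\<phi> k) x) ^ p\<bar>) - 0) < r" if "K \<le> k" for k
      proof -
        have "(LINT x|lborel. \<bar>norm (v x) ^ p - norm (grad (\<phi> k) x) ^ p\<bar>) < r"
          using le[OF e, of k] K[OF that] \<open>e * H \<le> r / 2\<close> by argo
        then show ?thesis by simp
      qed
      then show "\<exists>K. \<forall>k\<ge>K. norm ((LINT x|lborel. \<bar>norm (v x) ^ p - norm (grad (\<phi> k) x) ^ p\<bar>) - 0) < r" by blast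
    qed
  qed
qed

text \<open>\<open>smooth_translation_estimate\<close> in the limit: Fatou along an almost
  everywhere convergent subsequence on the left, convergence of the integrals of the gradient powers
  on the right.\<close>

lemma translation:
  assumes p: "p = 1 \<or> p = 2" and \<rho>: "0 < \<rho>"
  shows "(\<integral>\<^sup>+y\<in>ball x \<rho>. ennreal (\<bar>u (y + z) - u y\<bar> ^ p) \<partial>lborel)
        \<le> ennreal (norm z ^ p * (LINT y:ball x (\<rho> + norm z)|lborel. norm (v y) ^ p))"
proof -
  let ?B = "ball x (\<rho> + norm z)"
  have "\<exists>r. strict_mono r \<and> (AE y in lborel. (\<lambda>n. u y - \<phi> (r n) y) \<longlonglongrightarrow> 0)"
    by (rule tendsto_L1_AE_subseq) (use int_u test_function_integrable(1)[OF test] lim1_u in auto)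
  then obtain r where r: "strict_mono r" "AE y in lborel. (\<lambda>n. u y - \<phi> (r n) y) \<longlonglongrightarrow> 0" by blast
  \<comment> \<open>Null sets are translation invariant, so the subsequence also converges at z + y
    for almost every y.\<close>
  have "AE y in distr lborel borel ((+) z). (\<lambda>n. u y - \<phi> (r n) y) \<longlonglongrightarrow> 0"
    using r(2) by (simp only: lborel_distr_plus)
  then have r2: "AE y in lborel. (\<lambda>n. u (z + y) - \<phi> (r n) (z + y)) \<longlonglongrightarrow> 0"
    by (subst (asm) AE_distr_iff) auto
  have "(\<integral>\<^sup>+y\<in>ball x \<rho>. ennreal (\<bar>u (y + z) - u y\<bar> ^ p) \<partial>lborel)
     \<le> (\<integral>\<^sup>+y. liminf (\<lambda>n. ennreal (\<bar>\<phi> (r n) (y + z) - \<phi> (r n) y\<bar> ^ p) * indicator (ball x \<rho>) y) \<partial>lborel)"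
  proof (rule nn_integral_mono_AE)
    show "AE y in lborel. ennreal (\<bar>u (y + z) - u y\<bar> ^ p) * indicator (ball x \<rho>) y
      \<le> liminf (\<lambda>n. ennreal (\<bar>\<phi> (r n) (y + z) - \<phi> (r n) y\<bar> ^ p) * indicator (ball x \<rho>) y)"
      using r(2) r2
    proof eventually_elim
      case (elim y)
      have l1: "(\<lambda>n. \<phi> (r n) y) \<longlonglongrightarrow> u y" using tendsto_diff[OF tendsto_const elim(1), of "u y"] by simp
      have l2: "(\<lambda>n. \<phi> (r n) (y + z)) \<longlonglongrightarrow> u (y + z)"
        using tendsto_diff[OF tendsto_const elim(2), of "u (z + y)"] by (simp add: add.commute)
      have "(\<lambda>n. ennreal (\<bar>\<phi> (r n) (y + z) - \<phi> (r n) y\<bar> ^ p) * indicator (ball x \<rho>) y)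
         \<longlonglongrightarrow> ennreal (\<bar>u (y + z) - u y\<bar> ^ p) * indicator (ball x \<rho>) y"
        by (intro tendsto_mult_ennreal tendsto_ennrealI tendsto_intros l1 l2) (auto simp: indicator_def)
      from lim_imp_Liminf[OF sequentially_bot this] show ?case by simp
    qed
  qed
  also have "\<dots> \<le> liminf (\<lambda>n. \<integral>\<^sup>+y\<in>ball x \<rho>. ennreal (\<bar>\<phi> (r n) (y + z) - \<phi> (r n) y\<bar> ^ p) \<partial>lborel)"
    by (rule nn_integral_liminf) measurable
  also have "\<dots> \<le> liminf (\<lambda>n. ennreal (norm z ^ p * (LINT y:?B|lborel. norm (grad (\<phi> (r n)) y) ^ p)))"
  proof (rule Liminf_mono, rule always_eventually, rule allI)
    fix n
    have "(\<integral>\<^sup>+y\<in>ball x \<rho>. ennreal (\<bar>\<phi> (r n) (y + z) - \<phi> (r n) y\<bar> ^ p) \<partial>lborel)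
      \<le> ennreal (norm z ^ p) * (\<integral>\<^sup>+y\<in>?B. ennreal (norm (grad (\<phi> (r n)) y) ^ p) \<partial>lborel)"
      by (rule smooth_translation_estimate[OF smooth_phi p \<rho>])
    also have "\<dots> = ennreal (norm z ^ p * (LINT y:?B|lborel. norm (grad (\<phi> (r n)) y) ^ p))"
      by (subst ennreal_mult', simp, subst ennreal_set_integral[OF lim_norm_power(3)[OF p]]) auto
    finally show "(\<integral>\<^sup>+y\<in>ball x \<rho>. ennreal (\<bar>\<phi> (r n) (y + z) - \<phi> (r n) y\<bar> ^ p) \<partial>lborel)
      \<le> ennreal (norm z ^ p * (LINT y:?B|lborel. norm (grad (\<phi> (r n)) y) ^ p))" .
  qed
  also have "\<dots> = ennreal (norm z ^ p * (LINT y:?B|lborel. norm (v y) ^ p))"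
  proof (rule lim_imp_Liminf[OF sequentially_bot], rule tendsto_ennrealI, rule tendsto_mult[OF tendsto_const])
    have "(\<lambda>k. LINT y:?B|lborel. norm (grad (\<phi> k) y) ^ p) \<longlonglongrightarrow> (LINT y:?B|lborel. norm (v y) ^ p)"
    proof (rule LIM_zero_cancel, rule tendsto_rabs_zero_cancel, rule tendsto_sandwich[OF _ _ tendsto_const lim_norm_power(1)[OF p]])
      show "eventually (\<lambda>k. \<bar>(LINT y:?B|lborel. norm (grad (\<phi> k) y) ^ p) - (LINT y:?B|lborel. norm (v y) ^ p)\<bar>
        \<le> (LINT x|lborel. \<bar>norm (v x) ^ p - norm (grad (\<phi> k) x) ^ p\<bar>)) sequentially"
      proof (rule always_eventually, rule allI)
        fix k
        have si: "set_integrable lborel ?B (\<lambda>y. norm (grad (\<phi> k) y) ^ p)" "set_integrable lborel ?B (\<lambda>y. norm (v y) ^ p)"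
          using lim_norm_power(2,3)[OF p] by (auto intro: set_integrable_borel)
        have "\<bar>(LINT y:?B|lborel. norm (grad (\<phi> k) y) ^ p) - (LINT y:?B|lborel. norm (v y) ^ p)\<bar>
          = \<bar>LINT y:?B|lborel. norm (grad (\<phi> k) y) ^ p - norm (v y) ^ p\<bar>" using si by simp
        also have "\<dots> \<le> (LINT y:?B|lborel. \<bar>norm (grad (\<phi> k) y) ^ p - norm (v y) ^ p\<bar>)"
          using set_integral_norm_bound[OF set_integral_diff(1)[OF si]] by simp
        also have "\<dots> \<le> (LINT y:UNIV|lborel. \<bar>norm (grad (\<phi> k) y) ^ p - norm (v y) ^ p\<bar>)"
          by (rule set_integral_mono_set) (use lim_norm_power(2,3)[OF p] in auto)
        finally show "\<bar>(LINT y:?B|lborel. norm (grad (\<phi> k) y) ^ p) - (LINT y:?B|lborel. norm (v y) ^ p)\<bar>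
          \<le> (LINT x|lborel. \<bar>norm (v x) ^ p - norm (grad (\<phi> k) x) ^ p\<bar>)"
          by (simp add: set_lebesgue_integral_def abs_minus_commute)
      qed
    qed auto
    from LIMSEQ_subseq_LIMSEQ[OF this r(1)]
    show "(\<lambda>n. LINT y:?B|lborel. norm (grad (\<phi> (r n)) y) ^ p) \<longlonglongrightarrow> (LINT y:?B|lborel. norm (v y) ^ p)" by (simp add: o_def)
  qed
  finally show ?thesis .
qed

lemma gradient_pair: "gradient_pair u (\<lambda>x. norm (v x))"
proof
  show "integrable lborel u" "integrable lborel (\<lambda>x. (u x)\<^sup>2)" "integrable lborel (\<lambda>x. norm (v x))"
     "integrable lborel (\<lambda>x. (norm (v x))\<^sup>2)" by (fact int_u sq_u int_norm_v sq_v)+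
  show "(\<integral>\<^sup>+y\<in>ball x \<rho>. ennreal \<bar>u (y + z) - u y\<bar> \<partial>lborel)
        \<le> ennreal (norm z * (LINT y:ball x (\<rho> + norm z)|lborel. norm (v y)))" if "0 < \<rho>" for x z \<rho>
    using translation[of 1, OF _ that, where x=x and z=z] by simp
  show "(\<integral>\<^sup>+y\<in>ball x \<rho>. ennreal ((u (y + z) - u y)\<^sup>2) \<partial>lborel)
        \<le> ennreal ((norm z)\<^sup>2 * (LINT y:ball x (\<rho> + norm z)|lborel. (norm (v y))\<^sup>2))" if "0 < \<rho>" for x z \<rho>
    using translation[of 2, OF _ that, where x=x and z=z] by simp
  show "AE x in lborel. ((\<lambda>r. mean (ball x r) u) \<longlongrightarrow> u x) (at_right 0)"
    unfolding mean_def
    by (rule lebesgue_points[OF int_u test_function_integrable(1)[OF test] smooth_continuous[OF smooth_phi] lim1_u])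
  show "AE x in lborel. ((\<lambda>r. mean (ball x r) (\<lambda>y. (norm (v y))\<^sup>2)) \<longlongrightarrow> (norm (v x))\<^sup>2) (at_right 0)"
    unfolding mean_def
    by (rule lebesgue_points[OF sq_v test_function_integrable(4)[OF test] _ lim_norm_power(1)[of 2, simplified]])
       (intro continuous_intros grad_continuous smooth_phi)
qed auto

text \<open>S may be larger than \<Omega>, even the whole space: a test function on S need not
  vanish near the boundary of \<Omega>, but the approximants \<open>\<phi> k\<close> do, so
  integration by parts holds for them and passes to the limit. S = \<Omega> identifies the weak
  gradient, S = UNIV compares different domains.\<close>

lemma has_weak_grad:
  assumes S: "open S" "\<Omega> \<subseteq> S"
  shows "has_weak_grad S u v"
  unfolding has_weak_grad_def
proof (intro conjI allI impI)
  show "locally_integrable S u" "locally_integrable S v"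
    using int_u int_v by (auto simp: locally_integrable_def intro!: integrable_lebesgue_on_of_lborel lmeasurable_compact fmeasurableD)
  fix \<psi> i assume \<psi>: "test_function S \<psi>"
  then have tU: "test_function UNIV \<psi>" by (rule test_function_mono) simp
  have s: "smooth \<psi>" by (rule smooth_test_function[OF \<psi>])
  have [measurable]: "\<psi> \<in> borel_measurable borel" "(\<lambda>x. grad \<psi> x $ i) \<in> borel_measurable borel"
    using s smooth_grad_component[OF s] by (auto intro: smooth_measurable)
  obtain B1 where B1: "0 < B1" "\<And>x. \<bar>\<psi> x\<bar> \<le> B1" using test_function_bounded[OF \<psi>] by metis
  obtain B2 where B2: "0 < B2" "\<And>x. \<bar>grad \<psi> x $ i\<bar> \<le> B2" using test_function_bounded[OF test_function_grad_component[OF \<psi>]] by metis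
  have "(\<lambda>x. v x \<bullet> axis i 1) \<in> borel_measurable borel" by measurable
  then have mv: "(\<lambda>x. v x $ i) \<in> borel_measurable borel" by (simp add: inner_axis)
  have SS: "S \<in> sets lebesgue" using S by (auto intro: borel_open)
  have mS: "f \<in> borel_measurable (lebesgue_on S)" if "f \<in> borel_measurable borel" for f :: "real^'n \<Rightarrow> real"
    using that by (intro measurable_restrict_space1 measurable_completion) simp
  have m1: "(\<lambda>x. u x * grad \<psi> x $ i) \<in> borel_measurable borel" by measurable
  have e1: "(\<integral>x. u x * grad \<psi> x $ i \<partial>lebesgue_on S) = (LINT x|lborel. u x * grad \<psi> x $ i)"
  proof (rule integral_lebesgue_on_eq_lborel[OF SS m1 _ mS[OF m1]])
    show "u x * grad \<psi> x $ i = 0" if "x \<notin> S" for x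
    proof -
      have "u x = 0" using that S by (intro outside) auto
      then show ?thesis by simp
    qed
  qed simp
  have m2: "(\<lambda>x. v x $ i * \<psi> x) \<in> borel_measurable borel" using mv by measurable
  have e2: "(\<integral>x. v x $ i * \<psi> x \<partial>lebesgue_on S) = (LINT x|lborel. v x $ i * \<psi> x)"
  proof (rule integral_lebesgue_on_eq_lborel[OF SS m2 _ mS[OF m2]])
    show "v x $ i * \<psi> x = 0" if "x \<notin> S" for x
    proof -
      have "v x = 0" using that S by (intro outside) auto
      then show ?thesis by simp
    qed
  qed simp
  \<comment> \<open>L1 convergence tested against a bounded function; applied once to u and once to
    a component of the gradient.\<close>
  have conv: "(\<lambda>k. LINT x|lborel. f k x * g x) \<longlonglongrightarrow> (LINT x|lborel. w x * g x)"
    if w: "integrable lborel w" "\<And>k. integrable lborel (f k)" "(\<lambda>k. LINT x|lborel. \<bar>w x - f k x\<bar>) \<longlonglongrightarrow> 0"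
      and g[measurable]: "g \<in> borel_measurable borel" "\<And>x. \<bar>g x\<bar> \<le> B" for w g :: "real^'n \<Rightarrow> real" and f B
  proof (rule LIM_zero_cancel, rule tendsto_rabs_zero_cancel, rule tendsto_sandwich[OF _ _ tendsto_const tendsto_mult_right_zero[OF w(3), of B]])
    have ig: "integrable lborel (\<lambda>x. q x * g x)" if "integrable lborel q" for q :: "real^'n \<Rightarrow> real"
    proof (rule Bochner_Integration.integrable_bound)
      show "integrable lborel (\<lambda>x. B * q x)" using that by simp
      show "AE x in lborel. norm (q x * g x) \<le> norm (B * q x)"
        using g(2) by (intro AE_I2) (auto simp: abs_mult mult.commute intro!: mult_right_mono order.trans[OF g(2) abs_ge_self])
    qed (use that in \<open>auto dest: borel_measurable_integrable\<close>)
    show "eventually (\<lambda>k. \<bar>(LINT x|lborel. f k x * g x) - (LINT x|lborel. w x * g x)\<bar> \<le> B * (LINT x|lborel. \<bar>w x - f k x\<bar>)) sequentially"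
    proof (rule always_eventually, rule allI)
      fix k
      have "\<bar>(LINT x|lborel. f k x * g x) - (LINT x|lborel. w x * g x)\<bar> = \<bar>LINT x|lborel. (f k x - w x) * g x\<bar>"
        using ig w by (simp add: left_diff_distrib)
      also have "\<dots> \<le> (LINT x|lborel. \<bar>(f k x - w x) * g x\<bar>)" by (rule integral_abs_bound)
      also have "\<dots> \<le> (LINT x|lborel. B * \<bar>w x - f k x\<bar>)"
      proof (rule integral_mono)
        show "integrable lborel (\<lambda>x. \<bar>(f k x - w x) * g x\<bar>)" using ig w by auto
        show "\<bar>(f k x - w x) * g x\<bar> \<le> B * \<bar>w x - f k x\<bar>" for x
          using mult_left_mono[OF g(2)[of x], of "\<bar>f k x - w x\<bar>"] by (simp add: abs_mult abs_minus_commute mult.commute)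
      qed (use w in auto)
      finally show "\<bar>(LINT x|lborel. f k x * g x) - (LINT x|lborel. w x * g x)\<bar> \<le> B * (LINT x|lborel. \<bar>w x - f k x\<bar>)" by simp
    qed
  qed auto
  have c1: "(\<lambda>k. LINT x|lborel. \<phi> k x * grad \<psi> x $ i) \<longlonglongrightarrow> (LINT x|lborel. u x * grad \<psi> x $ i)"
    by (rule conv[OF int_u test_function_integrable(1)[OF test] lim1_u _ B2(2)]) measurable
  have c2: "(\<lambda>k. LINT x|lborel. grad (\<phi> k) x $ i * \<psi> x) \<longlonglongrightarrow> (LINT x|lborel. v x $ i * \<psi> x)"
  proof (rule conv[OF _ test_function_integrable(5)[OF test] _ _ B1(2)])
    show iv: "integrable lborel (\<lambda>x. v x $ i)" using int_v by (intro integrable_bounded_linear[OF bounded_linear_vec_nth])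
    show "(\<lambda>k. LINT x|lborel. \<bar>v x $ i - grad (\<phi> k) x $ i\<bar>) \<longlonglongrightarrow> 0"
    proof (rule tendsto_sandwich[OF _ _ tendsto_const lim1_v])
      show "eventually (\<lambda>k. (LINT x|lborel. \<bar>v x $ i - grad (\<phi> k) x $ i\<bar>) \<le> (LINT x|lborel. norm (v x - grad (\<phi> k) x))) sequentially"
        using iv test_function_integrable(5)[OF test] int_diff component_le_norm_cart[of "v _ - grad _ _" i]
        by (intro always_eventually allI integral_mono) auto
    qed auto
  qed measurable
  have "(LINT x|lborel. \<phi> k x * grad \<psi> x $ i) = - (LINT x|lborel. grad (\<phi> k) x $ i * \<psi> x)" for k
    by (rule integration_by_parts[OF test_function_mono[OF test] s]) simp
  then have "(\<lambda>k. - (LINT x|lborel. grad (\<phi> k) x $ i * \<psi> x)) \<longlonglongrightarrow> (LINT x|lborel. u x * grad \<psi> x $ i)" using c1 by simp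
  from LIMSEQ_unique[OF this tendsto_minus[OF c2]]
  show "(\<integral>x. u x * grad \<psi> x $ i \<partial>lebesgue_on S) = - (\<integral>x. v x $ i * \<psi> x \<partial>lebesgue_on S)" unfolding e1 e2 .
qed

end

section \<open>Passing between given functions and their Borel representatives\<close>

lemma Lp_transfer:
  fixes f g :: "'a::euclidean_space \<Rightarrow> 'b::euclidean_space"
  assumes S: "S \<in> sets lebesgue" and g: "g \<in> borel_measurable borel"
    and eq: "AE x in lebesgue. x \<in> S \<longrightarrow> f x = g x" and out: "\<And>x. x \<notin> S \<Longrightarrow> g x = 0"
  shows "f \<in> Lp S p \<longleftrightarrow> integrable lborel (\<lambda>x. norm (g x) powr p)"
    "Lp_norm S p f = (LINT x|lborel. norm (g x) powr p) powr (1 / p)"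
proof -
  have mf: "f \<in> borel_measurable (lebesgue_on S)" by (rule measurable_lebesgue_on_AE[OF S g eq])
  have mg: "(\<lambda>x. norm (g x) powr p) \<in> borel_measurable borel" using g by measurable
  have mfp: "(\<lambda>x. norm (f x) powr p) \<in> borel_measurable (lebesgue_on S)" using mf by measurable
  have eq': "AE x in lebesgue. x \<in> S \<longrightarrow> norm (f x) powr p = norm (g x) powr p"
    using eq by (rule eventually_mono) auto
  have o: "norm (g x) powr p = 0" if "x \<notin> S" for x using out[OF that] by simp
  show "f \<in> Lp S p \<longleftrightarrow> integrable lborel (\<lambda>x. norm (g x) powr p)"
    using mf integrable_lebesgue_on_iff_lborel[OF S mg eq' mfp o] by (simp add: Lp_def)
  show "Lp_norm S p f = (LINT x|lborel. norm (g x) powr p) powr (1 / p)"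
    using integral_lebesgue_on_eq_lborel[OF S mg eq' mfp o] by (simp add: Lp_norm_def)
qed

lemma norm_powr_2: "norm y powr 2 = (norm y)\<^sup>2"
  by simp

lemma abs_powr_2: "\<bar>y :: real\<bar> powr 2 = y\<^sup>2"
  by simp

lemma tendsto_powr_half_0_iff:
  fixes a :: "nat \<Rightarrow> real"
  assumes "\<And>k. 0 \<le> a k"
  shows "(\<lambda>k. a k powr (1 / 2)) \<longlonglongrightarrow> 0 \<longleftrightarrow> a \<longlonglongrightarrow> 0"
proof
  assume "(\<lambda>k. a k powr (1 / 2)) \<longlonglongrightarrow> 0"
  from tendsto_power[OF this, of 2] show "a \<longlonglongrightarrow> 0"
    using assms by (simp add: powr_half_sqrt)
next
  assume "a \<longlonglongrightarrow> 0"
  from tendsto_real_sqrt[OF this] show "(\<lambda>k. a k powr (1 / 2)) \<longlonglongrightarrow> 0"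
    using assms by (simp add: powr_half_sqrt)
qed

context zero_trace begin

text \<open>The way back from the locale to the space: membership is certified by the approximating
  sequence. A separate w occurs because the test function is built from the given solution, which is
  only almost everywhere equal to its Borel representative.\<close>

lemma W12_0_I:
  assumes out: "\<And>x. x \<notin> \<Omega> \<Longrightarrow> w x = 0" and eq: "AE x in lebesgue. w x = u x"
  shows "w \<in> W12_0 \<Omega>" "AE x in lebesgue. x \<in> \<Omega> \<longrightarrow> weak_grad \<Omega> w x = v x"
proof -
  note S = sets_Omega_lebesgue
  have eqS: "AE x in lebesgue. x \<in> T \<longrightarrow> w x = u x" for T using eq by (rule eventually_mono) auto
  have hu: "has_weak_grad \<Omega> u v" by (rule has_weak_grad[OF open_Omega]) simp
  have hw: "has_weak_grad \<Omega> w v"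
    unfolding has_weak_grad_def
  proof (intro conjI allI impI)
    show "locally_integrable \<Omega> v" using hu by (simp add: has_weak_grad_def)
    show "locally_integrable \<Omega> w"
      unfolding locally_integrable_def
    proof (intro allI impI)
      fix K assume K: "compact K \<and> K \<subseteq> \<Omega>"
      then have KS: "K \<in> sets lebesgue" by (auto intro!: lmeasurable_compact fmeasurableD)
      have iu: "integrable (lebesgue_on K) u" using hu K by (auto simp: has_weak_grad_def locally_integrable_def)
      show "integrable (lebesgue_on K) w"
      proof (rule integrable_cong_AE_imp[OF iu])
        show "w \<in> borel_measurable (lebesgue_on K)" by (rule measurable_lebesgue_on_AE[OF KS meas_u eqS])
        show "AE x in lebesgue_on K. u x = w x"
          using eq KS by (subst AE_restrict_space_iff) (auto elim!: eventually_mono)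
      qed
    qed
    fix \<psi> i assume \<psi>: "test_function \<Omega> \<psi>"
    have s: "smooth \<psi>" by (rule smooth_test_function[OF \<psi>])
    have [measurable]: "(\<lambda>x. grad \<psi> x $ i) \<in> borel_measurable borel"
      using smooth_grad_component[OF s] by (auto intro: smooth_measurable)
    have m1: "(\<lambda>x. u x * grad \<psi> x $ i) \<in> borel_measurable borel" by measurable
    have e: "AE x in lebesgue. x \<in> \<Omega> \<longrightarrow> w x * grad \<psi> x $ i = u x * grad \<psi> x $ i"
      using eq by (rule eventually_mono) auto
    have o: "u x * grad \<psi> x $ i = 0" if "x \<notin> \<Omega>" for x using outside(1)[OF that] by simp
    have "(\<integral>x. w x * grad \<psi> x $ i \<partial>lebesgue_on \<Omega>) = (LINT x|lborel. u x * grad \<psi> x $ i)"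
      by (rule integral_lebesgue_on_eq_lborel[OF S m1 e measurable_lebesgue_on_AE[OF S m1 e] o])
    also have "\<dots> = (\<integral>x. u x * grad \<psi> x $ i \<partial>lebesgue_on \<Omega>)"
      by (rule integral_lebesgue_on_eq_lborel[OF S m1 _ measurable_lebesgue_on_AE[OF S m1] o, symmetric]) auto
    also have "\<dots> = - (\<integral>x. v x $ i * \<psi> x \<partial>lebesgue_on \<Omega>)" using hu \<psi> by (simp add: has_weak_grad_def)
    finally show "(\<integral>x. w x * grad \<psi> x $ i \<partial>lebesgue_on \<Omega>) = - (\<integral>x. v x $ i * \<psi> x \<partial>lebesgue_on \<Omega>)" .
  qed
  have "has_weak_grad \<Omega> w (weak_grad \<Omega> w)" unfolding weak_grad_def by (rule someI[of "has_weak_grad \<Omega> w", OF hw])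
  from weak_grad_unique[OF open_Omega this hw]
  show wg: "AE x in lebesgue. x \<in> \<Omega> \<longrightarrow> weak_grad \<Omega> w x = v x"
    using S by (subst (asm) AE_restrict_space_iff) auto
  have L2w: "w \<in> Lp \<Omega> 2" using Lp_transfer(1)[OF S meas_u eqS outside(1), of 2] sq_u by simp
  have L2v: "weak_grad \<Omega> w \<in> Lp \<Omega> 2" using Lp_transfer(1)[OF S meas_v wg outside(2), of 2] sq_v by simp
  have "(\<lambda>k. Lp_norm \<Omega> 2 (\<lambda>x. w x - \<phi> k x)) \<longlonglongrightarrow> 0"
  proof -
    have "Lp_norm \<Omega> 2 (\<lambda>x. w x - \<phi> k x) = (LINT x|lborel. norm (u x - \<phi> k x) powr 2) powr (1 / 2)" for k
      by (rule Lp_transfer(2)[OF S]) (use eq outside test_function_outside[OF test] in \<open>auto elim!: eventually_mono\<close>)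
    then show ?thesis using lim_u by (simp only: real_norm_def abs_powr_2) (subst tendsto_powr_half_0_iff, auto)
  qed
  moreover have "(\<lambda>k. Lp_norm \<Omega> 2 (\<lambda>x. weak_grad \<Omega> w x - grad (\<phi> k) x)) \<longlonglongrightarrow> 0"
  proof -
    have "Lp_norm \<Omega> 2 (\<lambda>x. weak_grad \<Omega> w x - grad (\<phi> k) x) = (LINT x|lborel. norm (v x - grad (\<phi> k) x) powr 2) powr (1 / 2)" for k
      by (rule Lp_transfer(2)[OF S]) (use wg outside test_function_outside[OF test] in \<open>auto elim!: eventually_mono\<close>)
    then show ?thesis using lim_v by (simp only: norm_powr_2) (subst tendsto_powr_half_0_iff, auto)
  qed
  ultimately show "w \<in> W12_0 \<Omega>"
    using L2w L2v hw out test unfolding W12_0_def W12_def by blast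
qed

text \<open>Two ways for \<zeta> (u - c) to have zero trace: c = 0, where \<zeta> may cross the
  boundary, or \<zeta> supported inside \<Omega>, where any constant may be subtracted. They
  correspond to boundary and interior balls. The approximants are treated in the same way as u, and
  the gradient is given by the product rule.\<close>

lemma zero_trace_mult:
  assumes \<zeta>: "smooth \<zeta>" "\<And>x. \<bar>\<zeta> x\<bar> \<le> B" "\<And>x. norm (grad \<zeta> x) \<le> B"
    and c: "c = 0 \<or> test_function \<Omega> \<zeta>"
  shows "zero_trace \<Omega> (\<lambda>x. \<zeta> x * (u x - c)) (\<lambda>x. \<zeta> x *\<^sub>R v x + (u x - c) *\<^sub>R grad \<zeta> x) (\<lambda>k x. \<zeta> x * (\<phi> k x - c))"
proof
  have [measurable]: "\<zeta> \<in> borel_measurable borel" "grad \<zeta> \<in> borel_measurable borel"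
    using \<zeta>(1) by (auto intro: smooth_measurable grad_measurable)
  show "open \<Omega>" "bounded \<Omega>" by (fact open_Omega bounded_Omega)+
  show "(\<lambda>x. \<zeta> x * (u x - c)) \<in> borel_measurable borel" by measurable
  show "(\<lambda>x. \<zeta> x *\<^sub>R v x + (u x - c) *\<^sub>R grad \<zeta> x) \<in> borel_measurable borel" by measurable
  have c0: "c * \<zeta> x = 0" "c *\<^sub>R grad \<zeta> x = 0" if "x \<notin> \<Omega>" for x
    using c test_function_outside[of \<Omega> \<zeta> x] that by auto
  show "\<zeta> x * (u x - c) = 0" if "x \<notin> \<Omega>" for x
    using c0(1)[OF that] outside(1)[OF that] by (simp add: algebra_simps)
  show "\<zeta> x *\<^sub>R v x + (u x - c) *\<^sub>R grad \<zeta> x = 0" if "x \<notin> \<Omega>" for x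
    using c0(2)[OF that] outside[OF that] by (simp add: algebra_simps)
  have i1: "integrable lborel (\<lambda>x. (norm (c * \<zeta> x))\<^sup>2)" "integrable lborel (\<lambda>x. (norm (c *\<^sub>R grad \<zeta> x))\<^sup>2)"
    using c test_function_integrable(2,4)[of \<Omega> \<zeta>] by (auto simp: power_mult_distrib)
  have n: "\<bar>norm (grad \<zeta> x)\<bar> \<le> B" for x using \<zeta>(3)[of x] by simp
  have vec: "(norm (y *\<^sub>R grad \<zeta> x))\<^sup>2 = (norm (norm (grad \<zeta> x) *\<^sub>R y))\<^sup>2" for x and y :: real
    by (simp add: power_mult_distrib mult.commute)
  have sr: "integrable lborel (\<lambda>x. (norm (y x))\<^sup>2) \<Longrightarrow> y \<in> borel_measurable borel \<Longrightarrow> integrable lborel (\<lambda>x. (norm (y x *\<^sub>R grad \<zeta> x))\<^sup>2)"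
    "integrable lborel (\<lambda>x. (norm (y x))\<^sup>2) \<Longrightarrow> y \<in> borel_measurable borel \<Longrightarrow> (LINT x|lborel. (norm (y x *\<^sub>R grad \<zeta> x))\<^sup>2) \<le> B\<^sup>2 * (LINT x|lborel. (norm (y x))\<^sup>2)" for y :: "real^'n \<Rightarrow> real"
    unfolding vec using square_integrable_mult_bounded[of "\<lambda>x. norm (grad \<zeta> x)" lborel y B] n by auto
  show "integrable lborel (\<lambda>x. (\<zeta> x * (u x - c))\<^sup>2)"
  proof -
    have "integrable lborel (\<lambda>x. (norm (\<zeta> x *\<^sub>R u x + - (c * \<zeta> x)))\<^sup>2)"
      by (intro square_integrable_add(1) square_integrable_mult_bounded(1)[where B=B]) (use \<zeta>(2) sq_u i1 in auto)
    then show ?thesis by (simp add: algebra_simps)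
  qed
  show "integrable lborel (\<lambda>x. (norm (\<zeta> x *\<^sub>R v x + (u x - c) *\<^sub>R grad \<zeta> x))\<^sup>2)"
  proof -
    have "integrable lborel (\<lambda>x. (norm (\<zeta> x *\<^sub>R v x + (u x *\<^sub>R grad \<zeta> x + - (c *\<^sub>R grad \<zeta> x))))\<^sup>2)"
      by (intro square_integrable_add(1) square_integrable_mult_bounded(1)[where B=B] sr(1)) (use \<zeta>(2) sq_u sq_v i1 in auto)
    then show ?thesis by (simp add: algebra_simps)
  qed
  show "test_function \<Omega> (\<lambda>x. \<zeta> x * (\<phi> k x - c))" for k
    using c
  proof
    assume "c = 0"
    then show ?thesis using test_function_mult[OF test, of \<zeta> k] \<zeta>(1) by (simp add: smooth_def)
  next
    assume t: "test_function \<Omega> \<zeta>"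
    have "smooth (\<lambda>x. \<phi> k x - c)" by (intro smooth_diff smooth_phi smooth_const)
    then have "test_function \<Omega> (\<lambda>x. (\<phi> k x - c) * \<zeta> x)" by (intro test_function_mult[OF t]) (simp add: smooth_def)
    then show ?thesis by (simp add: mult.commute)
  qed
  show "(\<lambda>k. LINT x|lborel. (\<zeta> x * (u x - c) - \<zeta> x * (\<phi> k x - c))\<^sup>2) \<longlonglongrightarrow> 0"
  proof (rule tendsto_sandwich[OF _ _ tendsto_const tendsto_mult_right_zero[OF lim_u, of "B\<^sup>2"]])
    show "eventually (\<lambda>k. (LINT x|lborel. (\<zeta> x * (u x - c) - \<zeta> x * (\<phi> k x - c))\<^sup>2) \<le> B\<^sup>2 * (LINT x|lborel. (u x - \<phi> k x)\<^sup>2)) sequentially"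
    proof (rule always_eventually, rule allI)
      fix k
      have "(LINT x|lborel. (norm (\<zeta> x *\<^sub>R (u x - \<phi> k x)))\<^sup>2) \<le> B\<^sup>2 * (LINT x|lborel. (norm (u x - \<phi> k x))\<^sup>2)"
        by (rule square_integrable_mult_bounded(2)) (use \<zeta>(2) sq_diff in auto)
      then show "(LINT x|lborel. (\<zeta> x * (u x - c) - \<zeta> x * (\<phi> k x - c))\<^sup>2) \<le> B\<^sup>2 * (LINT x|lborel. (u x - \<phi> k x)\<^sup>2)"
        by (simp add: right_diff_distrib[symmetric])
    qed
  qed auto
  show "(\<lambda>k. LINT x|lborel. (norm (\<zeta> x *\<^sub>R v x + (u x - c) *\<^sub>R grad \<zeta> x - grad (\<lambda>x. \<zeta> x * (\<phi> k x - c)) x))\<^sup>2) \<longlonglongrightarrow> 0"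
  proof (rule tendsto_sandwich[OF _ _ tendsto_const])
    have "(\<lambda>k. 2 * (B\<^sup>2 * (LINT x|lborel. (norm (v x - grad (\<phi> k) x))\<^sup>2)) + 2 * (B\<^sup>2 * (LINT x|lborel. (u x - \<phi> k x)\<^sup>2))) \<longlonglongrightarrow> 2 * (B\<^sup>2 * 0) + 2 * (B\<^sup>2 * 0)"
      by (intro tendsto_intros lim_u lim_v)
    then show "(\<lambda>k. 2 * (B\<^sup>2 * (LINT x|lborel. (norm (v x - grad (\<phi> k) x))\<^sup>2)) + 2 * (B\<^sup>2 * (LINT x|lborel. (u x - \<phi> k x)\<^sup>2))) \<longlonglongrightarrow> 0" by simp
    show "eventually (\<lambda>k. (LINT x|lborel. (norm (\<zeta> x *\<^sub>R v x + (u x - c) *\<^sub>R grad \<zeta> x - grad (\<lambda>x. \<zeta> x * (\<phi> k x - c)) x))\<^sup>2)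
      \<le> 2 * (B\<^sup>2 * (LINT x|lborel. (norm (v x - grad (\<phi> k) x))\<^sup>2)) + 2 * (B\<^sup>2 * (LINT x|lborel. (u x - \<phi> k x)\<^sup>2))) sequentially"
    proof (rule always_eventually, rule allI)
      fix k
      have g: "grad (\<lambda>x. \<zeta> x * (\<phi> k x - c)) x = \<zeta> x *\<^sub>R grad (\<phi> k) x + (\<phi> k x - c) *\<^sub>R grad \<zeta> x" for x
        using grad_mult[OF \<zeta>(1) smooth_diff[OF smooth_phi smooth_const]] by (simp add: grad_diff_const[OF smooth_phi])
      have e: "\<zeta> x *\<^sub>R v x + (u x - c) *\<^sub>R grad \<zeta> x - grad (\<lambda>x. \<zeta> x * (\<phi> k x - c)) x
         = \<zeta> x *\<^sub>R (v x - grad (\<phi> k) x) + (u x - \<phi> k x) *\<^sub>R grad \<zeta> x" for x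
        unfolding g by (simp add: algebra_simps)
      have a: "integrable lborel (\<lambda>x. (norm (\<zeta> x *\<^sub>R (v x - grad (\<phi> k) x)))\<^sup>2)"
        "(LINT x|lborel. (norm (\<zeta> x *\<^sub>R (v x - grad (\<phi> k) x)))\<^sup>2) \<le> B\<^sup>2 * (LINT x|lborel. (norm (v x - grad (\<phi> k) x))\<^sup>2)"
        by (rule square_integrable_mult_bounded; use \<zeta>(2) sq_diff in auto)+
      have b: "integrable lborel (\<lambda>x. (norm ((u x - \<phi> k x) *\<^sub>R grad \<zeta> x))\<^sup>2)"
        "(LINT x|lborel. (norm ((u x - \<phi> k x) *\<^sub>R grad \<zeta> x))\<^sup>2) \<le> B\<^sup>2 * (LINT x|lborel. (norm (u x - \<phi> k x))\<^sup>2)"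
        by (rule sr; use sq_diff in auto)+
      have "(LINT x|lborel. (norm (\<zeta> x *\<^sub>R (v x - grad (\<phi> k) x) + (u x - \<phi> k x) *\<^sub>R grad \<zeta> x))\<^sup>2)
        \<le> 2 * (LINT x|lborel. (norm (\<zeta> x *\<^sub>R (v x - grad (\<phi> k) x)))\<^sup>2) + 2 * (LINT x|lborel. (norm ((u x - \<phi> k x) *\<^sub>R grad \<zeta> x))\<^sup>2)"
        by (rule square_integrable_add(2)[OF _ _ a(1) b(1)]) measurable
      also have "\<dots> \<le> 2 * (B\<^sup>2 * (LINT x|lborel. (norm (v x - grad (\<phi> k) x))\<^sup>2)) + 2 * (B\<^sup>2 * (LINT x|lborel. (norm (u x - \<phi> k x))\<^sup>2))"
        by (intro add_mono mult_left_mono a(2) b(2)) auto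
      finally show "(LINT x|lborel. (norm (\<zeta> x *\<^sub>R v x + (u x - c) *\<^sub>R grad \<zeta> x - grad (\<lambda>x. \<zeta> x * (\<phi> k x - c)) x))\<^sup>2)
      \<le> 2 * (B\<^sup>2 * (LINT x|lborel. (norm (v x - grad (\<phi> k) x))\<^sup>2)) + 2 * (B\<^sup>2 * (LINT x|lborel. (u x - \<phi> k x)\<^sup>2))"
        unfolding e by simp
    qed
  qed auto
qed

end

lemma borel_representative_on:
  fixes f :: "'a::euclidean_space \<Rightarrow> 'b::euclidean_space"
  assumes S: "S \<in> sets borel" and f: "f \<in> borel_measurable (lebesgue_on S)"
  obtains g where "g \<in> borel_measurable borel" "\<And>x. x \<notin> S \<Longrightarrow> g x = 0" "AE x in lebesgue. x \<in> S \<longrightarrow> f x = g x"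
proof -
  have "(\<lambda>x. indicator S x *\<^sub>R f x) \<in> borel_measurable lebesgue"
    using f S by (subst (asm) borel_measurable_restrict_space_iff) auto
  then obtain g where g: "g \<in> borel_measurable borel" "AE x in lebesgue. indicator S x *\<^sub>R f x = g x"
    using borel_representative by blast
  have "(\<lambda>x. indicator S x *\<^sub>R g x) \<in> borel_measurable borel" using g(1) S by measurable
  moreover have "AE x in lebesgue. x \<in> S \<longrightarrow> f x = indicator S x *\<^sub>R g x"
    using g(2) by (rule eventually_mono) (auto simp: indicator_def)
  ultimately show ?thesis by (intro that[of "\<lambda>x. indicator S x *\<^sub>R g x"]) auto
qed

text \<open>Opens the definition of the space: from here on all estimates concern Borel functions on
  the whole space, and limits of norms become limits of integrals of squares.\<close>

lemma W12_0_zero_trace: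
  fixes w :: "real^'n \<Rightarrow> real"
  assumes \<Omega>: "open \<Omega>" "bounded \<Omega>" and w: "w \<in> W12_0 \<Omega>"
  obtains u v \<phi> where "zero_trace \<Omega> u v \<phi>" "AE x in lebesgue. w x = u x"
    "AE x in lebesgue. x \<in> \<Omega> \<longrightarrow> weak_grad \<Omega> w x = v x"
proof -
  have S: "\<Omega> \<in> sets lebesgue" and SB: "\<Omega> \<in> sets borel" using \<Omega> by (auto intro: borel_open)
  have L: "w \<in> Lp \<Omega> 2" "weak_grad \<Omega> w \<in> Lp \<Omega> 2" "\<And>x. x \<notin> \<Omega> \<Longrightarrow> w x = 0"
    using w by (auto simp: W12_0_def W12_def)
  obtain \<phi> where \<phi>: "\<And>k::nat. test_function \<Omega> (\<phi> k)"
    and l1: "(\<lambda>k. Lp_norm \<Omega> 2 (\<lambda>x. w x - \<phi> k x)) \<longlonglongrightarrow> 0"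
    and l2: "(\<lambda>k. Lp_norm \<Omega> 2 (\<lambda>x. weak_grad \<Omega> w x - grad (\<phi> k) x)) \<longlonglongrightarrow> 0"
    using w by (auto simp: W12_0_def)
  have "w \<in> borel_measurable (lebesgue_on \<Omega>)" using L(1) by (simp add: Lp_def)
  then obtain u where u: "u \<in> borel_measurable borel" "\<And>x. x \<notin> \<Omega> \<Longrightarrow> u x = 0" "AE x in lebesgue. x \<in> \<Omega> \<longrightarrow> w x = u x"
  proof (rule borel_representative_on[OF SB], goal_cases)
    case (1 g)
    show ?case by (rule 1(1)) fact+
  qed
  have "weak_grad \<Omega> w \<in> borel_measurable (lebesgue_on \<Omega>)" using L(2) by (simp add: Lp_def)
  then obtain v where v: "v \<in> borel_measurable borel" "\<And>x. x \<notin> \<Omega> \<Longrightarrow> v x = 0" "AE x in lebesgue. x \<in> \<Omega> \<longrightarrow> weak_grad \<Omega> w x = v x"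
  proof (rule borel_representative_on[OF SB], goal_cases)
    case (1 g)
    show ?case by (rule 1(1)) fact+
  qed
  have m: "\<phi> k \<in> borel_measurable borel" "grad (\<phi> k) \<in> borel_measurable borel" for k
    using smooth_test_function[OF \<phi>] by (auto intro: smooth_measurable grad_measurable)
  have "zero_trace \<Omega> u v \<phi>"
  proof
    show "integrable lborel (\<lambda>x. (u x)\<^sup>2)" using Lp_transfer(1)[OF S u(1,3,2), of 2] L(1) by simp
    show "integrable lborel (\<lambda>x. (norm (v x))\<^sup>2)" using Lp_transfer(1)[OF S v(1,3,2), of 2] L(2) by simp
    have "Lp_norm \<Omega> 2 (\<lambda>x. w x - \<phi> k x) = (LINT x|lborel. norm (u x - \<phi> k x) powr 2) powr (1 / 2)" for k
      by (rule Lp_transfer(2)[OF S]) (use u m test_function_outside[OF \<phi>] in \<open>auto elim!: eventually_mono\<close>)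
    then have "(\<lambda>k. (LINT x|lborel. (u x - \<phi> k x)\<^sup>2) powr (1 / 2)) \<longlonglongrightarrow> 0"
      using l1 by (simp only: real_norm_def abs_powr_2)
    then show "(\<lambda>k. LINT x|lborel. (u x - \<phi> k x)\<^sup>2) \<longlonglongrightarrow> 0" by (subst (asm) tendsto_powr_half_0_iff) auto
    have "Lp_norm \<Omega> 2 (\<lambda>x. weak_grad \<Omega> w x - grad (\<phi> k) x) = (LINT x|lborel. norm (v x - grad (\<phi> k) x) powr 2) powr (1 / 2)" for k
      by (rule Lp_transfer(2)[OF S]) (use v m test_function_outside[OF \<phi>] in \<open>auto elim!: eventually_mono\<close>)
    then have "(\<lambda>k. (LINT x|lborel. (norm (v x - grad (\<phi> k) x))\<^sup>2) powr (1 / 2)) \<longlonglongrightarrow> 0"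
      using l2 by (simp only: norm_powr_2)
    then show "(\<lambda>k. LINT x|lborel. (norm (v x - grad (\<phi> k) x))\<^sup>2) \<longlonglongrightarrow> 0" by (subst (asm) tendsto_powr_half_0_iff) auto
  qed (use \<Omega> u v \<phi> in auto)
  moreover have "AE x in lebesgue. w x = u x"
    using u(3) by (rule eventually_mono) (metis L(3) u(2))
  ultimately show ?thesis using that v(3) by blast
qed

section \<open>Structure conditions\<close>

text \<open>Measurability of the coefficients along the solution: for a simple function in place of
  y only finitely many slices of F occur, and continuity in the second argument carries this to the
  limit.\<close>

lemma caratheodory_measurable:
  fixes F :: "'a::euclidean_space \<Rightarrow> 'b::euclidean_space \<Rightarrow> 'c::euclidean_space"
  assumes S: "S \<in> sets lebesgue" and F: "caratheodory S F" and y: "y \<in> borel_measurable (lebesgue_on S)"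
  shows "(\<lambda>x. F x (y x)) \<in> borel_measurable (lebesgue_on S)"
proof -
  let ?M = "lebesgue_on S"
  obtain s where s: "\<And>n. simple_function ?M (s n)" "\<And>x. x \<in> space ?M \<Longrightarrow> (\<lambda>n. s n x) \<longlonglongrightarrow> y x"
    using borel_measurable_implies_sequence_metric[OF y, of 0] by metis
  have G: "(\<lambda>x. F x (s n x)) \<in> borel_measurable ?M" for n
  proof (rule measurable_compose_countable'[where I="s n ` space ?M" and f="\<lambda>z x. F x z"])
    show "(\<lambda>x. F x z) \<in> borel_measurable ?M" for z using F by (auto simp: caratheodory_def)
    show "s n \<in> ?M \<rightarrow>\<^sub>M count_space (s n ` space ?M)"
      using s(1)[of n] by (subst measurable_count_space_eq2) (auto simp: simple_function_def)
    show "countable (s n ` space ?M)" using s(1)[of n] by (auto simp: simple_function_def intro: countable_finite)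
  qed
  define H where "H n x = indicator S x *\<^sub>R F x (s n x)" for n x
  have H: "H n \<in> borel_measurable lebesgue" for n
    using G[of n] S unfolding H_def by (subst (asm) borel_measurable_restrict_space_iff) auto
  have "AE x in lebesgue. x \<in> S \<longrightarrow> continuous_on UNIV (F x)"
    using F S by (auto simp: caratheodory_def AE_restrict_space_iff)
  then have ae: "AE x in lebesgue. lim (\<lambda>n. H n x) = indicator S x *\<^sub>R F x (y x)"
  proof eventually_elim
    case (elim x)
    have "(\<lambda>n. H n x) \<longlonglongrightarrow> indicator S x *\<^sub>R F x (y x)"
    proof (cases "x \<in> S")
      case True
      then have "isCont (F x) (y x)" using elim by (simp add: continuous_on_eq_continuous_at)
      have "(\<lambda>n. s n x) \<longlonglongrightarrow> y x" using s(2)[of x] True by simp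
      from isCont_tendsto_compose[OF \<open>isCont (F x) (y x)\<close> this] True show ?thesis by (simp add: H_def)
    qed (simp add: H_def)
    then show ?case by (rule limI)
  qed
  have "(\<lambda>x. lim (\<lambda>n. H n x)) \<in> borel_measurable lebesgue"
    by (rule borel_measurable_lim_metric[OF H])
  from borel_measurable_AE[OF this ae]
  have "(\<lambda>x. indicator S x *\<^sub>R F x (y x)) \<in> borel_measurable lebesgue" .
  then show ?thesis using S by (subst borel_measurable_restrict_space_iff) auto
qed

section \<open>Balls in the complement of a Lipschitz domain\<close>

lemma norm_hproj_le:
  assumes "norm e = 1"
  shows "norm (hproj e w) \<le> norm w"
proof -
  have ee: "e \<bullet> e = 1" using assms by (simp add: norm_eq_1)
  have "(norm (hproj e w))\<^sup>2 = (norm w)\<^sup>2 - (w \<bullet> e)\<^sup>2"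
    unfolding power2_norm_eq_inner hproj_def by (simp add: inner_diff_left inner_diff_right ee inner_commute power2_eq_square)
  then have "(norm (hproj e w))\<^sup>2 \<le> (norm w)\<^sup>2" by simp
  then show ?thesis by (rule power2_le_imp_le) simp
qed

lemma hproj_in_hyperplane: "norm e = 1 \<Longrightarrow> hproj e w \<in> hyperplane e"
  by (simp add: hyperplane_def hproj_def inner_diff_left norm_eq_1)

text \<open>If the ball of radius 2 r meets both \<Omega> and its complement, it contains a boundary
  point. Going down from there by r/2 along the axis leads below the graph, and the Lipschitz bound
  keeps a whole ball of radius \<kappa> r outside \<Omega>, with \<kappa> depending on \<beta>
  alone. The mean of u over that ball is 0, which makes the mean value Poincare inequality usable at
  the boundary.\<close>

lemma exterior_ball:
  fixes \<Omega> :: "'a::euclidean_space set"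
  assumes \<Omega>: "bounded_lipschitz_domain \<beta> \<Omega>" and \<beta>: "0 < \<beta>"
  obtains R \<kappa> where "0 < R" "0 < \<kappa>" "\<kappa> \<le> 1" "\<And>x r. 0 < r \<Longrightarrow> r \<le> R \<Longrightarrow>
    \<exists>q. ball q (\<kappa> * r) \<subseteq> ball x (3 * r) \<and> (cball x (2 * r) \<subseteq> \<Omega> \<or> ball q (\<kappa> * r) \<inter> \<Omega> = {})"
proof -
  obtain R where R: "0 < R" and L: "\<And>x0 r. x0 \<in> frontier \<Omega> \<Longrightarrow> 0 < r \<Longrightarrow> r \<le> R \<Longrightarrow>
        (\<exists>e (\<phi> :: 'a \<Rightarrow> real). norm e = 1 \<and> (\<exists>L. L-lipschitz_on (hyperplane e) \<phi>) \<and>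
           \<Omega> \<inter> ball x0 r = {x \<in> ball x0 r. x \<bullet> e > \<phi> (hproj e x)} \<and>
           \<beta>-lipschitz_on (hyperplane e \<inter> ball (hproj e x0) r) \<phi>)"
    using \<Omega> unfolding bounded_lipschitz_domain_def assumption_L_def by meson
  have op: "open \<Omega>" using \<Omega> by (simp add: bounded_lipschitz_domain_def)
  \<comment> \<open>Moving by w from the centre of the exterior ball raises the height over the
    graph by at most (1 + \<beta>) |w|, which must not exceed the depth r/2; hence (1 + \<beta>)
    \<kappa> = 1/2.\<close>
  define \<kappa> where "\<kappa> = 1 / (2 * (1 + \<beta>))"
  have \<kappa>: "0 < \<kappa>" "\<kappa> \<le> 1 / 2" "(1 + \<beta>) * \<kappa> = 1 / 2" using \<beta> by (auto simp: \<kappa>_def field_simps)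
  have "\<exists>q. ball q (\<kappa> * r) \<subseteq> ball x (3 * r) \<and> (cball x (2 * r) \<subseteq> \<Omega> \<or> ball q (\<kappa> * r) \<inter> \<Omega> = {})"
    if r: "0 < r" "r \<le> R" for x r
  proof (cases "cball x (2 * r) \<subseteq> \<Omega> \<or> cball x (2 * r) \<inter> \<Omega> = {}")
    case True
    have "\<kappa> * r \<le> 1 * r" using r \<kappa>(2) by (intro mult_right_mono) auto
    then have kr: "\<kappa> * r \<le> 3 * r" "\<kappa> * r \<le> 2 * r" using r by linarith+
    have "ball x (\<kappa> * r) \<subseteq> ball x (3 * r)" "ball x (\<kappa> * r) \<subseteq> cball x (2 * r)"
      using subset_ball[OF kr(1)] order.trans[OF ball_subset_cball subset_cball[OF kr(2)]] by blast+
    then show ?thesis using True by blast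
  next
    case False
    then have "cball x (2 * r) \<inter> frontier \<Omega> \<noteq> {}"
      by (intro connected_Int_frontier) auto
    then obtain x1 where x1: "dist x x1 \<le> 2 * r" "x1 \<in> frontier \<Omega>" by auto
    have x1\<Omega>: "x1 \<notin> \<Omega>" using x1(2) op frontier_disjoint_eq by blast
    obtain e and \<phi> :: "'a \<Rightarrow> real" where e: "norm e = 1"
      and eq: "\<Omega> \<inter> ball x1 r = {x \<in> ball x1 r. x \<bullet> e > \<phi> (hproj e x)}"
      and lip: "\<beta>-lipschitz_on (hyperplane e \<inter> ball (hproj e x1) r) \<phi>"
      using L[OF x1(2) r] by blast
    have ee: "e \<bullet> e = 1" using e by (simp add: norm_eq_1)
    have b1: "x1 \<bullet> e \<le> \<phi> (hproj e x1)"
    proof -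
      have "x1 \<in> ball x1 r" using r by simp
      then show ?thesis using eq x1\<Omega> by force
    qed
    define q where "q = x1 - (r / 2) *\<^sub>R e"
    have q: "y \<in> ball x1 r \<and> y \<notin> \<Omega>" if y: "y \<in> ball q (\<kappa> * r)" for y
    proof -
      define w where "w = y - q"
      have w: "norm w < \<kappa> * r" using y by (simp add: w_def dist_norm norm_minus_commute)
      have kr: "\<kappa> * r \<le> 1 / 2 * r" using r \<kappa>(2) by (intro mult_right_mono) auto
      have yw: "y = x1 - (r / 2) *\<^sub>R e + w" by (simp add: w_def q_def)
      have "norm (x1 - y) \<le> norm ((r / 2) *\<^sub>R e) + norm w"
        unfolding yw using norm_triangle_ineq4[of "(r / 2) *\<^sub>R e" w] by simp
      also have "norm ((r / 2) *\<^sub>R e) = r / 2" using e r by simp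
      also have "r / 2 + norm w < r / 2 + \<kappa> * r" using w by simp
      also have "\<dots> \<le> r / 2 + 1 / 2 * r" using kr by (rule add_left_mono)
      finally have yb: "y \<in> ball x1 r" by (simp add: dist_norm)
      have hy: "hproj e y = hproj e x1 + hproj e w"
        by (simp add: hproj_def yw inner_add_left inner_diff_left ee algebra_simps)
      have nw: "norm (hproj e w) \<le> norm w" by (rule norm_hproj_le[OF e])
      have "\<kappa> * r \<le> 1 * r" using r \<kappa>(2) by (intro mult_right_mono) auto
      then have "norm (hproj e w) < r" using nw w by linarith
      then have "hproj e y \<in> hyperplane e \<inter> ball (hproj e x1) r" "hproj e x1 \<in> hyperplane e \<inter> ball (hproj e x1) r"
        using hproj_in_hyperplane[OF e] r by (auto simp: hy dist_norm) (metis hproj_in_hyperplane[OF e] hy)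
      from lipschitz_onD[OF lip this] have "dist (\<phi> (hproj e y)) (\<phi> (hproj e x1)) \<le> \<beta> * norm (hproj e w)"
        by (simp add: hy dist_norm)
      also have "\<dots> \<le> \<beta> * norm w" using \<beta> nw by simp
      finally have l: "\<phi> (hproj e x1) \<le> \<phi> (hproj e y) + \<beta> * norm w" by (simp add: dist_real_def abs_le_iff)
      have "y \<bullet> e = x1 \<bullet> e - r / 2 + w \<bullet> e" by (simp add: yw inner_add_left inner_diff_left ee)
      also have "w \<bullet> e \<le> norm w" using Cauchy_Schwarz_ineq2[of w e] e by simp
      finally have "y \<bullet> e \<le> \<phi> (hproj e y) + ((1 + \<beta>) * norm w - r / 2)" using b1 l by (simp add: algebra_simps)
      moreover have "(1 + \<beta>) * norm w \<le> (1 + \<beta>) * (\<kappa> * r)" using w \<beta> by (intro mult_left_mono) auto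
      moreover have "(1 + \<beta>) * (\<kappa> * r) = r / 2" using \<kappa>(3) by (simp add: mult.assoc[symmetric])
      ultimately have "\<not> y \<bullet> e > \<phi> (hproj e y)" by linarith
      then show ?thesis using eq yb by blast
    qed
    have "ball q (\<kappa> * r) \<subseteq> ball x (3 * r)"
    proof
      fix y assume "y \<in> ball q (\<kappa> * r)"
      then have "dist x1 y < r" using q by auto
      then show "y \<in> ball x (3 * r)" using x1(1) dist_triangle[of x y x1] by simp
    qed
    then show ?thesis using q by blast
  qed
  then show ?thesis using that[of R \<kappa>] R \<kappa> by simp
qed

text \<open>Cut-off for the ball of radius 2 r: the argument of \<open>flat\<close> is positive
  exactly there and at least 1/2 on the ball of radius r. The value on the inner ball is thus not 1
  but at least exp(-2), which the Caccioppoli constant pays for.\<close>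

definition bump :: "real^'n \<Rightarrow> real \<Rightarrow> real^'n \<Rightarrow> real" where
  "bump x0 r x = flat 0 (1 - 1 / (4 * r\<^sup>2) * (norm (x - x0))\<^sup>2)"

lemma smooth_bump: "smooth (bump x0 r)"
  unfolding smooth_def bump_def[abs_def]
  by (intro allI Ck_flat_comp Ck_diff Ck_cmult Ck_norm_sq Ck_const)

lemma bump_bounds: "0 \<le> bump x0 r x" "bump x0 r x \<le> 1"
  by (simp_all add: bump_def flat_nonneg flat_0_le_1)

text \<open>\<open>flat 2\<close> is the derivative of \<open>flat 0\<close>. With s = 1/t the claim
  reads s^2 exp(-s) \<le> 2 and follows from the quadratic Taylor term of exp.\<close>

lemma flat_2_le: "flat 2 t \<le> 2"
proof (cases "0 < t")
  case True
  have "(1 / t)\<^sup>2 / 2 \<le> exp (1 / t)"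
    using exp_lower_Taylor_quadratic[of "1 / t"] True by (smt (verit) divide_nonneg_pos)
  then have "(1 / t)\<^sup>2 \<le> 2 * exp (1 / t)" by simp
  then have "(1 / t)\<^sup>2 * exp (- (1 / t)) \<le> 2 * exp (1 / t) * exp (- (1 / t))" by (intro mult_right_mono) auto
  also have "2 * exp (1 / t) * exp (- (1 / t)) = 2" by (simp add: mult.assoc mult_exp_exp)
  finally show ?thesis using True by (simp add: flat_def)
qed (simp add: flat_def)

lemma grad_bump:
  "grad (bump x0 r) x = flat 2 (1 - 1 / (4 * r\<^sup>2) * (norm (x - x0))\<^sup>2) *\<^sub>R (- (1 / (2 * r\<^sup>2)) *\<^sub>R (x - x0))"
proof (rule grad_eqI)
  let ?q = "\<lambda>x. 1 - 1 / (4 * r\<^sup>2) * (norm (x - x0))\<^sup>2"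
  have "((\<lambda>x. 1 - k * (norm (x - x0))\<^sup>2) has_derivative (\<lambda>h. - (2 * k) * ((x - x0) \<bullet> h))) (at x)" for k
    unfolding power2_norm_eq_inner
    by (auto intro!: derivative_eq_intros simp: inner_commute algebra_simps)
  from this[of "1 / (4 * r\<^sup>2)"]
  have q: "(?q has_derivative (\<lambda>h. - (1 / (2 * r\<^sup>2)) * ((x - x0) \<bullet> h))) (at x)"
    by simp
  then have d: "?q differentiable (at x)" using differentiable_def by blast
  have f: "frechet_derivative ?q (at x) h = - (1 / (2 * r\<^sup>2)) * ((x - x0) \<bullet> h)" for h
    by (rule has_derivative_imp_frechet_eq[OF q])
  have "(bump x0 r has_derivative (\<lambda>h. flat 2 (?q x) * (- (1 / (2 * r\<^sup>2)) * ((x - x0) \<bullet> h)))) (at x)"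
    using has_derivative_flat_comp[OF d, of 0] unfolding f bump_def[abs_def] by (simp add: numeral_2_eq_2)
  then show "(bump x0 r has_derivative (\<lambda>h. (flat 2 (?q x) *\<^sub>R (- (1 / (2 * r\<^sup>2)) *\<^sub>R (x - x0))) \<bullet> h)) (at x)"
    by simp
qed

lemma norm_grad_bump_le:
  assumes r: "0 < r"
  shows "norm (grad (bump x0 r) x) \<le> 2 / r"
proof (cases "norm (x - x0) < 2 * r")
  case True
  have "norm (grad (bump x0 r) x) = flat 2 (1 - 1 / (4 * r\<^sup>2) * (norm (x - x0))\<^sup>2) * (1 / (2 * r\<^sup>2) * norm (x - x0))"
    unfolding grad_bump using flat_nonneg by simp
  also have "\<dots> \<le> 2 * (1 / (2 * r\<^sup>2) * (2 * r))"
    using True flat_2_le flat_nonneg by (intro mult_mono) auto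
  also have "\<dots> = 2 / r" using r by (simp add: power2_eq_square)
  finally show ?thesis .
next
  case False
  then have "(2 * r)\<^sup>2 \<le> (norm (x - x0))\<^sup>2" using r by (intro power_mono) auto
  then have "1 - 1 / (4 * r\<^sup>2) * (norm (x - x0))\<^sup>2 \<le> 0" using r by (simp add: field_simps)
  then show ?thesis using r unfolding grad_bump by (simp add: flat_def)
qed

lemma bump_outside:
  assumes r: "0 < r" and x: "x \<notin> ball x0 (2 * r)"
  shows "bump x0 r x = 0" "grad (bump x0 r) x = 0"
proof -
  have "(2 * r)\<^sup>2 \<le> (norm (x - x0))\<^sup>2" using r x by (intro power_mono) (auto simp: dist_norm norm_minus_commute)
  then have "1 - 1 / (4 * r\<^sup>2) * (norm (x - x0))\<^sup>2 \<le> 0" using r by (simp add: field_simps)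
  then show "bump x0 r x = 0" "grad (bump x0 r) x = 0" unfolding grad_bump by (simp_all add: bump_def flat_def)
qed

lemma bump_lower:
  assumes r: "0 < r" and x: "x \<in> ball x0 r"
  shows "exp (- 2) \<le> bump x0 r x"
proof -
  have "(norm (x - x0))\<^sup>2 \<le> r\<^sup>2" using x by (intro power_mono) (auto simp: dist_norm norm_minus_commute)
  then have "(norm (x - x0))\<^sup>2 \<le> 2 * r\<^sup>2" using zero_le_power2[of r] by linarith
  then have q: "1 / 2 \<le> 1 - 1 / (4 * r\<^sup>2) * (norm (x - x0))\<^sup>2" using r by (simp add: field_simps)
  then have "1 / (1 - 1 / (4 * r\<^sup>2) * (norm (x - x0))\<^sup>2) \<le> 1 / (1 / 2)" by (intro divide_left_mono) auto
  then show ?thesis using q by (simp add: bump_def flat_def)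
qed

text \<open>Young's inequality for the exponents \<gamma>/(\<gamma> - 1) and \<gamma>, by comparing
  w with \<epsilon> h^(2/\<gamma>): if w is smaller it is replaced and the powers of h add up to 2;
  otherwise the power of h is replaced and those of w add up to \<gamma>.\<close>

lemma young_eps:
  assumes "1 < \<gamma>" "0 < \<epsilon>"
  obtains C where "0 \<le> C" "\<And>h w :: real. 0 \<le> h \<Longrightarrow> 0 \<le> w \<Longrightarrow> h powr (2 * (1 - 1 / \<gamma>)) * w \<le> \<epsilon> * h\<^sup>2 + C * w powr \<gamma>"
proof -
  have "h powr (2 * (1 - 1 / \<gamma>)) * w \<le> \<epsilon> * h\<^sup>2 + (1 / \<epsilon>) powr (\<gamma> - 1) * w powr \<gamma>" if h: "0 \<le> h" "0 \<le> w" for h w :: real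
  proof (cases "w \<le> \<epsilon> * h powr (2 / \<gamma>)")
    case True
    have "h powr (2 * (1 - 1 / \<gamma>)) * w \<le> h powr (2 * (1 - 1 / \<gamma>)) * (\<epsilon> * h powr (2 / \<gamma>))"
      using True by (intro mult_left_mono) auto
    also have "\<dots> = \<epsilon> * (h powr (2 * (1 - 1 / \<gamma>)) * h powr (2 / \<gamma>))" by (rule mult.left_commute)
    also have "h powr (2 * (1 - 1 / \<gamma>)) * h powr (2 / \<gamma>) = h powr (2 * (1 - 1 / \<gamma>) + 2 / \<gamma>)" by (rule powr_add[symmetric])
    also have "2 * (1 - 1 / \<gamma>) + 2 / \<gamma> = 2" using assms by (simp add: field_simps)
    finally show ?thesis using h by (simp add: add_increasing2)
  next
    case False
    then have w0: "0 < w" using assms by (smt (verit) mult_nonneg_nonneg powr_ge_zero)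
    have "h powr (2 / \<gamma>) \<le> w / \<epsilon>" using False assms by (simp add: field_simps)
    then have "(h powr (2 / \<gamma>)) powr (\<gamma> - 1) \<le> (w / \<epsilon>) powr (\<gamma> - 1)" using assms by (intro powr_mono2) auto
    moreover have "(h powr (2 / \<gamma>)) powr (\<gamma> - 1) = h powr (2 * (1 - 1 / \<gamma>))"
      using assms by (simp add: powr_powr field_simps)
    ultimately have "h powr (2 * (1 - 1 / \<gamma>)) * w \<le> (w / \<epsilon>) powr (\<gamma> - 1) * w" using h by (intro mult_right_mono) auto
    also have "\<dots> = (1 / \<epsilon>) powr (\<gamma> - 1) * w powr \<gamma>"
      using w0 assms by (simp add: powr_divide powr_diff)
    finally show ?thesis using h assms by (simp add: add_increasing)
  qed
  then show ?thesis using that[of "(1 / \<epsilon>) powr (\<gamma> - 1)"] by simp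
qed

text \<open>In the first inequality the larger of y and w replaces the other. The second is the
  first one for y^(1/(\<gamma> - 1)).\<close>

lemma powr_mult_le:
  assumes "1 < \<gamma>" "0 \<le> y" "0 \<le> (w :: real)"
  shows "y powr (\<gamma> - 1) * w \<le> y powr \<gamma> + w powr \<gamma>" "y * w \<le> y powr (\<gamma> / (\<gamma> - 1)) + w powr \<gamma>"
proof -
  have 1: "y powr (\<gamma> - 1) * w \<le> y powr \<gamma> + w powr \<gamma>" if "0 \<le> y" for y
  proof (cases "w \<le> y")
    case True
    have "y powr (\<gamma> - 1) * w \<le> y powr (\<gamma> - 1) * y" using True by (intro mult_left_mono) auto
    also have "\<dots> = y powr \<gamma>" using that assms by (cases "y = 0") (auto simp: powr_diff)
    finally show ?thesis by (simp add: add_increasing2)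
  next
    case False
    have "y powr (\<gamma> - 1) * w \<le> w powr (\<gamma> - 1) * w" using False assms that by (intro mult_right_mono powr_mono2) auto
    also have "\<dots> = w powr \<gamma>" using assms by (cases "w = 0") (auto simp: powr_diff)
    finally show ?thesis by (simp add: add_increasing)
  qed
  show "y powr (\<gamma> - 1) * w \<le> y powr \<gamma> + w powr \<gamma>" using 1[OF assms(2)] .
  have "(y powr (1 / (\<gamma> - 1))) powr (\<gamma> - 1) * w \<le> (y powr (1 / (\<gamma> - 1))) powr \<gamma> + w powr \<gamma>" by (rule 1) simp
  then show "y * w \<le> y powr (\<gamma> / (\<gamma> - 1)) + w powr \<gamma>" using assms by (simp add: powr_powr)
qed

lemma powr_add_le:
  assumes "0 \<le> s" "0 \<le> (x :: real)" "0 \<le> y"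
  shows "(x + y) powr s \<le> 2 powr s * (x powr s + y powr s)"
proof -
  have "(x + y) powr s \<le> (2 * max x y) powr s" using assms by (intro powr_mono2) auto
  also have "\<dots> = 2 powr s * (max x y) powr s" using assms by (simp add: powr_mult)
  also have "(max x y) powr s \<le> x powr s + y powr s" by (auto simp: max_def)
  finally show ?thesis by simp
qed

lemma norm_matrix_vector_le:
  fixes A :: "real^'n^'n"
  assumes "\<And>i j. \<bar>A $ i $ j\<bar> \<le> M"
  shows "norm (A *v p) \<le> (real CARD('n))\<^sup>2 * M * norm p"
proof -
  have "\<bar>(A *v p) $ i\<bar> \<le> real CARD('n) * (M * norm p)" for i
  proof -
    have "\<bar>(A *v p) $ i\<bar> \<le> (\<Sum>j\<in>UNIV. \<bar>A $ i $ j * p $ j\<bar>)" unfolding matrix_vector_mult_def by (simp add: sum_abs)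
    also have "\<dots> \<le> (\<Sum>j\<in>(UNIV :: 'n set). M * norm p)"
      using assms by (intro sum_mono) (auto simp: abs_mult intro!: mult_mono component_le_norm_cart order.trans[OF abs_ge_zero assms])
    finally show ?thesis by simp
  qed
  then have "(\<Sum>i\<in>UNIV. \<bar>(A *v p) $ i\<bar>) \<le> (\<Sum>i\<in>(UNIV :: 'n set). real CARD('n) * (M * norm p))" by (intro sum_mono)
  then show ?thesis using norm_le_l1_cart[of "A *v p"] by (simp add: power2_eq_square mult.assoc)
qed

text \<open>The Caccioppoli argument at one point, in plain numbers: p is the gradient, c the
  subtracted constant, \<eta> and g the cut-off and its gradient, and \<eta>^2 p + 2 \<eta> w g the
  gradient of the test function. K depends on neither r nor c. The two upper bounds secure the
  integrability of both sides of the weak formulation, since a Bochner integral that does not exist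
  is 0 by default and would carry no information; the lower bound is ellipticity minus
  errors.\<close>

lemma energy_pointwise:
  fixes \<mu> \<mu>1 \<mu>2 \<gamma> :: real
  assumes c: "0 < \<mu>" "0 < \<mu>1" "0 < \<mu>2" "1 < \<gamma>"
  obtains K where "0 < K" "\<And>(A :: real^'n^'n) p a b y c F G \<eta> g r. 0 < r \<Longrightarrow> 0 \<le> \<eta> \<Longrightarrow> \<eta> \<le> 1 \<Longrightarrow> norm g \<le> 2 / r \<Longrightarrow>
     (\<And>i j. \<bar>A $ i $ j\<bar> \<le> inverse \<mu>) \<Longrightarrow> (\<And>\<xi>. (\<Sum>i\<in>UNIV. \<Sum>j\<in>UNIV. A $ i $ j * \<xi> $ i * \<xi> $ j) \<ge> \<mu> * (norm \<xi>)\<^sup>2) \<Longrightarrow>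
     (\<And>i. \<bar>a $ i\<bar> \<le> \<mu>1 * (\<bar>y\<bar> powr (\<gamma> / 2) + F)) \<Longrightarrow>
     \<bar>b\<bar> \<le> \<mu>2 * (norm p powr (2 * (1 - 1 / \<gamma>)) + \<bar>y\<bar> powr (\<gamma> - 1) + G) \<Longrightarrow>
     (let w = y - c; I1 = (\<Sum>i\<in>UNIV. ((\<Sum>j\<in>UNIV. A $ i $ j * p $ j) + a $ i) * (\<eta>\<^sup>2 *\<^sub>R p + (w * (2 * \<eta>)) *\<^sub>R g) $ i);
          I2 = b * (\<eta>\<^sup>2 * w); T = w\<^sup>2 / r\<^sup>2 + \<bar>y\<bar> powr \<gamma> + \<bar>c\<bar> powr \<gamma> + F\<^sup>2 + \<bar>G\<bar> powr (\<gamma> / (\<gamma> - 1))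
      in \<bar>I1\<bar> \<le> K * ((norm p)\<^sup>2 + T) \<and> \<bar>I2\<bar> \<le> K * ((norm p)\<^sup>2 + T) \<and> \<mu> / 2 * (\<eta>\<^sup>2 * (norm p)\<^sup>2) - K * T \<le> I1 - I2)"
proof -
  define n where "n = real CARD('n)"
  have n: "0 < n" by (simp add: n_def)
  define CA where "CA = n\<^sup>2 * inverse \<mu>"
  have CA: "0 < CA" using n c by (simp add: CA_def)
  \<comment> \<open>Each of the three error terms that retain the gradient may cost \<mu>/8 of it,
    so that 5 \<mu>/8 remain, more than the claimed \<mu>/2. The parameter here is this share before
    multiplication by \<mu>2.\<close>
  obtain CY where CY: "0 \<le> CY" "\<And>h w :: real. 0 \<le> h \<Longrightarrow> 0 \<le> w \<Longrightarrow> h powr (2 * (1 - 1 / \<gamma>)) * w \<le> (\<mu> / (8 * \<mu>2)) * h\<^sup>2 + CY * w powr \<gamma>"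
    using young_eps[of \<gamma> "\<mu> / (8 * \<mu>2)"] c by (metis divide_pos_pos mult_pos_pos zero_less_numeral)
  define Ka where "Ka = 2 * (n * \<mu>1)\<^sup>2"
  define Kb where "Kb = \<mu>2 * ((CY + 2) * 2 powr \<gamma> + 1)"
  define Kw where "Kw = 32 * CA\<^sup>2 / \<mu> + 4"
  define K1 where "K1 = (2 / \<mu> + 1) * Ka + Kb + Kw"
  \<comment> \<open>K1 serves the lower bound; CA and \<mu> are added for the upper bounds, where
    the principal term itself is estimated.\<close>
  define K where "K = K1 + CA + \<mu>"
  have Kpos: "0 \<le> Ka" "0 \<le> Kb" "0 \<le> Kw" "0 \<le> K1" "0 < K"
    using c CY CA n by (auto simp: Ka_def Kb_def Kw_def K1_def K_def intro!: add_nonneg_nonneg mult_nonneg_nonneg add_nonneg_pos)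
  have "(let w = y - c; I1 = (\<Sum>i\<in>UNIV. ((\<Sum>j\<in>UNIV. A $ i $ j * p $ j) + a $ i) * (\<eta>\<^sup>2 *\<^sub>R p + (w * (2 * \<eta>)) *\<^sub>R g) $ i);
          I2 = b * (\<eta>\<^sup>2 * w); T = w\<^sup>2 / r\<^sup>2 + \<bar>y\<bar> powr \<gamma> + \<bar>c\<bar> powr \<gamma> + F\<^sup>2 + \<bar>G\<bar> powr (\<gamma> / (\<gamma> - 1))
      in \<bar>I1\<bar> \<le> K * ((norm p)\<^sup>2 + T) \<and> \<bar>I2\<bar> \<le> K * ((norm p)\<^sup>2 + T) \<and> \<mu> / 2 * (\<eta>\<^sup>2 * (norm p)\<^sup>2) - K * T \<le> I1 - I2)"
    if r: "0 < r" and \<eta>: "0 \<le> \<eta>" "\<eta> \<le> 1" and g: "norm g \<le> 2 / r" and A: "\<And>i j. \<bar>A $ i $ j\<bar> \<le> inverse \<mu>"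
      and ell: "\<And>\<xi>. (\<Sum>i\<in>UNIV. \<Sum>j\<in>UNIV. A $ i $ j * \<xi> $ i * \<xi> $ j) \<ge> \<mu> * (norm \<xi>)\<^sup>2"
      and a: "\<And>i. \<bar>a $ i\<bar> \<le> \<mu>1 * (\<bar>y\<bar> powr (\<gamma> / 2) + F)"
      and b: "\<bar>b\<bar> \<le> \<mu>2 * (norm p powr (2 * (1 - 1 / \<gamma>)) + \<bar>y\<bar> powr (\<gamma> - 1) + G)"
    for A :: "real^'n^'n" and p a b y c F G \<eta> g r
  proof -
    define w where "w = y - c"
    define I1 where "I1 = (\<Sum>i\<in>UNIV. ((\<Sum>j\<in>UNIV. A $ i $ j * p $ j) + a $ i) * (\<eta>\<^sup>2 *\<^sub>R p + (w * (2 * \<eta>)) *\<^sub>R g) $ i)"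
    define I2 where "I2 = b * (\<eta>\<^sup>2 * w)"
    define h where "h = norm p"
    define Y where "Y = \<bar>y\<bar> powr \<gamma> + \<bar>c\<bar> powr \<gamma>"
    define G' where "G' = \<bar>G\<bar> powr (\<gamma> / (\<gamma> - 1))"
    define T where "T = w\<^sup>2 / r\<^sup>2 + \<bar>y\<bar> powr \<gamma> + \<bar>c\<bar> powr \<gamma> + F\<^sup>2 + G'"
    define X where "X = A *v p"
    have h0: "0 \<le> h" by (simp add: h_def)
    have T: "w\<^sup>2 / r\<^sup>2 \<le> T" "\<bar>y\<bar> powr \<gamma> + F\<^sup>2 \<le> T" "Y + G' \<le> T" "0 \<le> T" "\<bar>y\<bar> powr \<gamma> + G' \<le> T"
      by (auto simp: T_def Y_def G'_def)
    have \<eta>2: "\<eta>\<^sup>2 \<le> \<eta>" "\<eta>\<^sup>2 \<le> 1" "0 \<le> \<eta>\<^sup>2" using \<eta> by (auto simp: power2_eq_square mult_left_le_one_le mult_le_one)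
    have I1: "I1 = \<eta>\<^sup>2 * (X \<bullet> p) + w * (2 * \<eta>) * (X \<bullet> g) + \<eta>\<^sup>2 * (a \<bullet> p) + w * (2 * \<eta>) * (a \<bullet> g)"
    proof -
      have "I1 = (X + a) \<bullet> (\<eta>\<^sup>2 *\<^sub>R p + (w * (2 * \<eta>)) *\<^sub>R g)"
        by (simp add: I1_def X_def inner_vec_def matrix_vector_mult_def)
      then show ?thesis by (simp add: inner_add_left inner_add_right algebra_simps)
    qed
    have Xp: "\<mu> * h\<^sup>2 \<le> X \<bullet> p"
    proof -
      have "X \<bullet> p = (\<Sum>i\<in>UNIV. \<Sum>j\<in>UNIV. A $ i $ j * p $ i * p $ j)"
        unfolding X_def inner_vec_def matrix_vector_mult_def by (simp add: sum_distrib_right sum_distrib_left mult_ac)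
      then show ?thesis using ell[of p] by (simp add: h_def)
    qed
    have Xn: "norm X \<le> CA * h" unfolding X_def CA_def h_def n_def by (rule norm_matrix_vector_le[OF A])
    define N where "N = norm a"
    have N0: "0 \<le> N" by (simp add: N_def)
    have N2: "N\<^sup>2 \<le> Ka * T"
    proof -
      have "N \<le> (\<Sum>i\<in>UNIV. \<bar>a $ i\<bar>)" unfolding N_def by (rule norm_le_l1_cart)
      also have "\<dots> \<le> (\<Sum>i\<in>(UNIV :: 'n set). \<mu>1 * (\<bar>y\<bar> powr (\<gamma> / 2) + F))" by (intro sum_mono a)
      finally have "N \<le> n * \<mu>1 * (\<bar>y\<bar> powr (\<gamma> / 2) + F)" by (simp add: n_def mult.assoc)
      then have "N\<^sup>2 \<le> (n * \<mu>1 * (\<bar>y\<bar> powr (\<gamma> / 2) + F))\<^sup>2" using N0 by (rule power_mono)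
      also have "\<dots> = (n * \<mu>1)\<^sup>2 * (\<bar>y\<bar> powr (\<gamma> / 2) + F)\<^sup>2" by (simp add: power_mult_distrib)
      also have "(\<bar>y\<bar> powr (\<gamma> / 2) + F)\<^sup>2 \<le> 2 * ((\<bar>y\<bar> powr (\<gamma> / 2))\<^sup>2 + F\<^sup>2)"
        using sum_squares_bound[of "\<bar>y\<bar> powr (\<gamma> / 2)" F] by (simp add: power2_sum)
      also have "(\<bar>y\<bar> powr (\<gamma> / 2))\<^sup>2 = \<bar>y\<bar> powr \<gamma>" by (simp add: power2_eq_square powr_add[symmetric])
      finally have "N\<^sup>2 \<le> (n * \<mu>1)\<^sup>2 * (2 * (\<bar>y\<bar> powr \<gamma> + F\<^sup>2))" by (simp add: mult_left_mono)
      also have "\<dots> \<le> (n * \<mu>1)\<^sup>2 * (2 * T)" using T(2) by (intro mult_left_mono) auto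
      finally show ?thesis by (simp add: Ka_def mult_ac)
    qed
    define d where "d = \<bar>w\<bar> / r"
    have d0: "0 \<le> d" using r by (simp add: d_def)
    have d2: "d\<^sup>2 \<le> T" using T(1) by (simp add: d_def power_divide)
    have gd: "\<bar>w\<bar> * norm g \<le> 2 * d" using mult_left_mono[OF g, of "\<bar>w\<bar>"] by (simp add: d_def mult.commute)
    have am: "2 * (s * t) \<le> \<epsilon> * s\<^sup>2 + 1 / \<epsilon> * t\<^sup>2" if "0 < \<epsilon>" for s t \<epsilon> :: real
    proof -
      have "0 \<le> (\<epsilon> * s - t)\<^sup>2" by simp
      then have "2 * (\<epsilon> * (s * t)) \<le> \<epsilon>\<^sup>2 * s\<^sup>2 + t\<^sup>2" by (simp add: power2_diff power_mult_distrib algebra_simps)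
      then show ?thesis using that by (simp add: field_simps power2_eq_square)
    qed
    have e1: "\<bar>w * (2 * \<eta>) * (X \<bullet> g)\<bar> \<le> \<mu> / 8 * (\<eta>\<^sup>2 * h\<^sup>2) + 32 * CA\<^sup>2 / \<mu> * T"
    proof -
      have "\<bar>w * (2 * \<eta>) * (X \<bullet> g)\<bar> \<le> 2 * \<eta> * \<bar>w\<bar> * (norm X * norm g)"
        using \<eta> Cauchy_Schwarz_ineq2[of X g] by (simp add: abs_mult mult_left_mono mult_ac)
      also have "\<dots> \<le> 2 * \<eta> * \<bar>w\<bar> * (CA * h * norm g)"
        using \<eta> Xn by (intro mult_left_mono mult_right_mono) auto
      also have "\<dots> = 2 * \<eta> * (CA * h) * (\<bar>w\<bar> * norm g)" by simp
      also have "\<dots> \<le> 2 * \<eta> * (CA * h) * (2 * d)" using \<eta> CA h0 gd by (intro mult_left_mono) auto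
      also have "\<dots> = 2 * ((\<eta> * h) * (2 * CA * d))" by simp
      also have "\<dots> \<le> \<mu> / 8 * (\<eta> * h)\<^sup>2 + 1 / (\<mu> / 8) * (2 * CA * d)\<^sup>2" by (rule am) (use c in simp)
      also have "\<dots> = \<mu> / 8 * (\<eta>\<^sup>2 * h\<^sup>2) + 32 * CA\<^sup>2 / \<mu> * d\<^sup>2" by (simp add: power_mult_distrib)
      also have "\<dots> \<le> \<mu> / 8 * (\<eta>\<^sup>2 * h\<^sup>2) + 32 * CA\<^sup>2 / \<mu> * T" using d2 c by (intro add_left_mono mult_left_mono) auto
      finally show ?thesis .
    qed
    have e2: "\<bar>\<eta>\<^sup>2 * (a \<bullet> p)\<bar> \<le> \<mu> / 8 * (\<eta>\<^sup>2 * h\<^sup>2) + 2 / \<mu> * Ka * T"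
    proof -
      have "\<bar>\<eta>\<^sup>2 * (a \<bullet> p)\<bar> \<le> \<eta> * (N * h)"
        using \<eta>2 \<eta> Cauchy_Schwarz_ineq2[of a p] by (auto simp: abs_mult N_def h_def intro!: mult_mono)
      also have "\<dots> = 2 * ((\<eta> * h) * (N / 2))" by simp
      also have "\<dots> \<le> \<mu> / 8 * (\<eta> * h)\<^sup>2 + 1 / (\<mu> / 8) * (N / 2)\<^sup>2" by (rule am) (use c in simp)
      also have "\<dots> = \<mu> / 8 * (\<eta>\<^sup>2 * h\<^sup>2) + 2 / \<mu> * N\<^sup>2" by (simp add: power_mult_distrib power_divide)
      also have "\<dots> \<le> \<mu> / 8 * (\<eta>\<^sup>2 * h\<^sup>2) + 2 / \<mu> * (Ka * T)" using N2 c by (intro add_left_mono mult_left_mono) auto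
      finally show ?thesis by simp
    qed
    have e3: "\<bar>w * (2 * \<eta>) * (a \<bullet> g)\<bar> \<le> (Ka + 4) * T"
    proof -
      have "\<bar>w * (2 * \<eta>) * (a \<bullet> g)\<bar> \<le> 2 * \<eta> * \<bar>w\<bar> * (N * norm g)"
        using \<eta> Cauchy_Schwarz_ineq2[of a g] by (simp add: abs_mult N_def mult_left_mono mult_ac)
      also have "\<dots> = 2 * \<eta> * N * (\<bar>w\<bar> * norm g)" by simp
      also have "\<dots> \<le> 2 * \<eta> * N * (2 * d)" using \<eta> N0 gd by (intro mult_left_mono) auto
      also have "\<dots> \<le> 2 * 1 * N * (2 * d)" using \<eta> N0 d0 by (intro mult_right_mono mult_left_mono) auto
      also have "\<dots> = 2 * (N * (2 * d))" by simp
      also have "\<dots> \<le> 1 * N\<^sup>2 + 1 / 1 * (2 * d)\<^sup>2" by (rule am) simp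
      also have "\<dots> = N\<^sup>2 + 4 * d\<^sup>2" by (simp add: power_mult_distrib)
      also have "\<dots> \<le> Ka * T + 4 * T" using N2 d2 by simp
      finally show ?thesis by (simp add: algebra_simps)
    qed
    have e4: "\<bar>I2\<bar> \<le> \<mu> / 8 * (\<eta>\<^sup>2 * h\<^sup>2) + Kb * T"
    proof -
      \<comment> \<open>This is where |c|^\<gamma> enters T: the power of w = y - c is split into
        those of y and c.\<close>
      have wg: "\<bar>w\<bar> powr \<gamma> \<le> 2 powr \<gamma> * Y"
      proof -
        have "\<bar>w\<bar> powr \<gamma> \<le> (\<bar>y\<bar> + \<bar>c\<bar>) powr \<gamma>" using c(4) \<open>1 < \<gamma>\<close> by (intro powr_mono2) (auto simp: w_def)
        also have "\<dots> \<le> 2 powr \<gamma> * Y" unfolding Y_def using \<open>1 < \<gamma>\<close> by (intro powr_add_le) auto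
        finally show ?thesis .
      qed
      have Gle: "G \<le> \<bar>G\<bar>" by simp
      have "\<bar>b\<bar> * \<bar>w\<bar> \<le> \<mu>2 * (h powr (2 * (1 - 1 / \<gamma>)) + \<bar>y\<bar> powr (\<gamma> - 1) + \<bar>G\<bar>) * \<bar>w\<bar>"
        using order.trans[OF b mult_left_mono[OF add_left_mono[OF Gle]]] c by (intro mult_right_mono) (auto simp: h_def)
      also have "\<dots> = \<mu>2 * (h powr (2 * (1 - 1 / \<gamma>)) * \<bar>w\<bar> + \<bar>y\<bar> powr (\<gamma> - 1) * \<bar>w\<bar> + \<bar>G\<bar> * \<bar>w\<bar>)" by (simp add: algebra_simps)
      also have "\<dots> \<le> \<mu>2 * ((\<mu> / (8 * \<mu>2) * h\<^sup>2 + CY * \<bar>w\<bar> powr \<gamma>) + (\<bar>y\<bar> powr \<gamma> + \<bar>w\<bar> powr \<gamma>) + (G' + \<bar>w\<bar> powr \<gamma>))"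
        unfolding G'_def using c h0 by (intro mult_left_mono add_mono CY(2) powr_mult_le) auto
      also have "\<dots> = \<mu> / 8 * h\<^sup>2 + \<mu>2 * ((CY + 2) * \<bar>w\<bar> powr \<gamma> + (\<bar>y\<bar> powr \<gamma> + G'))"
        using c by (simp add: field_simps)
      also have "\<dots> \<le> \<mu> / 8 * h\<^sup>2 + \<mu>2 * ((CY + 2) * (2 powr \<gamma> * T) + T)"
      proof (intro add_left_mono mult_left_mono add_mono)
        have "2 powr \<gamma> * Y \<le> 2 powr \<gamma> * T" using T(3) powr_ge_zero[of "\<bar>G\<bar>" "\<gamma> / (\<gamma> - 1)"]
          by (intro mult_left_mono powr_ge_zero) (simp add: G'_def del: powr_ge_zero)
        with wg show "\<bar>w\<bar> powr \<gamma> \<le> 2 powr \<gamma> * T" by (rule order.trans)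
        show "\<bar>y\<bar> powr \<gamma> + G' \<le> T" by (rule T(5))
      qed (use c CY in auto)
      also have "\<dots> = \<mu> / 8 * h\<^sup>2 + Kb * T" by (simp add: Kb_def algebra_simps)
      finally have bw: "\<bar>b\<bar> * \<bar>w\<bar> \<le> \<mu> / 8 * h\<^sup>2 + Kb * T" .
      have "\<bar>I2\<bar> = \<eta>\<^sup>2 * (\<bar>b\<bar> * \<bar>w\<bar>)" by (simp add: I2_def abs_mult)
      also have "\<dots> \<le> \<eta>\<^sup>2 * (\<mu> / 8 * h\<^sup>2 + Kb * T)" using bw by (intro mult_left_mono) auto
      also have "\<dots> = \<mu> / 8 * (\<eta>\<^sup>2 * h\<^sup>2) + \<eta>\<^sup>2 * (Kb * T)" by (simp add: algebra_simps)
      also have "\<eta>\<^sup>2 * (Kb * T) \<le> 1 * (Kb * T)" using \<eta>2 Kpos T by (intro mult_right_mono) auto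
      finally show ?thesis by simp
    qed
    define Z where "Z = \<eta>\<^sup>2 * h\<^sup>2"
    have Z: "0 \<le> Z" "Z \<le> h\<^sup>2" using \<eta>2 by (auto simp: Z_def mult_left_le_one_le)
    have K1T: "32 * CA\<^sup>2 / \<mu> * T + 2 / \<mu> * Ka * T + (Ka + 4) * T + Kb * T = K1 * T"
      by (simp add: K1_def Kw_def algebra_simps)
    have Kb': "0 \<le> Kb * T" "0 \<le> 32 * CA\<^sup>2 / \<mu> * T" "0 \<le> 2 / \<mu> * Ka * T" "0 \<le> (Ka + 4) * T" using Kpos T c by auto
    have K1le: "K1 * T \<le> K * T" using T CA c by (intro mult_right_mono) (auto simp: K_def)
    have e0: "\<bar>\<eta>\<^sup>2 * (X \<bullet> p)\<bar> \<le> CA * h\<^sup>2"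
    proof -
      have "\<eta>\<^sup>2 * \<bar>X \<bullet> p\<bar> \<le> 1 * (norm X * h)"
        by (rule mult_mono) (use \<eta>2 Cauchy_Schwarz_ineq2[of X p] in \<open>auto simp: h_def\<close>)
      then have "\<bar>\<eta>\<^sup>2 * (X \<bullet> p)\<bar> \<le> 1 * (norm X * h)" by (simp add: abs_mult)
      also have "\<dots> \<le> CA * h * h" using Xn h0 by (auto intro!: mult_right_mono)
      finally show ?thesis by (simp add: power2_eq_square mult.assoc)
    qed
    have KK: "K * (h\<^sup>2 + T) = K1 * h\<^sup>2 + CA * h\<^sup>2 + \<mu> * h\<^sup>2 + K * T" by (simp add: K_def algebra_simps)
    have K1h: "0 \<le> K1 * h\<^sup>2" "0 \<le> CA * h\<^sup>2" "0 \<le> \<mu> * h\<^sup>2" using Kpos CA c by auto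
    have muZ: "\<mu> * Z \<le> \<mu> * h\<^sup>2" "0 \<le> \<mu> * Z" using Z c by auto
    have e0': "\<mu> * Z \<le> \<eta>\<^sup>2 * (X \<bullet> p)" using mult_left_mono[OF Xp, of "\<eta>\<^sup>2"] by (simp add: Z_def mult_ac)
    note E = e1[folded Z_def] e2[folded Z_def] e3 e4[folded Z_def]
    have r1: "\<bar>I1\<bar> \<le> K * (h\<^sup>2 + T)"
    proof -
      have "\<bar>I1\<bar> \<le> \<bar>\<eta>\<^sup>2 * (X \<bullet> p)\<bar> + \<bar>w * (2 * \<eta>) * (X \<bullet> g)\<bar> + \<bar>\<eta>\<^sup>2 * (a \<bullet> p)\<bar> + \<bar>w * (2 * \<eta>) * (a \<bullet> g)\<bar>"
        unfolding I1 by linarith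
      also have "\<dots> \<le> CA * h\<^sup>2 + (\<mu> / 8 * Z + 32 * CA\<^sup>2 / \<mu> * T) + (\<mu> / 8 * Z + 2 / \<mu> * Ka * T) + (Ka + 4) * T"
        by (intro add_mono e0 E)
      also have "\<dots> \<le> K * (h\<^sup>2 + T)" unfolding KK using K1T Kb' K1le K1h muZ by argo
      finally show ?thesis .
    qed
    have r2: "\<bar>I2\<bar> \<le> K * (h\<^sup>2 + T)"
      unfolding KK using E(4) K1T Kb' K1le K1h muZ by argo
    have r3: "\<mu> / 2 * Z - K * T \<le> I1 - I2"
    proof -
      have gen: "z - B1 - B2 - B3 - B4 \<le> P + q1 + q2 + q3 - q4"
        if "z \<le> P" "\<bar>q1\<bar> \<le> B1" "\<bar>q2\<bar> \<le> B2" "\<bar>q3\<bar> \<le> B3" "\<bar>q4\<bar> \<le> B4" for z P q1 q2 q3 q4 B1 B2 B3 B4 :: real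
        using that by linarith
      have "\<mu> * Z - (\<mu> / 8 * Z + 32 * CA\<^sup>2 / \<mu> * T) - (\<mu> / 8 * Z + 2 / \<mu> * Ka * T) - (Ka + 4) * T - (\<mu> / 8 * Z + Kb * T)
         \<le> I1 - I2" unfolding I1 by (rule gen[OF e0' E])
      moreover have "\<mu> / 2 * Z - K * T \<le> \<mu> * Z - (\<mu> / 8 * Z + 32 * CA\<^sup>2 / \<mu> * T) - (\<mu> / 8 * Z + 2 / \<mu> * Ka * T) - (Ka + 4) * T - (\<mu> / 8 * Z + Kb * T)"
        using K1T K1le muZ by argo
      ultimately show ?thesis by (rule order.trans[rotated])
    qed
    show ?thesis
      using r1 r2 r3 unfolding Let_def w_def[symmetric] I1_def[symmetric] I2_def[symmetric] G'_def[symmetric] T_def[symmetric] h_def[symmetric] Z_def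
      by blast
  qed
  then show ?thesis by (rule that[OF Kpos(5)])
qed

section \<open>Higher integrability of weak solutions\<close>

lemma borel_measurable_vec_component:
  fixes f :: "'a \<Rightarrow> 'b::euclidean_space ^ 'n"
  assumes "f \<in> borel_measurable M"
  shows "(\<lambda>x. f x $ i) \<in> borel_measurable M"
  by (rule borel_measurable_continuous_on[OF _ assms, where f="\<lambda>y. y $ i"]) (intro continuous_intros)

lemma powr_between:
  assumes "s1 \<le> s" "s \<le> s2" "0 \<le> (x :: real)"
  shows "x powr s \<le> x powr s1 + x powr s2"
proof (cases "x \<le> 1")
  case True
  then have "x powr s \<le> x powr s1" using assms by (intro powr_mono') auto
  then show ?thesis by (simp add: add_increasing2)
next
  case False
  then have "x powr s \<le> x powr s2" using assms by (intro powr_mono) auto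
  then show ?thesis by (simp add: add_increasing)
qed

text \<open>Jensen for the power \<gamma> up to the factor 2^\<gamma>: |y| \<le> t + t^(1 -
  \<gamma>) |y|^\<gamma> for every t > 0, averaged and then balanced in t. It turns |c|^\<gamma>
  back into an integral of |u|^\<gamma>.\<close>

lemma mean_powr_le:
  fixes u :: "'a::euclidean_space \<Rightarrow> real"
  assumes \<gamma>: "1 < \<gamma>" and r: "0 < r" and u: "integrable lborel u" "integrable lborel (\<lambda>x. \<bar>u x\<bar> powr \<gamma>)"
  shows "\<bar>mean (ball q r) u\<bar> powr \<gamma> * vol (ball q r) \<le> 2 powr \<gamma> * (LINT x:ball q r|lborel. \<bar>u x\<bar> powr \<gamma>)"
proof -
  let ?S = "ball q r"
  define m where "m = mean ?S (\<lambda>x. \<bar>u x\<bar> powr \<gamma>)"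
  have V: "0 < vol ?S" using r by (rule vol_ball_pos)
  have m0: "0 \<le> m" unfolding m_def mean_def by (auto simp: set_lebesgue_integral_def intro!: divide_nonneg_nonneg integral_nonneg_AE)
  have si: "set_integrable lborel ?S u" "set_integrable lborel ?S (\<lambda>x. \<bar>u x\<bar> powr \<gamma>)"
    using u by (auto intro!: set_integrable_borel)
  have le: "\<bar>mean ?S u\<bar> \<le> t + t powr (1 - \<gamma>) * m" if t: "0 < t" for t
  proof -
    have pt: "\<bar>y\<bar> \<le> t + t powr (1 - \<gamma>) * \<bar>y\<bar> powr \<gamma>" for y :: real
    proof (cases "\<bar>y\<bar> \<le> t")
      case False
      then have y: "0 < \<bar>y\<bar>" using t by simp
      have "\<bar>y\<bar> = \<bar>y\<bar> powr (1 - \<gamma>) * \<bar>y\<bar> powr \<gamma>" using y by (simp add: powr_add[symmetric])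
      also have "\<dots> \<le> t powr (1 - \<gamma>) * \<bar>y\<bar> powr \<gamma>"
        using False t \<gamma> by (intro mult_right_mono powr_mono2') auto
      finally show ?thesis using t by simp
    qed (simp add: add_increasing2)
    have "\<bar>LINT x:?S|lborel. u x\<bar> \<le> (LINT x:?S|lborel. \<bar>u x\<bar>)" using set_integral_norm_bound[OF si(1)] by simp
    also have "\<dots> \<le> (LINT x:?S|lborel. t + t powr (1 - \<gamma>) * \<bar>u x\<bar> powr \<gamma>)"
      by (rule set_integral_mono) (use si pt in \<open>auto intro!: set_integrable_abs set_integral_add(1)\<close>)
    also have "\<dots> = t * vol ?S + t powr (1 - \<gamma>) * (LINT x:?S|lborel. \<bar>u x\<bar> powr \<gamma>)"
      using si by (subst set_integral_add(2)) auto
    finally show ?thesis using V by (simp add: mean_def m_def abs_divide field_simps)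
  qed
  have "\<bar>mean ?S u\<bar> powr \<gamma> \<le> 2 powr \<gamma> * m"
  proof (cases "m = 0")
    case True
    \<comment> \<open>The balancing value of t would be 0 here, so t is sent to 0 instead.\<close>
    have "\<bar>mean ?S u\<bar> \<le> 0"
    proof (rule field_le_epsilon)
      fix t :: real assume "0 < t"
      then show "\<bar>mean ?S u\<bar> \<le> 0 + t" using le[of t] True by simp
    qed
    then show ?thesis using True by simp
  next
    case False
    then have mp: "0 < m" using m0 by simp
    \<comment> \<open>Balances t against t^(1 - \<gamma>) m: both equal m^(1/\<gamma>).\<close>
    define t where "t = m powr (1 / \<gamma>)"
    have t: "0 < t" using mp by (simp add: t_def)
    have "t powr (1 - \<gamma>) * m = t powr (1 - \<gamma>) * t powr \<gamma>" using mp \<gamma> by (simp add: t_def powr_powr)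
    also have "\<dots> = t" using t by (simp add: powr_add[symmetric])
    finally have "\<bar>mean ?S u\<bar> \<le> 2 * t" using le[OF t] by simp
    then have "\<bar>mean ?S u\<bar> powr \<gamma> \<le> (2 * t) powr \<gamma>" using \<gamma> by (intro powr_mono2) auto
    also have "\<dots> = 2 powr \<gamma> * m" using mp \<gamma> by (simp add: t_def powr_mult powr_powr)
    finally show ?thesis .
  qed
  then have "\<bar>mean ?S u\<bar> powr \<gamma> * vol ?S \<le> 2 powr \<gamma> * m * vol ?S" using V by (intro mult_right_mono) auto
  also have "\<dots> = 2 powr \<gamma> * (LINT x:?S|lborel. \<bar>u x\<bar> powr \<gamma>)" using V by (simp add: m_def mean_def)
  finally show ?thesis .
qed

text \<open>The work is to supply RH: a Caccioppoli inequality for the zero extension on every ball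
  of the whole space with radius up to R. The choice \<alpha> = 2/\<gamma> makes |u|^(1/\<alpha>)
  equal to |u|^(\<gamma>/2), the quantity on the scale of |Du|; \<open>higher_integrability\<close>
  does the rest.\<close>

theorem weak_solution_higher_integrability:
  fixes u0 :: "real^'n \<Rightarrow> real"
  assumes \<Omega>: "bounded_lipschitz_domain \<beta> \<Omega>" and \<beta>: "0 < \<beta>"
    and sc: "structure_conditions \<Omega> \<gamma> \<mu> \<mu>1 \<mu>2 A a b f g" and pos: "0 < \<mu>" "0 < \<mu>1" "0 < \<mu>2"
    and \<gamma>: "2 < \<gamma>" "real CARD('n) * (1 - 2 / \<gamma>) \<le> 2"
    and \<sigma>: "2 < \<sigma>" "f \<in> Lp \<Omega> \<sigma>" and \<tau>: "\<gamma> / (\<gamma> - 1) < \<tau>" "g \<in> Lp \<Omega> \<tau>"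
    and ws: "weak_solution \<Omega> A a b u0"
  shows "\<exists>p>2. u0 \<in> Lp \<Omega> (\<gamma> * p / 2) \<and> weak_grad \<Omega> u0 \<in> Lp \<Omega> p"
proof -
  have op: "open \<Omega>" and bd: "bounded \<Omega>" using \<Omega> by (auto simp: bounded_lipschitz_domain_def)
  have S: "\<Omega> \<in> sets lebesgue" and SB[measurable]: "\<Omega> \<in> sets borel" using op by (auto intro: borel_open)
  have u0: "u0 \<in> W12_0 \<Omega>" using ws by (simp add: weak_solution_def)
  obtain u v \<phi> where zt: "zero_trace \<Omega> u v \<phi>" and uu: "AE x in lebesgue. u0 x = u x"
    and vv: "AE x in lebesgue. x \<in> \<Omega> \<longrightarrow> weak_grad \<Omega> u0 x = v x"
    using W12_0_zero_trace[OF op bd u0] .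
  interpret zt: zero_trace \<Omega> u v \<phi> by (rule zt)
  interpret gp: gradient_pair u "\<lambda>x. norm (v x)" by (rule zt.gradient_pair)
  define \<gamma>' where "\<gamma>' = \<gamma> / (\<gamma> - 1)"
  have \<gamma>': "0 < \<gamma>'" using \<gamma> by (simp add: \<gamma>'_def)
  have cg: "f \<in> Lp \<Omega> 2" "g \<in> Lp \<Omega> \<gamma>'"
    and ga: "AE x in lebesgue. x \<in> \<Omega> \<longrightarrow> (\<forall>z i. \<bar>a x z $ i\<bar> \<le> \<mu>1 * (\<bar>z\<bar> powr (\<gamma> / 2) + f x))"
    and gb: "AE x in lebesgue. x \<in> \<Omega> \<longrightarrow> (\<forall>z \<xi>. \<bar>b x z \<xi>\<bar> \<le> \<mu>2 * (norm \<xi> powr (2 * (1 - 1 / \<gamma>)) + \<bar>z\<bar> powr (\<gamma> - 1) + g x))"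
    and el: "AE x in lebesgue. x \<in> \<Omega> \<longrightarrow> (\<forall>z. (\<forall>i j. \<bar>A x z $ i $ j\<bar> \<le> inverse \<mu>) \<and>
       (\<forall>\<xi>. (\<Sum>i\<in>UNIV. \<Sum>j\<in>UNIV. A x z $ i $ j * \<xi> $ i * \<xi> $ j) \<ge> \<mu> * (norm \<xi>)\<^sup>2))"
    and cA: "caratheodory \<Omega> A" and ca: "caratheodory \<Omega> a" and cb: "caratheodory \<Omega> (\<lambda>x (z, \<xi>). b x z \<xi>)"
    using sc S by (auto simp: structure_conditions_def controlled_growth_def elliptic_def AE_restrict_space_iff \<gamma>'_def)
  have "f \<in> borel_measurable (lebesgue_on \<Omega>)" using cg(1) by (simp add: Lp_def)
  then obtain F where F[measurable]: "F \<in> borel_measurable borel" and F0: "\<And>x. x \<notin> \<Omega> \<Longrightarrow> F x = 0"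
    and fF: "AE x in lebesgue. x \<in> \<Omega> \<longrightarrow> f x = F x"
  proof (rule borel_representative_on[OF SB], goal_cases)
    case (1 F)
    show ?case by (rule 1(1)) fact+
  qed
  have "g \<in> borel_measurable (lebesgue_on \<Omega>)" using cg(2) by (simp add: Lp_def)
  then obtain G where G[measurable]: "G \<in> borel_measurable borel" and G0: "\<And>x. x \<notin> \<Omega> \<Longrightarrow> G x = 0"
    and gG: "AE x in lebesgue. x \<in> \<Omega> \<longrightarrow> g x = G x"
  proof (rule borel_representative_on[OF SB], goal_cases)
    case (1 G)
    show ?case by (rule 1(1)) fact+
  qed
  have iF: "integrable lborel (\<lambda>x. \<bar>F x\<bar> powr 2)" "integrable lborel (\<lambda>x. \<bar>F x\<bar> powr \<sigma>)"
    using Lp_transfer(1)[OF S F fF F0] cg(1) \<sigma>(2) by auto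
  have iG: "integrable lborel (\<lambda>x. \<bar>G x\<bar> powr \<gamma>')" "integrable lborel (\<lambda>x. \<bar>G x\<bar> powr \<tau>)"
    using Lp_transfer(1)[OF S G gG G0] cg(2) \<tau>(2) by auto
  define \<alpha> where "\<alpha> = 2 / \<gamma>"
  have \<alpha>: "0 < \<alpha>" "\<alpha> < 1" "real DIM(real^'n) * (1 - \<alpha>) \<le> 2" using \<gamma> by (auto simp: \<alpha>_def)
  have U2: "(\<bar>y\<bar> powr (1 / \<alpha>)) powr p = \<bar>y\<bar> powr (\<gamma> * p / 2)" for y p :: real
    using \<gamma> by (simp add: powr_powr \<alpha>_def)
  have U2': "(\<bar>y\<bar> powr (1 / \<alpha>))\<^sup>2 = \<bar>y\<bar> powr \<gamma>" for y :: real
    using U2[of y 2] by simp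
  \<comment> \<open>The Sobolev embedding, from \<open>integrable_u_powr\<close> with p = 2: the
    critical growth terms are integrable before any gain.\<close>
  have iU: "integrable lborel (\<lambda>x. \<bar>u x\<bar> powr \<gamma>)"
    using gp.integrable_u_powr[OF \<alpha>, of 2] zt.sq_v U2[where p=2] by simp
  \<comment> \<open>F^2 and |G|^\<gamma>' are the data on the scale of |Du|^2; a single W represents
    both.\<close>
  define W where "W x = sqrt ((F x)\<^sup>2 + \<bar>G x\<bar> powr \<gamma>')" for x
  have W0: "0 \<le> W x" for x by (simp add: W_def)
  have W2: "(W x)\<^sup>2 = (F x)\<^sup>2 + \<bar>G x\<bar> powr \<gamma>'" for x by (simp add: W_def)
  have mW[measurable]: "W \<in> borel_measurable borel" unfolding W_def[abs_def] by measurable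
  have iW: "integrable lborel (\<lambda>x. (W x)\<^sup>2)" unfolding W2 using iF iG by simp
  \<comment> \<open>The common gain that the data allow: 2 + e \<le> \<sigma> for F, and \<gamma>'
    (1 + e/2) \<le> \<tau> for G, as W^(2 + e) involves |G|^(\<gamma>' (1 + e/2)).\<close>
  define e where "e = min (\<sigma> - 2) (2 * (\<tau> / \<gamma>' - 1))"
  have e: "0 < e" "2 + e \<le> \<sigma>" "\<gamma>' * (1 + e / 2) \<le> \<tau>"
  proof -
    have "\<gamma>' < \<tau>" using \<tau>(1) by (simp only: \<gamma>'_def)
    then have "1 < \<tau> / \<gamma>'" using \<gamma>' by (simp add: less_divide_eq)
    then show "0 < e" using \<sigma> by (simp add: e_def)
    show "2 + e \<le> \<sigma>" by (simp add: e_def)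
    have "e \<le> 2 * (\<tau> / \<gamma>' - 1)" unfolding e_def by (rule min.cobounded2)
    moreover have "e \<le> 2 * (X - 1) \<Longrightarrow> 1 + e / 2 \<le> X" for X :: real by argo
    ultimately have "1 + e / 2 \<le> \<tau> / \<gamma>'" by blast
    then show "\<gamma>' * (1 + e / 2) \<le> \<tau>" using \<gamma>' by (simp only: pos_le_divide_eq mult.commute)
  qed
  have iWe: "integrable lborel (\<lambda>x. W x powr (2 + e))"
  proof (rule Bochner_Integration.integrable_bound)
    let ?h = "\<lambda>x. 2 powr (1 + e / 2) * ((\<bar>F x\<bar> powr 2 + \<bar>F x\<bar> powr \<sigma>) + (\<bar>G x\<bar> powr \<gamma>' + \<bar>G x\<bar> powr \<tau>))"
    show "integrable lborel ?h" using iF iG by (intro integrable_mult_right Bochner_Integration.integrable_add)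
    show "AE x in lborel. norm (W x powr (2 + e)) \<le> norm (?h x)"
    proof (rule AE_I2)
      fix x
      have "W x powr (2 + e) = (W x powr 2) powr (1 + e / 2)" by (simp add: powr_powr del: powr_numeral)
      also have "W x powr 2 = (F x)\<^sup>2 + \<bar>G x\<bar> powr \<gamma>'" using W0[of x] W2[of x] by simp
      also have "((F x)\<^sup>2 + \<bar>G x\<bar> powr \<gamma>') powr (1 + e / 2) \<le> 2 powr (1 + e / 2) * (((F x)\<^sup>2) powr (1 + e / 2) + (\<bar>G x\<bar> powr \<gamma>') powr (1 + e / 2))"
        using e by (intro powr_add_le) auto
      also have "((F x)\<^sup>2) powr (1 + e / 2) = \<bar>F x\<bar> powr (2 + e)"
      proof -
        have "((F x)\<^sup>2) powr (1 + e / 2) = (\<bar>F x\<bar> powr 2) powr (1 + e / 2)" by simp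
        also have "\<dots> = \<bar>F x\<bar> powr (2 * (1 + e / 2))" by (rule powr_powr)
        finally show ?thesis by (simp add: algebra_simps)
      qed
      also have "(\<bar>G x\<bar> powr \<gamma>') powr (1 + e / 2) = \<bar>G x\<bar> powr (\<gamma>' * (1 + e / 2))" by (rule powr_powr)
      also have "2 powr (1 + e / 2) * (\<bar>F x\<bar> powr (2 + e) + \<bar>G x\<bar> powr (\<gamma>' * (1 + e / 2))) \<le> ?h x"
      proof (intro mult_left_mono add_mono powr_between)
        show "\<gamma>' \<le> \<gamma>' * (1 + e / 2)" using \<gamma>' e by simp
      qed (use e in auto)
      finally show "norm (W x powr (2 + e)) \<le> norm (?h x)" by simp
    qed
  qed measurable
  obtain R \<kappa> where R: "0 < R" and \<kappa>: "0 < \<kappa>" "\<kappa> \<le> 1" and ext: "\<And>x r. 0 < r \<Longrightarrow> r \<le> R \<Longrightarrow>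
    \<exists>q. ball q (\<kappa> * r) \<subseteq> ball x (3 * r) \<and> (cball x (2 * r) \<subseteq> \<Omega> \<or> ball q (\<kappa> * r) \<inter> \<Omega> = {})"
    using exterior_ball[OF \<Omega> \<beta>] by metis
  have \<gamma>1: "1 < \<gamma>" using \<gamma>(1) by simp
  obtain K where K: "0 < K" and en: "\<And>(A :: real^'n^'n) p a b y c F G \<eta> g r. 0 < r \<Longrightarrow> 0 \<le> \<eta> \<Longrightarrow> \<eta> \<le> 1 \<Longrightarrow> norm g \<le> 2 / r \<Longrightarrow>
     (\<And>i j. \<bar>A $ i $ j\<bar> \<le> inverse \<mu>) \<Longrightarrow> (\<And>\<xi>. (\<Sum>i\<in>UNIV. \<Sum>j\<in>UNIV. A $ i $ j * \<xi> $ i * \<xi> $ j) \<ge> \<mu> * (norm \<xi>)\<^sup>2) \<Longrightarrow>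
     (\<And>i. \<bar>a $ i\<bar> \<le> \<mu>1 * (\<bar>y\<bar> powr (\<gamma> / 2) + F)) \<Longrightarrow>
     \<bar>b\<bar> \<le> \<mu>2 * (norm p powr (2 * (1 - 1 / \<gamma>)) + \<bar>y\<bar> powr (\<gamma> - 1) + G) \<Longrightarrow>
     (let w = y - c; I1 = (\<Sum>i\<in>UNIV. ((\<Sum>j\<in>UNIV. A $ i $ j * p $ j) + a $ i) * (\<eta>\<^sup>2 *\<^sub>R p + (w * (2 * \<eta>)) *\<^sub>R g) $ i);
          I2 = b * (\<eta>\<^sup>2 * w); T = w\<^sup>2 / r\<^sup>2 + \<bar>y\<bar> powr \<gamma> + \<bar>c\<bar> powr \<gamma> + F\<^sup>2 + \<bar>G\<bar> powr (\<gamma> / (\<gamma> - 1))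
      in \<bar>I1\<bar> \<le> K * ((norm p)\<^sup>2 + T) \<and> \<bar>I2\<bar> \<le> K * ((norm p)\<^sup>2 + T) \<and> \<mu> / 2 * (\<eta>\<^sup>2 * (norm p)\<^sup>2) - K * T \<le> I1 - I2)"
  proof (rule energy_pointwise[where 'n='n, OF pos \<gamma>1], goal_cases)
    case (1 K)
    show ?case by (rule 1(1)) fact+
  qed
  \<comment> \<open>2 / \<kappa> is the ratio of the radii 2 r and \<kappa> r: |c|^\<gamma> times
    the volume of the larger ball is bounded by an integral over the smaller one. The factor
    2^\<gamma> is that of \<open>mean_powr_le\<close>.\<close>
  define M where "M = 1 + 2 powr \<gamma> * (2 / \<kappa>) ^ DIM(real^'n)"
  have M: "1 \<le> M" using \<kappa> by (simp add: M_def)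
  \<comment> \<open>exp 4 undoes the lower bound exp(-4) of \<eta>^2 on the inner ball, and 2 /
    \<mu> the factor \<mu> / 2 left from ellipticity.\<close>
  define C1 where "C1 = 2 * exp 4 / \<mu> * K * M"
  have C1: "0 < C1" using K M pos by (auto simp: C1_def intro!: mult_pos_pos divide_pos_pos)
  have mu0: "u0 \<in> borel_measurable (lebesgue_on \<Omega>)" and mw0: "weak_grad \<Omega> u0 \<in> borel_measurable (lebesgue_on \<Omega>)"
    using u0 by (auto simp: W12_0_def W12_def Lp_def)
  have RH: "\<exists>q. ball q (\<kappa> * r) \<subseteq> ball x0 (3 * r) \<and>
      (LINT y:ball x0 r|lborel. (norm (v y))\<^sup>2) \<le> C1 * (1 / r\<^sup>2 * (LINT w:ball x0 (2 * r)|lborel. (u w - mean (ball q (\<kappa> * r)) u)\<^sup>2)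
         + (LINT y:ball x0 (3 * r)|lborel. (\<bar>u y\<bar> powr (1 / \<alpha>))\<^sup>2 + (W y)\<^sup>2))"
    if r: "0 < r" "r \<le> R" for x0 r
  proof -
    obtain q where q: "ball q (\<kappa> * r) \<subseteq> ball x0 (3 * r)" "cball x0 (2 * r) \<subseteq> \<Omega> \<or> ball q (\<kappa> * r) \<inter> \<Omega> = {}"
      using ext[OF r] by blast
    have kr: "0 < \<kappa> * r" using \<kappa> r by simp
    define c where "c = mean (ball q (\<kappa> * r)) u"
    define \<eta> where "\<eta> = bump x0 r"
    define \<zeta> where "\<zeta> x = \<eta> x * \<eta> x" for x
    let ?B = "ball x0 (2 * r)"
    have s\<eta>: "smooth \<eta>" unfolding \<eta>_def by (rule smooth_bump)
    have s\<zeta>: "smooth \<zeta>" unfolding \<zeta>_def[abs_def] by (intro smooth_mult s\<eta>)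
    have [measurable]: "\<eta> \<in> borel_measurable borel" "\<zeta> \<in> borel_measurable borel" using s\<eta> s\<zeta> by (auto intro: smooth_measurable)
    have \<eta>01: "0 \<le> \<eta> x" "\<eta> x \<le> 1" for x by (auto simp: \<eta>_def bump_bounds)
    have \<zeta>01: "0 \<le> \<zeta> x" "\<zeta> x \<le> 1" for x using \<eta>01[of x] by (auto simp: \<zeta>_def mult_le_one)
    have g\<zeta>: "grad \<zeta> x = (2 * \<eta> x) *\<^sub>R grad \<eta> x" for x
      unfolding \<zeta>_def[abs_def] grad_mult[OF s\<eta> s\<eta>] by (simp add: scaleR_2[symmetric])
    have ng: "norm (grad \<eta> x) \<le> 2 / r" for x unfolding \<eta>_def by (rule norm_grad_bump_le[OF r(1)])
    have \<eta>out: "\<eta> x = 0" "grad \<eta> x = 0" if "x \<notin> ?B" for x unfolding \<eta>_def by (rule bump_outside[OF r(1) that])+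
    have B1: "\<bar>\<zeta> x\<bar> \<le> 1 + 4 / r" for x
    proof -
      have "0 \<le> 4 / r" using r by simp
      then show ?thesis using \<zeta>01[of x] by linarith
    qed
    have B2: "norm (grad \<zeta> x) \<le> 1 + 4 / r" for x
    proof -
      have "norm (grad \<zeta> x) = 2 * \<eta> x * norm (grad \<eta> x)" using \<eta>01[of x] by (simp add: g\<zeta>)
      also have "\<dots> \<le> 2 * 1 * (2 / r)" using \<eta>01[of x] ng[of x] by (intro mult_mono) auto
      finally show ?thesis by simp
    qed
    \<comment> \<open>In an interior ball \<zeta> is a test function on \<Omega>. Otherwise the mean
      is taken over a ball on which u vanishes, so c = 0.\<close>
    have c0: "c = 0 \<or> test_function \<Omega> \<zeta>"
      using q(2)
    proof
      assume "cball x0 (2 * r) \<subseteq> \<Omega>"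
      moreover have "\<zeta> x = 0" if "x \<notin> cball x0 (2 * r)" for x
        using \<eta>out(1)[of x] that by (simp add: \<zeta>_def)
      ultimately show ?thesis using test_functionI[of \<zeta> "cball x0 (2 * r)" \<Omega>] s\<zeta> by (auto simp: smooth_def)
    next
      assume "ball q (\<kappa> * r) \<inter> \<Omega> = {}"
      then have "u y = 0" if "y \<in> ball q (\<kappa> * r)" for y using zt.outside(1) that by blast
      then have "(LINT y:ball q (\<kappa> * r)|lborel. u y) = (LINT y:ball q (\<kappa> * r)|lborel. 0)"
        by (intro set_lebesgue_integral_cong) auto
      then show ?thesis by (simp add: c_def mean_def)
    qed
    interpret z2: zero_trace \<Omega> "\<lambda>x. \<zeta> x * (u x - c)" "\<lambda>x. \<zeta> x *\<^sub>R v x + (u x - c) *\<^sub>R grad \<zeta> x" "\<lambda>k x. \<zeta> x * (\<phi> k x - c)"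
      by (rule zt.zero_trace_mult[OF s\<zeta> B1 B2 c0])
    define \<Phi> where "\<Phi> x = \<zeta> x * (u0 x - c)" for x
    have \<Phi>out: "\<Phi> x = 0" if "x \<notin> \<Omega>" for x
    proof -
      have "u0 x = 0" using u0 that by (simp add: W12_0_def)
      moreover have "c * \<zeta> x = 0" using c0 test_function_outside(1)[of \<Omega> \<zeta> x] that by auto
      ultimately show ?thesis by (simp add: \<Phi>_def algebra_simps)
    qed
    have \<Phi>eq: "AE x in lebesgue. \<Phi> x = \<zeta> x * (u x - c)" using uu by (rule eventually_mono) (simp add: \<Phi>_def)
    have \<Phi>W: "\<Phi> \<in> W12_0 \<Omega>" by (rule z2.W12_0_I(1)[OF \<Phi>out \<Phi>eq])
    have \<Phi>g: "AE x in lebesgue. x \<in> \<Omega> \<longrightarrow> weak_grad \<Omega> \<Phi> x = \<zeta> x *\<^sub>R v x + (u x - c) *\<^sub>R grad \<zeta> x"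
      by (rule z2.W12_0_I(2)[OF \<Phi>out \<Phi>eq])
    have m\<Phi>: "\<Phi> \<in> borel_measurable (lebesgue_on \<Omega>)" "weak_grad \<Omega> \<Phi> \<in> borel_measurable (lebesgue_on \<Omega>)"
      using \<Phi>W by (auto simp: W12_0_def W12_def Lp_def)
    define I1 where "I1 x = (\<Sum>i\<in>UNIV. ((\<Sum>j\<in>UNIV. A x (u0 x) $ i $ j * weak_grad \<Omega> u0 x $ j) + a x (u0 x) $ i) * weak_grad \<Omega> \<Phi> x $ i)" for x
    define I2 where "I2 x = b x (u0 x) (weak_grad \<Omega> u0 x) * \<Phi> x" for x
    have weak: "(\<integral>x. I1 x \<partial>lebesgue_on \<Omega>) = (\<integral>x. I2 x \<partial>lebesgue_on \<Omega>)"
      using ws \<Phi>W unfolding weak_solution_def I1_def I2_def by blast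
    have mI1: "I1 \<in> borel_measurable (lebesgue_on \<Omega>)"
      unfolding I1_def[abs_def]
      by (intro borel_measurable_sum borel_measurable_times borel_measurable_add borel_measurable_vec_component
          caratheodory_measurable[OF S cA mu0] caratheodory_measurable[OF S ca mu0] mw0 m\<Phi>)
    have mI2: "I2 \<in> borel_measurable (lebesgue_on \<Omega>)"
    proof -
      have "(\<lambda>x. (u0 x, weak_grad \<Omega> u0 x)) \<in> borel_measurable (lebesgue_on \<Omega>)" by (intro borel_measurable_Pair mu0 mw0)
      from caratheodory_measurable[OF S cb this] show ?thesis
        unfolding I2_def[abs_def] by (intro borel_measurable_times m\<Phi>) simp
    qed
    define T where "T x = (u x - c)\<^sup>2 / r\<^sup>2 + \<bar>u x\<bar> powr \<gamma> + \<bar>c\<bar> powr \<gamma> + (F x)\<^sup>2 + \<bar>G x\<bar> powr \<gamma>'" for x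
    have T0: "0 \<le> T x" for x by (simp add: T_def)
    have mT[measurable]: "T \<in> borel_measurable borel" unfolding T_def[abs_def] by measurable
    have siT: "set_integrable lborel ?B (\<lambda>x. (u x - c)\<^sup>2)" "set_integrable lborel ?B (\<lambda>x. \<bar>u x\<bar> powr \<gamma>)" "set_integrable lborel ?B (\<lambda>x. (W x)\<^sup>2)"
      by (rule gp.set_integrable_u_sq, auto intro!: set_integrable_borel iU iW)
    have Tsplit: "T x = 1 / r\<^sup>2 * (u x - c)\<^sup>2 + (\<bar>u x\<bar> powr \<gamma> + (\<bar>c\<bar> powr \<gamma> + (W x)\<^sup>2))" for x by (simp add: T_def W2)
    have iT1: "set_integrable lborel ?B T"
      unfolding Tsplit[abs_def] using siT by (intro set_integral_add(1) set_integrable_mult_right set_integrable_const_ball) auto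
    have iT: "integrable lborel (\<lambda>x. indicator ?B x * T x)" using iT1 by (simp add: set_integrable_def)
    have iv: "integrable lborel (\<lambda>x. \<zeta> x * (norm (v x))\<^sup>2)"
    proof (rule Bochner_Integration.integrable_bound[OF zt.sq_v])
      show "AE x in lborel. norm (\<zeta> x * (norm (v x))\<^sup>2) \<le> norm ((norm (v x))\<^sup>2)"
        using \<zeta>01 by (intro AE_I2) (simp add: abs_mult mult_left_le_one_le)
    qed measurable
    \<comment> \<open>On the ball this is \<open>energy_pointwise\<close>; off it the cut-off and
      its gradient vanish, and with them both integrands. The indicator is what makes the T-term
      integrable, as T contains the constant |c|^\<gamma>.\<close>
    have good: "AE x in lebesgue_on \<Omega>. \<bar>I1 x\<bar> \<le> K * ((norm (v x))\<^sup>2 + indicator ?B x * T x) \<and> \<bar>I2 x\<bar> \<le> K * ((norm (v x))\<^sup>2 + indicator ?B x * T x)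
       \<and> \<mu> / 2 * (\<zeta> x * (norm (v x))\<^sup>2) - K * (indicator ?B x * T x) \<le> I1 x - I2 x"
    proof -
      have "AE x in lebesgue. x \<in> \<Omega> \<longrightarrow> \<bar>I1 x\<bar> \<le> K * ((norm (v x))\<^sup>2 + indicator ?B x * T x) \<and> \<bar>I2 x\<bar> \<le> K * ((norm (v x))\<^sup>2 + indicator ?B x * T x)
       \<and> \<mu> / 2 * (\<zeta> x * (norm (v x))\<^sup>2) - K * (indicator ?B x * T x) \<le> I1 x - I2 x"
        using uu vv \<Phi>g fF gG ga gb el
      proof eventually_elim
        case (elim x)
        show ?case
        proof
          assume x: "x \<in> \<Omega>"
          have eqs: "u0 x = u x" "weak_grad \<Omega> u0 x = v x" "f x = F x" "g x = G x"
            "weak_grad \<Omega> \<Phi> x = (\<eta> x)\<^sup>2 *\<^sub>R v x + ((u x - c) * (2 * \<eta> x)) *\<^sub>R grad \<eta> x"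
            using elim x by (simp_all add: g\<zeta> \<zeta>_def power2_eq_square)
          have P: "\<Phi> x = (\<eta> x)\<^sup>2 * (u x - c)" by (simp add: \<Phi>_def eqs \<zeta>_def power2_eq_square)
          show "\<bar>I1 x\<bar> \<le> K * ((norm (v x))\<^sup>2 + indicator ?B x * T x) \<and> \<bar>I2 x\<bar> \<le> K * ((norm (v x))\<^sup>2 + indicator ?B x * T x)
            \<and> \<mu> / 2 * (\<zeta> x * (norm (v x))\<^sup>2) - K * (indicator ?B x * T x) \<le> I1 x - I2 x"
          proof (cases "x \<in> ?B")
            case True
            have "let w = u x - c; I1 = (\<Sum>i\<in>UNIV. ((\<Sum>j\<in>UNIV. A x (u x) $ i $ j * v x $ j) + a x (u x) $ i) * ((\<eta> x)\<^sup>2 *\<^sub>R v x + (w * (2 * \<eta> x)) *\<^sub>R grad \<eta> x) $ i);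
                I2 = b x (u x) (v x) * ((\<eta> x)\<^sup>2 * w); T = w\<^sup>2 / r\<^sup>2 + \<bar>u x\<bar> powr \<gamma> + \<bar>c\<bar> powr \<gamma> + (F x)\<^sup>2 + \<bar>G x\<bar> powr (\<gamma> / (\<gamma> - 1))
              in \<bar>I1\<bar> \<le> K * ((norm (v x))\<^sup>2 + T) \<and> \<bar>I2\<bar> \<le> K * ((norm (v x))\<^sup>2 + T) \<and> \<mu> / 2 * ((\<eta> x)\<^sup>2 * (norm (v x))\<^sup>2) - K * T \<le> I1 - I2"
            proof (rule en[OF r(1) \<eta>01 ng])
              show "\<bar>A x (u x) $ i $ j\<bar> \<le> inverse \<mu>" for i j using elim(8) x by blast
              show "\<mu> * (norm \<xi>)\<^sup>2 \<le> (\<Sum>i\<in>UNIV. \<Sum>j\<in>UNIV. A x (u x) $ i $ j * \<xi> $ i * \<xi> $ j)" for \<xi> using elim(8) x by blast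
              show "\<bar>a x (u x) $ i\<bar> \<le> \<mu>1 * (\<bar>u x\<bar> powr (\<gamma> / 2) + F x)" for i using elim(6) x eqs(3) by metis
              show "\<bar>b x (u x) (v x)\<bar> \<le> \<mu>2 * (norm (v x) powr (2 * (1 - 1 / \<gamma>)) + \<bar>u x\<bar> powr (\<gamma> - 1) + G x)" using elim(7) x eqs(4) by metis
            qed
            then show ?thesis using True unfolding Let_def I1_def I2_def eqs P T_def \<gamma>'_def \<zeta>_def
              by (simp add: power2_eq_square)
          next
            case False
            then have z: "\<eta> x = 0" "grad \<eta> x = 0" using \<eta>out by auto
            have "I1 x = 0" "I2 x = 0" "\<zeta> x = 0" unfolding I1_def I2_def eqs P \<zeta>_def z by auto
            then show ?thesis using False K by simp
          qed
        qed
      qed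
      then show ?thesis using S by (subst AE_restrict_space_iff) auto
    qed
    let ?D = "\<lambda>x. K * ((norm (v x))\<^sup>2 + indicator ?B x * T x)"
    have iD: "integrable (lebesgue_on \<Omega>) ?D"
      using zt.sq_v iT by (intro integrable_lebesgue_on_of_lborel[OF _ S] integrable_mult_right Bochner_Integration.integrable_add)
    have D0: "0 \<le> ?D x" for x using K T0[of x] by simp
    \<comment> \<open>Both sides of the weak formulation are genuine integrals, so they may be
      subtracted under one integral sign.\<close>
    have iI1: "integrable (lebesgue_on \<Omega>) I1"
      by (rule Bochner_Integration.integrable_bound[OF iD mI1]) (use good D0 in \<open>auto elim!: eventually_mono\<close>)
    have iI2: "integrable (lebesgue_on \<Omega>) I2"
      by (rule Bochner_Integration.integrable_bound[OF iD mI2]) (use good D0 in \<open>auto elim!: eventually_mono\<close>)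
    have L1: "(\<integral>x. \<zeta> x * (norm (v x))\<^sup>2 \<partial>lebesgue_on \<Omega>) = (LINT x|lborel. \<zeta> x * (norm (v x))\<^sup>2)"
    proof (rule integral_lebesgue_on_eq_lborel[OF S])
      show "(\<lambda>x. \<zeta> x * (norm (v x))\<^sup>2) \<in> borel_measurable (lebesgue_on \<Omega>)"
        using integrable_lebesgue_on_of_lborel[OF iv S] by auto
    qed (auto simp: zt.outside)
    have mBT: "(\<lambda>x. indicator ?B x * T x) \<in> borel_measurable (lebesgue_on \<Omega>)"
      using integrable_lebesgue_on_of_lborel[OF iT S] by auto
    \<comment> \<open>The ball may stick out of \<Omega>; as T is nonnegative, extending the
      integral only enlarges it.\<close>
    have L2: "(\<integral>x. indicator ?B x * T x \<partial>lebesgue_on \<Omega>) \<le> (LINT x|lborel. indicator ?B x * T x)"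
    proof -
      have "(\<integral>x. indicator ?B x * T x \<partial>lebesgue_on \<Omega>) = (LINT x|lborel. indicator \<Omega> x *\<^sub>R (indicator ?B x * T x))"
        by (rule integral_lebesgue_on_eq_lborel[OF S _ _ mBT]) auto
      also have "\<dots> \<le> (LINT x|lborel. indicator ?B x * T x)"
      proof (rule integral_mono[OF integrable_mult_indicator[OF _ iT] iT])
        show "indicator \<Omega> x *\<^sub>R (indicator ?B x * T x) \<le> indicator ?B x * T x" for x using T0[of x] by (auto simp: indicator_def)
      qed simp
      finally show ?thesis .
    qed
    \<comment> \<open>The lower bound is integrated over \<Omega>; the chain ends in 0 by the
      equation tested with \<Phi>.\<close>
    have "\<mu> / 2 * (LINT x|lborel. \<zeta> x * (norm (v x))\<^sup>2) - K * (\<integral>x. indicator ?B x * T x \<partial>lebesgue_on \<Omega>)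
       = (\<integral>x. \<mu> / 2 * (\<zeta> x * (norm (v x))\<^sup>2) - K * (indicator ?B x * T x) \<partial>lebesgue_on \<Omega>)"
      unfolding L1[symmetric] using integrable_lebesgue_on_of_lborel[OF iv S] integrable_lebesgue_on_of_lborel[OF iT S]
      by (subst Bochner_Integration.integral_diff) auto
    also have "\<dots> \<le> (\<integral>x. I1 x - I2 x \<partial>lebesgue_on \<Omega>)"
    proof (rule integral_mono_AE)
      show "integrable (lebesgue_on \<Omega>) (\<lambda>x. \<mu> / 2 * (\<zeta> x * (norm (v x))\<^sup>2) - K * (indicator ?B x * T x))"
        using integrable_lebesgue_on_of_lborel[OF iv S] integrable_lebesgue_on_of_lborel[OF iT S]
        by (intro Bochner_Integration.integrable_diff integrable_mult_right)
      show "AE x in lebesgue_on \<Omega>. \<mu> / 2 * (\<zeta> x * (norm (v x))\<^sup>2) - K * (indicator ?B x * T x) \<le> I1 x - I2 x"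
        using good by (rule eventually_mono) blast
    qed (use iI1 iI2 in simp)
    also have "\<dots> = 0" using iI1 iI2 weak by simp
    finally have cac: "\<mu> / 2 * (LINT x|lborel. \<zeta> x * (norm (v x))\<^sup>2) \<le> K * (LINT x|lborel. indicator ?B x * T x)"
      using mult_left_mono[OF L2 less_imp_le[OF K]] by linarith
    have low: "exp (- 4) * (LINT x:ball x0 r|lborel. (norm (v x))\<^sup>2) \<le> (LINT x|lborel. \<zeta> x * (norm (v x))\<^sup>2)"
    proof -
      have "exp (- 4) * (LINT x:ball x0 r|lborel. (norm (v x))\<^sup>2) = (LINT x|lborel. exp (- 4) * (indicator (ball x0 r) x *\<^sub>R (norm (v x))\<^sup>2))"
        by (simp add: set_lebesgue_integral_def)
      also have "\<dots> \<le> (LINT x|lborel. \<zeta> x * (norm (v x))\<^sup>2)"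
      proof (rule integral_mono[OF _ iv])
        show "integrable lborel (\<lambda>x. exp (- 4) * (indicator (ball x0 r) x *\<^sub>R (norm (v x))\<^sup>2))"
          by (intro integrable_mult_right integrable_mult_indicator zt.sq_v) simp
        show "exp (- 4) * (indicator (ball x0 r) x *\<^sub>R (norm (v x))\<^sup>2) \<le> \<zeta> x * (norm (v x))\<^sup>2" for x
        proof (cases "x \<in> ball x0 r")
          case True
          have b: "exp (- 2) \<le> \<eta> x" unfolding \<eta>_def by (rule bump_lower[OF r(1) True])
          have "0 \<le> \<eta> x" by (rule order.trans[OF exp_ge_zero b])
          then have "exp (- 2) * exp (- 2) \<le> \<zeta> x" unfolding \<zeta>_def using b by (intro mult_mono) auto
          moreover have "exp (- 2 :: real) * exp (- 2) = exp (- 4)" by (simp add: mult_exp_exp)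
          ultimately have "exp (- 4) \<le> \<zeta> x" by simp
          then show ?thesis using True by (simp add: mult_right_mono)
        qed (use \<zeta>01[of x] in auto)
      qed
      finally show ?thesis .
    qed
    let ?Q = "LINT y:ball x0 (3 * r)|lborel. (\<bar>u y\<bar> powr (1 / \<alpha>))\<^sup>2 + (W y)\<^sup>2"
    let ?P = "LINT w:?B|lborel. (u w - c)\<^sup>2"
    have iUW: "integrable lborel (\<lambda>y. \<bar>u y\<bar> powr \<gamma> + (W y)\<^sup>2)" using iU iW by simp
    have up: "(LINT x|lborel. indicator ?B x * T x) \<le> 1 / r\<^sup>2 * ?P + M * ?Q"
    proof -
      have "(LINT x|lborel. indicator ?B x * T x) = (LINT x:?B|lborel. T x)" by (simp add: set_lebesgue_integral_def)
      also have "\<dots> = 1 / r\<^sup>2 * ?P + ((LINT x:?B|lborel. \<bar>u x\<bar> powr \<gamma>) + (\<bar>c\<bar> powr \<gamma> * vol ?B + (LINT x:?B|lborel. (W x)\<^sup>2)))"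
        unfolding Tsplit using siT
        by (subst set_integral_add(2), simp, simp, subst set_integral_add(2), simp, simp, subst set_integral_add(2)) auto
      also have "(LINT x:?B|lborel. \<bar>u x\<bar> powr \<gamma>) + (\<bar>c\<bar> powr \<gamma> * vol ?B + (LINT x:?B|lborel. (W x)\<^sup>2))
        = (LINT x:?B|lborel. \<bar>u x\<bar> powr \<gamma> + (W x)\<^sup>2) + \<bar>c\<bar> powr \<gamma> * vol ?B"
        using siT by simp
      also have "\<dots> \<le> ?Q + 2 powr \<gamma> * (2 / \<kappa>) ^ DIM(real^'n) * ?Q"
      proof (rule add_mono)
        show "(LINT x:?B|lborel. \<bar>u x\<bar> powr \<gamma> + (W x)\<^sup>2) \<le> ?Q"
          unfolding U2' by (rule set_integral_mono_set) (use iUW r in auto)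
        have "\<bar>c\<bar> powr \<gamma> * vol ?B = (2 / \<kappa>) ^ DIM(real^'n) * (\<bar>c\<bar> powr \<gamma> * vol (ball q (\<kappa> * r)))"
        proof -
          have "vol ?B = (2 / \<kappa>) ^ DIM(real^'n) * vol (ball q (\<kappa> * r))"
          proof -
            have "2 * r = 2 / \<kappa> * (\<kappa> * r)" using \<kappa> by simp
            then have "(2 * r) ^ DIM(real^'n) = (2 / \<kappa>) ^ DIM(real^'n) * (\<kappa> * r) ^ DIM(real^'n)" by (metis power_mult_distrib)
            then show ?thesis using r kr by (simp only: content_ball[OF less_imp_le[OF kr]] content_ball[of "2 * r"] mult_nonneg_nonneg zero_le_numeral less_imp_le) (simp add: mult_ac)
          qed
          then show ?thesis by simp
        qed
        also have "\<dots> \<le> (2 / \<kappa>) ^ DIM(real^'n) * (2 powr \<gamma> * ?Q)"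
        proof (rule mult_left_mono)
          have "\<bar>c\<bar> powr \<gamma> * vol (ball q (\<kappa> * r)) \<le> 2 powr \<gamma> * (LINT x:ball q (\<kappa> * r)|lborel. \<bar>u x\<bar> powr \<gamma>)"
            unfolding c_def by (rule mean_powr_le) (use \<gamma> kr zt.int_u iU in auto)
          also have "\<dots> \<le> 2 powr \<gamma> * ?Q"
          proof (rule mult_left_mono)
            have "(LINT x:ball q (\<kappa> * r)|lborel. \<bar>u x\<bar> powr \<gamma>) \<le> (LINT x:ball x0 (3 * r)|lborel. \<bar>u x\<bar> powr \<gamma>)"
              by (rule set_integral_mono_set) (use iU q in auto)
            also have "\<dots> \<le> ?Q" unfolding U2'
              by (rule set_integral_mono) (auto intro!: set_integrable_borel iU iUW)
            finally show "(LINT x:ball q (\<kappa> * r)|lborel. \<bar>u x\<bar> powr \<gamma>) \<le> ?Q" .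
          qed simp
          finally show "\<bar>c\<bar> powr \<gamma> * vol (ball q (\<kappa> * r)) \<le> 2 powr \<gamma> * ?Q" .
        qed (use \<kappa> in simp)
        finally show "\<bar>c\<bar> powr \<gamma> * vol ?B \<le> 2 powr \<gamma> * (2 / \<kappa>) ^ DIM(real^'n) * ?Q" by (simp add: mult_ac)
      qed
      also have "\<dots> = M * ?Q" by (simp add: M_def distrib_right)
      finally show ?thesis by simp
    qed
    have P0: "0 \<le> 1 / r\<^sup>2 * ?P" by (simp add: gp.set_integral_square_nonneg)
    have "1 / r\<^sup>2 * ?P + M * ?Q \<le> M * (1 / r\<^sup>2 * ?P + ?Q)"
      using mult_right_mono[OF M P0] by (simp only: distrib_left mult_1)
    then have up2: "(LINT x|lborel. indicator ?B x * T x) \<le> M * (1 / r\<^sup>2 * ?P + ?Q)" using up by (rule order.trans[rotated])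
    have "\<mu> / 2 * (exp (- 4) * (LINT x:ball x0 r|lborel. (norm (v x))\<^sup>2)) \<le> \<mu> / 2 * (LINT x|lborel. \<zeta> x * (norm (v x))\<^sup>2)"
      using low pos by (intro mult_left_mono) auto
    also have "\<dots> \<le> K * (M * (1 / r\<^sup>2 * ?P + ?Q))" using cac mult_left_mono[OF up2 less_imp_le[OF K]] by (rule order.trans)
    finally have "2 * exp 4 / \<mu> * (\<mu> / 2 * (exp (- 4) * (LINT x:ball x0 r|lborel. (norm (v x))\<^sup>2))) \<le> 2 * exp 4 / \<mu> * (K * (M * (1 / r\<^sup>2 * ?P + ?Q)))"
      using pos by (intro mult_left_mono) auto
    moreover have "2 * exp 4 / \<mu> * (\<mu> / 2 * (exp (- 4) * (LINT x:ball x0 r|lborel. (norm (v x))\<^sup>2))) = (LINT x:ball x0 r|lborel. (norm (v x))\<^sup>2)"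
    proof -
      have "exp (4 :: real) * exp (- 4) = 1" by (simp add: mult_exp_exp)
      moreover have "2 * E1 / \<mu> * (\<mu> / 2 * (E2 * X)) = E1 * E2 * X" for E1 E2 X :: real using pos by simp
      ultimately show ?thesis by simp
    qed
    ultimately have "(LINT x:ball x0 r|lborel. (norm (v x))\<^sup>2) \<le> C1 * (1 / r\<^sup>2 * ?P + ?Q)" by (simp only: C1_def mult.assoc)
    then show ?thesis using q(1) unfolding c_def by blast
  qed
  obtain p where p: "2 < p" "integrable lborel (\<lambda>x. norm (v x) powr p)" "integrable lborel (\<lambda>x. (\<bar>u x\<bar> powr (1 / \<alpha>)) powr p)"
    using gp.higher_integrability[OF \<alpha> R \<kappa>(1) C1 mW W0 iW e(1) iWe RH] by blast
  have uu': "AE x in lebesgue. x \<in> \<Omega> \<longrightarrow> u0 x = u x" using uu by (rule eventually_mono) simp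
  have "u0 \<in> Lp \<Omega> (\<gamma> * p / 2)"
    using Lp_transfer(1)[OF S zt.meas_u uu' zt.outside(1)] p(3) unfolding U2 by simp
  moreover have "weak_grad \<Omega> u0 \<in> Lp \<Omega> p"
    using Lp_transfer(1)[OF S zt.meas_v vv zt.outside(2)] p(2) by simp
  ultimately show ?thesis using p(1) by blast
qed

text \<open>The function \<open>u\<close> vanishes outside every admissible domain, so both norms are norms on the whole space
  and do not depend on the domain.\<close>

lemma W12_0_norms_independent:
  fixes w :: "real^'n \<Rightarrow> real"
  assumes 1: "open \<Omega>" "bounded \<Omega>" "w \<in> W12_0 \<Omega>" and 2: "open \<Omega>'" "bounded \<Omega>'" "w \<in> W12_0 \<Omega>'"
  shows "w \<in> Lp \<Omega> p \<longleftrightarrow> w \<in> Lp \<Omega>' p" "Lp_norm \<Omega> p w = Lp_norm \<Omega>' p w"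
    "weak_grad \<Omega> w \<in> Lp \<Omega> p \<longleftrightarrow> weak_grad \<Omega>' w \<in> Lp \<Omega>' p" "Lp_norm \<Omega> p (weak_grad \<Omega> w) = Lp_norm \<Omega>' p (weak_grad \<Omega>' w)"
proof -
  obtain u v \<phi> where z1: "zero_trace \<Omega> u v \<phi>" and e1: "AE x in lebesgue. w x = u x"
    and g1: "AE x in lebesgue. x \<in> \<Omega> \<longrightarrow> weak_grad \<Omega> w x = v x"
    using W12_0_zero_trace[OF 1] .
  obtain u' v' \<phi>' where z2: "zero_trace \<Omega>' u' v' \<phi>'" and e2: "AE x in lebesgue. w x = u' x"
    and g2: "AE x in lebesgue. x \<in> \<Omega>' \<longrightarrow> weak_grad \<Omega>' w x = v' x"
    using W12_0_zero_trace[OF 2] .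
  interpret z1: zero_trace \<Omega> u v \<phi> by (rule z1)
  interpret z2: zero_trace \<Omega>' u' v' \<phi>' by (rule z2)
  have uu: "AE x in lebesgue. u x = u' x" using e1 e2 by eventually_elim simp
  \<comment> \<open>The zero extensions have weak gradients on the whole space, where the two
    domains no longer matter; uniqueness there identifies v and v'.\<close>
  have h1: "has_weak_grad UNIV u v" by (rule z1.has_weak_grad) auto
  have h2: "has_weak_grad UNIV u' v'" by (rule z2.has_weak_grad) auto
  have "has_weak_grad UNIV u v'"
    unfolding has_weak_grad_def
  proof (intro conjI allI impI)
    show "locally_integrable UNIV u" using h1 by (simp add: has_weak_grad_def)
    show "locally_integrable UNIV v'" using h2 by (simp add: has_weak_grad_def)
    fix \<psi> :: "real^'n \<Rightarrow> real" and i assume \<psi>: "test_function UNIV \<psi>"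
    have [measurable]: "(\<lambda>x. grad \<psi> x $ i) \<in> borel_measurable borel"
      by (intro smooth_measurable smooth_grad_component smooth_test_function[OF \<psi>])
    have "(\<integral>x. u x * grad \<psi> x $ i \<partial>lebesgue) = (\<integral>x. u' x * grad \<psi> x $ i \<partial>lebesgue)"
    proof (rule integral_cong_AE)
      show "AE x in lebesgue. u x * grad \<psi> x $ i = u' x * grad \<psi> x $ i" using uu by (rule eventually_mono) simp
      show "(\<lambda>x. u x * grad \<psi> x $ i) \<in> borel_measurable lebesgue" "(\<lambda>x. u' x * grad \<psi> x $ i) \<in> borel_measurable lebesgue"
        by (rule measurable_completion, measurable)+
    qed
    then show "(\<integral>x. u x * grad \<psi> x $ i \<partial>lebesgue_on UNIV) = - (\<integral>x. v' x $ i * \<psi> x \<partial>lebesgue_on UNIV)"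
      using h2 \<psi> by (simp add: has_weak_grad_def lebesgue_on_UNIV_eq)
  qed
  from weak_grad_unique[OF open_UNIV h1 this] have vv: "AE x in lebesgue. v x = v' x" unfolding lebesgue_on_UNIV_eq .
  have e1': "AE x in lebesgue. x \<in> \<Omega> \<longrightarrow> w x = u x" and e2': "AE x in lebesgue. x \<in> \<Omega>' \<longrightarrow> w x = u' x"
    using e1 e2 by (auto elim: eventually_mono)
  have same: "integrable lborel (\<lambda>x. norm (k x) powr p) \<longleftrightarrow> integrable lborel (\<lambda>x. norm (k' x) powr p)"
    "(LINT x|lborel. norm (k x) powr p) = (LINT x|lborel. norm (k' x) powr p)"
    if k[measurable]: "k \<in> borel_measurable borel" "k' \<in> borel_measurable borel" and "AE x in lebesgue. k x = k' x"
    for k k' :: "real^'n \<Rightarrow> 'b::euclidean_space"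
  proof -
    have ae: "AE x in lborel. norm (k x) powr p = norm (k' x) powr p"
      using that(3) unfolding AE_completion_iff by (rule eventually_mono) simp
    show "integrable lborel (\<lambda>x. norm (k x) powr p) \<longleftrightarrow> integrable lborel (\<lambda>x. norm (k' x) powr p)"
      by (rule integrable_cong_AE[OF _ _ ae]) measurable
    show "(LINT x|lborel. norm (k x) powr p) = (LINT x|lborel. norm (k' x) powr p)"
      by (rule integral_cong_AE[OF _ _ ae]) measurable
  qed
  note s1 = same[OF z1.meas_u z2.meas_u uu] and s2 = same[OF z1.meas_v z2.meas_v vv]
  note a = Lp_transfer[OF z1.sets_Omega_lebesgue z1.meas_u e1' z1.outside(1), of p]
    and a' = Lp_transfer[OF z2.sets_Omega_lebesgue z2.meas_u e2' z2.outside(1), of p]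
    and b = Lp_transfer[OF z1.sets_Omega_lebesgue z1.meas_v g1 z1.outside(2), of p]
    and b' = Lp_transfer[OF z2.sets_Omega_lebesgue z2.meas_v g2 z2.outside(2), of p]
  show "w \<in> Lp \<Omega> p \<longleftrightarrow> w \<in> Lp \<Omega>' p" "Lp_norm \<Omega> p w = Lp_norm \<Omega>' p w" using a a' s1 by simp_all
  show "weak_grad \<Omega> w \<in> Lp \<Omega> p \<longleftrightarrow> weak_grad \<Omega>' w \<in> Lp \<Omega>' p" "Lp_norm \<Omega> p (weak_grad \<Omega> w) = Lp_norm \<Omega>' p (weak_grad \<Omega>' w)"
    using b b' s2 by simp_all
qed

theorem theorem3p2:
  fixes \<gamma> \<mu> \<mu>1 \<mu>2 \<sigma> \<tau> \<beta> :: real and u :: "real^'n \<Rightarrow> real"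
  assumes "CARD('n) \<ge> 2" and "critical_exponent CARD('n) \<gamma>"
    and "0 < \<mu>" "\<mu> \<le> 1" "0 < \<mu>1" "0 < \<mu>2"
    and "2 < \<sigma>" "\<gamma> / (\<gamma> - 1) < \<tau>" "0 < \<beta>"
  shows "\<exists>p>2. \<forall>F G V. \<exists>N. \<forall>\<Omega> A a b f g.
    bounded_lipschitz_domain \<beta> \<Omega> \<and>
    structure_conditions \<Omega> \<gamma> \<mu> \<mu>1 \<mu>2 A a b f g \<and>
    f \<in> Lp \<Omega> \<sigma> \<and> g \<in> Lp \<Omega> \<tau> \<and>
    Lp_norm \<Omega> \<sigma> f = F \<and> Lp_norm \<Omega> \<tau> g = G \<and> measure lebesgue \<Omega> = V \<and>
    weak_solution \<Omega> A a b u
    \<longrightarrow> u \<in> Lp \<Omega> (\<gamma> * p / 2) \<and> weak_grad \<Omega> u \<in> Lp \<Omega> p \<and>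
        Lp_norm \<Omega> (\<gamma> * p / 2) u + Lp_norm \<Omega> p (weak_grad \<Omega> u) \<le> N"
proof (cases "\<exists>\<Omega> A a b f g. bounded_lipschitz_domain \<beta> \<Omega> \<and> structure_conditions \<Omega> \<gamma> \<mu> \<mu>1 \<mu>2 A a b f g \<and>
    f \<in> Lp \<Omega> \<sigma> \<and> g \<in> Lp \<Omega> \<tau> \<and> weak_solution \<Omega> A a b u")
  case False
  \<comment> \<open>Without admissible data the claim is vacuous for every p > 2, and 3 is one of
    them.\<close>
  then show ?thesis by (intro exI[of _ 3]) auto
next
  case True
  then obtain \<Omega> A a b f g where \<Omega>: "bounded_lipschitz_domain \<beta> \<Omega>" and sc: "structure_conditions \<Omega> \<gamma> \<mu> \<mu>1 \<mu>2 A a b f g"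
    and fg: "f \<in> Lp \<Omega> \<sigma>" "g \<in> Lp \<Omega> \<tau>" and ws: "weak_solution \<Omega> A a b u" by blast
  have \<gamma>: "2 < \<gamma>" "real CARD('n) * (1 - 2 / \<gamma>) \<le> 2"
  proof -
    have "2 < \<gamma> \<and> real CARD('n) * (1 - 2 / \<gamma>) \<le> 2"
    proof (cases "CARD('n) = 2")
      case True
      then have "2 < \<gamma>" using assms(2) by (simp add: critical_exponent_def)
      moreover have "real CARD('n) * (1 - 2 / \<gamma>) \<le> 2" unfolding True using \<open>2 < \<gamma>\<close> by simp
      ultimately show ?thesis by blast
    next
      case False
      then have d: "2 < real CARD('n)" and g: "\<gamma> = 2 * real CARD('n) / (real CARD('n) - 2)"
        using assms(1,2) by (auto simp: critical_exponent_def)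
      have "2 < \<gamma>" unfolding g using d by (simp add: field_simps)
      \<comment> \<open>For d > 2 the exponent is exactly critical: the dimensional condition holds
        with equality.\<close>
      moreover have "real CARD('n) * (1 - 2 / \<gamma>) = 2" unfolding g using d by (simp add: field_simps)
      ultimately show ?thesis by simp
    qed
    then show "2 < \<gamma>" "real CARD('n) * (1 - 2 / \<gamma>) \<le> 2" by auto
  qed
  \<comment> \<open>p is found from one admissible choice of domain and coefficients and has to
    serve all the others.\<close>
  obtain p where p: "2 < p" "u \<in> Lp \<Omega> (\<gamma> * p / 2)" "weak_grad \<Omega> u \<in> Lp \<Omega> p"
    using weak_solution_higher_integrability[OF \<Omega> assms(9) sc assms(3,5,6) \<gamma> assms(7) fg(1) assms(8) fg(2) ws] by blast
  have dom: "open \<Omega>' \<and> bounded \<Omega>' \<and> u \<in> W12_0 \<Omega>'" if "bounded_lipschitz_domain \<beta> \<Omega>'" "weak_solution \<Omega>' A' a' b' u" for \<Omega>' A' a' b'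
    using that by (auto simp: bounded_lipschitz_domain_def weak_solution_def)
  \<comment> \<open>The bound N is the sum of the two norms for the domain chosen above, the same
    for all values of F, G and V.\<close>
  have "u \<in> Lp \<Omega>' (\<gamma> * p / 2) \<and> weak_grad \<Omega>' u \<in> Lp \<Omega>' p \<and>
        Lp_norm \<Omega>' (\<gamma> * p / 2) u + Lp_norm \<Omega>' p (weak_grad \<Omega>' u) \<le> Lp_norm \<Omega> (\<gamma> * p / 2) u + Lp_norm \<Omega> p (weak_grad \<Omega> u)"
    if "bounded_lipschitz_domain \<beta> \<Omega>'" "weak_solution \<Omega>' A' a' b' u" for \<Omega>' A' a' b'
    using p(2,3) W12_0_norms_independent[of \<Omega> u \<Omega>'] dom[OF \<Omega> ws] dom[OF that] by simp
  then show ?thesis using p(1) by blast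
qed

end
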